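(* Let $\beta>1$ be a Yrrap number, i.e. the orbit of $1$ under the $(-\beta)$-transformation $T_{-\beta}$ is eventually periodic. Let $L$ be Lebesgue measure on $[0,1]$ and $\varphi\equiv\log\beta$. Then $([0,1],T_{-\beta})$ satisfies a level-2 large deviation principle with reference measure $L$ and rate function the free energy $\mathcal{F}_\varphi(\mu)=h(\mu)-\log\beta$ for $T_{-\beta}$-invariant $\mu$ and $\mathcal{F}_\varphi(\mu)=-\infty$ otherwise.
   Context: $(-\beta)$-transformation $T_{-\beta}\colon[0,1]\to[0,1]$: let $b=\max\{k\in\mathbb{Z}:k<\beta\}$, $I_i=(i/\beta,(i+1)/\beta)$ for $0\le i\le b-1$, $I_b=(b/\beta,1)$, and $T_{-\beta}(x)=-\beta x+(i+1)$ for $x\in I_i$. For $x\notin\bigcup_{i\ge0}T_{-\beta}^{-i}\{0,1/\beta,\dots,b/\beta,1\}$ let $i'(x)\in\{0,\dots,b\}^{\mathbb{Z}_+}$, $(i'(x))_k=j$ iff $T_{-\beta}^k(x)\in I_j$, and let $i'(1)=\lim_{x\to1^-}i'(x)$. Case 1: $i'(1)=(w0)^\infty$ for some finite word $w$; then $T_{-\beta}(0)=1$, $T_{-\beta}(i/\beta)=0$ for $1\le i\le b$, $T_{-\beta}(1)=\lim_{x\to1^-}T_{-\beta}(x)$. Case 2: otherwise; then $T_{-\beta}(0)=1$, $T_{-\beta}(i/\beta)=1$ for $1\le i\le b$, $T_{-\beta}(1)=\lim_{x\to1^-}T_{-\beta}(x)$. $\mathcal{M}([0,1])$: Borel probability measures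 with weak topology; $\mathcal{E}_n(x)=\frac1n\sum_{j=0}^{n-1}\delta_{T_{-\beta}^j(x)}$; $h$ = metric entropy. Level-2 LDP with reference $L$ and rate $q$: $q\colon\mathcal{M}([0,1])\to[-\infty,0]$ upper semicontinuous, $\liminf_n\frac1n\log L(\{x:\mathcal{E}_n(x)\in G\})\ge\sup_G q$ for every open $G$ and $\limsup_n\frac1n\log L(\{x:\mathcal{E}_n(x)\in F\})\le\sup_F q$ for every closed $F$. *)

theory Defs
  imports "HOL-Probability.Probability"
begin

definition bdig :: "real \<Rightarrow> nat" where
  "bdig \<beta> = nat (\<lceil>\<beta>\<rceil> - 1)"   (* = max {k \<in> Z. k < \<beta>} for \<beta> > 1 *)

definition Iint :: "real \<Rightarrow> nat \<Rightarrow> real set" where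
  "Iint \<beta> i = (if i < bdig \<beta> then {real i / \<beta> <..< (real i + 1) / \<beta>}
                else {real (bdig \<beta>) / \<beta> <..< 1})"

text \<open>The branch formula, used on the open intervals I_i (value 0 elsewhere, irrelevant).\<close>
definition Tint :: "real \<Rightarrow> real \<Rightarrow> real" where
  "Tint \<beta> x = (if \<exists>i\<le>bdig \<beta>. x \<in> Iint \<beta> i
     then - \<beta> * x + real (THE i. i \<le> bdig \<beta> \<and> x \<in> Iint \<beta> i) + 1 else 0)"

definition Dset :: "real \<Rightarrow> real set" where
  "Dset \<beta> = {real i / \<beta> | i. i \<le> bdig \<beta>} \<union> {1}"

definition badset :: "real \<Rightarrow> real set" where
  "badset \<beta> = {x. \<exists>k. (Tint \<beta> ^^ k) x \<in> Dset \<beta>}"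

definition itin :: "real \<Rightarrow> real \<Rightarrow> nat \<Rightarrow> nat" where
  "itin \<beta> x k = (THE j. j \<le> bdig \<beta> \<and> (Tint \<beta> ^^ k) x \<in> Iint \<beta> j)"

text \<open>Case 1: i'(1) = lim_{x \<rightarrow> 1-} i'(x) exists and equals (w0)^\<infinity> for a finite word w.\<close>
definition case1 :: "real \<Rightarrow> bool" where
  "case1 \<beta> = (\<exists>d :: nat \<Rightarrow> nat.
      (\<forall>k. \<forall>\<^sub>F x in at_left 1. x \<notin> badset \<beta> \<longrightarrow> itin \<beta> x k = d k) \<and>
      (\<exists>p>0. d (p - 1) = 0 \<and> (\<forall>k. d (k + p) = d k)))"

definition Tneg :: "real \<Rightarrow> real \<Rightarrow> real" where
  "Tneg \<beta> x =
    (if x = 0 then 1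
     else if x = 1 then Lim (at_left 1) (Tint \<beta>)
     else if \<exists>i\<in>{1..bdig \<beta>}. x = real i / \<beta> then (if case1 \<beta> then 0 else 1)
     else Tint \<beta> x)"

definition yrrap :: "real \<Rightarrow> bool" where
  "yrrap \<beta> = (\<exists>m p. p > 0 \<and> (Tneg \<beta> ^^ (m + p)) 1 = (Tneg \<beta> ^^ m) 1)"

abbreviation B01 :: "real measure" where
  "B01 \<equiv> restrict_space borel {0..1}"

definition Pm :: "real measure set" where
  "Pm = {M. space M = {0..1} \<and> sets M = sets B01 \<and> prob_space M}"

definition weak_top :: "real measure topology" where
  "weak_top = topology_generated_by
     {{\<mu>\<in>Pm. (\<integral>x. f x \<partial>\<mu>) \<in> U} | (f :: real \<Rightarrow> real) U. continuous_on {0..1} f \<and> open U}"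

definition empirical :: "(real \<Rightarrow> real) \<Rightarrow> nat \<Rightarrow> real \<Rightarrow> real measure" where
  "empirical T n x = measure_of {0..1} (sets B01)
     (\<lambda>A. ennreal ((\<Sum>j<n. indicator A ((T ^^ j) x)) / real n))"

definition eta :: "real \<Rightarrow> real" where
  "eta t = (if t = 0 then 0 else - t * ln t)"

definition fin_partitions :: "real set set set" where
  "fin_partitions = {P. finite P \<and> P \<subseteq> sets B01 \<and> disjoint P \<and> \<Union>P = {0..1}}"

definition join_n :: "(real \<Rightarrow> real) \<Rightarrow> real set set \<Rightarrow> nat \<Rightarrow> real set set" where
  "join_n T P n = {(\<Inter>i<n. (T ^^ i) -` a i) \<inter> {0..1} | a. \<forall>i<n. a i \<in> P} - {{}}"

definition part_entropy :: "real measure \<Rightarrow> real set set \<Rightarrow> real" where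
  "part_entropy \<mu> Q = (\<Sum>A\<in>Q. eta (measure \<mu> A))"

definition ks_entropy :: "real measure \<Rightarrow> (real \<Rightarrow> real) \<Rightarrow> ereal" where
  "ks_entropy \<mu> T = (SUP P\<in>fin_partitions.
      ereal (lim (\<lambda>n. part_entropy \<mu> (join_n T P n) / real n)))"

definition invariant :: "(real \<Rightarrow> real) \<Rightarrow> real measure \<Rightarrow> bool" where
  "invariant T \<mu> \<longleftrightarrow> T \<in> B01 \<rightarrow>\<^sub>M B01 \<and> distr \<mu> B01 T = \<mu>"

definition free_energy :: "real \<Rightarrow> real measure \<Rightarrow> ereal" where
  "free_energy \<beta> \<mu> = (if invariant (Tneg \<beta>) \<mu>
      then ks_entropy \<mu> (Tneg \<beta>) - ereal (ln \<beta>) else -\<infinity>)"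

definition elog :: "real \<Rightarrow> ereal" where
  "elog t = (if t > 0 then ereal (ln t) else -\<infinity>)"

definition level2_LDP :: "(real \<Rightarrow> real) \<Rightarrow> real measure \<Rightarrow> (real measure \<Rightarrow> ereal) \<Rightarrow> bool" where
  "level2_LDP T L q \<longleftrightarrow>
     (\<forall>\<mu>\<in>Pm. q \<mu> \<le> 0) \<and>
     (\<forall>t::real. openin weak_top {\<mu>\<in>Pm. q \<mu> < ereal t}) \<and>
     (\<forall>G. openin weak_top G \<longrightarrow>
        liminf (\<lambda>n. elog (measure L {x\<in>{0..1}. empirical T n x \<in> G}) / ereal (real n))
          \<ge> (SUP \<mu>\<in>G. q \<mu>)) \<and>
     (\<forall>F. closedin weak_top F \<longrightarrow>
        limsup (\<lambda>n. elog (measure L {x\<in>{0..1}. empirical T n x \<in> F}) / ereal (real n))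
          \<le> (SUP \<mu>\<in>F. q \<mu>))"

end

theory Submission
  imports Defs "HOL-Real_Asymp.Real_Asymp" "HOL-Combinatorics.Multiset_Permutations"
begin

text \<open>
  Let \<open>S\<close> be the finite set consisting of the cut points \<open>i / \<beta>\<close>, of \<open>1\<close>, and of the orbit of \<open>1\<close>. It is
  forward invariant, so the intervals between its points (atoms) form a Markov partition, and a cell of
  order \<open>n\<close> that avoids the preimages of \<open>S\<close> has length comparable to \<open>\<beta>\<close> to the power \<open>-n\<close>.

  Upper bound. For an invariant \<open>\<mu>\<close> approximate the information function of the cells of order \<open>k\<close> from
  above by \<open>- ln \<rho>\<close> with \<open>\<rho>\<close> continuous; a Kraft inequality for \<open>\<rho>\<close> and the transfer operator bound
  the measure of the points whose orbit average of \<open>- ln \<rho>\<close> is close to its \<open>\<mu>\<close>-mean. A non-invariant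
  \<open>\<mu>\<close> is no limit of empirical measures: the values of \<open>T\<close> at the cut points are chosen so that the side
  on which \<open>T\<close> is discontinuous is never revisited by its own one-sided orbit, hence is visited with
  frequency zero.

  Lower bound. Arrange blocks of length \<open>N\<close>, each cell of order \<open>N\<close> occurring with its \<open>\<mu>\<close>-frequency,
  in all possible orders, and shadow the arrangements by orbits using the Markov property. The dynamics need
  not be transitive, but the recurrent atoms are totally ordered by reachability: an interval grows until
  it contains a cut point, and from then on it reaches exactly what a one-sided neighbourhood of \<open>1\<close>
  reaches, and such neighbourhoods are nested. Sorting the blocks along this order costs only a factor
  that is exponential in the number of blocks, which is negligible as \<open>N\<close> grows.
\<close>

text \<open>The main obstacle is that an invariant measure may charge points of \<open>S\<close> or
  of its preimages, which Lebesgue measure does not see and to which the Markov property does not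
  apply. In the upper bound their masses enter \<open>\<rho>\<close> through narrow tents; a point
  has at most two adjacent open cells of a given order, so the Kraft sum stays below a constant that
  does not depend on the order. In the lower bound recurrence forces a charged point of this kind to
  be periodic. Its orbit is also the orbit of a one-sided germ, so generic points beside it can take
  its place. That one-sided germs and true orbits agree is due to the two cases in the definition of
  \<open>T\<close>: at a cut point \<open>T\<close> is continuous from exactly the side on which the
  left germ of 1 may arrive. Nonpositivity and upper semicontinuity of the free energy are not taken
  from entropy theory. They follow by comparing the lower bound at a measure with the total mass and
  with the upper bound on a half-space around it.\<close>

section \<open>The map on its branches\<close>

locale neg_beta =
  fixes \<beta> :: real
  assumes beta_gt_1: "1 < \<beta>"
begin

abbreviation T :: "real \<Rightarrow> real" where "T \<equiv> Tneg \<beta>"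
abbreviation b :: nat where "b \<equiv> bdig \<beta>"

lemma b_less: "real b < \<beta>" and beta_le: "\<beta> \<le> real b + 1" and b_ge_1: "1 \<le> b"
proof -
  have c: "2 \<le> \<lceil>\<beta>\<rceil>" using beta_gt_1 by linarith
  have eq: "real b = of_int \<lceil>\<beta>\<rceil> - 1" using c by (simp add: bdig_def)
  show "real b < \<beta>" "\<beta> \<le> real b + 1" unfolding eq by linarith+
  show "1 \<le> b" unfolding bdig_def using c by linarith
qed

lemma beta_pos [simp]: "0 < \<beta>" "0 \<le> \<beta>" "\<beta> \<noteq> 0"
  using beta_gt_1 by auto

lemma digit_le: 
  assumes "real i < \<beta> * x" "x \<le> 1" shows "i \<le> b"
proof -
  have "\<beta> * x \<le> \<beta>" using assms(2) by simp
  then have "real i < real b + 1" using assms(1) beta_le by linarith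
  then show ?thesis by linarith
qed

lemma Iint_iff:
  assumes "i \<le> b"
  shows "x \<in> Iint \<beta> i \<longleftrightarrow> 0 < x \<and> x < 1 \<and> real i < \<beta> * x \<and> \<beta> * x < real i + 1"
proof (cases "i < b")
  case True
  have A: "x < 1" if "\<beta> * x < real i + 1"
  proof (rule ccontr)
    assume "\<not> x < 1"
    then have "\<beta> \<le> \<beta> * x" by simp
    then show False using that True b_less by linarith
  qed
  have B: "0 < x" if "real i < \<beta> * x" using that
    by (metis beta_pos(1) of_nat_0_le_iff order_le_less_trans zero_less_mult_pos)
  show ?thesis using True A B by (auto simp: Iint_def field_simps)
next
  case False
  then have i: "i = b" using assms by simp
  have A: "\<beta> * x < real b + 1" if "x < 1"
  proof -
    have "\<beta> * x < \<beta> * 1" using that by (simp only: mult_less_cancel_left_pos beta_pos)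
    then show ?thesis using beta_le by linarith
  qed
  have B: "0 < x" if "real i < \<beta> * x" using that
    by (metis beta_pos(1) of_nat_0_le_iff order_le_less_trans zero_less_mult_pos)
  show ?thesis using A B i by (auto simp: Iint_def field_simps)
qed

lemma digit_unique: "real i < y \<Longrightarrow> y < real i + 1 \<Longrightarrow> real j < y \<Longrightarrow> y < real j + 1 \<Longrightarrow> i = j"
  by linarith

lemma Iint_the:
  assumes "0 < x" "x < 1" "real i < \<beta> * x" "\<beta> * x < real i + 1"
  shows "i \<le> b" "x \<in> Iint \<beta> i" "(THE j. j \<le> b \<and> x \<in> Iint \<beta> j) = i"
proof -
  show 1: "i \<le> b" using digit_le assms by simp
  then show 2: "x \<in> Iint \<beta> i" using assms by (simp add: Iint_iff)
  show "(THE j. j \<le> b \<and> x \<in> Iint \<beta> j) = i"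
    using 1 2 assms digit_unique by (intro the_equality) (auto simp: Iint_iff)
qed

lemma Tint_eq:
  assumes "0 < x" "x < 1" "real i < \<beta> * x" "\<beta> * x < real i + 1"
  shows "Tint \<beta> x = real i + 1 - \<beta> * x"
  using Iint_the[OF assms] by (auto simp: Tint_def)

lemma T_eq:
  assumes "0 < x" "x < 1" "real i < \<beta> * x" "\<beta> * x < real i + 1"
  shows "T x = real i + 1 - \<beta> * x"
proof -
  have "x \<noteq> real j / \<beta>" for j
  proof
    assume "x = real j / \<beta>"
    then have "\<beta> * x = real j" by simp
    then have "real i < real j" "real j < real i + 1" using assms by simp_all
    then have "i < j" "j < i + 1" by linarith+
    then show False by simp
  qed
  then show ?thesis using assms Tint_eq[OF assms] by (auto simp: Tneg_def)
qed

lemma T_0: "T 0 = 1" by (simp add: Tneg_def)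

lemma T_div: "i \<in> {1..b} \<Longrightarrow> T (real i / \<beta>) = (if case1 \<beta> then 0 else 1)"
proof -
  assume i: "i \<in> {1..b}"
  have "real i / \<beta> < 1" using i b_less by (auto simp: field_simps) 
  then show ?thesis using i by (auto simp: Tneg_def)
qed

lemma T_1: "T 1 = real b + 1 - \<beta>"
proof -
  have ev: "\<forall>\<^sub>F x in at_left 1. real b + 1 - \<beta> * x = Tint \<beta> x"
  proof -
    have "real b / \<beta> < 1" using b_less by (simp add: field_simps)
    then have "\<forall>\<^sub>F x in at_left 1. real b / \<beta> < x \<and> x < 1"
      using eventually_at_left_field by blast
    then show ?thesis
    proof eventually_elim
      case (elim x)
      have "0 < x" using elim beta_pos by (meson divide_nonneg_pos of_nat_0_le_iff order_le_less_trans)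
      moreover have "\<beta> * x < \<beta> * 1" using elim by (simp only: mult_less_cancel_left_pos beta_pos)
      moreover have "real b < \<beta> * x" using elim by (simp add: field_simps)
      ultimately have "Tint \<beta> x = real b + 1 - \<beta> * x" using elim beta_le by (intro Tint_eq) linarith+
      then show ?case by simp
    qed
  qed
  have "((\<lambda>x. real b + 1 - \<beta> * x) \<longlongrightarrow> real b + 1 - \<beta> * 1) (at_left 1)"
    by (intro tendsto_intros)
  then have "(Tint \<beta> \<longlongrightarrow> real b + 1 - \<beta>) (at_left 1)"
    using tendsto_cong[OF ev] by simp
  then have "Lim (at_left 1) (Tint \<beta>) = real b + 1 - \<beta>"
    by (intro tendsto_Lim) simp
  then show ?thesis by (simp add: Tneg_def)
qed

lemma T_cases:
  assumes "x \<in> {0..1}"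
  obtains "x = 0" | "x = 1" | i where "i \<in> {1..b}" "x = real i / \<beta>"
    | i where "i \<le> b" "0 < x" "x < 1" "real i < \<beta> * x" "\<beta> * x < real i + 1"
proof -
  define i where "i = nat \<lfloor>\<beta> * x\<rfloor>"
  have nn: "0 \<le> \<beta> * x" using assms by simp
  have i: "real i \<le> \<beta> * x" "\<beta> * x < real i + 1" using nn by (auto simp: i_def)
  show ?thesis
  proof (cases "x = 0 \<or> x = 1")
    case True then show ?thesis using that(1,2) by blast
  next
    case False
    then have x: "0 < x" "x < 1" using assms by auto
    show ?thesis
    proof (cases "real i = \<beta> * x")
      case True
      then have xi: "x = real i / \<beta>" by simp
      have "real i < real b + 1" using True x beta_le
        by (smt (verit) beta_pos(1) mult_le_cancel_left1)
      moreover have "i \<noteq> 0" using True x by (metis beta_pos(3) less_numeral_extra(3) mult_eq_0_iff of_nat_0)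
      ultimately have "i \<in> {1..b}" by auto
      then show ?thesis using that(3) xi by blast
    next
      case False
      then show ?thesis using that(4)[of i] i x digit_le by simp
    qed
  qed
qed

lemma T_range: "x \<in> {0..1} \<Longrightarrow> T x \<in> {0..1}"
proof -
  assume x: "x \<in> {0..1}"
  then show "T x \<in> {0..1}"
  proof (cases rule: T_cases[OF x])
    case 1 then show ?thesis by (simp add: T_0)
  next
    case 2 then show ?thesis using T_1 b_less beta_le by simp
  next
    case (3 i) then show ?thesis using T_div by auto
  next
    case (4 i) then show ?thesis using T_eq[of x i] by simp
  qed
qed

lemma Tpow_range: "x \<in> {0..1} \<Longrightarrow> (T ^^ n) x \<in> {0..1}"
  by (induction n) (use T_range in auto)

lemma T_borel: "T \<in> borel_measurable B01"
proof -
  \<comment> \<open>At a cut point \<open>\<beta> * x\<close> is an integer, so the ceiling formula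
    gives 0 and the floor formula gives 1, the two prescribed values; between cut points both agree
    with the branch.\<close>
  define U where "U x = (if x = 0 then 1 else if x = 1 then real b + 1 - \<beta>
     else if case1 \<beta> then of_int \<lceil>\<beta> * x\<rceil> - \<beta> * x else of_int \<lfloor>\<beta> * x\<rfloor> + 1 - \<beta> * x)" for x
  have "T x = U x" if x: "x \<in> {0..1}" for x
  proof (cases rule: T_cases[OF x])
    case 1 then show ?thesis by (simp add: T_0 U_def)
  next
    case 2 then show ?thesis by (simp add: T_1 U_def)
  next
    case (3 i)
    have "real i / \<beta> < 1" using 3 b_less by (auto simp: field_simps)
    then show ?thesis using 3 T_div[of i] by (auto simp: U_def)
  next
    case (4 i)
    have "\<lceil>\<beta> * x\<rceil> = int i + 1" "\<lfloor>\<beta> * x\<rfloor> = int i" using 4 by linarith+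
    then show ?thesis using T_eq[of x i] 4 by (auto simp: U_def)
  qed
  moreover have "U \<in> borel_measurable borel" unfolding U_def by measurable
  then have "U \<in> borel_measurable B01" by (rule measurable_restrict_space1)
  ultimately show ?thesis
    by (subst measurable_cong[of _ _ U]) (auto simp: space_restrict_space)
qed

lemma T_measurable [measurable]: "T \<in> B01 \<rightarrow>\<^sub>M B01"
  using T_borel T_range
  by (intro measurable_restrict_space2) (auto simp: space_restrict_space)

lemma Tpow_measurable [measurable]: "(T ^^ n) \<in> B01 \<rightarrow>\<^sub>M B01"
proof (induction n)
  case 0 then show ?case by (simp add: id_def)
next
  case (Suc n) then show ?case using measurable_comp[OF Suc T_measurable] by (simp add: comp_def)
qed

lemma T_nonsing: 
  assumes "x \<in> {0..1}" "x \<notin> Dset \<beta>"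
  obtains i where "i \<le> b" "0 < x" "x < 1" "real i < \<beta> * x" "\<beta> * x < real i + 1"
    "T x = real i + 1 - \<beta> * x"
proof (rule T_cases[OF assms(1)])
  assume "x = 0"
  then have "x = real 0 / \<beta>" by simp
  then show ?thesis using assms(2) unfolding Dset_def by blast
qed (use assms(2) that T_eq in \<open>auto simp: Dset_def\<close>)

section \<open>One-sided germs of orbits\<close>

text \<open>A germ \<open>(c, s)\<close> stands for the points \<open>c + s t\<close>, \<open>t \<rightarrow> 0+\<close>; only the sign of \<open>s\<close> matters
  for its digits.\<close>

definition gd :: "real \<Rightarrow> real \<Rightarrow> nat" where
  "gd c s = (if s > 0 then nat \<lfloor>\<beta> * c\<rfloor> else nat (\<lceil>\<beta> * c\<rceil> - 1))"

text \<open>Only the base point is propagated: the direction after \<open>k\<close> steps is the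
  explicit \<open>(-\<beta>)^k * s\<close>. Its sign alternates and selects the side on which the
  next digit is read.\<close>

primrec gc :: "real \<Rightarrow> real \<Rightarrow> nat \<Rightarrow> real" where
  "gc c s 0 = c"
| "gc c s (Suc k) = real (gd (gc c s k) ((-\<beta>)^k * s)) + 1 - \<beta> * gc c s k"

definition inner_germ :: "real \<Rightarrow> real \<Rightarrow> bool" where
  "inner_germ c s \<longleftrightarrow> s \<noteq> 0 \<and> (\<forall>\<^sub>F t in at_right 0. 0 < c + s * t \<and> c + s * t < 1)"

lemma eventually_germ_less:
  fixes c s u :: real
  assumes "c < u \<or> (c = u \<and> s < 0)"
  shows "\<forall>\<^sub>F t in at_right 0. c + s * t < u"
proof (cases "c < u")
  case True
  have "((\<lambda>t. c + s * t) \<longlongrightarrow> c + s * 0) (at_right 0)" by (intro tendsto_intros)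
  then show ?thesis using True order_tendstoD(2) by fastforce
next
  case False
  then have "c = u" "s < 0" using assms by auto
  then show ?thesis
    using eventually_at_right_less[of 0] by (auto simp: mult_neg_pos elim: eventually_mono)
qed

lemma eventually_germ_greater:
  fixes c s u :: real
  assumes "u < c \<or> (c = u \<and> s > 0)"
  shows "\<forall>\<^sub>F t in at_right 0. u < c + s * t"
  using eventually_germ_less[of "-c" "-u" "-s"] assms by (force elim: eventually_mono)

lemma germ_range:
  assumes "inner_germ c s" shows "0 \<le> c" "c \<le> 1" "c = 0 \<Longrightarrow> s > 0" "c = 1 \<Longrightarrow> s < 0"
proof -
  have ev: "\<forall>\<^sub>F t in at_right 0. 0 < c + s * t \<and> c + s * t < 1" using assms by (simp add: inner_germ_def)
  have *: "False" if "\<forall>\<^sub>F t in at_right (0::real). \<not> (0 < c + s * t \<and> c + s * t < 1)"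
    using eventually_conj[OF ev that] by (metis (no_types, lifting) eventually_False eventually_mono trivial_limit_at_right_real)
  have s: "s \<noteq> 0" using assms by (simp add: inner_germ_def)
  show "0 \<le> c" using *[OF eventually_mono[OF eventually_germ_less[of c 0 s]]] by force
  show "c \<le> 1" using *[OF eventually_mono[OF eventually_germ_greater[of 1 c s]]] by force
  show "s > 0" if "c = 0" using *[OF eventually_mono[OF eventually_germ_less[of c 0 s]]] that s by force
  show "s < 0" if "c = 1" using *[OF eventually_mono[OF eventually_germ_greater[of 1 c s]]] that s by force
qed

lemma inner_germI:
  assumes "s \<noteq> 0" "0 < c \<or> (c = 0 \<and> s > 0)" "c < 1 \<or> (c = 1 \<and> s < 0)"
  shows "inner_germ c s"
  unfolding inner_germ_def using assms
  by (auto intro!: eventually_conj eventually_germ_less eventually_germ_greater)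

lemma gd_digit:
  assumes "inner_germ c s"
  shows "\<forall>\<^sub>F t in at_right 0. real (gd c s) < \<beta> * (c + s * t) \<and> \<beta> * (c + s * t) < real (gd c s) + 1"
proof -
  have s: "s \<noteq> 0" using assms by (simp add: inner_germ_def)
  have "real (gd c s) < \<beta> * c \<or> (\<beta> * c = real (gd c s) \<and> \<beta> * s > 0)"
       "\<beta> * c < real (gd c s) + 1 \<or> (\<beta> * c = real (gd c s) + 1 \<and> \<beta> * s < 0)"
  proof -
    have *: "(real (gd c s) < \<beta> * c \<or> (\<beta> * c = real (gd c s) \<and> \<beta> * s > 0)) \<and>
       (\<beta> * c < real (gd c s) + 1 \<or> (\<beta> * c = real (gd c s) + 1 \<and> \<beta> * s < 0))"
    proof (cases "s > 0")
      case True
      have "0 \<le> \<beta> * c" using germ_range(1)[OF assms] by simp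
      then have "real (gd c s) = of_int \<lfloor>\<beta> * c\<rfloor>" using True by (simp add: gd_def)
      moreover have "\<beta> * s > 0" using True by simp
      ultimately show ?thesis by linarith
    next
      case False
      then have sn: "s < 0" using s by simp
      then have "0 < c" using germ_range[OF assms] by fastforce
      then have "0 < \<beta> * c" by simp
      then have "1 \<le> \<lceil>\<beta> * c\<rceil>" by linarith
      then have "real (gd c s) = of_int \<lceil>\<beta> * c\<rceil> - 1" using False by (simp add: gd_def)
      moreover have "\<beta> * s < 0" using sn by (simp add: mult_pos_neg)
      ultimately show ?thesis by linarith
    qed
    show "real (gd c s) < \<beta> * c \<or> (\<beta> * c = real (gd c s) \<and> \<beta> * s > 0)" using * by blast
    show "\<beta> * c < real (gd c s) + 1 \<or> (\<beta> * c = real (gd c s) + 1 \<and> \<beta> * s < 0)" using * by blast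
  qed
  note eventually_conj[OF eventually_germ_greater[OF this(1)] eventually_germ_less[OF this(2)]]
  then show ?thesis by (simp add: algebra_simps)
qed

lemma germ_step:
  assumes "inner_germ c s"
  shows "\<forall>\<^sub>F t in at_right 0. T (c + s * t) = (real (gd c s) + 1 - \<beta> * c) + (- \<beta> * s) * t"
    "inner_germ (real (gd c s) + 1 - \<beta> * c) (- \<beta> * s)"
proof -
  have ev: "\<forall>\<^sub>F t in at_right 0. 0 < c + s * t \<and> c + s * t < 1" and s: "s \<noteq> 0"
    using assms by (simp_all add: inner_germ_def)
  show "\<forall>\<^sub>F t in at_right 0. T (c + s * t) = (real (gd c s) + 1 - \<beta> * c) + (- \<beta> * s) * t"
    using ev gd_digit[OF assms]
  proof eventually_elim
    case (elim t) then show ?case using T_eq[of "c + s * t" "gd c s"] by (simp add: algebra_simps)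
  qed
  have "\<forall>\<^sub>F t in at_right 0. 0 < (real (gd c s) + 1 - \<beta> * c) + (- \<beta> * s) * t \<and>
     (real (gd c s) + 1 - \<beta> * c) + (- \<beta> * s) * t < 1"
    using gd_digit[OF assms] by eventually_elim (auto simp: algebra_simps)
  then show "inner_germ (real (gd c s) + 1 - \<beta> * c) (- \<beta> * s)"
    using s by (simp add: inner_germ_def)
qed

lemma inner_germ_gc: "inner_germ c s \<Longrightarrow> inner_germ (gc c s k) ((-\<beta>)^k * s)"
proof (induction k)
  case (Suc k)
  show ?case using germ_step(2)[OF Suc.IH[OF Suc.prems]] by (simp add: algebra_simps)
qed simp

text \<open>For small \<open>t\<close> every point of the germ lies inside an open branch at each of
  the \<open>k\<close> steps, so the values of \<open>T\<close> at the cut points never enter. How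
  small \<open>t\<close> must be depends on \<open>k\<close>.\<close>

lemma germ_iter:
  assumes "inner_germ c s"
  shows "\<forall>\<^sub>F t in at_right 0. (T ^^ k) (c + s * t) = gc c s k + ((-\<beta>)^k * s) * t"
proof (induction k)
  case (Suc k)
  show ?case using Suc germ_step(1)[OF inner_germ_gc[OF assms, of k]]
    by eventually_elim (simp add: algebra_simps)
qed simp

lemma gd_scale: "r > 0 \<Longrightarrow> gd c (r * s) = gd c s"
  by (simp add: gd_def zero_less_mult_iff)

lemma gc_scale: "r > 0 \<Longrightarrow> gc c (r * s) k = gc c s k"
proof (induction k)
  case (Suc k)
  have "(-\<beta>)^k * (r * s) = r * ((-\<beta>)^k * s)" by simp
  then show ?case using Suc gd_scale[of r] by (simp del: mult.left_commute add: mult.left_commute[of _ r])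
qed simp

lemma gc_add: "gc c s (k + j) = gc (gc c s k) ((-\<beta>)^k * s) j"
  by (induction j) (simp_all add: power_add algebra_simps)

section \<open>The left germ of 1 and the two cases of the definition\<close>

lemma inner_germ_1: "inner_germ 1 (-1)" by (rule inner_germI) auto

text \<open>Base points, directions and digits of the left germ of 1; the digits \<open>d1\<close>
  turn out to be the limit itinerary \<open>i'(1)\<close> on which the two cases depend.\<close>

abbreviation e1 :: "nat \<Rightarrow> real" where "e1 \<equiv> gc 1 (-1)"
definition s1 :: "nat \<Rightarrow> real" where "s1 k = (-\<beta>)^k * (-1)"
definition d1 :: "nat \<Rightarrow> nat" where "d1 k = gd (e1 k) (s1 k)"

lemma e1_Suc: "e1 (Suc k) = real (d1 k) + 1 - \<beta> * e1 k"
  by (simp add: d1_def s1_def)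

lemma s1_Suc: "s1 (Suc k) = - \<beta> * s1 k" by (simp add: s1_def)

lemma inner_germ_e1: "inner_germ (e1 k) (s1 k)"
  using inner_germ_gc[OF inner_germ_1, of k] by (simp add: s1_def)

text \<open>A germ inside the unit interval can sit at 1 only on its left. After \<open>k\<close>
  steps it is therefore the initial germ up to a positive scale, and all digits repeat.\<close>

lemma e1_period:
  assumes "e1 k = 1" shows "d1 (k + j) = d1 j"
proof -
  have neg: "s1 k < 0" using germ_range(4)[OF inner_germ_e1] assms by simp
  have "e1 (k + j) = gc 1 (s1 k) j" using gc_add[of 1 "-1" k j] assms by (simp add: s1_def)
  also have "\<dots> = e1 j" using gc_scale[of "- s1 k" 1 "-1"] neg by simp
  finally have e: "e1 (k + j) = e1 j" .
  have "s1 (k + j) = (- s1 k) * s1 j" by (simp add: s1_def power_add)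
  then show ?thesis unfolding d1_def e using gd_scale[of "- s1 k"] neg by simp
qed

lemma eventually_at_left_1: "eventually P (at_left (1::real)) \<longleftrightarrow> (\<forall>\<^sub>F t in at_right 0. P (1 + (-1) * t))"
proof
  assume "eventually P (at_left (1::real))"
  then obtain y where "y < 1" "\<And>x. y < x \<Longrightarrow> x < 1 \<Longrightarrow> P x" by (auto simp: eventually_at_left_field)
  then show "\<forall>\<^sub>F t in at_right 0. P (1 + (-1) * t)"
    unfolding eventually_at_right_field by (intro exI[of _ "1 - y"]) auto
next
  assume "\<forall>\<^sub>F t in at_right 0. P (1 + (-1) * t)"
  then obtain y where y: "y > 0" "\<And>t. 0 < t \<Longrightarrow> t < y \<Longrightarrow> P (1 + (-1) * t)" by (auto simp: eventually_at_right_field)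
  have "P x" if "1 - y < x" "x < 1" for x using y(2)[of "1 - x"] that by simp
  then show "eventually P (at_left (1::real))"
    unfolding eventually_at_left_field using y(1) by (intro exI[of _ "1 - y"]) auto
qed

text \<open>\<open>case1\<close> is stated through \<open>Tint\<close>, so the germ has to be
  followed under \<open>Tint\<close> rather than under \<open>T\<close>.\<close>

lemma itin_d1: "\<forall>\<^sub>F x in at_left 1. itin \<beta> x k = d1 k"
proof -
  have pw: "\<forall>\<^sub>F t in at_right 0. (Tint \<beta> ^^ j) (1 + (-1) * t) = e1 j + s1 j * t" for j
  proof (induction j)
    case 0 then show ?case by (simp add: s1_def)
  next
    case (Suc j)
    have "\<forall>\<^sub>F t in at_right 0. 0 < e1 j + s1 j * t \<and> e1 j + s1 j * t < 1"
      using inner_germ_e1[of j] by (simp add: inner_germ_def)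
    then show ?case using Suc gd_digit[OF inner_germ_e1[of j]]
    proof eventually_elim
      case (elim t)
      then have "Tint \<beta> (e1 j + s1 j * t) = e1 (Suc j) + s1 (Suc j) * t"
        using Tint_eq[of "e1 j + s1 j * t" "d1 j"] unfolding e1_Suc s1_Suc
        by (simp add: d1_def algebra_simps)
      then show ?case using elim by simp
    qed
  qed
  have "\<forall>\<^sub>F t in at_right 0. 0 < e1 k + s1 k * t \<and> e1 k + s1 k * t < 1"
    using inner_germ_e1[of k] by (simp add: inner_germ_def)
  then show ?thesis unfolding eventually_at_left_1 using pw[of k] gd_digit[OF inner_germ_e1[of k]]
  proof eventually_elim
    case (elim t)
    then show ?case using Iint_the[of "e1 k + s1 k * t" "d1 k"] by (simp add: itin_def d1_def)
  qed
qed

text \<open>The condition in \<open>case1\<close> speaks only about points outside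
  \<open>badset\<close>. Countability provides such points arbitrarily close to 1, so the digits
  required there are unique.\<close>

lemma countable_badset: "countable (badset \<beta> \<inter> {0<..<1})"
proof -
  have step: "countable {x \<in> {0<..<1}. Tint \<beta> x \<in> A}" if "countable A" for A :: "real set"
  proof -
    have "{x \<in> {0<..<1}. Tint \<beta> x \<in> A} \<subseteq> (\<lambda>i. real i / \<beta>) ` UNIV \<union> (\<Union>i. (\<lambda>a. (real i + 1 - a) / \<beta>) ` A)"
    proof
      fix x assume x: "x \<in> {x \<in> {0<..<1}. Tint \<beta> x \<in> A}"
      then have x1: "x \<in> {0..1}" by auto
      show "x \<in> (\<lambda>i. real i / \<beta>) ` UNIV \<union> (\<Union>i. (\<lambda>a. (real i + 1 - a) / \<beta>) ` A)"
      proof (cases rule: T_cases[OF x1])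
        case (4 i)
        then have "Tint \<beta> x = real i + 1 - \<beta> * x" using Tint_eq by blast
        then have "x = (real i + 1 - Tint \<beta> x) / \<beta>" by simp
        then show ?thesis using x by blast
      qed (use x in auto)
    qed
    moreover have "countable ((\<lambda>i. real i / \<beta>) ` UNIV \<union> (\<Union>i. (\<lambda>a. (real i + 1 - a) / \<beta>) ` A))"
      using that by (intro countable_Un countable_image countable_UN) auto
    ultimately show ?thesis by (rule countable_subset)
  qed
  have D: "countable (Dset \<beta>)" by (simp add: Dset_def setcompr_eq_image countable_finite)
  \<comment> \<open>The extra value 0 is the default of \<open>Tint\<close> off the open branches;
    it is added to the countable target set in the induction below.\<close>
  have rng: "Tint \<beta> x \<in> insert 0 {0<..<1}" for x
  proof (cases "\<exists>i\<le>b. x \<in> Iint \<beta> i")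
    case True
    then obtain i where "i \<le> b" "x \<in> Iint \<beta> i" by blast
    then have "0 < x" "x < 1" "real i < \<beta> * x" "\<beta> * x < real i + 1" by (auto simp: Iint_iff)
    then show ?thesis using Tint_eq[of x i] by simp
  qed (auto simp: Tint_def)
  have Z: "countable {x \<in> {0<..<1}. (Tint \<beta> ^^ k) x \<in> Dset \<beta>}" for k
  proof (induction k)
    case 0 show ?case using D by (auto intro: countable_subset)
  next
    case (Suc k)
    have "{x \<in> {0<..<1}. (Tint \<beta> ^^ Suc k) x \<in> Dset \<beta>} \<subseteq>
      {x \<in> {0<..<1}. Tint \<beta> x \<in> insert 0 {x \<in> {0<..<1}. (Tint \<beta> ^^ k) x \<in> Dset \<beta>}}"
      using rng by (auto simp: funpow_swap1)
    then show ?case using step[OF countable_insert[OF Suc, of 0]] countable_subset by blast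
  qed
  have "badset \<beta> \<inter> {0<..<1} = (\<Union>k. {x \<in> {0<..<1}. (Tint \<beta> ^^ k) x \<in> Dset \<beta>})"
    by (auto simp: badset_def)
  then show ?thesis using Z by simp
qed

lemma case1_iff: "case1 \<beta> \<longleftrightarrow> (\<exists>p>0. d1 (p - 1) = 0 \<and> (\<forall>k. d1 (k + p) = d1 k))"
proof
  assume "case1 \<beta>"
  then obtain d p where d: "\<And>k. \<forall>\<^sub>F x in at_left 1. x \<notin> badset \<beta> \<longrightarrow> itin \<beta> x k = d k"
    and p: "p > 0" "d (p - 1) = 0" "\<And>k. d (k + p) = d k" unfolding case1_def by blast
  have "d k = d1 k" for k
  proof -
    have "\<forall>\<^sub>F x in at_left 1. x \<notin> badset \<beta> \<longrightarrow> d k = d1 k"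
      using d[of k] itin_d1[of k] by eventually_elim auto
    then obtain y where y: "y < 1" "\<And>x. y < x \<Longrightarrow> x < 1 \<Longrightarrow> x \<notin> badset \<beta> \<longrightarrow> d k = d1 k"
      unfolding eventually_at_left_field by blast
    have "uncountable {max y 0<..<(1::real)}" using y(1) by (intro uncountable_open_interval[THEN iffD2]) auto
    then have "\<not> {max y 0<..<1} \<subseteq> badset \<beta> \<inter> {0<..<1}" using countable_badset countable_subset by blast
    then obtain x where "max y 0 < x" "x < 1" "x \<notin> badset \<beta>" by fastforce
    then show ?thesis using y(2)[of x] by auto
  qed
  then show "\<exists>p>0. d1 (p - 1) = 0 \<and> (\<forall>k. d1 (k + p) = d1 k)" using p by auto
next
  assume "\<exists>p>0. d1 (p - 1) = 0 \<and> (\<forall>k. d1 (k + p) = d1 k)"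
  moreover have "\<forall>k. \<forall>\<^sub>F x in at_left 1. x \<notin> badset \<beta> \<longrightarrow> itin \<beta> x k = d1 k"
    
  proof
    fix k show "\<forall>\<^sub>F x in at_left 1. x \<notin> badset \<beta> \<longrightarrow> itin \<beta> x k = d1 k"
      by (rule eventually_mono[OF itin_d1[of k]]) simp
  qed
  ultimately show "case1 \<beta>" unfolding case1_def by blast
qed

text \<open>The side from which \<open>T\<close> is not continuous at the points \<open>i / \<beta>\<close>.\<close>
definition bad_side :: real where "bad_side = (if case1 \<beta> then 1 else -1)"

lemma div_bounds: "i \<in> {1..b} \<Longrightarrow> 0 < real i / \<beta> \<and> real i / \<beta> < 1"
  using b_less by (auto simp: field_simps)

lemma inner_germ_div: "i \<in> {1..b} \<Longrightarrow> s \<noteq> 0 \<Longrightarrow> inner_germ (real i / \<beta>) s"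
  using div_bounds by (intro inner_germI) auto

text \<open>Landing on the side of \<open>i / \<beta>\<close> that is mapped to \<open>1\<close> closes the orbit of \<open>1\<close> with the digit \<open>i\<close>;
  landing on the other side closes it, via \<open>0\<close>, with the digit \<open>0\<close>.\<close>
lemma e1_not_bad_side:
  assumes i: "i \<in> {1..b}" and e: "e1 k = real i / \<beta>"
  shows "bad_side * s1 k < 0"
proof (rule ccontr)
  assume "\<not> bad_side * s1 k < 0"
  moreover have s: "s1 k \<noteq> 0" by (simp add: s1_def)
  ultimately have bad: "bad_side * s1 k > 0" by (simp add: bad_side_def split: if_splits)
  show False
  proof (cases "case1 \<beta>")
    case True
    then have sp: "s1 k > 0" using bad by (simp add: bad_side_def)
    then have dk: "d1 k = i" using e by (simp add: d1_def gd_def)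
    have "e1 (Suc k) = 1" using e1_Suc[of k] dk e by simp
    note per = e1_period[OF this]
    obtain p where p: "p > 0" "d1 (p - 1) = 0" "\<And>k. d1 (k + p) = d1 k" using True case1_iff by blast
    have 1: "d1 (p - 1 + m * p) = 0" for m
    proof (induction m)
      case (Suc m) then show ?case using p(3)[of "p - 1 + m * p"] by (simp add: algebra_simps)
    qed (use p in simp)
    have 2: "d1 (k + m * Suc k) = i" for m
    proof (induction m)
      case (Suc m) then show ?case using per[of "k + m * Suc k"] by (simp add: algebra_simps)
    qed (use dk in simp)
    \<comment> \<open>Both arithmetic progressions contain \<open>p * Suc k - 1\<close>, where the
      first forces the digit 0 and the second the digit \<open>i\<close>, which is at least
      1.\<close>
    have eq: "p - 1 + k * p = k + (p - 1) * Suc k" using p(1) by (cases p) (auto simp: algebra_simps)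
    have "i = d1 (k + (p - 1) * Suc k)" by (rule 2[symmetric])
    also have "\<dots> = 0" unfolding eq[symmetric] by (rule 1)
    finally have "i = 0" .
    then show False using i by simp
  next
    case False
    then have sn: "s1 k < 0" using bad by (simp add: bad_side_def)
    then have dk: "real (d1 k) = real i - 1" using e i by (auto simp: d1_def gd_def nat_diff_distrib)
    have e2: "e1 (Suc k) = 0" using e1_Suc[of k] dk e by simp
    have "s1 (Suc k) > 0" using sn by (simp add: s1_Suc mult_pos_neg)
    then have d2: "d1 (Suc k) = 0" using e2 by (simp add: d1_def gd_def)
    have "e1 (Suc (Suc k)) = 1" using e1_Suc[of "Suc k"] d2 e2 by simp
    note per = e1_period[OF this]
    \<comment> \<open>The digit at position \<open>Suc k\<close> is 0, so the period
      \<open>Suc (Suc k)\<close> has the form required by case 1, which is excluded here.\<close>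
    have "case1 \<beta>" unfolding case1_iff
      by (rule exI[of _ "Suc (Suc k)"]) (use d2 per in \<open>auto simp: add.commute\<close>)
    then show False using False by simp
  qed
qed

text \<open>At a cut point \<open>T\<close> takes its one-sided limit from the side opposite to
  \<open>bad_side\<close>, and the germ of 1 only ever arrives on that side. The prescribed values
  at the cut points, at 0 and at 1 thus continue the germ.\<close>

lemma e1_eq_Tpow: "e1 k = (T ^^ k) 1"
proof (induction k)
  case (Suc k)
  have r: "e1 k \<in> {0..1}" using germ_range[OF inner_germ_e1[of k]] by simp
  have "T (e1 k) = real (d1 k) + 1 - \<beta> * e1 k"
  proof (cases rule: T_cases[OF r])
    case 1
    then have "s1 k > 0" using germ_range(3)[OF inner_germ_e1[of k]] by simp
    then show ?thesis using 1 by (simp add: d1_def gd_def T_0)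
  next
    case 2
    then have "s1 k < 0" using germ_range(4)[OF inner_germ_e1[of k]] by simp
    moreover have "\<lceil>\<beta>\<rceil> - 1 = int b" using b_less beta_le by linarith
    ultimately show ?thesis using 2 T_1 by (simp add: d1_def gd_def)
  next
    case (3 i)
    show ?thesis
    proof (cases "case1 \<beta>")
      case True
      then have "s1 k < 0" using e1_not_bad_side[OF 3] by (simp add: bad_side_def)
      then show ?thesis using 3 True T_div[of i] by (auto simp: d1_def gd_def nat_diff_distrib)
    next
      case False
      then have "s1 k > 0" using e1_not_bad_side[OF 3] by (simp add: bad_side_def)
      then show ?thesis using 3 False T_div[of i] by (auto simp: d1_def gd_def)
    qed
  next
    case (4 i)
    have "\<lceil>\<beta> * e1 k\<rceil> = int i + 1" "\<lfloor>\<beta> * e1 k\<rfloor> = int i" using 4 by linarith+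
    then have "d1 k = i" by (auto simp: d1_def gd_def)
    then show ?thesis using T_eq[OF 4(2-)] by simp
  qed
  then show ?case using Suc e1_Suc[of k] by (simp del: gc.simps)
qed simp

section \<open>Orbits on the discontinuous side of the cut points\<close>

definition bad_nbhd :: "nat \<Rightarrow> real \<Rightarrow> real set" where
  "bad_nbhd i \<delta> = (\<lambda>t. real i / \<beta> + bad_side * t) ` {0<..<\<delta>}"

lemma bad_side_sq: "bad_side * bad_side = 1" "bad_side \<noteq> 0" by (simp_all add: bad_side_def)

text \<open>From the bad side the germ is carried to the left of 1, in one step in case 1 and in two
  steps through 0 in case 2. From then on it is the germ of 1, which meets
  \<open>i / \<beta>\<close> only on the other side, so a return must reverse the direction.\<close>

lemma gc_bad_no_return:
  assumes i: "i \<in> {1..b}" and j: "j \<ge> 1" and e: "gc (real i / \<beta>) bad_side j = real i / \<beta>"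
  shows "(-\<beta>)^j < 0"
proof -
  define D where "D = real i / \<beta>"
  have D: "0 < D" "D < 1" using div_bounds[OF i] by (auto simp: D_def)
  show ?thesis
  proof (cases "case1 \<beta>")
    case True
    then have bs: "bad_side = 1" by (simp add: bad_side_def)
    obtain k where k: "j = Suc k" using j by (cases j) auto
    have c1: "gc D bad_side 1 = 1" by (simp add: bs gd_def D_def)
    have "gc D bad_side j = gc 1 (-\<beta>) k" using gc_add[of D bad_side 1 k] c1 by (simp add: k bs del: gc.simps)
    also have "\<dots> = e1 k" using gc_scale[of \<beta> 1 "-1" k] by simp
    finally have "e1 k = real i / \<beta>" using e by (simp add: D_def)
    from e1_not_bad_side[OF i this] have "(-\<beta>)^k > 0" by (simp add: bs s1_def)
    then show ?thesis by (simp add: k)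
  next
    case False
    then have bs: "bad_side = -1" by (simp add: bad_side_def)
    have c1: "gc D bad_side (Suc 0) = 0" using i by (auto simp: bs gd_def D_def nat_diff_distrib)
    have c2: "gc D bad_side 2 = 1" using gc.simps(2)[of D bad_side "Suc 0"] unfolding c1 by (simp add: numeral_2_eq_2 bs gd_def)
    obtain k where k: "j = Suc k" using j by (cases j) auto
    have "k \<noteq> 0"
    proof
      assume "k = 0"
      then have "gc D bad_side j = 0" using k c1 by simp
      then show False using e D by (simp add: D_def)
    qed
    then obtain l where l: "j = Suc (Suc l)" using k by (cases k) auto
    have "gc D bad_side j = gc 1 (- (\<beta>^2)) l" using gc_add[of D bad_side 2 l] c2
      by (simp add: l bs del: gc.simps)
    also have "\<dots> = e1 l" using gc_scale[of "\<beta>^2" 1 "-1" l] by simp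
    finally have "e1 l = real i / \<beta>" using e by (simp add: D_def)
    from e1_not_bad_side[OF i this] have "(-\<beta>)^l < 0" by (simp add: bs s1_def)
    then show ?thesis by (simp add: l mult_less_0_iff)
  qed
qed

text \<open>Up to time \<open>M\<close> there are finitely many limit positions of the germ: those
  different from the cut point keep a positive distance from it, and those equal to it arrive on the
  other side.\<close>

lemma bad_nbhd_no_return:
  assumes i: "i \<in> {1..b}"
  shows "\<forall>\<^sub>F \<delta> in at_right 0. \<forall>x\<in>bad_nbhd i \<delta>. \<forall>j\<in>{1..M}. (T ^^ j) x \<notin> bad_nbhd i \<delta>"
proof -
  define D where "D = real i / \<beta>"
  have ig: "inner_germ D bad_side" using inner_germ_div[OF i bad_side_sq(2)] by (simp add: D_def)
  have one: "\<forall>\<^sub>F \<delta> in at_right 0. \<forall>x\<in>bad_nbhd i \<delta>. (T ^^ j) x \<notin> bad_nbhd i \<delta>" if j: "j \<in> {1..M}" for j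
  proof -
    define c where "c = gc D bad_side j"
    have "\<exists>e>0. \<forall>t\<in>{0<..<e}. \<forall>u\<in>{0<..<e}. c + ((-\<beta>)^j * bad_side) * t \<noteq> D + bad_side * u"
    proof (cases "c = D")
      case True
      then have "(-\<beta>)^j < 0" using gc_bad_no_return[OF i, of j] j by (simp add: c_def D_def)
      then have "(-\<beta>)^j * t < u" if "t > 0" "u > 0" for t u using that
        by (meson less_trans mult_neg_pos)
      then have "(-\<beta>)^j * t \<noteq> u" if "t > 0" "u > 0" for t u using that by fastforce
      then have "\<forall>t\<in>{0<..<1}. \<forall>u\<in>{0<..<1}. c + ((-\<beta>)^j * bad_side) * t \<noteq> D + bad_side * u"
        using True bad_side_sq(2) by (auto simp: mult.commute[of _ bad_side] mult.assoc)
      then show ?thesis using zero_less_one by blast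
    next
      case False
      \<comment> \<open>The germ moves by less than \<open>\<beta>^j * e\<close> and the target by
        less than \<open>e\<close>; together they cannot bridge the gap between \<open>c\<close> and
        \<open>D\<close>.\<close>
      define e where "e = \<bar>c - D\<bar> / (\<beta>^j + 1)"
      have bp: "\<beta>^j > 0" by simp
      have e: "e > 0" unfolding e_def using False bp by (intro divide_pos_pos) (auto intro: add_pos_pos)
      have "c + ((-\<beta>)^j * bad_side) * t \<noteq> D + bad_side * u" if tu: "t \<in> {0<..<e}" "u \<in> {0<..<e}" for t u
      proof
        assume "c + ((-\<beta>)^j * bad_side) * t = D + bad_side * u"
        then have "c - D = bad_side * u - (-\<beta>)^j * bad_side * t" by simp
        moreover have "\<bar>bad_side\<bar> = 1" by (simp add: bad_side_def)
        moreover have "\<bar>bad_side * u - (-\<beta>)^j * bad_side * t\<bar> \<le> \<bar>bad_side * u\<bar> + \<bar>(-\<beta>)^j * bad_side * t\<bar>"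
          by (rule abs_triangle_ineq4)
        ultimately have "\<bar>c - D\<bar> \<le> u + \<beta>^j * t" using tu by (simp add: abs_mult power_abs)
        also have "\<dots> < e + \<beta>^j * e" using tu bp by (intro add_strict_mono) auto
        also have "\<dots> = \<bar>c - D\<bar>" 
        proof -
          have "e + \<beta>^j * e = e * (\<beta>^j + 1)" by (simp add: algebra_simps)
          moreover have "\<beta>^j + 1 \<noteq> 0" using bp by linarith
          ultimately show ?thesis by (simp add: e_def)
        qed
        finally show False by simp
      qed
      then show ?thesis using e by blast
    qed
    then obtain e where e: "e > 0" "\<And>t u. t \<in> {0<..<e} \<Longrightarrow> u \<in> {0<..<e} \<Longrightarrow> c + ((-\<beta>)^j * bad_side) * t \<noteq> D + bad_side * u"
      by blast
    obtain e' where e': "e' > 0" "\<And>t. 0 < t \<Longrightarrow> t < e' \<Longrightarrow> (T ^^ j) (D + bad_side * t) = c + ((-\<beta>)^j * bad_side) * t"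
      using germ_iter[OF ig, of j] by (auto simp: eventually_at_right_field c_def)
    show ?thesis unfolding eventually_at_right_field
    proof (intro exI[of _ "min e e'"] conjI allI impI ballI notI)
      fix \<delta> x assume d: "0 < \<delta>" "\<delta> < min e e'" and x: "x \<in> bad_nbhd i \<delta>" and "(T ^^ j) x \<in> bad_nbhd i \<delta>"
      then obtain t u where "0 < t" "t < \<delta>" "x = D + bad_side * t" "0 < u" "u < \<delta>" "(T ^^ j) x = D + bad_side * u"
        by (auto simp: bad_nbhd_def D_def)
      then show False using e(2)[of t u] e'(2)[of t] d by auto
    qed (use e e' in auto)
  qed
  have "\<forall>\<^sub>F \<delta> in at_right 0. \<forall>j\<in>{1..M}. \<forall>x\<in>bad_nbhd i \<delta>. (T ^^ j) x \<notin> bad_nbhd i \<delta>"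
    using one by (intro eventually_ball_finite) auto
  then show ?thesis by (rule eventually_mono) blast
qed

end

section \<open>Entropy of simple functions along an invariant measure\<close>

text \<open>Division with remainder by a fixed \<open>m\<close> compares \<open>a n / n\<close> with
  \<open>a m / m\<close>. The limit is also recorded as a lower bound of the sequence, since the
  count of arrangements uses the entropy at one finite block length.\<close>

lemma fekete:
  fixes a :: "nat \<Rightarrow> real"
  assumes nn: "\<And>n. 0 \<le> a n" and sub: "\<And>m n. a (m + n) \<le> a m + a n"
  shows "\<exists>L. (\<lambda>n. a n / real n) \<longlonglongrightarrow> L \<and> (\<forall>n\<ge>1. L \<le> a n / real n)"
proof -
  define L where "L = Inf ((\<lambda>n. a n / real n) ` {1..})"
  have bdd: "bdd_below ((\<lambda>n. a n / real n) ` {1..})" using nn by (intro bdd_belowI2[of _ 0]) auto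
  have L: "L \<le> a n / real n" if "n \<ge> 1" for n
    unfolding L_def using that bdd by (intro cInf_lower) auto
  have mult: "a (q * m + r) \<le> real q * a m + a r" for q m r
  proof (induction q)
    case (Suc q)
    have "a (Suc q * m + r) \<le> a m + a (q * m + r)" using sub[of m "q * m + r"] by (simp add: algebra_simps)
    then show ?case using Suc by (simp add: algebra_simps)
  qed simp
  have "(\<lambda>n. a n / real n) \<longlonglongrightarrow> L"
  proof (rule LIMSEQ_I)
    fix e :: real assume e: "0 < e"
    have "\<exists>x\<in>(\<lambda>n. a n / real n) ` {1..}. x < L + e / 2"
      using cInf_lessD[of "(\<lambda>n. a n / real n) ` {1..}" "L + e/2"] e by (auto simp: L_def)
    then obtain m where m: "m \<ge> 1" "a m / real m < L + e / 2" by auto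
    define K where "K = (\<Sum>r<m. a r)"
    have K: "a r \<le> K" if "r < m" for r unfolding K_def using nn that by (intro member_le_sum) auto
    have K0: "K \<ge> 0" unfolding K_def using nn by (intro sum_nonneg) auto
    obtain N where N: "real N > 2 * K / e" using reals_Archimedean2 by blast
    have "norm (a n / real n - L) < e" if n: "n \<ge> Suc N" for n
    proof -
      have np: "real n > 0" using n by simp
      have "a n \<le> real (n div m) * a m + a (n mod m)" using mult[of "n div m" m "n mod m"] by simp
      also have "\<dots> \<le> (real n / real m) * a m + K"
        using K[of "n mod m"] m nn[of m] by (intro add_mono mult_right_mono) (auto simp: field_simps simp flip: of_nat_mult)
      finally have "a n / real n \<le> ((real n / real m) * a m + K) / real n"
        using np by (simp add: divide_right_mono)
      also have "\<dots> = a m / real m + K / real n" using np by (simp add: field_simps)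
      also have "K / real n < e / 2"
      proof -
        have "2 * K / e < real n" using N n by (meson Suc_le_lessD less_imp_le less_le_trans of_nat_le_iff)
        then show ?thesis using e np by (simp add: field_simps)
      qed
      finally have "a n / real n < L + e" using m by simp
      then show ?thesis using L[of n] n e by simp
    qed
    then show "\<exists>no. \<forall>n\<ge>no. norm (a n / real n - L) < e" by blast
  qed
  then show ?thesis using L by blast
qed

lemma eta_nonneg: "0 \<le> t \<Longrightarrow> t \<le> 1 \<Longrightarrow> 0 \<le> eta t"
  by (auto simp: eta_def mult_nonneg_nonpos)

lemma tendsto_eta_0: "(eta \<longlongrightarrow> 0) (at_right 0)"
proof -
  have "((\<lambda>t::real. - t * ln t) \<longlongrightarrow> 0) (at_right 0)" by real_asymp
  moreover have "\<forall>\<^sub>F t in at_right 0. - t * ln t = eta t"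
    using eventually_at_right_less[of "0::real"] by eventually_elim (simp add: eta_def)
  ultimately show ?thesis using tendsto_cong by fastforce
qed

text \<open>Both ends matter: an almost constant label has one class of measure near 1 and all
  others near 0, and each of them must contribute little entropy.\<close>

lemma eta_small:
  assumes "(e::real) > 0"
  obtains d where "d > 0" "d < 1" "\<And>t. 0 \<le> t \<Longrightarrow> t \<le> d \<Longrightarrow> eta t \<le> e" "\<And>t. 1 - d \<le> t \<Longrightarrow> t \<le> 1 \<Longrightarrow> eta t \<le> e"
proof -
  have "\<forall>\<^sub>F t in at_right 0. eta t < e" using order_tendstoD(2)[OF tendsto_eta_0 assms] .
  then obtain d0 where d0: "d0 > 0" "\<And>t. 0 < t \<Longrightarrow> t < d0 \<Longrightarrow> eta t < e" by (auto simp: eventually_at_right_field)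
  \<comment> \<open>The part \<open>d \<le> e\<close> serves the end near 1, where
    \<open>eta t \<le> 1 - t\<close>.\<close>
  define d where "d = min (1/2) (min (d0 / 2) e)"
  have d: "d > 0" "d < 1" "d < d0" "d \<le> e" using d0(1) assms by (auto simp: d_def)
  have 1: "eta t \<le> e" if "0 \<le> t" "t \<le> d" for t
    using that d0(2)[of t] d assms by (cases "t = 0") (auto simp: eta_def)
  have 2: "eta t \<le> e" if "1 - d \<le> t" "t \<le> 1" for t
  proof -
    have t: "t > 0" using that d by simp
    have "- t * ln t = t * ln (1 / t)" using t by (simp add: ln_div)
    also have "\<dots> \<le> t * (1 / t - 1)" using t by (intro mult_left_mono ln_le_minus_one) auto
    also have "\<dots> = 1 - t" using t by (simp add: field_simps)
    also have "\<dots> \<le> e" using that d by simp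
    finally show ?thesis using t by (simp add: eta_def)
  qed
  show thesis using that[OF d(1,2)] 1 2 by blast
qed

section \<open>Shannon entropy of labels\<close>

text \<open>Labels take the place of partitions: coarser and joint partitions become functions and
  pairs of random variables, for which the inequalities of information theory are stated.\<close>

definition ent :: "real measure \<Rightarrow> (real \<Rightarrow> 'a) \<Rightarrow> real" where
  "ent \<mu> Y = (\<Sum>v\<in>Y ` {0..1}. eta (measure \<mu> (Y -` {v} \<inter> {0..1})))"

lemma ent_cong: "(\<And>x. x \<in> {0..1} \<Longrightarrow> X x = Y x) \<Longrightarrow> ent \<mu> X = ent \<mu> Y"
proof -
  assume a: "\<And>x. x \<in> {0..1} \<Longrightarrow> X x = Y x"
  then have "X ` {0..1} = Y ` {0..1}" by (intro image_cong) auto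
  moreover have "X -` {v} \<inter> {0..1} = Y -` {v} \<inter> {0..1}" for v using a by auto
  ultimately show ?thesis by (simp add: ent_def)
qed

lemma PmD:
  assumes "\<mu> \<in> Pm"
  shows "space \<mu> = {0..1}" "sets \<mu> = sets B01" "prob_space \<mu>"
  using assms by (auto simp: Pm_def)

lemma ent_entropy:
  assumes "\<mu> \<in> Pm" "simple_function \<mu> Y"
  shows "prob_space.entropy \<mu> (exp 1) (count_space (Y ` space \<mu>)) Y = ent \<mu> Y"
proof -
  interpret prob_space \<mu> using PmD[OF assms(1)] by simp
  interpret information_space \<mu> "exp 1" by unfold_locales simp
  show ?thesis
    by (subst entropy_simple_distributed[OF simple_distributedI[OF assms(2) measure_nonneg refl]])
      (auto simp: ent_def eta_def PmD[OF assms(1)] log_def sum_negf[symmetric] intro!: sum.cong)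
qed

text \<open>Data processing: \<open>Y\<close> factors through \<open>X\<close> on the unit interval,
  the factor being defined by picking a representative of each fibre of \<open>X\<close>.\<close>

lemma ent_mono:
  assumes "\<mu> \<in> Pm" "simple_function \<mu> X"
    and k: "\<And>x y. x \<in> {0..1} \<Longrightarrow> y \<in> {0..1} \<Longrightarrow> X x = X y \<Longrightarrow> Y x = Y y"
  shows "ent \<mu> Y \<le> ent \<mu> X"
proof -
  interpret prob_space \<mu> using PmD[OF assms(1)] by simp
  interpret information_space \<mu> "exp 1" by unfold_locales simp
  define f where "f v = Y (SOME x. x \<in> {0..1} \<and> X x = v)" for v
  have f: "f (X x) = Y x" if "x \<in> {0..1}" for x
  proof -
    have "(SOME z. z \<in> {0..1} \<and> X z = X x) \<in> {0..1} \<and> X (SOME z. z \<in> {0..1} \<and> X z = X x) = X x"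
      by (rule someI[of _ x]) (use that in auto)
    then show ?thesis using k[of "SOME z. z \<in> {0..1} \<and> X z = X x" x] that by (simp add: f_def)
  qed
  have "simple_function \<mu> (f \<circ> X)" using assms(2) by (rule simple_function_compose)
  then have "ent \<mu> (f \<circ> X) \<le> ent \<mu> X"
    using entropy_data_processing[OF assms(2), of f] ent_entropy assms by metis
  moreover have "ent \<mu> (f \<circ> X) = ent \<mu> Y" by (rule ent_cong) (simp add: f)
  ultimately show ?thesis by simp
qed

text \<open>Chain rule, then conditioning does not increase entropy.\<close>

lemma ent_pair:
  assumes "\<mu> \<in> Pm" "simple_function \<mu> X" "simple_function \<mu> Y"
  shows "ent \<mu> (\<lambda>x. (X x, Y x)) \<le> ent \<mu> X + ent \<mu> Y"
proof -
  interpret prob_space \<mu> using PmD[OF assms(1)] by simp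
  interpret information_space \<mu> "exp 1" by unfold_locales simp
  have p: "simple_function \<mu> (\<lambda>x. (X x, Y x))" using assms by (intro simple_function_Pair)
  show ?thesis
    using entropy_chain_rule[OF assms(2,3)] conditional_entropy_less_eq_entropy[OF assms(3,2)]
      ent_entropy[OF assms(1,2)] ent_entropy[OF assms(1,3)] ent_entropy[OF assms(1) p]
    by simp
qed

lemma ent_nonneg: "\<mu> \<in> Pm \<Longrightarrow> 0 \<le> ent \<mu> Y"
  unfolding ent_def by (intro sum_nonneg eta_nonneg) (auto simp: prob_space.prob_le_1 PmD)

locale invariant_system =
  fixes T :: "real \<Rightarrow> real" and \<mu> :: "real measure"
  assumes mu: "\<mu> \<in> Pm" and inv: "invariant T \<mu>"
begin

lemma spc [simp]: "space \<mu> = {0..1}" and sts: "sets \<mu> = sets B01" and prb: "prob_space \<mu>"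
  using PmD[OF mu] by auto

sublocale prob_space \<mu> by (rule prb)

lemma T_meas: "T \<in> B01 \<rightarrow>\<^sub>M B01" using inv by (simp add: invariant_def)

lemma T_meas_mu [measurable]: "T \<in> \<mu> \<rightarrow>\<^sub>M \<mu>"
  using T_meas sts by (simp cong: measurable_cong_sets)

lemma T_pow_meas [measurable]: "(T ^^ n) \<in> \<mu> \<rightarrow>\<^sub>M \<mu>"
proof (induction n)
  case 0 then show ?case by (simp add: id_def)
next
  case (Suc n) then show ?case using measurable_comp[OF Suc T_meas_mu] by (simp add: comp_def)
qed

lemma T_pow_in: "x \<in> {0..1} \<Longrightarrow> (T ^^ n) x \<in> {0..1}"
  using measurable_space[OF T_pow_meas] by simp

lemma distr_T: "distr \<mu> \<mu> T = \<mu>"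
proof -
  have "distr \<mu> \<mu> T = distr \<mu> B01 T" by (rule distr_cong) (auto simp: sts)
  then show ?thesis using inv by (simp add: invariant_def)
qed

lemma distr_T_pow: "distr \<mu> \<mu> (T ^^ n) = \<mu>"
proof (induction n)
  case 0 then show ?case using distr_id[of \<mu>] by (simp add: id_def)
next
  case (Suc n)
  have "distr \<mu> \<mu> (T ^^ Suc n) = distr (distr \<mu> \<mu> (T ^^ n)) \<mu> T"
    by (subst distr_distr) (auto simp: comp_def)
  also have "\<dots> = \<mu>" unfolding Suc by (rule distr_T)
  finally show ?case .
qed

lemma measure_T_pow: "A \<in> sets \<mu> \<Longrightarrow> measure \<mu> ((T ^^ n) -` A \<inter> {0..1}) = measure \<mu> A"
  using measure_distr[OF T_pow_meas, of A n] distr_T_pow[of n] by simp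

lemma integral_T_pow:
  fixes f :: "real \<Rightarrow> real"
  assumes "f \<in> borel_measurable \<mu>"
  shows "(\<integral>x. f ((T ^^ n) x) \<partial>\<mu>) = (\<integral>x. f x \<partial>\<mu>)"
  using integral_distr[OF T_pow_meas assms, of n] distr_T_pow[of n] by simp

lemma fiber_sets: "simple_function \<mu> Y \<Longrightarrow> Y -` {v} \<inter> {0..1} \<in> sets \<mu>"
proof (cases "v \<in> Y ` {0..1}")
  case False then have "Y -` {v} \<inter> {0..1} = {}" by auto
  then show ?thesis by simp
qed (auto simp: simple_function_def)

lemma simple_comp_T: "simple_function \<mu> Y \<Longrightarrow> simple_function \<mu> (\<lambda>x. Y ((T ^^ n) x))"
proof -
  assume Y: "simple_function \<mu> Y"
  have "(\<lambda>x. Y ((T ^^ n) x)) ` {0..1} \<subseteq> Y ` {0..1}" using T_pow_in by blast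
  then have fin: "finite ((\<lambda>x. Y ((T ^^ n) x)) ` {0..1})"
    using Y finite_subset by (auto simp: simple_function_def)
  have "(\<lambda>x. Y ((T ^^ n) x)) -` {v} \<inter> {0..1} \<in> sets \<mu>" for v
  proof -
    have A: "Y -` {v} \<inter> {0..1} \<in> sets \<mu>" by (rule fiber_sets[OF Y])
    have "(\<lambda>x. Y ((T ^^ n) x)) -` {v} \<inter> {0..1} = (T ^^ n) -` (Y -` {v} \<inter> {0..1}) \<inter> space \<mu>"
      using T_pow_in by auto
    then show ?thesis using measurable_sets[OF T_pow_meas A, of n] by simp
  qed
  then show ?thesis using fin by (simp add: simple_function_def)
qed

lemma ent_comp_T:
  assumes Y: "simple_function \<mu> Y" shows "ent \<mu> (\<lambda>x. Y ((T ^^ n) x)) = ent \<mu> Y"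
proof -
  have eq: "measure \<mu> ((\<lambda>x. Y ((T ^^ n) x)) -` {v} \<inter> {0..1}) = measure \<mu> (Y -` {v} \<inter> {0..1})" for v
  proof -
    have "(\<lambda>x. Y ((T ^^ n) x)) -` {v} \<inter> {0..1} = (T ^^ n) -` (Y -` {v} \<inter> {0..1}) \<inter> {0..1}"
      using T_pow_in by auto
    then show ?thesis using measure_T_pow[OF fiber_sets[OF Y]] by simp
  qed
  have "ent \<mu> (\<lambda>x. Y ((T ^^ n) x)) = (\<Sum>v\<in>(\<lambda>x. Y ((T ^^ n) x)) ` {0..1}. eta (measure \<mu> (Y -` {v} \<inter> {0..1})))"
    unfolding ent_def eq ..
  also have "\<dots> = ent \<mu> Y" unfolding ent_def
  proof (rule sum.mono_neutral_left)
    show "finite (Y ` {0..1})" using Y by (simp add: simple_function_def)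
    show "(\<lambda>x. Y ((T ^^ n) x)) ` {0..1} \<subseteq> Y ` {0..1}" using T_pow_in by blast
    \<comment> \<open>By invariance a value of \<open>Y\<close> that is missed along
      \<open>T ^^ n\<close> has a fibre of measure zero, and \<open>eta 0 = 0\<close>.\<close>
    show "\<forall>i\<in>Y ` {0..1} - (\<lambda>x. Y ((T ^^ n) x)) ` {0..1}. eta (measure \<mu> (Y -` {i} \<inter> {0..1})) = 0"
    proof
      fix v assume "v \<in> Y ` {0..1} - (\<lambda>x. Y ((T ^^ n) x)) ` {0..1}"
      then have "(\<lambda>x. Y ((T ^^ n) x)) -` {v} \<inter> {0..1} = {}" by blast
      then show "eta (measure \<mu> (Y -` {v} \<inter> {0..1})) = 0" using eq[of v] by (simp add: eta_def)
    qed
  qed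
  finally show ?thesis .
qed

definition name :: "(real \<Rightarrow> 'a) \<Rightarrow> nat \<Rightarrow> real \<Rightarrow> 'a list" where
  "name l n x = map (\<lambda>i. l ((T ^^ i) x)) [0..<n]"

lemma name_eq_iff: "name l n x = name l n y \<longleftrightarrow> (\<forall>i<n. l ((T ^^ i) x) = l ((T ^^ i) y))"
  by (auto simp: name_def)

lemma simple_name: "simple_function \<mu> l \<Longrightarrow> simple_function \<mu> (name l n)"
proof (induction n)
  case 0 then show ?case by (simp add: name_def[abs_def])
next
  case (Suc n)
  have "name l (Suc n) = (\<lambda>x. name l n x @ [l ((T ^^ n) x)])" by (auto simp: name_def)
  then show ?case using simple_function_compose2[OF Suc.IH[OF Suc.prems] simple_comp_T[OF Suc.prems, of n], of "\<lambda>a b. a @ [b]"]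
    by simp
qed

lemma ent_name_add:
  assumes "simple_function \<mu> l"
  shows "ent \<mu> (name l (m + n)) \<le> ent \<mu> (name l m) + ent \<mu> (name l n)"
proof -
  have s: "simple_function \<mu> (name l m)" "simple_function \<mu> (\<lambda>x. name l n ((T ^^ m) x))"
    using simple_name[OF assms] simple_comp_T[OF simple_name[OF assms]] by auto
  have "ent \<mu> (name l (m + n)) \<le> ent \<mu> (\<lambda>x. (name l m x, name l n ((T ^^ m) x)))"
  proof (rule ent_mono[OF mu simple_function_Pair[OF s]])
    fix x y assume "(name l m x, name l n ((T ^^ m) x)) = (name l m y, name l n ((T ^^ m) y))"
    then have 1: "\<And>i. i < m \<Longrightarrow> l ((T ^^ i) x) = l ((T ^^ i) y)"
      and 2: "\<And>i. i < n \<Longrightarrow> l ((T ^^ i) ((T ^^ m) x)) = l ((T ^^ i) ((T ^^ m) y))"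
      by (auto simp: name_eq_iff)
    have "l ((T ^^ i) x) = l ((T ^^ i) y)" if "i < m + n" for i
    proof (cases "i < m")
      case False
      then have "(T ^^ i) z = (T ^^ (i - m)) ((T ^^ m) z)" for z
        by (metis comp_apply funpow_add le_add_diff_inverse2 linorder_not_less)
      then show ?thesis using 2[of "i - m"] that False by auto
    qed (use 1 in auto)
    then show "name l (m + n) x = name l (m + n) y" by (simp add: name_eq_iff)
  qed
  also have "\<dots> \<le> ent \<mu> (name l m) + ent \<mu> (\<lambda>x. name l n ((T ^^ m) x))" by (rule ent_pair[OF mu s])
  also have "ent \<mu> (\<lambda>x. name l n ((T ^^ m) x)) = ent \<mu> (name l n)" by (rule ent_comp_T[OF simple_name[OF assms]])
  finally show ?thesis .
qed

lemma ent_name_limit: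
  assumes "simple_function \<mu> l"
  shows "\<exists>L. (\<lambda>n. ent \<mu> (name l n) / real n) \<longlonglongrightarrow> L \<and> (\<forall>n\<ge>1. L \<le> ent \<mu> (name l n) / real n)"
  by (rule fekete) (use ent_nonneg[OF mu] ent_name_add[OF assms] in auto)

lemma ent_name_le: 
  assumes "simple_function \<mu> l"
  shows "ent \<mu> (name l n) \<le> real n * ent \<mu> l"
proof (induction n)
  case 0
  have "name l 0 = (\<lambda>x. [])" by (simp add: name_def[abs_def])
  then have "ent \<mu> (name l 0) = eta (measure \<mu> ({0..1}))"
    by (simp add: ent_def image_constant_conv vimage_def)
  also have "\<dots> = 0" using prob_space by (simp add: eta_def)
  finally show ?case by simp
next
  case (Suc n)
  have "ent \<mu> (name l 1) \<le> ent \<mu> l" by (rule ent_mono[OF mu assms]) (simp add: name_def)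
  then show ?case using ent_name_add[OF assms, of n 1] Suc by (simp add: algebra_simps)
qed

text \<open>Inner regularity of finite Borel measures, applied to the push-forward of
  \<open>\<mu>\<close> to the whole line.\<close>

lemma compact_approx:
  assumes A: "A \<in> sets \<mu>" and e: "e > 0"
  obtains K where "compact K" "K \<subseteq> A" "measure \<mu> (A - K) < e"
proof -
  define \<nu> where "\<nu> = distr \<mu> borel (\<lambda>x. x)"
  have m: "(\<lambda>x. x) \<in> \<mu> \<rightarrow>\<^sub>M borel"
    by (subst measurable_cong_sets[OF sts refl]) (auto intro: measurable_restrict_space1)
  interpret \<nu>: prob_space \<nu> unfolding \<nu>_def by (rule prob_space_distr[OF m])
  have Ab: "A \<in> sets borel" and A01: "A \<subseteq> {0..1}" using A sets.sets_into_space[OF A] by (auto simp: sts sets_restrict_space)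
  have "emeasure \<nu> A = (SUP K \<in> {K. K \<subseteq> A \<and> compact K}. emeasure \<nu> K)"
    by (rule inner_regular) (use \<nu>.emeasure_space_1 in \<open>auto simp: \<nu>_def Ab\<close>)
  then have sup: "(SUP K \<in> {K. K \<subseteq> A \<and> compact K}. emeasure \<nu> K) = emeasure \<nu> A" by simp
  have "\<exists>K. K \<subseteq> A \<and> compact K \<and> emeasure \<nu> A < emeasure \<nu> K + ennreal e"
  proof (rule ccontr)
    assume "\<nexists>K. K \<subseteq> A \<and> compact K \<and> emeasure \<nu> A < emeasure \<nu> K + ennreal e"
    then have le: "emeasure \<nu> K + ennreal e \<le> emeasure \<nu> A" if "K \<subseteq> A" "compact K" for K using that not_less by blast
    have "(SUP K \<in> {K. K \<subseteq> A \<and> compact K}. emeasure \<nu> K) + ennreal e = (SUP K \<in> {K. K \<subseteq> A \<and> compact K}. emeasure \<nu> K + ennreal e)"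
      by (rule ennreal_SUP_add_left[symmetric]) auto
    also have "\<dots> \<le> emeasure \<nu> A" using le by (auto intro!: SUP_least)
    finally have "emeasure \<nu> A + ennreal e \<le> emeasure \<nu> A" using sup by simp
    then have "ennreal (measure \<nu> A + e) \<le> ennreal (measure \<nu> A)"
      using e by (simp add: \<nu>.emeasure_eq_measure ennreal_plus[symmetric] del: ennreal_plus)
    then show False using e by (simp add: ennreal_le_iff)
  qed
  then obtain K where K: "K \<subseteq> A" "compact K" "emeasure \<nu> A < emeasure \<nu> K + ennreal e" by blast
  have Kb: "K \<in> sets borel" using K by (simp add: borel_compact)
  have nu: "measure \<nu> B = measure \<mu> B" if "B \<in> sets borel" "B \<subseteq> {0..1}" for B
    unfolding \<nu>_def using measure_distr[OF m that(1)] that by (simp add: Int_absorb2)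
  have Ks: "K \<in> sets \<mu>" using Kb K A01 by (auto simp: sts sets_restrict_space image_iff)
  have "measure \<nu> A < measure \<nu> K + e"
    using K(3) e by (simp add: \<nu>.emeasure_eq_measure ennreal_less_iff flip: ennreal_plus)
  then have "measure \<mu> A < measure \<mu> K + e" using nu Ab Kb A01 K by auto
  then have "measure \<mu> (A - K) < e" using finite_measure_Diff[OF A Ks K(1)] by simp
  then show thesis using that K by blast
qed

text \<open>A generating label determines every finite label up to an error label that is almost
  surely constant, hence has small entropy.\<close>
lemma ent_name_generator:
  fixes l :: "real \<Rightarrow> 'a" and l' :: "real \<Rightarrow> 'c"
  assumes l: "simple_function \<mu> l" and l': "simple_function \<mu> l'"
    and gen: "\<And>d. d > 0 \<Longrightarrow> \<exists>k. \<forall>x\<in>{0..1}. \<forall>y\<in>{0..1}. name l k x = name l k y \<longrightarrow> \<bar>x - y\<bar> < d"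
    and e: "e > 0"
  shows "\<exists>C. \<forall>n. ent \<mu> (name l' n) \<le> ent \<mu> (name l n) + real n * e + C"
proof -
  define V where "V = l' ` {0..1}"
  define c where "c = real (card V)"
  have V: "finite V" using l' by (simp add: V_def simple_function_def)
  have c: "c \<ge> 1"
  proof -
    have "card V > 0" using V by (simp add: card_gt_0_iff V_def)
    then show ?thesis by (simp add: c_def)
  qed
  \<comment> \<open>The error label has at most \<open>c\<close> rare values and the dominant value
    \<open>None\<close>; each is allotted the share \<open>e / (c + 1)\<close>.\<close>
  obtain d where d: "d > 0" "d < 1" "\<And>t. 0 \<le> t \<Longrightarrow> t \<le> d \<Longrightarrow> eta t \<le> e / (c + 1)"
    "\<And>t. 1 - d \<le> t \<Longrightarrow> t \<le> 1 \<Longrightarrow> eta t \<le> e / (c + 1)"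
    by (rule eta_small[of "e / (c + 1)"]) (use e c in auto)
  have "\<exists>K. compact K \<and> K \<subseteq> l' -` {v} \<inter> {0..1} \<and> measure \<mu> (l' -` {v} \<inter> {0..1} - K) < d / c" for v
    using compact_approx[OF fiber_sets[OF l', of v], of "d / c"] d c
    by (metis divide_pos_pos less_le_trans zero_less_one)
  then obtain K where K: "\<And>v. compact (K v)" "\<And>v. K v \<subseteq> l' -` {v} \<inter> {0..1}"
    "\<And>v. measure \<mu> (l' -` {v} \<inter> {0..1} - K v) < d / c" by metis
  have Ks: "K v \<in> sets \<mu>" for v
  proof -
    have "K v \<in> sets borel" using K(1) by (simp add: borel_compact)
    moreover have "K v \<subseteq> {0..1}" using K(2) by blast
    ultimately show ?thesis by (auto simp: sts sets_restrict_space image_iff)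
  qed
  \<comment> \<open>Disjoint compact parts of the label classes lie at positive distance, so on
    their union \<open>L\<close> a sufficiently long \<open>l\<close>-name pins down the value of
    \<open>l'\<close>.\<close>
  have "\<exists>r>0. \<forall>x\<in>K u. \<forall>y\<in>K v. r \<le> dist x y" if "u \<noteq> v" for u v
  proof (rule separate_compact_closed)
    show "K u \<inter> K v = {}" using K(2)[of u] K(2)[of v] that by auto
  qed (use K(1) in \<open>auto simp: compact_imp_closed\<close>)
  then obtain r where r: "\<And>u v. u \<noteq> v \<Longrightarrow> r u v > 0" "\<And>u v x y. u \<noteq> v \<Longrightarrow> x \<in> K u \<Longrightarrow> y \<in> K v \<Longrightarrow> r u v \<le> dist x y"
    by metis
  define \<rho> where "\<rho> = Min (insert 1 ((\<lambda>(u, v). r u v) ` {(u, v). u \<in> V \<and> v \<in> V \<and> u \<noteq> v}))"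
  have finp: "finite {(u, v). u \<in> V \<and> v \<in> V \<and> u \<noteq> v}"
    by (rule finite_subset[of _ "V \<times> V"]) (use V in auto)
  have \<rho>0: "\<rho> > 0" unfolding \<rho>_def using finp r(1) by (subst Min_gr_iff) auto
  have \<rho>: "\<rho> \<le> r u v" if "u \<in> V" "v \<in> V" "u \<noteq> v" for u v
    unfolding \<rho>_def using finp that by (intro Min_le) (auto simp: image_iff)
  obtain k where k: "\<And>x y. x \<in> {0..1} \<Longrightarrow> y \<in> {0..1} \<Longrightarrow> name l k x = name l k y \<Longrightarrow> \<bar>x - y\<bar> < \<rho>"
    using gen[OF \<rho>0] by blast
  define L where "L = (\<Union>v\<in>V. K v)"
  \<comment> \<open>\<open>f\<close> decodes an \<open>l\<close>-name by looking at some point of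
    \<open>L\<close> with that name. On names that do not occur in \<open>L\<close> its value is
    arbitrary, and \<open>E\<close> records the correction.\<close>
  define f where "f w = l' (SOME y. y \<in> L \<and> name l k y = w)" for w
  define l2 where "l2 x = f (name l k x)" for x
  define E where "E x = (if l2 x = l' x then None else Some (l' x))" for x
  have L01: "L \<subseteq> {0..1}" using K(2) by (auto simp: L_def)
  have good: "l2 x = l' x" if x: "x \<in> L" for x
  proof -
    define y where "y = (SOME y. y \<in> L \<and> name l k y = name l k x)"
    have y: "y \<in> L \<and> name l k y = name l k x" unfolding y_def by (rule someI[of _ x]) (use x in auto)
    obtain u v where uv: "u \<in> V" "v \<in> V" "x \<in> K u" "y \<in> K v" using x y by (auto simp: L_def)
    have "\<bar>x - y\<bar> < \<rho>" using k[of x y] x y subsetD[OF L01] by metis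
    have "u = v"
    proof (rule ccontr)
      assume "u \<noteq> v"
      then have "\<rho> \<le> \<bar>x - y\<bar>" using r(2)[OF _ uv(3,4)] \<rho>[OF uv(1,2)] by (simp add: dist_real_def)
      then show False using \<open>\<bar>x - y\<bar> < \<rho>\<close> by simp
    qed
    then have "l' y = l' x" using uv K(2) by blast
    then show ?thesis by (simp add: l2_def f_def y_def)
  qed
  have sl2: "simple_function \<mu> l2" unfolding l2_def using simple_function_compose[OF simple_name[OF l], of f] by (simp add: comp_def)
  have sE: "simple_function \<mu> E" unfolding E_def
    using simple_function_compose2[OF sl2 l', of "\<lambda>a b. if a = b then None else Some b"] by simp
  have Lsets: "L \<in> sets \<mu>" unfolding L_def using V Ks by auto
  have bad: "measure \<mu> ({0..1} - L) \<le> d"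
  proof -
    have "{0..1} - L \<subseteq> (\<Union>v\<in>V. l' -` {v} \<inter> {0..1} - K v)" by (auto simp: L_def V_def)
    then have "measure \<mu> ({0..1} - L) \<le> measure \<mu> (\<Union>v\<in>V. l' -` {v} \<inter> {0..1} - K v)"
      using V fiber_sets[OF l'] Ks by (intro finite_measure_mono) auto
    also have "\<dots> \<le> (\<Sum>v\<in>V. measure \<mu> (l' -` {v} \<inter> {0..1} - K v))"
      using V fiber_sets[OF l'] Ks by (intro finite_measure_subadditive_finite) auto
    also have "\<dots> \<le> (\<Sum>v\<in>V. d / c)" using K(3) by (intro sum_mono) (auto intro: less_imp_le)
    also have "\<dots> = d" using c by (simp add: c_def)
    finally show ?thesis .
  qed
  have Ebad: "measure \<mu> (E -` {Some v} \<inter> {0..1}) \<le> d" for v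
  proof -
    have "E -` {Some v} \<inter> {0..1} \<subseteq> {0..1} - L" using good by (auto simp: E_def)
    then have "measure \<mu> (E -` {Some v} \<inter> {0..1}) \<le> measure \<mu> ({0..1} - L)"
      using Lsets sets.top[of \<mu>] by (intro finite_measure_mono) auto
    then show ?thesis using bad by simp
  qed
  have Egood: "1 - d \<le> measure \<mu> (E -` {None} \<inter> {0..1})"
  proof -
    have "L \<subseteq> E -` {None} \<inter> {0..1}" using good L01 by (auto simp: E_def)
    then have "measure \<mu> L \<le> measure \<mu> (E -` {None} \<inter> {0..1})" using fiber_sets[OF sE] by (intro finite_measure_mono) auto
    moreover have "measure \<mu> ({0..1} - L) = 1 - measure \<mu> L" using prob_compl[OF Lsets] by simp
    ultimately show ?thesis using bad by simp
  qed
  have entE: "ent \<mu> E \<le> e"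
  proof -
    have "E ` {0..1} \<subseteq> insert None (Some ` V)" by (auto simp: E_def V_def)
    then have "ent \<mu> E \<le> (\<Sum>v\<in>insert None (Some ` V). eta (measure \<mu> (E -` {v} \<inter> {0..1})))"
      unfolding ent_def using V by (intro sum_mono2) (auto intro!: eta_nonneg prob_le_1)
    also have "\<dots> \<le> (\<Sum>v\<in>insert None (Some ` V). e / (c + 1))"
      using Ebad Egood d by (intro sum_mono) auto
    also have "\<dots> = real (card (insert None (Some ` V))) * (e / (c + 1))" by simp
    also have "card (insert None (Some ` V)) = card V + 1"
      using V by (subst card_insert_disjoint) (auto simp: card_image)
    also have "real (card V + 1) * (e / (c + 1)) = e"
    proof -
      have "real (card V + 1) = c + 1" by (simp add: c_def)
      moreover have "c + 1 \<noteq> 0" using c by linarith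
      ultimately show ?thesis by (metis nonzero_mult_div_cancel_left times_divide_eq_right)
    qed
    finally show ?thesis .
  qed
  \<comment> \<open>Decoding the label at a time \<open>i < n\<close> reads \<open>k\<close> symbols
    from there on, so \<open>n + k\<close> symbols of \<open>l\<close> and \<open>n\<close> error
    symbols determine the \<open>l'\<close>-name.\<close>
  have "ent \<mu> (name l' n) \<le> ent \<mu> (name l n) + real n * e + ent \<mu> (name l k)" for n
  proof -
    have s: "simple_function \<mu> (name l (n + k))" "simple_function \<mu> (name E n)"
      using simple_name[OF l] simple_name[OF sE] by auto
    have "ent \<mu> (name l' n) \<le> ent \<mu> (\<lambda>x. (name l (n + k) x, name E n x))"
    proof (rule ent_mono[OF mu simple_function_Pair[OF s]])
      fix x y assume "(name l (n + k) x, name E n x) = (name l (n + k) y, name E n y)"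
      then have 1: "\<And>i. i < n + k \<Longrightarrow> l ((T ^^ i) x) = l ((T ^^ i) y)"
        and 2: "\<And>i. i < n \<Longrightarrow> E ((T ^^ i) x) = E ((T ^^ i) y)" by (auto simp: name_eq_iff)
      have "l' ((T ^^ i) x) = l' ((T ^^ i) y)" if i: "i < n" for i
      proof -
        have "l ((T ^^ j) ((T ^^ i) x)) = l ((T ^^ j) ((T ^^ i) y))" if "j < k" for j
          using 1[of "j + i"] that i by (simp add: funpow_add)
        then have "name l k ((T ^^ i) x) = name l k ((T ^^ i) y)" by (simp add: name_eq_iff)
        then have "l2 ((T ^^ i) x) = l2 ((T ^^ i) y)" by (simp add: l2_def)
        then show ?thesis using 2[OF i] by (auto simp: E_def split: if_splits)
      qed
      then show "name l' n x = name l' n y" by (simp add: name_eq_iff)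
    qed
    also have "\<dots> \<le> ent \<mu> (name l (n + k)) + ent \<mu> (name E n)" by (rule ent_pair[OF mu s])
    also have "\<dots> \<le> (ent \<mu> (name l n) + ent \<mu> (name l k)) + real n * ent \<mu> E"
      using ent_name_add[OF l] ent_name_le[OF sE] by (intro add_mono) auto
    also have "real n * ent \<mu> E \<le> real n * e" using entE by (intro mult_left_mono) auto
    finally show ?thesis by simp
  qed
  then show ?thesis by blast
qed

text \<open>With \<open>l\<close> sending a point to its partition element, the nonempty sets of the
  refined partition are exactly the fibres of the \<open>n\<close>-name.\<close>

lemma part_entropy_join:
  assumes P: "finite P" "disjoint P" "\<Union>P = {0..1}"
    and l: "\<And>x. x \<in> {0..1} \<Longrightarrow> l x \<in> P \<and> x \<in> l x"
  shows "part_entropy \<mu> (join_n T P n) = ent \<mu> (name l n)"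
proof -
  have uniq: "l x = A" if "x \<in> {0..1}" "A \<in> P" "x \<in> A" for x A
    using l[OF that(1)] that(2,3) P(2) by (auto simp: disjoint_def)
  define fib where "fib v = name l n -` {v} \<inter> {0..1}" for v
  have "join_n T P n = fib ` name l n ` {0..1}"
  proof (intro set_eqI iffI)
    fix A assume "A \<in> join_n T P n"
    then obtain a where a: "A = (\<Inter>i<n. (T ^^ i) -` a i) \<inter> {0..1}" "\<And>i. i < n \<Longrightarrow> a i \<in> P" "A \<noteq> {}"
      by (auto simp: join_n_def)
    then obtain x where x: "x \<in> A" by blast
    have x01: "x \<in> {0..1}" using x a(1) by blast
    have ai: "a i = l ((T ^^ i) x)" if "i < n" for i
      using uniq[OF T_pow_in[OF x01] a(2)[OF that]] x a(1) that by auto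
    have "A = fib (name l n x)"
    proof (intro set_eqI iffI)
      fix y assume y: "y \<in> A"
      have y01: "y \<in> {0..1}" using y a(1) by blast
      have "l ((T ^^ i) y) = l ((T ^^ i) x)" if "i < n" for i
        using uniq[OF T_pow_in[OF y01] a(2)[OF that]] y a(1) that ai[OF that] by auto
      then show "y \<in> fib (name l n x)" using y01 by (simp add: fib_def name_eq_iff)
    next
      fix y assume "y \<in> fib (name l n x)"
      then have y: "y \<in> {0..1}" "\<And>i. i < n \<Longrightarrow> l ((T ^^ i) y) = l ((T ^^ i) x)" by (auto simp: fib_def name_eq_iff)
      then have "(T ^^ i) y \<in> a i" if "i < n" for i using ai[OF that] l[OF T_pow_in[OF y(1)], of i] that by simp
      then show "y \<in> A" using a(1) y(1) by auto
    qed
    then show "A \<in> fib ` name l n ` {0..1}" using x01 by blast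
  next
    fix A assume "A \<in> fib ` name l n ` {0..1}"
    then obtain x where x: "x \<in> {0..1}" "A = fib (name l n x)" by blast
    have "A = (\<Inter>i<n. (T ^^ i) -` l ((T ^^ i) x)) \<inter> {0..1}"
    proof (intro set_eqI iffI)
      fix y assume "y \<in> A"
      then have y: "y \<in> {0..1}" "\<And>i. i < n \<Longrightarrow> l ((T ^^ i) y) = l ((T ^^ i) x)" by (auto simp: x fib_def name_eq_iff)
      have "(T ^^ i) y \<in> l ((T ^^ i) x)" if "i < n" for i using l[OF T_pow_in[OF y(1), of i]] y(2)[OF that] by simp
      then show "y \<in> (\<Inter>i<n. (T ^^ i) -` l ((T ^^ i) x)) \<inter> {0..1}" using y(1) by auto
    next
      fix y assume y: "y \<in> (\<Inter>i<n. (T ^^ i) -` l ((T ^^ i) x)) \<inter> {0..1}"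
      have "l ((T ^^ i) y) = l ((T ^^ i) x)" if "i < n" for i
        using y that l[OF T_pow_in[OF x(1), of i]] T_pow_in[of y i] by (intro uniq) auto
      then show "y \<in> A" using y by (auto simp: x fib_def name_eq_iff)
    qed
    moreover have "x \<in> A" using x by (simp add: fib_def)
    moreover have "\<forall>i<n. l ((T ^^ i) x) \<in> P" using l[OF T_pow_in[OF x(1)]] by blast
    ultimately show "A \<in> join_n T P n" unfolding join_n_def
      by (intro DiffI CollectI exI[of _ "\<lambda>i. l ((T ^^ i) x)"] conjI) blast+
  qed
  moreover have "inj_on fib (name l n ` {0..1})"
  proof (rule inj_onI)
    fix v w assume "v \<in> name l n ` {0..1}" "w \<in> name l n ` {0..1}" and eq: "fib v = fib w"
    then obtain x where x: "x \<in> {0..1}" "v = name l n x" by blast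
    then have "x \<in> fib v" by (simp add: fib_def)
    then have "x \<in> fib w" using eq by simp
    then show "v = w" using x by (simp add: fib_def)
  qed
  ultimately have "part_entropy \<mu> (join_n T P n) = (\<Sum>v\<in>name l n ` {0..1}. eta (measure \<mu> (fib v)))"
    by (simp add: part_entropy_def sum.reindex)
  then show ?thesis by (simp add: ent_def fib_def)
qed

text \<open>The Kolmogorov-Sinai theorem. Any finite partition is recovered from the generator up to
  an error of entropy rate \<open>e\<close>, so its own rate exceeds \<open>h\<close> by at most
  \<open>e\<close>; the partition into the fibres of \<open>l\<close> attains
  \<open>h\<close>.\<close>

theorem ks_entropy_generator:
  assumes l: "simple_function \<mu> l"
    and gen: "\<And>d. d > 0 \<Longrightarrow> \<exists>k. \<forall>x\<in>{0..1}. \<forall>y\<in>{0..1}. name l k x = name l k y \<longrightarrow> \<bar>x - y\<bar> < d"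
  shows "\<exists>h. ks_entropy \<mu> T = ereal h \<and> (\<lambda>n. ent \<mu> (name l n) / real n) \<longlonglongrightarrow> h \<and> (\<forall>n\<ge>1. h \<le> ent \<mu> (name l n) / real n)"
proof -
  obtain h where h: "(\<lambda>n. ent \<mu> (name l n) / real n) \<longlonglongrightarrow> h" "\<forall>n\<ge>1. h \<le> ent \<mu> (name l n) / real n"
    using ent_name_limit[OF l] by blast
  have le: "lim (\<lambda>n. part_entropy \<mu> (join_n T P n) / real n) \<le> h" if P: "P \<in> fin_partitions" for P
  proof -
    define l' where "l' x = (THE A. A \<in> P \<and> x \<in> A)" for x
    have P': "finite P" "P \<subseteq> sets B01" "disjoint P" "\<Union>P = {0..1}" using P by (auto simp: fin_partitions_def)
    have uniq: "l' x = A" if "A \<in> P" "x \<in> A" for x A unfolding l'_def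
      using that P'(3) by (intro the_equality) (auto simp: disjoint_def)
    have l': "l' x \<in> P \<and> x \<in> l' x" if "x \<in> {0..1}" for x
    proof -
      have "x \<in> \<Union>P" using P'(4) that by simp
      then obtain A where "A \<in> P" "x \<in> A" by (rule UnionE)
      then show ?thesis using uniq by metis
    qed
    have pe: "part_entropy \<mu> (join_n T P n) = ent \<mu> (name l' n)" for n
      by (rule part_entropy_join[OF P'(1,3,4) l'])
    have "simple_function \<mu> l'" unfolding simple_function_def
    proof safe
      show "finite (l' ` space \<mu>)" using l' P'(1) by (auto intro: finite_subset[of _ P])
      fix x assume x: "x \<in> space \<mu>"
      then have lx: "l' x \<in> P" "x \<in> l' x" using l' by auto
      have "l' x \<subseteq> {0..1}" using lx(1) P'(4) by (metis Union_upper)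
      have "l' -` {l' x} \<inter> space \<mu> = l' x"
      proof (intro set_eqI iffI)
        fix y assume "y \<in> l' -` {l' x} \<inter> space \<mu>"
        then have "y \<in> {0..1}" "l' y = l' x" by auto
        then show "y \<in> l' x" using l'[of y] by metis
      next
        fix y assume y: "y \<in> l' x"
        then have "l' y = l' x" by (rule uniq[OF lx(1)])
        moreover have "y \<in> space \<mu>" using y \<open>l' x \<subseteq> {0..1}\<close> by (simp add: subset_eq)
        ultimately show "y \<in> l' -` {l' x} \<inter> space \<mu>" by simp
      qed
      then show "l' -` {l' x} \<inter> space \<mu> \<in> sets \<mu>" using lx P'(2) sts by auto
    qed
    note sl' = this
    obtain L where L: "(\<lambda>n. ent \<mu> (name l' n) / real n) \<longlonglongrightarrow> L" using ent_name_limit[OF sl'] by blast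
    have "L \<le> h + e" if e: "e > 0" for e
    proof -
      obtain C where C: "\<And>n. ent \<mu> (name l' n) \<le> ent \<mu> (name l n) + real n * e + C"
        using ent_name_generator[OF l sl' gen e] by blast
      have "(\<lambda>n. ent \<mu> (name l n) / real n + e + C / real n) \<longlonglongrightarrow> h + e + 0"
        by (intro tendsto_intros h lim_const_over_n)
      moreover have "\<forall>n\<ge>1. ent \<mu> (name l' n) / real n \<le> ent \<mu> (name l n) / real n + e + C / real n"
      proof (intro allI impI)
        fix n :: nat assume n: "n \<ge> 1"
        then have "ent \<mu> (name l n) / real n + e + C / real n = (ent \<mu> (name l n) + real n * e + C) / real n"
          by (simp add: add_divide_distrib)
        then show "ent \<mu> (name l' n) / real n \<le> ent \<mu> (name l n) / real n + e + C / real n"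
          using C[of n] by (simp add: divide_right_mono)
      qed
      ultimately show ?thesis using LIMSEQ_le[OF L] by (metis (no_types, lifting) add.right_neutral)
    qed
    then have "L \<le> h" by (rule field_le_epsilon)
    then show ?thesis using L limI[OF L] by (simp add: pe)
  qed
  have "\<exists>P\<in>fin_partitions. lim (\<lambda>n. part_entropy \<mu> (join_n T P n) / real n) = h"
  proof -
    define l' where "l' x = l -` {l x} \<inter> {0..1}" for x
    define P where "P = l' ` {0..1}"
    have "P = (\<lambda>v. l -` {v} \<inter> {0..1}) ` l ` {0..1}" by (auto simp: P_def l'_def)
    then have fin: "finite P" using l by (simp add: simple_function_def)
    have dj: "disjoint P" by (auto simp: disjoint_def P_def l'_def)
    have un: "\<Union>P = {0..1}" by (auto simp: P_def l'_def)
    have "P \<subseteq> sets B01" using fiber_sets[OF l] by (auto simp: P_def l'_def sts)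
    then have PP: "P \<in> fin_partitions" using fin dj un by (simp add: fin_partitions_def)
    have pe: "part_entropy \<mu> (join_n T P n) = ent \<mu> (name l' n)" for n
      by (rule part_entropy_join[OF fin dj un]) (auto simp: P_def l'_def)
    have ker: "l' x = l' y \<longleftrightarrow> l x = l y" if "x \<in> {0..1}" for x y using that by (auto simp: l'_def)
    have sl': "simple_function \<mu> l'" using simple_function_compose[OF l, of "\<lambda>v. l -` {v} \<inter> {0..1}"]
      by (simp add: comp_def l'_def[abs_def])
    have "ent \<mu> (name l' n) = ent \<mu> (name l n)" for n
    proof (rule antisym)
      show "ent \<mu> (name l' n) \<le> ent \<mu> (name l n)"
        by (rule ent_mono[OF mu simple_name[OF l]]) (use ker T_pow_in in \<open>simp add: name_eq_iff\<close>)
      show "ent \<mu> (name l n) \<le> ent \<mu> (name l' n)"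
        by (rule ent_mono[OF mu simple_name[OF sl']]) (use ker T_pow_in in \<open>simp add: name_eq_iff\<close>)
    qed
    then have "lim (\<lambda>n. part_entropy \<mu> (join_n T P n) / real n) = h" using pe limI[OF h(1)] by simp
    then show ?thesis using PP by blast
  qed
  then obtain P0 where P0: "P0 \<in> fin_partitions" "lim (\<lambda>n. part_entropy \<mu> (join_n T P0 n) / real n) = h" by blast
  have "ks_entropy \<mu> T = ereal h" unfolding ks_entropy_def
  proof (rule antisym)
    show "(SUP P\<in>fin_partitions. ereal (lim (\<lambda>n. part_entropy \<mu> (join_n T P n) / real n))) \<le> ereal h"
      using le by (intro SUP_least) auto
    show "ereal h \<le> (SUP P\<in>fin_partitions. ereal (lim (\<lambda>n. part_entropy \<mu> (join_n T P n) / real n)))"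
      using P0 by (intro SUP_upper2[of P0]) auto
  qed
  then show ?thesis using h by blast
qed

end

section \<open>The weak topology and empirical measures\<close>

lemma topspace_weak: "topspace weak_top = Pm"
proof -
  have "Pm \<in> {{\<mu>\<in>Pm. (\<integral>x. f x \<partial>\<mu>) \<in> U} | (f :: real \<Rightarrow> real) U. continuous_on {0..1} f \<and> open U}"
    by (rule CollectI, rule exI[of _ "\<lambda>x. 0"], rule exI[of _ UNIV]) auto
  then show ?thesis unfolding weak_top_def topology_generated_by_topspace by blast
qed

lemma openin_weak_integral:
  fixes f :: "real \<Rightarrow> real"
  shows
  "continuous_on {0..1} f \<Longrightarrow> open U \<Longrightarrow> openin weak_top {\<mu>\<in>Pm. (\<integral>x. f x \<partial>\<mu>) \<in> U}"
  unfolding weak_top_def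
  by (rule topology_generated_by_Basis, rule CollectI, rule exI[of _ f], rule exI[of _ U]) simp

lemma openin_weak_less:
  fixes f :: "real \<Rightarrow> real"
  assumes "continuous_on {0..1} f" shows "openin weak_top {\<mu>\<in>Pm. (\<integral>x. f x \<partial>\<mu>) < a}"
  using openin_weak_integral[OF assms open_lessThan, of a] by simp

text \<open>Induction over the generated topology; a common tolerance survives finite intersections
  by taking a minimum. This is the form in which openness is used later.\<close>

lemma weak_basis:
  assumes "openin weak_top G" "\<mu> \<in> G"
  shows "\<exists>(F :: (real \<Rightarrow> real) set) (e :: real). finite F \<and> e > 0 \<and> (\<forall>f\<in>F. continuous_on {0..1} f) \<and>
    {\<nu>\<in>Pm. \<forall>f\<in>F. \<bar>(\<integral>x. f x \<partial>\<nu>) - (\<integral>x. f x \<partial>\<mu>)\<bar> < e} \<subseteq> G"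
proof -
  have "generate_topology_on {{\<mu>\<in>Pm. (\<integral>x. f x \<partial>\<mu>) \<in> U} | (f :: real \<Rightarrow> real) U. continuous_on {0..1} f \<and> open U} G"
    using assms(1) by (simp add: weak_top_def openin_topology_generated_by_iff)
  then show ?thesis using assms(2)
  proof (induction rule: generate_topology_on.induct)
    case Empty then show ?case by simp
  next
    case (Int A B)
    obtain F :: "(real \<Rightarrow> real) set" and e :: real where 1: "finite F" "e > 0" "\<forall>f\<in>F. continuous_on {0..1} f"
      "{\<nu>\<in>Pm. \<forall>f\<in>F. \<bar>(\<integral>x. f x \<partial>\<nu>) - (\<integral>x. f x \<partial>\<mu>)\<bar> < e} \<subseteq> A" using Int.IH(1)[OF IntD1[OF Int.prems]] by blast
    obtain F' :: "(real \<Rightarrow> real) set" and e' :: real where 2: "finite F'" "e' > 0" "\<forall>f\<in>F'. continuous_on {0..1} f"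
      "{\<nu>\<in>Pm. \<forall>f\<in>F'. \<bar>(\<integral>x. f x \<partial>\<nu>) - (\<integral>x. f x \<partial>\<mu>)\<bar> < e'} \<subseteq> B" using Int.IH(2)[OF IntD2[OF Int.prems]] by blast
    have "{\<nu>\<in>Pm. \<forall>f\<in>F \<union> F'. \<bar>(\<integral>x. f x \<partial>\<nu>) - (\<integral>x. f x \<partial>\<mu>)\<bar> < min e e'} \<subseteq> A \<inter> B"
      using 1(4) 2(4) by auto
    then show ?case using 1(1-3) 2(1-3)
      by (intro exI[of _ "F \<union> F'"] exI[of _ "min e e'"]) auto
  next
    case (UN K)
    then obtain k where k: "k \<in> K" "\<mu> \<in> k" by blast
    then obtain F :: "(real \<Rightarrow> real) set" and e :: real where Fe: "finite F" "e > 0" "\<forall>f\<in>F. continuous_on {0..1} f"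
      "{\<nu>\<in>Pm. \<forall>f\<in>F. \<bar>(\<integral>x. f x \<partial>\<nu>) - (\<integral>x. f x \<partial>\<mu>)\<bar> < e} \<subseteq> k" using UN.IH[OF k] by blast
    have kK: "k \<subseteq> \<Union>K" by (rule Union_upper[OF k(1)])
    show ?case
      by (rule exI[of _ F], rule exI[of _ e], rule conjI[OF Fe(1)], rule conjI[OF Fe(2)], rule conjI[OF Fe(3)],
          rule order_trans[OF Fe(4) kK])
  next
    case (Basis A)
    then obtain f :: "real \<Rightarrow> real" and U where f: "A = {\<mu>\<in>Pm. (\<integral>x. f x \<partial>\<mu>) \<in> U}" "continuous_on {0..1} f" "open U" by blast
    then have "(\<integral>x. f x \<partial>\<mu>) \<in> U" using Basis by simp
    then obtain e where e: "e > 0" "\<And>y. dist y (\<integral>x. f x \<partial>\<mu>) < e \<Longrightarrow> y \<in> U" using f(3) open_dist by metis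
    then have "{\<nu>\<in>Pm. \<forall>f\<in>{f}. \<bar>(\<integral>x. f x \<partial>\<nu>) - (\<integral>x. f x \<partial>\<mu>)\<bar> < e} \<subseteq> A"
      unfolding f(1) by (auto simp: dist_real_def)
    then show ?case using e f by (intro exI[of _ "{f}"] exI[of _ e]) auto
  qed
qed

lemma cont_borel: "continuous_on {0..1} f \<Longrightarrow> (f :: real \<Rightarrow> real) \<in> borel_measurable B01"
  by (rule borel_measurable_continuous_on_restrict)

lemma Pm_measurable: "\<mu> \<in> Pm \<Longrightarrow> f \<in> borel_measurable \<mu> \<longleftrightarrow> f \<in> borel_measurable B01"
  using measurable_cong_sets[of \<mu> B01 borel borel] PmD by blast

lemma cont_bounded:
  assumes "continuous_on {0..1::real} (f :: real \<Rightarrow> real)"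
  obtains B where "B > 0" "\<And>x. x \<in> {0..1} \<Longrightarrow> \<bar>f x\<bar> \<le> B"
proof -
  have "bounded (f ` {0..1})" using assms by (intro compact_imp_bounded compact_continuous_image) auto
  then show thesis using that unfolding bounded_pos by auto
qed

lemma bounded_integrable:
  fixes f :: "real \<Rightarrow> real"
  assumes "\<mu> \<in> Pm" "f \<in> borel_measurable B01" "\<And>x. x \<in> {0..1} \<Longrightarrow> \<bar>f x\<bar> \<le> B"
  shows "integrable \<mu> f"
proof -
  interpret prob_space \<mu> using PmD assms by blast
  show ?thesis using assms PmD[OF assms(1)] Pm_measurable[OF assms(1)]
    by (intro integrable_const_bound[of _ B]) auto
qed

lemma cont_integrable: "\<mu> \<in> Pm \<Longrightarrow> continuous_on {0..1} f \<Longrightarrow> integrable \<mu> (f :: real \<Rightarrow> real)"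
  by (metis bounded_integrable cont_borel cont_bounded)

text \<open>As the push-forward of the uniform distribution on the times below \<open>n\<close>, the
  empirical measure inherits countable additivity and the integration formula.\<close>

lemma empirical_distr:
  assumes n: "n \<ge> 1" and r: "\<And>j. (T ^^ j) x \<in> {0..1}"
  shows "empirical T n x = distr (uniform_count_measure {..<n}) B01 (\<lambda>j. (T ^^ j) x)"
proof -
  let ?M = "distr (uniform_count_measure {..<n}) B01 (\<lambda>j. (T ^^ j) x)"
  have m: "(\<lambda>j. (T ^^ j) x) \<in> uniform_count_measure {..<n} \<rightarrow>\<^sub>M B01"
    using r by (auto simp: measurable_def space_uniform_count_measure sets_uniform_count_measure space_restrict_space)
  have em: "emeasure ?M A = ennreal ((\<Sum>j<n. indicator A ((T ^^ j) x)) / real n)" if "A \<in> sets B01" for A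
  proof -
    have "emeasure ?M A = emeasure (uniform_count_measure {..<n}) ((\<lambda>j. (T ^^ j) x) -` A \<inter> {..<n})"
      using emeasure_distr[OF m that] by (simp add: space_uniform_count_measure)
    also have "\<dots> = ennreal (real (card ((\<lambda>j. (T ^^ j) x) -` A \<inter> {..<n})) / real n)"
      using n by (subst emeasure_uniform_count_measure) auto
    also have "real (card ((\<lambda>j. (T ^^ j) x) -` A \<inter> {..<n})) = (\<Sum>j<n. indicator A ((T ^^ j) x))"
    proof -
      have "(\<Sum>j<n. indicator A ((T ^^ j) x) :: real) = (\<Sum>j<n. indicator ((\<lambda>j. (T ^^ j) x) -` A \<inter> {..<n}) j)"
        by (intro sum.cong) (auto simp: indicator_def)
      also have "\<dots> = real (card ((\<lambda>j. (T ^^ j) x) -` A \<inter> {..<n}))"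
        by (simp add: sum.If_cases indicator_def Int_def conj_commute)
      finally show ?thesis by simp
    qed
    finally show ?thesis .
  qed
  have "empirical T n x = measure_of {0..1} (sets B01) (emeasure ?M)" unfolding empirical_def
  proof (rule measure_of_eq)
    show "sets B01 \<subseteq> Pow {0..1}" using sets.space_closed[of B01] by (simp add: space_restrict_space)
    fix A assume "A \<in> sigma_sets {0..1} (sets B01)"
    then have "A \<in> sets B01" using sets.sigma_sets_eq[of B01] by (simp add: space_restrict_space)
    then show "ennreal ((\<Sum>j<n. indicator A ((T ^^ j) x)) / real n) = emeasure ?M A" using em by simp
  qed
  also have "\<dots> = measure_of (space ?M) (sets ?M) (emeasure ?M)" by (simp add: space_restrict_space)
  also have "\<dots> = ?M" by (rule measure_of_of_measure)
  finally show ?thesis .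
qed

lemma empirical_Pm:
  assumes n: "n \<ge> 1" and r: "\<And>j. (T ^^ j) x \<in> {0..1}"
  shows "empirical T n x \<in> Pm"
proof -
  interpret U: prob_space "uniform_count_measure {..<n}"
    using n by (intro prob_space_uniform_count_measure) (auto simp: lessThan_empty_iff)
  have "(\<lambda>j. (T ^^ j) x) \<in> uniform_count_measure {..<n} \<rightarrow>\<^sub>M B01"
    using r by (auto simp: measurable_def space_uniform_count_measure sets_uniform_count_measure space_restrict_space)
  then show ?thesis unfolding empirical_distr[OF assms] Pm_def
    by (auto simp: space_restrict_space intro: U.prob_space_distr)
qed

lemma empirical_integral:
  fixes f :: "real \<Rightarrow> real"
  assumes n: "n \<ge> 1" and r: "\<And>j. (T ^^ j) x \<in> {0..1}" and f: "f \<in> borel_measurable B01"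
  shows "(\<integral>y. f y \<partial>empirical T n x) = (\<Sum>j<n. f ((T ^^ j) x)) / real n"
proof -
  have m: "(\<lambda>j. (T ^^ j) x) \<in> uniform_count_measure {..<n} \<rightarrow>\<^sub>M B01"
    using r by (auto simp: measurable_def space_uniform_count_measure sets_uniform_count_measure space_restrict_space)
  have "(\<integral>y. f y \<partial>empirical T n x) = (\<integral>j. f ((T ^^ j) x) \<partial>uniform_count_measure {..<n})"
    unfolding empirical_distr[OF n r] by (rule integral_distr[OF m f])
  also have "\<dots> = (\<Sum>j<n. (1 / real n) *\<^sub>R f ((T ^^ j) x))"
    unfolding uniform_count_measure_def by (subst lebesgue_integral_point_measure_finite) auto
  also have "\<dots> = (\<Sum>j<n. f ((T ^^ j) x)) / real n" by (simp add: sum_divide_distrib)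
  finally show ?thesis .
qed

section \<open>Separation and compactness in the space of measures\<close>

text \<open>Continuous ramps decrease to the indicator of \<open>{0..a}\<close>, so integrals of
  continuous functions fix the distribution function and with it the measure.\<close>

lemma Pm_eqI:
  assumes "\<mu> \<in> Pm" "\<nu> \<in> Pm"
    and eq: "\<And>f. continuous_on {0..1} f \<Longrightarrow> (\<integral>x. f x \<partial>\<mu>) = (\<integral>x. (f x :: real) \<partial>\<nu>)"
  shows "\<mu> = \<nu>"
proof -
  have meas: "measure M {0..a} = lim (\<lambda>n. \<integral>x. max 0 (1 - real n * max 0 (x - a)) \<partial>M)" if M: "M \<in> Pm" and a: "0 \<le> a" "a \<le> 1" for M a
  proof -
    interpret prob_space M using M PmD by blast
    have "(\<lambda>n. \<integral>x. max 0 (1 - real n * max 0 (x - a)) \<partial>M) \<longlonglongrightarrow> (\<integral>x. indicator {0..a} x \<partial>M)"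
    proof (rule integral_dominated_convergence[where w="\<lambda>_. 1"])
      show "(\<lambda>x. indicator {0..a} x :: real) \<in> borel_measurable M"
        unfolding Pm_measurable[OF M] by (intro measurable_restrict_space1) simp
      show "(\<lambda>x. max 0 (1 - real n * max 0 (x - a))) \<in> borel_measurable M" for n
        unfolding Pm_measurable[OF M] by (intro cont_borel continuous_intros)
      show "AE x in M. (\<lambda>n. max 0 (1 - real n * max 0 (x - a))) \<longlonglongrightarrow> indicator {0..a} x"
      proof (rule AE_I2)
        fix x assume "x \<in> space M"
        then have x: "x \<in> {0..1}" using PmD[OF M] by simp
        show "(\<lambda>n. max 0 (1 - real n * max 0 (x - a))) \<longlonglongrightarrow> indicator {0..a} x"
        proof (cases "x \<le> a")
          case True then show ?thesis using x by simp
        next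
          case False
          obtain N where N: "real N > 1 / (x - a)" using reals_Archimedean2 by blast
          have "\<forall>n\<ge>N. max 0 (1 - real n * max 0 (x - a)) = indicator {0..a} x"
          proof (intro allI impI)
            fix n assume "n \<ge> N"
            then have "real n > 1 / (x - a)" using N by (meson less_le_trans of_nat_le_iff)
            then have "1 < real n * (x - a)" using False by (simp add: field_simps)
            then show "max 0 (1 - real n * max 0 (x - a)) = indicator {0..a} x" using False by auto
          qed
          then show ?thesis by (intro tendsto_eventually) (auto simp: eventually_sequentially)
        qed
      qed
      show "AE x in M. norm (max 0 (1 - real n * max 0 (x - a))) \<le> 1" for n by (rule AE_I2) auto
    qed auto
    moreover have "(\<integral>x. indicator {0..a} x \<partial>M) = measure M {0..a}"
    proof -
      have "{0..a} \<in> sets M" using PmD[OF M] a by (auto simp: sets_restrict_space image_iff intro!: bexI[of _ "{0..a}"])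
      then show ?thesis by simp
    qed
    ultimately show ?thesis using limI by metis
  qed
  have int: "measure \<mu> {0..a} = measure \<nu> {0..a}" if "0 \<le> a" "a \<le> 1" for a
    unfolding meas[OF assms(1) that] meas[OF assms(2) that]
    by (intro arg_cong[of _ _ lim] ext eq continuous_intros)
  interpret M: prob_space \<mu> using assms PmD by blast
  interpret N: prob_space \<nu> using assms PmD by blast
  define M' where "M' = distr \<mu> borel (\<lambda>x. x)"
  define N' where "N' = distr \<nu> borel (\<lambda>x. x)"
  have m: "(\<lambda>x. x) \<in> M \<rightarrow>\<^sub>M borel" if "M \<in> Pm" for M :: "real measure"
    unfolding Pm_measurable[OF that] by (intro cont_borel continuous_intros)
  have cdfM: "cdf M' a = measure \<mu> ({..a} \<inter> {0..1})" for a
    unfolding M'_def cdf_def using measure_distr[OF m[OF assms(1)], of "{..a}"] PmD[OF assms(1)] by (simp add: vimage_def)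
  have cdfN: "cdf N' a = measure \<nu> ({..a} \<inter> {0..1})" for a
    unfolding N'_def cdf_def using measure_distr[OF m[OF assms(2)], of "{..a}"] PmD[OF assms(2)] by (simp add: vimage_def)
  interpret M': real_distribution M' unfolding M'_def
    using M.real_distribution_distr m[OF assms(1)] by simp
  interpret N': real_distribution N' unfolding N'_def
    using N.real_distribution_distr m[OF assms(2)] by simp
  have "cdf M' a = cdf N' a" for a
  proof (cases "a < 0")
    case True
    then have "{..a} \<inter> {0..1} = {}" by auto
    then show ?thesis unfolding cdfM cdfN by simp
  next
    case False
    then have "{..a} \<inter> {0..1} = {0..min a 1}" by auto
    then show ?thesis unfolding cdfM cdfN using int[of "min a 1"] False by simp
  qed
  then have "M' = N'" using cdf_unique'[of M' N'] M'.finite_borel_measure_axioms N'.finite_borel_measure_axioms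
    by (metis M'.real_distribution_axioms N'.real_distribution_axioms cdf_unique ext)
  show ?thesis
  proof (rule measure_eqI)
    show "sets \<mu> = sets \<nu>" using PmD assms by simp
    fix A assume A: "A \<in> sets \<mu>"
    then have A01: "A \<subseteq> {0..1}" and Ab: "A \<in> sets borel" using PmD[OF assms(1)] sets.sets_into_space[OF A]
      by (auto simp: sets_restrict_space)
    have "emeasure \<mu> A = emeasure M' A" unfolding M'_def
      using emeasure_distr[OF m[OF assms(1)] Ab] A01 PmD[OF assms(1)] by (simp add: vimage_def Int_absorb2)
    also have "\<dots> = emeasure N' A" using \<open>M' = N'\<close> by simp
    also have "\<dots> = emeasure \<nu> A" unfolding N'_def
      using emeasure_distr[OF m[OF assms(2)] Ab] A01 PmD[OF assms(2)] by (simp add: vimage_def Int_absorb2)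
    finally show "emeasure \<mu> A = emeasure \<nu> A" .
  qed
qed

text \<open>Measures carried by the unit interval form a tight family on the line, which has a
  convergent subsequence; what remains is that the limit has no mass outside the interval.\<close>

lemma Pm_seq_compact:
  assumes "\<And>n. \<nu> n \<in> Pm"
  shows "\<exists>r M. strict_mono (r :: nat \<Rightarrow> nat) \<and> M \<in> Pm \<and>
    (\<forall>f. continuous_on {0..1} f \<longrightarrow> (\<lambda>n. \<integral>x. f x \<partial>\<nu> (r n)) \<longlonglongrightarrow> (\<integral>x. (f x::real) \<partial>M))"
proof -
  define \<mu> where "\<mu> n = distr (\<nu> n) borel (\<lambda>x. x)" for n
  have m: "(\<lambda>x. x) \<in> \<nu> n \<rightarrow>\<^sub>M borel" for n
    unfolding Pm_measurable[OF assms] by (intro cont_borel continuous_intros)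
  have P: "prob_space (\<nu> n)" for n using PmD[OF assms] by blast
  have rd: "real_distribution (\<mu> n)" for n unfolding \<mu>_def
    using prob_space.real_distribution_distr[OF P m] .
  define cl where "cl x = max 0 (min 1 x)" for x :: real
  have ccl: "continuous_on UNIV cl" unfolding cl_def by (intro continuous_intros)
  have cl01: "cl x \<in> {0..1}" for x by (simp add: cl_def)
  have "tight \<mu>" unfolding tight_def
  proof (intro conjI allI impI)
    fix e :: real assume "e > 0"
    have "measure (\<mu> n) {-1<..1} = 1" for n
    proof -
      have "measure (\<mu> n) {-1<..1} = measure (\<nu> n) ((\<lambda>x. x) -` {-1<..1} \<inter> space (\<nu> n))"
        unfolding \<mu>_def using measure_distr[OF m, of "{-1<..1}"] by simp
      also have "(\<lambda>x. x) -` {-1<..1} \<inter> space (\<nu> n) = space (\<nu> n)" using PmD[OF assms] by auto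
      finally show ?thesis using prob_space.prob_space[OF P] by simp
    qed
    then show "\<exists>a b. a < b \<and> (\<forall>n. 1 - e < measure (\<mu> n) {a<..b})"
      using \<open>e > 0\<close> by (intro exI[of _ "-1"] exI[of _ 1]) auto
  qed (use rd in auto)
  then obtain r M where r: "strict_mono (r :: nat \<Rightarrow> nat)" and M: "real_distribution M" and w: "weak_conv_m (\<mu> \<circ> id \<circ> r) M"
    using tight_imp_convergent_subsubsequence[of \<mu> id] by (auto simp: strict_mono_def)
  interpret M: real_distribution M by fact
  have conv: "(\<lambda>n. \<integral>x. f x \<partial>\<mu> (r n)) \<longlonglongrightarrow> (\<integral>x. f x \<partial>M)"
    if "continuous_on UNIV f" "\<And>x. \<bar>f x\<bar> \<le> B" for f :: "real \<Rightarrow> real" and B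
    using weak_conv_imp_integral_bdd_continuous_conv[of "\<mu> \<circ> id \<circ> r" M f B] w rd M that
    by (auto simp: continuous_on_eq_continuous_at)
  have tr: "(\<integral>x. f x \<partial>\<mu> n) = (\<integral>x. f x \<partial>\<nu> n)" if "continuous_on UNIV f" for f :: "real \<Rightarrow> real" and n
    unfolding \<mu>_def using that by (intro integral_distr m borel_measurable_continuous_onI)
  \<comment> \<open>A bounded continuous function that vanishes exactly on the unit interval; its
    integral is 0 along the sequence and hence in the limit.\<close>
  define g where "g x = min 1 \<bar>x - cl x\<bar>" for x
  have cg: "continuous_on UNIV g" unfolding g_def by (intro continuous_intros ccl)
  have gb: "\<bar>g x\<bar> \<le> 1" for x by (simp add: g_def)
  have "(\<integral>x. g x \<partial>\<mu> n) = 0" for n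
  proof -
    have "(\<integral>x. g x \<partial>\<nu> n) = (\<integral>x. 0 \<partial>\<nu> n)" using PmD[OF assms]
      by (intro Bochner_Integration.integral_cong) (auto simp: g_def cl_def)
    then show ?thesis using tr[OF cg] by simp
  qed
  then have "(\<integral>x. g x \<partial>M) = 0" using conv[OF cg gb] by (simp add: LIMSEQ_const_iff)
  moreover have "integrable M g" using gb cg
    by (intro M.integrable_const_bound[of _ 1]) (auto dest: borel_measurable_continuous_onI)
  moreover have "AE x in M. 0 \<le> g x" by (simp add: g_def)
  ultimately have "AE x in M. g x = 0" using integral_nonneg_eq_0_iff_AE[of M g] by blast
  then have ae: "AE x in M. x \<in> {0..1}" by eventually_elim (auto simp: g_def cl_def split: if_splits)
  then have "emeasure M {0..1} = 1" using M.emeasure_eq_1_AE[of "{0..1}"] by simp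
  then have ps: "prob_space (restrict_space M {0..1})" by (intro prob_space_restrict_space) auto
  have N: "restrict_space M {0..1} \<in> Pm" unfolding Pm_def using ps
    by (auto simp: space_restrict_space intro!: sets_restrict_space_cong)
  moreover have "(\<lambda>n. \<integral>x. f x \<partial>\<nu> (r n)) \<longlonglongrightarrow> (\<integral>x. f x \<partial>restrict_space M {0..1})"
    if f: "continuous_on {0..1} f" for f :: "real \<Rightarrow> real"
  proof -
    define F where "F x = f (cl x)" for x
    have cF: "continuous_on UNIV F" unfolding F_def
      by (rule continuous_on_compose2[OF f ccl]) (use cl01 in auto)
    obtain B where B: "\<And>x. x \<in> {0..1} \<Longrightarrow> \<bar>f x\<bar> \<le> B" using cont_bounded[OF f] by blast
    have "\<bar>F x\<bar> \<le> B" for x using B cl01 by (simp add: F_def)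
    note conv[OF cF this]
    moreover have "(\<integral>x. F x \<partial>\<mu> n) = (\<integral>x. f x \<partial>\<nu> n)" for n
      unfolding tr[OF cF] using PmD[OF assms] by (intro Bochner_Integration.integral_cong) (auto simp: F_def cl_def)
    moreover have "(\<integral>x. f x \<partial>restrict_space M {0..1}) = (\<integral>x. F x \<partial>restrict_space M {0..1})"
      by (intro Bochner_Integration.integral_cong) (auto simp: F_def cl_def space_restrict_space)
    moreover have "\<dots> = (\<integral>x. F x \<partial>M)"
    proof -
      have "(\<integral>x. F x \<partial>restrict_space M {0..1}) = (\<integral>x. indicator {0..1} x *\<^sub>R F x \<partial>M)"
        by (rule integral_restrict_space) simp
      also have "\<dots> = (\<integral>x. F x \<partial>M)"
      proof (rule integral_cong_AE)
        show "AE x in M. indicator {0..1} x *\<^sub>R F x = F x" using ae by eventually_elim simp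
      qed (use borel_measurable_continuous_onI[OF cF] in auto)
      finally show ?thesis .
    qed
    ultimately show ?thesis by simp
  qed
  ultimately show ?thesis using r by blast
qed

text \<open>Bernstein polynomials with rational coefficients, indexed by a countable type: a
  countable uniformly dense family, which does the work of a metric on the space of
  measures.\<close>

definition bern :: "rat list \<Rightarrow> real \<Rightarrow> real" where
  "bern q x = (\<Sum>k\<le>length q - 1. of_rat (q ! k) * Bernstein (length q - 1) k x)"

lemma bern_continuous: "continuous_on S (bern q)"
  unfolding bern_def Bernstein_def by (intro continuous_intros)

lemma bern_dense:
  assumes f: "continuous_on {0..1} f" and e: "e > 0"
  obtains q where "\<And>x. x \<in> {0..1} \<Longrightarrow> \<bar>f x - bern q x\<bar> < e"
proof -
  obtain N where N: "\<And>n x. N \<le> n \<Longrightarrow> x \<in> {0..1} \<Longrightarrow> \<bar>f x - (\<Sum>k\<le>n. f(k/n) * Bernstein n k x)\<bar> < e / 2"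
    using Bernstein_Weierstrass[OF f, of "e/2"] e by auto
  have "\<exists>a. \<bar>f (real k / real N) - of_rat a\<bar> < e / 2" for k
  proof -
    obtain y where "y \<in> \<rat>" "f (real k / real N) - e/2 < y" "y < f (real k / real N) + e/2"
      using Rats_dense_in_real[of "f (real k / real N) - e/2" "f (real k / real N) + e/2"] e by auto
    then obtain a where "f (real k / real N) - e/2 < of_rat a" "of_rat a < f (real k / real N) + e/2" by (auto simp: Rats_def)
    then show ?thesis by (intro exI[of _ a]) (simp only: abs_less_iff, linarith)
  qed
  then obtain a where a: "\<And>k. \<bar>f (real k / real N) - of_rat (a k)\<bar> < e / 2" by metis
  define q where "q = map a [0..<Suc N]"
  have bq: "bern q x = (\<Sum>k\<le>N. of_rat (a k) * Bernstein N k x)" for x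
    by (auto simp: bern_def q_def simp del: upt_Suc intro!: sum.cong)
  have "\<bar>f x - bern q x\<bar> < e" if x: "x \<in> {0..1}" for x
  proof -
    have nn: "0 \<le> Bernstein N k x" for k using x by (intro Bernstein_nonneg) auto
    have "\<bar>(\<Sum>k\<le>N. f(k/N) * Bernstein N k x) - bern q x\<bar> = \<bar>\<Sum>k\<le>N. (f(k/N) - of_rat (a k)) * Bernstein N k x\<bar>"
      by (simp add: bq sum_subtractf algebra_simps)
    also have "\<dots> \<le> (\<Sum>k\<le>N. \<bar>(f(k/N) - of_rat (a k)) * Bernstein N k x\<bar>)" by (rule sum_abs)
    also have "\<dots> \<le> (\<Sum>k\<le>N. e/2 * Bernstein N k x)"
    proof (rule sum_mono)
      fix k
      have "\<bar>(f(k/N) - of_rat (a k)) * Bernstein N k x\<bar> = \<bar>f(k/N) - of_rat (a k)\<bar> * Bernstein N k x"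
        using nn by (simp add: abs_mult)
      also have "\<dots> \<le> e/2 * Bernstein N k x" by (rule mult_right_mono[OF less_imp_le[OF a] nn])
      finally show "\<bar>(f(k/N) - of_rat (a k)) * Bernstein N k x\<bar> \<le> e/2 * Bernstein N k x" .
    qed
    also have "\<dots> = e / 2" unfolding sum_distrib_left[symmetric] by simp
    finally have "\<bar>(\<Sum>k\<le>N. f(k/N) * Bernstein N k x) - bern q x\<bar> \<le> e / 2" .
    moreover have "\<bar>f x - (\<Sum>k\<le>N. f(k/N) * Bernstein N k x)\<bar> < e / 2" using N[of N x] x by simp
    ultimately show ?thesis by linarith
  qed
  then show thesis using that by blast
qed

lemma integral_close:
  assumes "M \<in> Pm" "continuous_on {0..1} f" "continuous_on {0..1} g" "\<And>x. x \<in> {0..1} \<Longrightarrow> \<bar>f x - g x\<bar> < e"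
  shows "\<bar>(\<integral>x. (f x::real) \<partial>M) - (\<integral>x. g x \<partial>M)\<bar> \<le> e"
proof -
  interpret prob_space M using assms PmD by blast
  have i: "integrable M f" "integrable M g" using assms cont_integrable by auto
  have "\<bar>(\<integral>x. f x \<partial>M) - (\<integral>x. g x \<partial>M)\<bar> = \<bar>\<integral>x. f x - g x \<partial>M\<bar>" using i by simp
  also have "\<dots> \<le> (\<integral>x. \<bar>f x - g x\<bar> \<partial>M)" by (rule integral_abs_bound)
  also have "\<dots> \<le> (\<integral>x. e \<partial>M)"
    using i assms(4) PmD[OF assms(1)] by (intro integral_mono) (auto intro: less_imp_le)
  also have "\<dots> = e" by (simp add: prob_space)
  finally show ?thesis .
qed

text \<open>A limit point argument yields finite subcovers of countable covers, so each half-space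
  is first replaced by a smaller one given by a rational Bernstein polynomial and a rational bound.
  \<open>Q\<close> carries the estimate attached to a half-space.\<close>

lemma weak_finite_cover:
  fixes Q :: "(real \<Rightarrow> real) \<Rightarrow> real \<Rightarrow> bool"
  assumes F: "closedin weak_top F"
    and cov: "\<And>\<mu>. \<mu> \<in> F \<Longrightarrow> \<exists>f a. continuous_on {0..1} f \<and> (\<integral>x. f x \<partial>\<mu>) < a \<and> Q f a"
  shows "\<exists>A. finite A \<and> (\<forall>(f, a)\<in>A. continuous_on {0..1} f \<and> Q f a) \<and>
    (\<forall>\<nu>\<in>F. \<exists>(f, a)\<in>A. (\<integral>x. f x \<partial>\<nu>) < a)"
proof -
  have FP: "F \<subseteq> Pm" using closedin_subset[OF F] topspace_weak by simp
  define good where "good q r f a \<longleftrightarrow> continuous_on {0..1} f \<and> Q f a \<and>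
    (\<forall>\<nu>\<in>Pm. (\<integral>x. bern q x \<partial>\<nu>) < of_rat r \<longrightarrow> (\<integral>x. f x \<partial>\<nu>) < a)" for q and r :: rat and f a
  define C where "C = {(q, r). \<exists>f a. good q r f a}"
  have cC: "\<exists>(q, r)\<in>C. (\<integral>x. bern q x \<partial>\<mu>) < of_rat r" if \<mu>: "\<mu> \<in> F" for \<mu>
  proof -
    obtain f a where fa: "continuous_on {0..1} f" "(\<integral>x. f x \<partial>\<mu>) < a" "Q f a" using cov[OF \<mu>] by blast
    \<comment> \<open>The slack at \<open>\<mu>\<close> is \<open>4 * e\<close>: passing to the
      polynomial and back costs \<open>e\<close> each time, and a rational bound is found between
      \<open>a - 2 * e\<close> and \<open>a - e\<close>.\<close>
    define e where "e = (a - (\<integral>x. f x \<partial>\<mu>)) / 4"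
    have e: "e > 0" using fa by (simp add: e_def)
    obtain q where q: "\<And>x. x \<in> {0..1} \<Longrightarrow> \<bar>f x - bern q x\<bar> < e" using bern_dense[OF fa(1) e] by blast
    obtain r' where "r' \<in> \<rat>" "a - 2 * e < r'" "r' < a - e" using Rats_dense_in_real[of "a - 2 * e" "a - e"] e by auto
    then obtain r where r: "a - 2 * e < of_rat r" "of_rat r < a - e" by (auto simp: Rats_def)
    have cl: "\<bar>(\<integral>x. f x \<partial>\<nu>) - (\<integral>x. bern q x \<partial>\<nu>)\<bar> \<le> e" if "\<nu> \<in> Pm" for \<nu>
      by (rule integral_close[OF that fa(1) bern_continuous q])
    have "good q r f a" unfolding good_def
    proof (intro conjI ballI impI)
      fix \<nu> assume "\<nu> \<in> Pm" "(\<integral>x. bern q x \<partial>\<nu>) < of_rat r"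
      then show "(\<integral>x. f x \<partial>\<nu>) < a" using cl[of \<nu>] r by simp
    qed (use fa in auto)
    moreover have "(\<integral>x. bern q x \<partial>\<mu>) < of_rat r" 
    proof -
      have "\<bar>(\<integral>x. f x \<partial>\<mu>) - (\<integral>x. bern q x \<partial>\<mu>)\<bar> \<le> e" using cl \<mu> FP by blast
      moreover have "(\<integral>x. f x \<partial>\<mu>) = a - 4 * e" unfolding e_def by argo
      ultimately show ?thesis using r(1) e unfolding abs_le_iff by linarith
    qed
    ultimately show ?thesis unfolding C_def by blast
  qed
  show ?thesis
  proof (cases "F = {}")
    case True then show ?thesis by (intro exI[of _ "{}"]) auto
  next
    case False
    then have Cne: "C \<noteq> {}" using cC by blast
    define en where "en = from_nat_into C"
    have en: "range en = C" unfolding en_def using Cne by (intro range_from_nat_into) auto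
    \<comment> \<open>Otherwise measures that avoid the first \<open>m\<close> half-spaces
      accumulate at some \<open>M\<close>. It lies in the closed set \<open>F\<close>, hence in one
      of the half-spaces, which late members of the sequence avoid although it is open.\<close>
    have "\<exists>m. \<forall>\<nu>\<in>F. \<exists>i\<le>m. (\<integral>x. bern (fst (en i)) x \<partial>\<nu>) < of_rat (snd (en i))"
    proof (rule ccontr)
      assume "\<nexists>m. \<forall>\<nu>\<in>F. \<exists>i\<le>m. (\<integral>x. bern (fst (en i)) x \<partial>\<nu>) < of_rat (snd (en i))"
      then have "\<forall>m. \<exists>\<nu>\<in>F. \<forall>i\<le>m. \<not> (\<integral>x. bern (fst (en i)) x \<partial>\<nu>) < of_rat (snd (en i))" by blast
      then obtain \<nu> where \<nu>: "\<And>m. \<nu> m \<in> F" "\<And>m i. i \<le> m \<Longrightarrow> \<not> (\<integral>x. bern (fst (en i)) x \<partial>\<nu> m) < of_rat (snd (en i))"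
        by metis
      obtain r M where r: "strict_mono (r :: nat \<Rightarrow> nat)" "M \<in> Pm"
        "\<And>f. continuous_on {0..1} f \<Longrightarrow> (\<lambda>n. \<integral>x. f x \<partial>\<nu> (r n)) \<longlonglongrightarrow> (\<integral>x. (f x::real) \<partial>M)"
        using Pm_seq_compact[of \<nu>] \<nu>(1) FP by blast
      have MF: "M \<in> F"
      proof (rule ccontr)
        assume "M \<notin> F"
        then have "M \<in> Pm - F" using r by simp
        note weak_basis[OF _ this]
        moreover have "openin weak_top (Pm - F)" using F topspace_weak by (simp add: closedin_def)
        ultimately obtain G :: "(real \<Rightarrow> real) set" and e :: real where G: "finite G" "e > 0" "\<forall>f\<in>G. continuous_on {0..1} f"
          "{\<nu>\<in>Pm. \<forall>f\<in>G. \<bar>(\<integral>x. f x \<partial>\<nu>) - (\<integral>x. f x \<partial>M)\<bar> < e} \<subseteq> Pm - F" by blast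
        have "\<forall>\<^sub>F n in sequentially. \<forall>f\<in>G. \<bar>(\<integral>x. f x \<partial>\<nu> (r n)) - (\<integral>x. f x \<partial>M)\<bar> < e"
        proof (rule eventually_ball_finite[OF G(1)], rule ballI)
          fix f assume "f \<in> G"
          then have "(\<lambda>n. \<integral>x. f x \<partial>\<nu> (r n)) \<longlonglongrightarrow> (\<integral>x. f x \<partial>M)" using r(3) G(3) by blast
          then show "\<forall>\<^sub>F n in sequentially. \<bar>(\<integral>x. f x \<partial>\<nu> (r n)) - (\<integral>x. f x \<partial>M)\<bar> < e"
            using G(2) by (auto dest!: tendstoD simp: dist_real_def)
        qed
        then obtain n where "\<forall>f\<in>G. \<bar>(\<integral>x. f x \<partial>\<nu> (r n)) - (\<integral>x. f x \<partial>M)\<bar> < e"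
          by (auto simp: eventually_sequentially)
        then have "\<nu> (r n) \<notin> F" using G(4) \<nu>(1)[of "r n"] FP by blast
        then show False using \<nu>(1) by blast
      qed
      then obtain i where i: "(\<integral>x. bern (fst (en i)) x \<partial>M) < of_rat (snd (en i))"
        using cC[OF MF] en by (metis (no_types, lifting) case_prod_beta rangeE)
      have "\<forall>\<^sub>F n in sequentially. (\<integral>x. bern (fst (en i)) x \<partial>\<nu> (r n)) < of_rat (snd (en i))"
        using order_tendstoD(2)[OF r(3)[OF bern_continuous] i] .
      then have "\<forall>\<^sub>F n in sequentially. (\<integral>x. bern (fst (en i)) x \<partial>\<nu> (r n)) < of_rat (snd (en i)) \<and> i \<le> n"
        using eventually_ge_at_top[of i] by eventually_elim auto
      then obtain n where n: "(\<integral>x. bern (fst (en i)) x \<partial>\<nu> (r n)) < of_rat (snd (en i))" "i \<le> n"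
        by (auto simp: eventually_sequentially)
      have "i \<le> r n" using n(2) seq_suble[OF r(1), of n] by simp
      then show False using \<nu>(2)[of i "r n"] n(1) by blast
    qed
    then obtain m where m: "\<And>\<nu>. \<nu> \<in> F \<Longrightarrow> \<exists>i\<le>m. (\<integral>x. bern (fst (en i)) x \<partial>\<nu>) < of_rat (snd (en i))" by blast
    have "\<exists>p. good (fst (en i)) (snd (en i)) (fst p) (snd p)" for i
    proof -
      have "en i \<in> C" using en by blast
      then obtain f a where "good (fst (en i)) (snd (en i)) f a" by (auto simp: C_def case_prod_beta)
      then show ?thesis by (intro exI[of _ "(f, a)"]) simp
    qed
    then obtain p where p: "\<And>i. good (fst (en i)) (snd (en i)) (fst (p i)) (snd (p i))" by metis
    show ?thesis
    proof (intro exI[of _ "p ` {..m}"] conjI)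
      show "\<forall>(f, a)\<in>p ` {..m}. continuous_on {0..1} f \<and> Q f a" using p unfolding good_def by (auto simp: case_prod_beta)
      show "\<forall>\<nu>\<in>F. \<exists>(f, a)\<in>p ` {..m}. (\<integral>x. f x \<partial>\<nu>) < a"
      proof
        fix \<nu> assume \<nu>: "\<nu> \<in> F"
        then obtain i where i: "i \<le> m" "(\<integral>x. bern (fst (en i)) x \<partial>\<nu>) < of_rat (snd (en i))" using m by blast
        then have "(\<integral>x. fst (p i) x \<partial>\<nu>) < snd (p i)" using p[of i] \<nu> FP by (auto simp: good_def)
        then show "\<exists>(f, a)\<in>p ` {..m}. (\<integral>x. f x \<partial>\<nu>) < a" using i(1) by (intro bexI[of _ "p i"]) (auto simp: case_prod_beta)
      qed
    qed auto
  qed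
qed

context neg_beta begin

section \<open>Non-invariant measures are not limits of empirical measures\<close>

text \<open>Visits are more than \<open>M\<close> steps apart, so each block of \<open>M + 1\<close>
  consecutive times contains at most one.\<close>

lemma visits_bound:
  assumes "\<And>x j. x \<in> A \<Longrightarrow> j \<in> {1..M} \<Longrightarrow> (T ^^ j) x \<notin> A"
  shows "card {j. j < n \<and> (T ^^ j) x \<in> A} \<le> n div (M + 1) + 1"
proof -
  have "inj_on (\<lambda>j. j div (M + 1)) {j. j < n \<and> (T ^^ j) x \<in> A}"
  proof (rule linorder_inj_onI)
    fix i j assume ij: "i < j" "i \<in> {j. j < n \<and> (T ^^ j) x \<in> A}" "j \<in> {j. j < n \<and> (T ^^ j) x \<in> A}"
    have "(T ^^ j) x = (T ^^ (j - i)) ((T ^^ i) x)" using ij(1)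
      by (metis comp_apply funpow_add le_add_diff_inverse2 less_imp_le)
    then have "\<not> j - i \<in> {1..M}" using assms[of "(T ^^ i) x" "j - i"] ij by auto
    then have "j \<ge> i + (M + 1)" using ij(1) by auto
    then have "j div (M + 1) \<ge> i div (M + 1) + 1"
      by (metis Suc_eq_plus1 add.commute add_gr_0 div_add_self2 div_le_mono zero_less_one not_less_zero neq0_conv)
    then show "i div (M + 1) \<noteq> j div (M + 1)" by simp
  qed (auto simp: linorder_class.linear)
  moreover have "(\<lambda>j. j div (M + 1)) ` {j. j < n \<and> (T ^^ j) x \<in> A} \<subseteq> {..n div (M + 1)}"
    by (auto intro: div_le_mono)
  ultimately show ?thesis using card_inj_on_le[of _ _ "{..n div (M + 1)}"] by fastforce
qed

text \<open>\<open>f \<circ> T\<close> jumps between \<open>f 0\<close> and \<open>f 1\<close> at the points \<open>i / \<beta>\<close>; the tent interpolates the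
  jump on the side that does not carry the value of \<open>T\<close>.\<close>

definition tent :: "real \<Rightarrow> nat \<Rightarrow> real \<Rightarrow> real" where
  "tent \<delta> i x = (let u = bad_side * (x - real i / \<beta>) in if u > 0 then max 0 (1 - u / \<delta>) else 0)"

text \<open>From the bad side \<open>f \<circ> T\<close> tends to \<open>f 1\<close> in case 1 and
  to \<open>f 0\<close> in case 2, while the value at \<open>i / \<beta>\<close> is the other one;
  \<open>bad_side\<close> therefore also supplies the sign of the jump.\<close>

definition smooth :: "(real \<Rightarrow> real) \<Rightarrow> real \<Rightarrow> real \<Rightarrow> real" where
  "smooth f \<delta> x = f (T x) - bad_side * (f 1 - f 0) * (\<Sum>i\<in>{1..b}. tent \<delta> i x)"

lemma tent_zero:
  assumes "\<delta> > 0" "bad_side * (x - real i / \<beta>) \<ge> \<delta> \<or> bad_side * (x - real i / \<beta>) \<le> 0"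
  shows "tent \<delta> i x = 0"
proof (cases "bad_side * (x - real i / \<beta>) > 0")
  case True
  then have "1 \<le> bad_side * (x - real i / \<beta>) / \<delta>" using assms by (subst le_divide_eq_1_pos) auto
  then show ?thesis by (simp add: tent_def Let_def)
qed (simp add: tent_def)

lemma tent_bound: "\<delta> > 0 \<Longrightarrow> 0 \<le> tent \<delta> i x \<and> tent \<delta> i x \<le> indicator (bad_nbhd i \<delta>) x"
proof -
  assume d: "\<delta> > 0"
  define u where "u = bad_side * (x - real i / \<beta>)"
  have x: "x = real i / \<beta> + bad_side * u" using bad_side_sq by (simp add: u_def algebra_simps bad_side_def)
  show ?thesis
  proof (cases "0 < u \<and> u < \<delta>")
    case True
    then have "x \<in> bad_nbhd i \<delta>" using x by (auto simp: bad_nbhd_def)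
    then show ?thesis using True d by (auto simp: tent_def u_def[symmetric] Let_def)
  next
    case False
    then have "tent \<delta> i x = 0" using d by (intro tent_zero) (auto simp: u_def)
    then show ?thesis by simp
  qed
qed

lemma tent_eq_0: "\<delta> > 0 \<Longrightarrow> \<delta> < 1 / \<beta> \<Longrightarrow> \<bar>x - real i / \<beta>\<bar> \<ge> 1 / \<beta> \<Longrightarrow> tent \<delta> i x = 0"
  by (auto simp: tent_def Let_def bad_side_def field_simps split: if_splits)

text \<open>On each closed branch interval \<open>K i\<close> the function is \<open>f\<close> of
  the affine branch plus one tent, and finitely many closed pieces suffice. The tent sits at the
  left end of \<open>K i\<close> in case 1 and at the right end in case 2; at 0 and at 1 there is no
  jump to repair. The bound \<open>\<delta> < 1 / \<beta>\<close> keeps the tents of other cut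
  points out of \<open>K i\<close>.\<close>

lemma smooth_continuous:
  assumes f: "continuous_on {0..1} f" and d: "\<delta> > 0" "\<delta> < 1 / \<beta>"
  shows "continuous_on {0..1} (smooth f \<delta>)"
proof -
  define K where "K i = {real i / \<beta>..min 1 ((real i + 1) / \<beta>)}" for i :: nat
  define J where "J = f 1 - f 0"
  define c where "c i x = (if case1 \<beta> then (if i = 0 then 0 else - J * max 0 (1 - (x - real i / \<beta>) / \<delta>))
     else (if i = b then 0 else J * max 0 (1 - ((real i + 1) / \<beta> - x) / \<delta>)))" for i x
  have cov: "{0..1} = (\<Union>i\<in>{..b}. K i)"
  proof
    show "{0..1} \<subseteq> (\<Union>i\<in>{..b}. K i)"
    proof
      fix x :: real assume x: "x \<in> {0..1}"
      show "x \<in> (\<Union>i\<in>{..b}. K i)"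
      proof (cases rule: T_cases[OF x])
        case 1 then show ?thesis by (auto simp: K_def intro!: bexI[of _ 0])
      next
        case 2 then show ?thesis using b_less beta_le by (auto simp: K_def field_simps intro!: bexI[of _ b])
      next
        case (3 i) then show ?thesis using x by (auto simp: K_def divide_right_mono intro!: bexI[of _ i])
      next
        case (4 i) then show ?thesis by (auto simp: K_def field_simps intro!: bexI[of _ i])
      qed
    qed
    show "(\<Union>i\<in>{..b}. K i) \<subseteq> {0..1}" 
      by (auto simp: K_def) (metis beta_pos(2) divide_nonneg_nonneg of_nat_0_le_iff order_trans)
  qed
  have sum_one: "(\<Sum>i\<in>{1..b}. tent \<delta> i x) = tent \<delta> j x"
    if "j \<in> {1..b}" "\<And>i. i \<in> {1..b} \<Longrightarrow> i \<noteq> j \<Longrightarrow> tent \<delta> i x = 0" for j x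
    using that by (subst sum.remove[of _ j]) auto
  have eq: "smooth f \<delta> x = f (real i + 1 - \<beta> * x) + c i x" if i: "i \<le> b" and x: "x \<in> K i" for i x
  proof -
    have xb: "real i / \<beta> \<le> x" "x \<le> 1" "x \<le> (real i + 1) / \<beta>" using x by (auto simp: K_def)
    then have x0: "0 \<le> x" by (metis beta_pos(2) divide_nonneg_nonneg of_nat_0_le_iff order_trans)
    have far: "tent \<delta> j x = 0" if "j \<noteq> i" "j \<noteq> Suc i" for j
    proof (rule tent_eq_0[OF d])
      have "\<beta> * \<bar>x - real j / \<beta>\<bar> = \<bar>\<beta> * x - real j\<bar>" by (simp add: abs_mult_pos' field_simps abs_mult[symmetric])
      moreover have "real i \<le> \<beta> * x" "\<beta> * x \<le> real i + 1" using xb by (auto simp: field_simps)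
      moreover have "real j \<le> real i - 1 \<or> real j \<ge> real i + 2" using that by linarith
      ultimately have "1 \<le> \<beta> * \<bar>x - real j / \<beta>\<bar>" by linarith
      then show "1 / \<beta> \<le> \<bar>x - real j / \<beta>\<bar>" by (simp add: field_simps)
    qed
    show ?thesis
    proof (cases "case1 \<beta>")
      case True
      then have bs: "bad_side = 1" by (simp add: bad_side_def)
      have t2: "tent \<delta> (Suc i) x = 0" using xb by (auto simp: tent_def bs Let_def add.commute)
      have far': "tent \<delta> j x = 0" if "j \<noteq> i" for j using that far t2 by (cases "j = Suc i") auto
      have s: "(\<Sum>j\<in>{1..b}. tent \<delta> j x) = (if i = 0 then 0 else tent \<delta> i x)"
        using sum_one[of i x] far' i by auto
      show ?thesis
      proof (cases "x = real i / \<beta>")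
        case True
        show ?thesis
        proof (cases "i = 0")
          case True then show ?thesis using \<open>x = real i / \<beta>\<close> \<open>case1 \<beta>\<close> s by (simp add: smooth_def c_def T_0)
        next
          case False
          then have ib: "i \<in> {1..b}" using i by auto
          have "tent \<delta> i x = 0" using True by (simp add: tent_def)
          then show ?thesis using False \<open>case1 \<beta>\<close> s T_div[OF ib] True d by (simp add: smooth_def c_def J_def)
        qed
      next
        case False
        then have xi: "x > real i / \<beta>" using xb by simp
        have "T x = real i + 1 - \<beta> * x"
        proof (cases "x = 1")
          case True
          then have "i = b" using i xi xb beta_le b_less by (simp add: field_simps)
          then show ?thesis using True T_1 by simp
        next
          case x1: False
          show ?thesis
          proof (cases "x = (real i + 1) / \<beta>")
            case True
            then have "(real i + 1) / \<beta> < 1" using x1 xb by simp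
            then have "real i + 1 < \<beta>" by (simp add: field_simps)
            then have "Suc i \<in> {1..b}" using beta_le by auto
            from T_div[OF this] show ?thesis using True \<open>case1 \<beta>\<close> by (simp add: add.commute)
          next
            case False
            then show ?thesis using xi xb x1 x0
              by (intro T_eq) (auto simp: field_simps le_less)
          qed
        qed
        moreover have "tent \<delta> i x = max 0 (1 - (x - real i / \<beta>) / \<delta>)" using xi by (simp add: tent_def bs)
        ultimately show ?thesis using \<open>case1 \<beta>\<close> s by (simp add: smooth_def c_def bs flip: J_def)
      qed
    next
      case c2: False
      then have bs: "bad_side = -1" by (simp add: bad_side_def)
      have t2: "tent \<delta> i x = 0" using xb by (auto simp: tent_def bs Let_def)
      have far': "tent \<delta> j x = 0" if "j \<noteq> Suc i" for j using that far t2 by (cases "j = i") auto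
      have s: "(\<Sum>j\<in>{1..b}. tent \<delta> j x) = (if i = b then 0 else tent \<delta> (Suc i) x)"
        using sum_one[of "Suc i" x] far' i by auto
      show ?thesis
      proof (cases "i \<noteq> b \<and> x = (real i + 1) / \<beta>")
        case True
        then have ib: "Suc i \<in> {1..b}" using i by auto
        have "tent \<delta> (Suc i) x = 0" using True by (simp add: tent_def add.commute)
        then show ?thesis using True c2 s T_div[OF ib] d by (simp add: smooth_def c_def J_def add.commute)
      next
        case False
        have "T x = real i + 1 - \<beta> * x"
        proof (cases "x = 1")
          case True
          then have "real i + 1 \<ge> \<beta>" using xb by (simp add: field_simps)
          then have "i = b" using False True i b_less
            by (smt (verit) divide_self_if nat_le_real_less le_antisym not_less_eq_eq of_nat_Suc beta_pos(3))
          then show ?thesis using True T_1 by simp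
        next
          case x1: False
          show ?thesis
          proof (cases "x = real i / \<beta>")
            case True
            show ?thesis
            proof (cases "i = 0")
              case True then show ?thesis using \<open>x = real i / \<beta>\<close> by (simp add: T_0)
            next
              case False
              then have "i \<in> {1..b}" using i by auto
              from T_div[OF this] show ?thesis using True c2 by simp
            qed
          next
            case xi: False
            then have "real i < \<beta> * x" using xb by (simp add: field_simps le_less)
            moreover have "\<beta> * x < real i + 1"
            proof (cases "i = b")
              case True
              have "\<beta> * x < \<beta> * 1" using x1 xb by (simp only: mult_less_cancel_left_pos beta_pos)
              then show ?thesis unfolding True using beta_le by linarith
            next
              case False
              then have "x < (real i + 1) / \<beta>" using xb \<open>\<not> (i \<noteq> b \<and> x = (real i + 1) / \<beta>)\<close> by auto
              then show ?thesis by (simp add: field_simps)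
            qed
            moreover have "0 < x" using \<open>real i < \<beta> * x\<close> x0 by (cases "x = 0") auto
            ultimately show ?thesis using x1 xb by (intro T_eq) auto
          qed
        qed
        moreover have "i \<noteq> b \<Longrightarrow> tent \<delta> (Suc i) x = max 0 (1 - ((real i + 1) / \<beta> - x) / \<delta>)"
          using False xb by (auto simp: tent_def bs add.commute)
        ultimately show ?thesis using c2 s by (simp add: smooth_def c_def bs flip: J_def)
      qed
    qed
  qed
  have "continuous_on (K i) (smooth f \<delta>)" if i: "i \<le> b" for i
  proof -
    have "continuous_on (K i) (\<lambda>x. f (real i + 1 - \<beta> * x) + c i x)"
    proof (intro continuous_on_add continuous_on_compose2[OF f, of "K i" "\<lambda>x. real i + 1 - \<beta> * x"])
      show "continuous_on (K i) (c i)" unfolding c_def using d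
        by (cases "case1 \<beta>"; cases "i = 0"; cases "i = b") (simp_all, (intro continuous_intros, simp_all)+)
      show "(\<lambda>x. real i + 1 - \<beta> * x) ` K i \<subseteq> {0..1}" by (auto simp: K_def field_simps)
    qed (intro continuous_intros)
    then show ?thesis by (rule continuous_on_eq) (simp add: eq[OF i])
  qed
  then show ?thesis unfolding cov by (intro continuous_on_closed_Union) (auto simp: K_def)
qed

text \<open>Along any orbit the sum of \<open>f \<circ> T - f\<close> telescopes, so its average is
  uniformly small, whereas a non-invariant \<open>\<mu>\<close> gives some such difference a nonzero
  integral. Smoothing preserves both facts up to \<open>e\<close>, because the half-neighbourhood of
  each cut point where the functions differ is visited at most once in \<open>M + 1\<close>
  steps.\<close>

lemma noninvariant_upper:
  assumes \<mu>: "\<mu> \<in> Pm" and ni: "\<not> invariant T \<mu>"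
  shows "\<exists>g a. continuous_on {0..1} g \<and> (\<integral>x. g x \<partial>\<mu>) < a \<and>
    (\<forall>\<^sub>F n in sequentially. {x\<in>{0..1}. (\<Sum>j<n. g ((T ^^ j) x)) < real n * a} = {})"
proof -
  interpret prob_space \<mu> using PmD[OF \<mu>] by simp
  have Tm: "T \<in> \<mu> \<rightarrow>\<^sub>M B01" using T_measurable PmD(2)[OF \<mu>] measurable_cong_sets by blast
  have dP: "distr \<mu> B01 T \<in> Pm" unfolding Pm_def using prob_space_distr[OF Tm] by (auto simp: space_restrict_space)
  have "distr \<mu> B01 T \<noteq> \<mu>" using ni T_measurable by (simp add: invariant_def)
  then obtain f :: "real \<Rightarrow> real" where f: "continuous_on {0..1} f" "(\<integral>x. f x \<partial>distr \<mu> B01 T) \<noteq> (\<integral>x. f x \<partial>\<mu>)"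
    using Pm_eqI[OF dP \<mu>] by blast
  define I where "I = (\<integral>x. f (T x) \<partial>\<mu>) - (\<integral>x. f x \<partial>\<mu>)"
  have I: "I \<noteq> 0" using f(2) integral_distr[OF Tm cont_borel[OF f(1)]] by (simp add: I_def)
  define J where "J = \<bar>f 1 - f 0\<bar>"
  obtain B where B: "B > 0" "\<And>x. x \<in> {0..1} \<Longrightarrow> \<bar>f x\<bar> \<le> B" using cont_bounded[OF f(1)] by blast
  have fTm: "(\<lambda>x. f (T x)) \<in> borel_measurable \<mu>" using measurable_comp[OF Tm cont_borel[OF f(1)]] by (simp add: comp_def)
  \<comment> \<open>The integral of \<open>g\<close> will lie below \<open>-3 * e\<close> and long
    orbit averages within \<open>e\<close> of 0; the threshold \<open>-2 * e\<close> separates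
    them.\<close>
  define e where "e = \<bar>I\<bar> / 4"
  have e: "e > 0" using I by (simp add: e_def)
  obtain M :: nat where M: "real M > J * real b / e" using reals_Archimedean2 by blast
  have M': "J * real b / real (M + 1) < e"
  proof -
    have "J * real b < e * real (M + 1)" using M e by (simp add: field_simps)
    then show ?thesis by (simp add: field_simps)
  qed
  have ev1: "\<forall>\<^sub>F \<delta> in at_right 0. \<forall>i\<in>{1..b}. \<forall>x\<in>bad_nbhd i \<delta>. \<forall>j\<in>{1..M}. (T ^^ j) x \<notin> bad_nbhd i \<delta>"
    by (rule eventually_ball_finite) (use bad_nbhd_no_return in auto)
  have small: "\<forall>\<^sub>F \<delta> in at_right 0. \<delta> < (r::real)" if "r > 0" for r
    using that by (auto simp: eventually_at_right_field intro!: exI[of _ r])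
  have seq: "LIM n sequentially. 1 / real (Suc n) :> at_right 0"
    by (intro tendsto_imp_filterlim_at_right LIMSEQ_Suc lim_1_over_n) auto
  have tent0: "(\<lambda>n. tent (1 / real (Suc n)) i x) \<longlonglongrightarrow> 0" for i x
  proof (cases "bad_side * (x - real i / \<beta>) > 0")
    case True
    define u where "u = bad_side * (x - real i / \<beta>)"
    have "\<forall>\<^sub>F n in sequentially. 1 / real (Suc n) < u"
      using filterlim_iff[THEN iffD1, OF seq] small[of u] True by (auto simp: u_def)
    then have "\<forall>\<^sub>F n in sequentially. tent (1 / real (Suc n)) i x = 0"
      by eventually_elim (intro tent_zero, auto simp: u_def)
    then show ?thesis by (rule tendsto_eventually)
  qed (simp add: tent_def)
  have "(\<lambda>n. \<integral>x. smooth f (1 / real (Suc n)) x \<partial>\<mu>) \<longlonglongrightarrow> (\<integral>x. f (T x) \<partial>\<mu>)"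
  proof (rule integral_dominated_convergence[where w="\<lambda>_. B + J * real b"])
    show "(\<lambda>x. f (T x)) \<in> borel_measurable \<mu>" by (rule fTm)
    have "tent \<delta> i \<in> borel_measurable borel" for \<delta> i unfolding tent_def Let_def by measurable
    then have tm: "tent \<delta> i \<in> borel_measurable \<mu>" for \<delta> i
      unfolding Pm_measurable[OF \<mu>] by (rule measurable_restrict_space1)
    show "smooth f (1 / real (Suc n)) \<in> borel_measurable \<mu>" for n
      unfolding smooth_def[abs_def] using fTm tm by (intro borel_measurable_diff borel_measurable_times borel_measurable_sum) auto
    show "AE x in \<mu>. (\<lambda>n. smooth f (1 / real (Suc n)) x) \<longlonglongrightarrow> f (T x)"
    proof (rule AE_I2)
      fix x
      have "(\<lambda>n. f (T x) - bad_side * (f 1 - f 0) * (\<Sum>i\<in>{1..b}. tent (1 / real (Suc n)) i x))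
        \<longlonglongrightarrow> f (T x) - bad_side * (f 1 - f 0) * (\<Sum>i\<in>{1..b}. 0)"
        by (intro tendsto_diff tendsto_mult tendsto_const tendsto_sum tent0)
      then show "(\<lambda>n. smooth f (1 / real (Suc n)) x) \<longlonglongrightarrow> f (T x)" by (simp add: smooth_def)
    qed
    show "AE x in \<mu>. norm (smooth f (1 / real (Suc n)) x) \<le> B + J * real b" for n
    proof (rule AE_I2)
      fix x assume "x \<in> space \<mu>"
      then have x: "x \<in> {0..1}" using PmD[OF \<mu>] by simp
      have t1: "0 \<le> tent (1 / real (Suc n)) i x \<and> tent (1 / real (Suc n)) i x \<le> 1" for i
        using tent_bound[of "1 / real (Suc n)" i x] by (auto intro: order_trans[OF _ indicator_le_1])
      have "\<bar>\<Sum>i\<in>{1..b}. tent (1 / real (Suc n)) i x\<bar> \<le> (\<Sum>i\<in>{1..b}. 1)"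
        using t1 by (intro order_trans[OF sum_abs] sum_mono) auto
      then have s: "\<bar>\<Sum>i\<in>{1..b}. tent (1 / real (Suc n)) i x\<bar> \<le> real b" by simp
      have "\<bar>bad_side * (f 1 - f 0) * (\<Sum>i\<in>{1..b}. tent (1 / real (Suc n)) i x)\<bar> \<le> J * real b"
        unfolding abs_mult J_def using s by (simp add: bad_side_def mult_left_mono)
      moreover have "\<bar>f (T x)\<bar> \<le> B" using B(2) T_range[OF x] by blast
      ultimately show "norm (smooth f (1 / real (Suc n)) x) \<le> B + J * real b" unfolding smooth_def real_norm_def by linarith
    qed
  qed auto
  then have "\<forall>\<^sub>F n in sequentially. dist (\<integral>x. smooth f (1 / real (Suc n)) x \<partial>\<mu>) (\<integral>x. f (T x) \<partial>\<mu>) < e"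
    using e by (rule tendstoD)
  moreover have "\<forall>\<^sub>F n in sequentially. \<forall>i\<in>{1..b}. \<forall>x\<in>bad_nbhd i (1 / real (Suc n)). \<forall>j\<in>{1..M}. (T ^^ j) x \<notin> bad_nbhd i (1 / real (Suc n))"
    using filterlim_iff[THEN iffD1, OF seq] ev1 by fast
  moreover have "\<forall>\<^sub>F n in sequentially. 1 / real (Suc n) < 1 / \<beta>"
    by (rule filterlim_iff[THEN iffD1, OF seq, rule_format, OF small]) simp
  ultimately have "\<forall>\<^sub>F n in sequentially. dist (\<integral>x. smooth f (1 / real (Suc n)) x \<partial>\<mu>) (\<integral>x. f (T x) \<partial>\<mu>) < e \<and>
     (\<forall>i\<in>{1..b}. \<forall>x\<in>bad_nbhd i (1 / real (Suc n)). \<forall>j\<in>{1..M}. (T ^^ j) x \<notin> bad_nbhd i (1 / real (Suc n))) \<and>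
     1 / real (Suc n) < 1 / \<beta>"
    by eventually_elim blast
  then obtain n0 where n0: "dist (\<integral>x. smooth f (1 / real (Suc n0)) x \<partial>\<mu>) (\<integral>x. f (T x) \<partial>\<mu>) < e"
     "\<And>i x j. i \<in> {1..b} \<Longrightarrow> x \<in> bad_nbhd i (1 / real (Suc n0)) \<Longrightarrow> j\<in>{1..M} \<Longrightarrow> (T ^^ j) x \<notin> bad_nbhd i (1 / real (Suc n0))"
     "1 / real (Suc n0) < 1 / \<beta>"
    unfolding eventually_sequentially by blast
  define \<delta> where "\<delta> = 1 / real (Suc n0)"
  have d: "\<delta> > 0" "\<delta> < 1 / \<beta>" using n0(3) by (simp_all add: \<delta>_def)
  define F where "F = smooth f \<delta>"
  have cF: "continuous_on {0..1} F" unfolding F_def by (rule smooth_continuous[OF f(1) d])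
  have orbit: "\<bar>\<Sum>j<n. F ((T ^^ j) x) - f ((T ^^ j) x)\<bar> \<le> 2 * B + J * real b * (real n / real (M + 1) + 1)"
    if x: "x \<in> {0..1}" for x n
  proof -
    have "\<bar>F y - f (T y)\<bar> \<le> J * (\<Sum>i\<in>{1..b}. indicator (bad_nbhd i \<delta>) y)" for y
    proof -
      have "\<bar>\<Sum>i\<in>{1..b}. tent \<delta> i y\<bar> \<le> (\<Sum>i\<in>{1..b}. indicator (bad_nbhd i \<delta>) y)"
        using tent_bound[OF d(1)] by (intro order_trans[OF sum_abs] sum_mono) auto
      then have "J * \<bar>\<Sum>i\<in>{1..b}. tent \<delta> i y\<bar> \<le> J * (\<Sum>i\<in>{1..b}. indicator (bad_nbhd i \<delta>) y)"
        by (intro mult_left_mono) (auto simp: J_def)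
      moreover have "\<bar>F y - f (T y)\<bar> = J * \<bar>\<Sum>i\<in>{1..b}. tent \<delta> i y\<bar>"
        unfolding F_def smooth_def J_def by (simp add: abs_mult bad_side_def)
      ultimately show ?thesis by simp
    qed
    then have "\<bar>\<Sum>j<n. F ((T ^^ j) x) - f (T ((T ^^ j) x))\<bar> \<le> (\<Sum>j<n. J * (\<Sum>i\<in>{1..b}. indicator (bad_nbhd i \<delta>) ((T ^^ j) x)))"
      by (intro order_trans[OF sum_abs] sum_mono)
    also have "\<dots> = J * (\<Sum>i\<in>{1..b}. \<Sum>j<n. indicator (bad_nbhd i \<delta>) ((T ^^ j) x))"
      by (subst sum.swap) (simp add: sum_distrib_left)
    also have "\<dots> \<le> J * (\<Sum>i\<in>{1..b}. real n / real (M + 1) + 1)"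
    proof (intro mult_left_mono sum_mono)
      fix i assume i: "i \<in> {1..b}"
      have "(\<Sum>j<n. indicator (bad_nbhd i \<delta>) ((T ^^ j) x) :: real) = real (card {j. j < n \<and> (T ^^ j) x \<in> bad_nbhd i \<delta>})"
        by (simp add: indicator_def sum.If_cases Int_def)
      also have "\<dots> \<le> real (n div (M + 1) + 1)"
        using visits_bound[of "bad_nbhd i \<delta>" M n x] n0(2)[OF i] by (simp add: \<delta>_def)
      also have "\<dots> \<le> real n / real (M + 1) + 1"
        using of_nat_div_le_of_nat[of n "M + 1", where ?'a = real] by simp
      finally show "(\<Sum>j<n. indicator (bad_nbhd i \<delta>) ((T ^^ j) x)) \<le> real n / real (M + 1) + 1" .
    qed (simp add: J_def)
    also have "\<dots> = J * real b * (real n / real (M + 1) + 1)" by simp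
    finally have 1: "\<bar>\<Sum>j<n. F ((T ^^ j) x) - f (T ((T ^^ j) x))\<bar> \<le> J * real b * (real n / real (M + 1) + 1)" .
    have "(\<Sum>j<n. f ((T ^^ Suc j) x) - f ((T ^^ j) x)) = f ((T ^^ n) x) - f ((T ^^ 0) x)"
      by (rule sum_lessThan_telescope)
    then have 2: "\<bar>\<Sum>j<n. f (T ((T ^^ j) x)) - f ((T ^^ j) x)\<bar> \<le> 2 * B"
      using B(2)[OF Tpow_range[OF x, of n]] B(2)[OF x] by simp
    have "(\<Sum>j<n. F ((T ^^ j) x) - f ((T ^^ j) x)) =
      (\<Sum>j<n. F ((T ^^ j) x) - f (T ((T ^^ j) x))) + (\<Sum>j<n. f (T ((T ^^ j) x)) - f ((T ^^ j) x))"
      by (simp add: sum.distrib[symmetric])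
    then show ?thesis using 1 2 by linarith
  qed
  \<comment> \<open>The sign makes the deviation a negative one, so the separating set is a
    half-space of the form used in the finite cover.\<close>
  define \<sigma> where "\<sigma> = - sgn I"
  have sg: "\<bar>\<sigma>\<bar> = 1" "\<sigma> * I = - \<bar>I\<bar>" using I by (auto simp: \<sigma>_def sgn_if)
  define g where "g x = \<sigma> * (F x - f x)" for x
  have cg: "continuous_on {0..1} g" unfolding g_def by (intro continuous_intros cF f(1))
  have ig: "(\<integral>x. g x \<partial>\<mu>) < - 2 * e"
  proof -
    have "(\<integral>x. g x \<partial>\<mu>) = \<sigma> * ((\<integral>x. F x \<partial>\<mu>) - (\<integral>x. f x \<partial>\<mu>))"
      unfolding g_def using cont_integrable[OF \<mu> cF] cont_integrable[OF \<mu> f(1)] by simp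
    also have "\<dots> = \<sigma> * I + \<sigma> * ((\<integral>x. F x \<partial>\<mu>) - (\<integral>x. f (T x) \<partial>\<mu>))" by (simp add: I_def algebra_simps)
    also have "\<dots> \<le> - \<bar>I\<bar> + \<bar>(\<integral>x. F x \<partial>\<mu>) - (\<integral>x. f (T x) \<partial>\<mu>)\<bar>"
      using sg abs_ge_self[of "\<sigma> * ((\<integral>x. F x \<partial>\<mu>) - (\<integral>x. f (T x) \<partial>\<mu>))"] by (simp add: abs_mult)
    also have "\<dots> < - 4 * e + e" using n0(1) by (simp add: dist_real_def e_def F_def \<delta>_def)
    finally show ?thesis using e by simp
  qed
  have "\<forall>\<^sub>F n in sequentially. (2 * B + J * real b) < real n * (e - J * real b / real (M + 1)) + 0 * real n"
  proof -
    have "filterlim (\<lambda>n. (e - J * real b / real (M + 1)) * real n) at_top sequentially"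
      using M' by (intro filterlim_tendsto_pos_mult_at_top[OF tendsto_const _ filterlim_real_sequentially]) simp
    then show ?thesis by (auto simp: filterlim_at_top_dense mult.commute)
  qed
  then have "\<forall>\<^sub>F n in sequentially. {x\<in>{0..1}. (\<Sum>j<n. g ((T ^^ j) x)) < real n * (- 2 * e)} = {}"
  proof eventually_elim
    case (elim n)
    have "\<not> (\<Sum>j<n. g ((T ^^ j) x)) < real n * (- 2 * e)" if x: "x \<in> {0..1}" for x
    proof -
      have "\<bar>\<Sum>j<n. g ((T ^^ j) x)\<bar> = \<bar>\<Sum>j<n. F ((T ^^ j) x) - f ((T ^^ j) x)\<bar>"
        unfolding g_def by (simp add: sum_distrib_left[symmetric] abs_mult sg)
      also have "\<dots> \<le> 2 * B + J * real b * (real n / real (M + 1) + 1)" by (rule orbit[OF x])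
      also have "\<dots> = (2 * B + J * real b) + real n * (J * real b / real (M + 1))" by (simp add: algebra_simps)
      also have "\<dots> < real n * e" using elim by (simp add: algebra_simps)
      also have "\<dots> \<le> real n * (2 * e)" using e by (intro mult_left_mono) auto
      finally show ?thesis by simp
    qed
    then show ?case by blast
  qed
  then show ?thesis using cg ig by blast
qed

end

section \<open>Labels and cells of an invariant finite partition\<close>

locale markov_neg_beta = neg_beta +
  fixes S :: "real set"
  assumes fin_S: "finite S" and D_S: "Dset \<beta> \<subseteq> S" and S_01: "S \<subseteq> {0..1}" and T_S: "x \<in> S \<Longrightarrow> T x \<in> S"
begin

text \<open>Recording strict and weak comparisons gives every point of \<open>S\<close> a label of
  its own, while all points of a gap between neighbours in \<open>S\<close> share one.\<close>

definition lab :: "real \<Rightarrow> real set \<times> real set" where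
  "lab x = ({s\<in>S. s < x}, {s\<in>S. s \<le> x})"

definition cell :: "nat \<Rightarrow> real \<Rightarrow> real set" where
  "cell n x = {y\<in>{0..1}. \<forall>i<n. lab ((T ^^ i) y) = lab ((T ^^ i) x)}"

lemma S0: "0 \<in> S" and S1: "1 \<in> S" and Sdiv: "i \<le> b \<Longrightarrow> real i / \<beta> \<in> S"
proof -
  show "real i / \<beta> \<in> S" if "i \<le> b" for i using that D_S by (auto simp: Dset_def)
  from this[of 0] show "0 \<in> S" by simp
  show "1 \<in> S" using D_S by (auto simp: Dset_def)
qed

lemma lab_range: "lab x \<in> Pow S \<times> Pow S" by (auto simp: lab_def)

lemma lab_iff: "lab x = lab y \<longleftrightarrow> (\<forall>s\<in>S. (s < x \<longleftrightarrow> s < y) \<and> (s \<le> x \<longleftrightarrow> s \<le> y))"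
  unfolding lab_def prod.inject set_eq_iff mem_Collect_eq by blast

lemma lab_S: "lab x = lab y \<Longrightarrow> x \<in> S \<Longrightarrow> x = y"
  unfolding lab_iff by force

lemma lab_notin: "lab x = lab y \<Longrightarrow> x \<notin> S \<Longrightarrow> y \<notin> S"
  using lab_S[of y x] by auto

lemma lab_eq_notin_iff:
  assumes "x \<notin> S" "y \<notin> S"
  shows "lab x = lab y \<longleftrightarrow> \<not> (\<exists>s\<in>S. min x y \<le> s \<and> s \<le> max x y)"
  unfolding lab_iff using assms by (auto simp: min_def max_def)

lemma lab_digit:
  assumes x: "x \<in> {0..1}" "x \<notin> S" and l: "lab z = lab x"
  obtains i where "i \<le> b" "0 < x" "x < 1" "real i < \<beta> * x" "\<beta> * x < real i + 1"
    "0 < z" "z < 1" "real i < \<beta> * z" "\<beta> * z < real i + 1"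
    "T x = real i + 1 - \<beta> * x" "T z = real i + 1 - \<beta> * z"
proof -
  have "x \<notin> Dset \<beta>" using x D_S by blast
  from T_nonsing[OF x(1) this] obtain i where i: "i \<le> b" "0 < x" "x < 1" "real i < \<beta> * x" "\<beta> * x < real i + 1"
    "T x = real i + 1 - \<beta> * x" by metis
  have l': "\<And>s. s \<in> S \<Longrightarrow> (s < z \<longleftrightarrow> s < x) \<and> (s \<le> z \<longleftrightarrow> s \<le> x)" using l unfolding lab_iff by blast
  have z: "0 < z" "z < 1" using l'[OF S0] l'[OF S1] i by auto
  have "real i / \<beta> < x" using i by (simp add: field_simps)
  then have "real i / \<beta> < z" using l'[OF Sdiv[OF i(1)]] by simp
  then have 1: "real i < \<beta> * z" by (simp add: field_simps)
  have 2: "\<beta> * z < real i + 1"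
  proof (cases "i = b")
    case True
    have "\<beta> * z < \<beta> * 1" using z by (simp only: mult_less_cancel_left_pos beta_pos)
    then show ?thesis unfolding True using beta_le by linarith
  next
    case False
    then have s: "real (Suc i) / \<beta> \<in> S" using i by (intro Sdiv) auto
    have "\<not> real (Suc i) / \<beta> \<le> x" using i by (simp add: field_simps)
    then have "\<not> real (Suc i) / \<beta> \<le> z" using l'[OF s] by simp
    then show ?thesis by (simp add: field_simps)
  qed
  show thesis using that[OF i(1-5) z 1 2 i(6) T_eq[OF z 1 2]] .
qed

text \<open>As \<open>S\<close> contains all cut points, equal labels off \<open>S\<close> force the
  same branch at each step, and every branch has slope \<open>-\<beta>\<close>.\<close>

lemma affine:
  assumes x: "x \<in> {0..1}" and ns: "\<And>i. i < n \<Longrightarrow> (T ^^ i) x \<notin> S"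
    and l: "\<And>i. i < n \<Longrightarrow> lab ((T ^^ i) y) = lab ((T ^^ i) x)"
  shows "(T ^^ n) y - (T ^^ n) x = (-\<beta>)^n * (y - x)"
  using ns l
proof (induction n)
  case (Suc n)
  have "(T ^^ n) x \<in> {0..1}" "(T ^^ n) x \<notin> S" "lab ((T ^^ n) y) = lab ((T ^^ n) x)"
    using Suc.prems Tpow_range[OF x] by auto
  then obtain i where "T ((T ^^ n) x) = real i + 1 - \<beta> * (T ^^ n) x" "T ((T ^^ n) y) = real i + 1 - \<beta> * (T ^^ n) y"
    by (metis lab_digit)
  then have "(T ^^ Suc n) y - (T ^^ Suc n) x = -\<beta> * ((T ^^ n) y - (T ^^ n) x)" by (simp add: algebra_simps)
  also have "(T ^^ n) y - (T ^^ n) x = (-\<beta>)^n * (y - x)" using Suc.prems by (intro Suc.IH) auto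
  finally show ?case by simp
qed simp

lemma cell_self: "x \<in> {0..1} \<Longrightarrow> x \<in> cell n x" by (simp add: cell_def)

lemma cell_eq: "y \<in> cell n x \<Longrightarrow> cell n y = cell n x" by (auto simp: cell_def)

lemma cell_01: "cell n x \<subseteq> {0..1}" by (auto simp: cell_def)

text \<open>Up to the first visit to \<open>S\<close> the iterate is affine and injective on the
  cell, and at that visit the label admits a single point.\<close>

lemma cell_singleton:
  assumes x: "x \<in> {0..1}" and i: "i < n" "(T ^^ i) x \<in> S"
  shows "cell n x = {x}"
proof -
  define j where "j = (LEAST i. (T ^^ i) x \<in> S)"
  have j: "(T ^^ j) x \<in> S" unfolding j_def using i(2) by (rule LeastI)
  have jl: "(T ^^ k) x \<notin> S" if "k < j" for k using that not_less_Least unfolding j_def by blast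
  have jn: "j < n" using Least_le[of "\<lambda>i. (T ^^ i) x \<in> S", OF i(2)] i(1) by (simp add: j_def)
  have "y = x" if "y \<in> cell n x" for y
  proof -
    have l: "lab ((T ^^ k) y) = lab ((T ^^ k) x)" if "k \<le> j" for k using \<open>y \<in> cell n x\<close> that jn by (auto simp: cell_def)
    have "(T ^^ j) y = (T ^^ j) x" using lab_S[of "(T ^^ j) x" "(T ^^ j) y"] l[of j] j by simp
    then have "(-\<beta>)^j * (y - x) = 0" using affine[OF x jl, of j y] l by simp
    then show ?thesis by simp
  qed
  then show ?thesis using cell_self[OF x] by auto
qed

text \<open>A cell without visits to \<open>S\<close> is stretched by \<open>\<beta>^n\<close> and
  still fits into an interval of length 1. This makes the label a generator.\<close>

lemma cell_close:
  assumes x: "x \<in> {0..1}" and y: "y \<in> cell n x"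
  shows "\<bar>y - x\<bar> \<le> (1/\<beta>)^n"
proof (cases "\<exists>i<n. (T ^^ i) x \<in> S")
  case True
  then show ?thesis using cell_singleton[OF x] y by auto
next
  case False
  have y01: "y \<in> {0..1}" using y cell_01 by blast
  have "(T ^^ n) y - (T ^^ n) x = (-\<beta>)^n * (y - x)" using False y by (intro affine[OF x]) (auto simp: cell_def)
  then have "\<beta>^n * \<bar>y - x\<bar> = \<bar>(T ^^ n) y - (T ^^ n) x\<bar>" by (simp add: abs_mult power_abs)
  also have "\<dots> \<le> 1" using Tpow_range[OF x, of n] Tpow_range[OF y01, of n] by auto
  finally show ?thesis by (simp add: field_simps power_one_over)
qed

lemma lab_nbhd:
  assumes "x \<notin> S" shows "\<exists>e>0. \<forall>y. \<bar>y - x\<bar> < e \<longrightarrow> lab y = lab x"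
proof -
  have "open (- S)" using fin_S by (simp add: finite_imp_closed open_Compl)
  then obtain e where e: "e > 0" "\<And>y. \<bar>y - x\<bar> < e \<Longrightarrow> y \<notin> S" using assms unfolding open_dist dist_real_def by (metis ComplD ComplI)
  have "lab y = lab x" if y: "\<bar>y - x\<bar> < e" for y
  proof -
    have "\<bar>s - x\<bar> < e" if "min y x \<le> s" "s \<le> max y x" for s using y that by (auto simp: min_def max_def split: if_splits)
    then show ?thesis using e(2) y assms by (subst lab_eq_notin_iff) auto
  qed
  then show ?thesis using e(1) by blast
qed

lemma cell_nbhd:
  assumes x: "x \<in> {0..1}" and ns: "\<And>i. i < n \<Longrightarrow> (T ^^ i) x \<notin> S"
  shows "\<exists>e>0. \<forall>y. \<bar>y - x\<bar> < e \<longrightarrow> (\<forall>i<n. lab ((T ^^ i) y) = lab ((T ^^ i) x))"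
  using ns
proof (induction n)
  case 0 then show ?case by (auto intro: exI[of _ 1])
next
  case (Suc n)
  obtain e where e: "e > 0" "\<And>y i. \<bar>y - x\<bar> < e \<Longrightarrow> i < n \<Longrightarrow> lab ((T ^^ i) y) = lab ((T ^^ i) x)" 
  proof -
    have "\<exists>e>0. \<forall>y. \<bar>y - x\<bar> < e \<longrightarrow> (\<forall>i<n. lab ((T ^^ i) y) = lab ((T ^^ i) x))" by (rule Suc.IH) (use Suc.prems in auto)
    then show thesis using that by blast
  qed
  obtain r where r: "r > 0" "\<And>y. \<bar>y - (T ^^ n) x\<bar> < r \<Longrightarrow> lab y = lab ((T ^^ n) x)" 
  proof -
    have "(T ^^ n) x \<notin> S" using Suc.prems by simp
    from lab_nbhd[OF this] show thesis using that by blast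
  qed
  have key: "lab ((T ^^ i) y) = lab ((T ^^ i) x)" if y: "\<bar>y - x\<bar> < min e (r / \<beta>^n)" and i: "i < Suc n" for y i
  proof (cases "i < n")
    case False
    then have i: "i = n" using i by simp
    have "(T ^^ n) y - (T ^^ n) x = (-\<beta>)^n * (y - x)" using Suc.prems e(2) y by (intro affine[OF x]) auto
    then have "\<bar>(T ^^ n) y - (T ^^ n) x\<bar> = \<beta>^n * \<bar>y - x\<bar>" by (simp add: abs_mult power_abs)
    also have "\<dots> < r" using y by (simp add: field_simps)
    finally show ?thesis unfolding i by (rule r(2))
  next
    case True
    then show ?thesis using y by (intro e(2)) auto
  qed
  have "min e (r / \<beta>^n) > 0" using e(1) r(1) by simp
  then show ?case using key by blast
qed

lemma cell_open:
  assumes x: "x \<in> {0..1}" and n: "n \<ge> 1" and ns: "\<And>i. i < n \<Longrightarrow> (T ^^ i) x \<notin> S"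
  shows "open (cell n x)"
proof -
  have "\<exists>e>0. \<forall>z. dist z y < e \<longrightarrow> z \<in> cell n x" if y: "y \<in> cell n x" for y
  proof -
    have y01: "y \<in> {0..1}" using y by (simp add: cell_def)
    have ly: "lab ((T ^^ i) y) = lab ((T ^^ i) x)" if "i < n" for i using y that by (simp add: cell_def)
    have ny: "(T ^^ i) y \<notin> S" if "i < n" for i using lab_notin[of "(T ^^ i) x" "(T ^^ i) y"] ly[OF that] ns[OF that] by simp
    obtain e where e: "e > 0" "\<And>z i. \<bar>z - y\<bar> < e \<Longrightarrow> i < n \<Longrightarrow> lab ((T ^^ i) z) = lab ((T ^^ i) y)" using cell_nbhd[OF y01 ny] by blast
    have "z \<in> cell n x" if "\<bar>z - y\<bar> < e" for z
    proof -
      have "lab z = lab y" using e(2)[OF that, of 0] n by simp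
      then have "0 < z \<and> z < 1" using lab_digit[OF y01, of z] ny[of 0] n by auto
      then show ?thesis using e(2)[OF that] ly by (auto simp: cell_def)
    qed
    then show ?thesis using e(1) by (auto simp: dist_real_def)
  qed
  then show ?thesis by (simp add: open_dist)
qed

definition cells :: "nat \<Rightarrow> real set set" where "cells n = cell n ` {0..1}"

lemma finite_cells: "finite (cells n)"
proof -
  define nm where "nm x = map (\<lambda>i. lab ((T ^^ i) x)) [0..<n]" for x
  have "finite {xs. set xs \<subseteq> Pow S \<times> Pow S \<and> length xs = n}"
    using fin_S by (intro finite_lists_length_eq) auto
  moreover have "nm ` {0..1} \<subseteq> {xs. set xs \<subseteq> Pow S \<times> Pow S \<and> length xs = n}"
  proof (rule image_subsetI)
    fix x show "nm x \<in> {xs. set xs \<subseteq> Pow S \<times> Pow S \<and> length xs = n}" unfolding nm_def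
      by (rule CollectI, rule conjI, unfold set_map, rule image_subsetI, rule lab_range, simp)
  qed
  ultimately have "finite (nm ` {0..1})" by (rule finite_subset[rotated])
  moreover have "cells n = (\<lambda>v. {y\<in>{0..1}. nm y = v}) ` nm ` {0..1}"
  proof -
    have "cell n x = {y\<in>{0..1}. nm y = nm x}" for x by (auto simp: cell_def nm_def)
    then show ?thesis unfolding cells_def by (auto simp: image_image)
  qed
  ultimately show ?thesis by simp
qed

lemma cells_disjoint: "A \<in> cells n \<Longrightarrow> B \<in> cells n \<Longrightarrow> A \<noteq> B \<Longrightarrow> A \<inter> B = {}"
  unfolding cells_def using cell_eq by blast

lemma Union_cells: "\<Union>(cells n) = {0..1}"
  unfolding cells_def using cell_self cell_01 by blast

lemma mem_cells_eq: "C \<in> cells n \<Longrightarrow> x \<in> C \<Longrightarrow> C = cell n x"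
  unfolding cells_def using cell_eq by blast

lemma lab_fiber_borel: "{x. lab x = v} \<in> sets borel"
proof -
  have "{x. lab x = v} = (if v \<in> Pow S \<times> Pow S then {x. \<forall>s\<in>S. (s < x \<longleftrightarrow> s \<in> fst v) \<and> (s \<le> x \<longleftrightarrow> s \<in> snd v)} else {})"
  proof (cases "v \<in> Pow S \<times> Pow S")
    case True
    then show ?thesis by (cases v) (auto simp: lab_def)
  next
    case False
    then show ?thesis using lab_range by auto
  qed
  moreover have "{x::real. \<forall>s\<in>S. (s < x \<longleftrightarrow> s \<in> fst v) \<and> (s \<le> x \<longleftrightarrow> s \<in> snd v)} \<in> sets borel"
    using fin_S by measurable
  ultimately show ?thesis by simp
qed

lemma cell_sets: "cell n x \<in> sets B01"
proof -
  have f: "{y\<in>{0..1}. lab ((T ^^ i) y) = lab ((T ^^ i) x)} \<in> sets B01" for i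
  proof -
    have "{y. lab y = lab ((T ^^ i) x)} \<inter> {0..1} \<in> sets B01"
      unfolding sets_restrict_space by (rule image_eqI[OF Int_commute lab_fiber_borel])
    from measurable_sets[OF Tpow_measurable[of i] this]
    have "(T ^^ i) -` ({y. lab y = lab ((T ^^ i) x)} \<inter> {0..1}) \<inter> {0..1} \<in> sets B01" by (simp add: space_restrict_space)
    moreover have "(T ^^ i) -` ({y. lab y = lab ((T ^^ i) x)} \<inter> {0..1}) \<inter> {0..1} = {y\<in>{0..1}. lab ((T ^^ i) y) = lab ((T ^^ i) x)}"
      using Tpow_range by auto
    ultimately show ?thesis by simp
  qed
  have "cell n x = {0..1} \<inter> (\<Inter>i\<in>{..<n}. {y\<in>{0..1}. lab ((T ^^ i) y) = lab ((T ^^ i) x)})" if "n > 0"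
    using that by (auto simp: cell_def)
  moreover have "cell 0 x = {0..1}" by (auto simp: cell_def)
  moreover have "{0..1} \<in> sets B01" using sets.top[of B01] by (simp add: space_restrict_space)
  ultimately show ?thesis using f by (cases "n > 0") (auto intro!: sets.Int sets.finite_INT)
qed

lemma cell_borel: "cell n x \<in> sets borel"
  using cell_sets[of n x] by (auto simp: sets_restrict_space)

lemma cells_sets: "C \<in> cells n \<Longrightarrow> C \<in> sets B01"
  using cell_sets by (auto simp: cells_def)

text \<open>\<open>sing n\<close> collects the one-point cells, which an invariant measure may
  charge; the cells in \<open>gen_cells n\<close> are open for \<open>n \<ge> 1\<close> and carry
  all of Lebesgue measure.\<close>

definition sing :: "nat \<Rightarrow> real set" where "sing n = {x\<in>{0..1}. \<exists>i<n. (T ^^ i) x \<in> S}"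
definition gen_cells :: "nat \<Rightarrow> real set set" where "gen_cells n = cell n ` ({0..1} - sing n)"

lemma gen_cells_sub: "gen_cells n \<subseteq> cells n" by (auto simp: gen_cells_def cells_def)

lemma sing_cell: "x \<in> sing n \<Longrightarrow> cell n x = {x}"
  using cell_singleton by (auto simp: sing_def)

lemma finite_sing: "finite (sing n)"
proof -
  have "(\<lambda>x. {x}) ` sing n \<subseteq> cells n"
  proof
    fix C assume "C \<in> (\<lambda>x. {x}) ` sing n"
    then obtain x where "x \<in> sing n" "C = {x}" by blast
    then show "C \<in> cells n" using sing_cell[of x n] by (auto simp: cells_def sing_def)
  qed
  then have "finite ((\<lambda>x. {x}) ` sing n)" using finite_cells finite_subset by blast
  then show ?thesis by (rule finite_imageD) (auto simp: inj_on_def)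
qed

lemma cells_split: "cells n = gen_cells n \<union> (\<lambda>x. {x}) ` sing n"
proof -
  have "cells n = cell n ` ({0..1} - sing n) \<union> cell n ` sing n"
    unfolding cells_def by (auto simp: sing_def)
  also have "cell n ` sing n = (\<lambda>x. {x}) ` sing n" using sing_cell by (intro image_cong) auto
  finally show ?thesis by (simp add: gen_cells_def)
qed

lemma gen_cell_ns:
  assumes "C \<in> gen_cells n" "x \<in> C" "i < n" shows "(T ^^ i) x \<notin> S"
proof -
  obtain y where y: "y \<in> {0..1}" "y \<notin> sing n" "C = cell n y" using assms(1) unfolding gen_cells_def by blast
  then have "lab ((T ^^ i) x) = lab ((T ^^ i) y)" "(T ^^ i) y \<notin> S" using assms by (auto simp: cell_def sing_def)
  then show ?thesis using lab_notin by metis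
qed

lemma gen_cell_open: "n \<ge> 1 \<Longrightarrow> C \<in> gen_cells n \<Longrightarrow> open C"
proof -
  assume n: "n \<ge> 1" and "C \<in> gen_cells n"
  then obtain x where x: "x \<in> {0..1}" "x \<notin> sing n" "C = cell n x" unfolding gen_cells_def by blast
  then show "open C" using cell_open[OF x(1) n] unfolding sing_def by blast
qed

section \<open>Cells next to a point\<close>

lemma germ_less_or_greater:
  assumes "c \<noteq> u \<or> s \<noteq> 0" shows "(\<forall>\<^sub>F t in at_right 0. c + s * t < u) \<or> (\<forall>\<^sub>F t in at_right (0::real). u < c + s * t)"
  using eventually_germ_less[of c u s] eventually_germ_greater[of u c s] assms
  by (cases c u rule: linorder_cases; cases s "0::real" rule: linorder_cases) auto

lemma germ_lab_const:
  assumes "s \<noteq> 0" shows "\<exists>l. \<forall>\<^sub>F t in at_right 0. lab (c + s * t) = l"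
proof -
  define A where "A = {u\<in>S. \<forall>\<^sub>F t in at_right 0. u < c + s * t}"
  have "\<forall>\<^sub>F t in at_right 0. \<forall>u\<in>S. (u < c + s * t \<longleftrightarrow> u \<in> A) \<and> (u \<le> c + s * t \<longleftrightarrow> u \<in> A)"
  proof (rule eventually_ball_finite[OF fin_S], rule ballI)
    fix u assume u: "u \<in> S"
    consider "\<forall>\<^sub>F t in at_right 0. c + s * t < u" | "\<forall>\<^sub>F t in at_right 0. u < c + s * t" using germ_less_or_greater[of c u s] assms by blast
    then show "\<forall>\<^sub>F t in at_right 0. (u < c + s * t \<longleftrightarrow> u \<in> A) \<and> (u \<le> c + s * t \<longleftrightarrow> u \<in> A)"
    proof cases
      case 1
      have "u \<notin> A"
      proof
        assume "u \<in> A"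
        then have "\<forall>\<^sub>F t in at_right 0. u < c + s * t" by (simp add: A_def)
        with 1 have "\<forall>\<^sub>F t in at_right (0::real). False" by eventually_elim simp
        then show False by simp
      qed
      with 1 show ?thesis by (auto elim: eventually_mono)
    next
      case 2
      then have "u \<in> A" using u by (simp add: A_def)
      with 2 show ?thesis by (auto elim: eventually_mono)
    qed
  qed
  then have "\<forall>\<^sub>F t in at_right 0. lab (c + s * t) = (A, A)"
    by (rule eventually_mono) (auto simp: lab_def A_def)
  then show ?thesis by blast
qed

lemma germ_lab_iter:
  assumes "inner_germ c s" shows "\<exists>l. \<forall>\<^sub>F t in at_right 0. lab ((T ^^ k) (c + s * t)) = l"
proof -
  have "(-\<beta>)^k * s \<noteq> 0" using assms by (simp add: inner_germ_def)
  then obtain l where "\<forall>\<^sub>F t in at_right 0. lab (gc c s k + ((-\<beta>)^k * s) * t) = l" using germ_lab_const by blast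
  with germ_iter[OF assms, of k] have "\<forall>\<^sub>F t in at_right 0. lab ((T ^^ k) (c + s * t)) = l" by eventually_elim simp
  then show ?thesis by blast
qed

lemma germ_cell:
  assumes "inner_germ c s" shows "\<exists>C. \<forall>\<^sub>F t in at_right 0. cell n (c + s * t) = C"
proof -
  obtain l where l: "\<And>k. \<forall>\<^sub>F t in at_right 0. lab ((T ^^ k) (c + s * t)) = l k" using germ_lab_iter[OF assms] by metis
  have "\<forall>\<^sub>F t in at_right 0. \<forall>k\<in>{..<n}. lab ((T ^^ k) (c + s * t)) = l k"
    by (rule eventually_ball_finite) (use l in auto)
  then have "\<forall>\<^sub>F t in at_right 0. cell n (c + s * t) = {y\<in>{0..1}. \<forall>k<n. lab ((T ^^ k) y) = l k}"
    by (rule eventually_mono) (auto simp: cell_def)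
  then show ?thesis by blast
qed

text \<open>On each side the germ at \<open>p\<close> has an eventually constant label at every time
  below \<open>n\<close>, hence a single cell. The Kraft sum needs that a narrow tent around
  \<open>p\<close> reaches no others.\<close>

lemma cells_near:
  assumes p: "p \<in> {0..1}"
  shows "\<exists>e>0. \<exists>C1 C2. \<forall>y\<in>{0..1}. y \<noteq> p \<and> \<bar>y - p\<bar> < e \<longrightarrow> cell n y \<in> {C1, C2}"
proof -
  have R: "\<exists>e>0. \<exists>C. \<forall>t. 0 < t \<and> t < e \<longrightarrow> p + s * t \<in> {0..1} \<longrightarrow> cell n (p + s * t) = C" if s: "s \<in> {1, -1}" for s
  proof (cases "inner_germ p s")
    case True
    obtain C where "\<forall>\<^sub>F t in at_right 0. cell n (p + s * t) = C" using germ_cell[OF True] by blast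
    then obtain e where "e > 0" "\<And>t. 0 < t \<Longrightarrow> t < e \<Longrightarrow> cell n (p + s * t) = C"
      unfolding eventually_at_right_field by auto
    then show ?thesis by (intro exI[of _ e] exI[of _ C] conjI allI impI) auto
  next
    case False
    have "(p = 0 \<and> s = -1) \<or> (p = 1 \<and> s = 1)"
    proof (rule ccontr)
      assume "\<not> ?thesis"
      then have "0 < p \<or> (p = 0 \<and> s > 0)" "p < 1 \<or> (p = 1 \<and> s < 0)" using s p by (auto simp: less_le)
      then show False using inner_germI[of s p] False s by auto
    qed
    then show ?thesis by (intro exI[of _ 1]) auto
  qed
  obtain ea C1 where 1: "ea > 0" "\<forall>t. 0 < t \<and> t < ea \<longrightarrow> p + 1 * t \<in> {0..1} \<longrightarrow> cell n (p + 1 * t) = C1"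
    using R[of 1] by auto
  obtain eb C2 where 2: "eb > 0" "\<forall>t. 0 < t \<and> t < eb \<longrightarrow> p + (-1) * t \<in> {0..1} \<longrightarrow> cell n (p + (-1) * t) = C2"
    using R[of "-1"] by auto
  have key: "cell n y \<in> {C1, C2}" if "y \<in> {0..1}" "y \<noteq> p" "\<bar>y - p\<bar> < min ea eb" for y
  proof (cases "y > p")
    case True then show ?thesis using spec[OF 1(2), of "y - p"] that by auto
  next
    case False then show ?thesis using spec[OF 2(2), of "p - y"] that by auto
  qed
  have pos: "min ea eb > 0" using 1(1) 2(1) by simp
  show ?thesis
    by (rule exI[of _ "min ea eb"], rule conjI[OF pos], rule exI[of _ C1], rule exI[of _ C2],
        intro ballI impI, elim conjE, rule key)
qed

section \<open>Upper bound near invariant measures\<close>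

definition unit_int :: "(real \<Rightarrow> ennreal) \<Rightarrow> ennreal" where
  "unit_int \<Phi> = (\<integral>\<^sup>+x. \<Phi> x * indicator {0..1} x \<partial>lborel)"

lemma unit_int_meas:
  fixes \<Phi> :: "real \<Rightarrow> ennreal"
  assumes "\<Phi> \<in> borel_measurable B01"
  shows "(\<lambda>x. \<Phi> x * indicator {0..1} x) \<in> borel_measurable borel"
  using assms by (subst (asm) borel_measurable_restrict_space_iff_ennreal) auto

text \<open>\<open>T\<^sup>k\<close> is affine with slope \<open>\<plusminus>\<beta>\<^sup>k\<close> on each generic cell, and the other cells are points.\<close>
lemma transfer_bound:
  fixes \<Phi> :: "real \<Rightarrow> ennreal"
  assumes \<Phi>: "\<Phi> \<in> borel_measurable B01" and r: "\<And>C x. C \<in> gen_cells k \<Longrightarrow> x \<in> C \<Longrightarrow> \<rho> x \<le> r C"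
    and rn: "\<And>C. 0 \<le> r C"
  shows "unit_int (\<lambda>x. ennreal (\<rho> x) * \<Phi> ((T ^^ k) x)) \<le> ennreal ((\<Sum>C\<in>gen_cells k. r C) / \<beta>^k) * unit_int \<Phi>"
proof -
  define \<Psi> where "\<Psi> x = \<Phi> x * indicator {0..1} x" for x
  have \<Psi>m: "\<Psi> \<in> borel_measurable borel" unfolding \<Psi>_def by (rule unit_int_meas[OF \<Phi>])
  have fing: "finite (gen_cells k)" using finite_cells gen_cells_sub finite_subset by blast
  have "\<exists>a. \<forall>x\<in>C. (T ^^ k) x = a + (-\<beta>)^k * x" if Cg: "C \<in> gen_cells k" for C
  proof -
    obtain y where y: "y \<in> {0..1}" "y \<notin> sing k" "C = cell k y" using Cg unfolding gen_cells_def by blast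
    have "(T ^^ k) x = ((T ^^ k) y - (-\<beta>)^k * y) + (-\<beta>)^k * x" if "x \<in> C" for x
    proof -
      have "(T ^^ k) x - (T ^^ k) y = (-\<beta>)^k * (x - y)" using y that by (intro affine) (auto simp: sing_def cell_def)
      then show ?thesis by (simp add: algebra_simps)
    qed
    then show ?thesis by blast
  qed
  then obtain a where a: "\<And>C x. C \<in> gen_cells k \<Longrightarrow> x \<in> C \<Longrightarrow> (T ^^ k) x = a C + (-\<beta>)^k * x" by metis
  have "unit_int (\<lambda>x. ennreal (\<rho> x) * \<Phi> ((T ^^ k) x)) \<le> (\<integral>\<^sup>+x. (\<Sum>C\<in>gen_cells k. ennreal (r C) * \<Psi> (a C + (-\<beta>)^k * x)) \<partial>lborel)"
    unfolding unit_int_def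
  proof (rule nn_integral_mono_AE)
    have "AE x in lborel. x \<notin> sing k"
      using finite_imp_null_set_lborel[OF finite_sing] by (rule AE_not_in)
    then show "AE x in lborel. ennreal (\<rho> x) * \<Phi> ((T ^^ k) x) * indicator {0..1} x \<le> (\<Sum>C\<in>gen_cells k. ennreal (r C) * \<Psi> (a C + (-\<beta>)^k * x))"
    proof eventually_elim
      case (elim x)
      show ?case
      proof (cases "x \<in> {0..1}")
        case True
        then have C: "cell k x \<in> gen_cells k" "x \<in> cell k x" using elim cell_self by (auto simp: gen_cells_def)
        have "ennreal (\<rho> x) * \<Phi> ((T ^^ k) x) \<le> ennreal (r (cell k x)) * \<Psi> (a (cell k x) + (-\<beta>)^k * x)"
          using r[OF C] a[OF C, symmetric] Tpow_range[OF True, of k] by (intro mult_mono) (auto simp: \<Psi>_def ennreal_leI)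
        also have "\<dots> \<le> (\<Sum>C\<in>gen_cells k. ennreal (r C) * \<Psi> (a C + (-\<beta>)^k * x))"
          using fing C(1) by (intro member_le_sum) auto
        finally show ?thesis using True by simp
      qed simp
    qed
  qed
  also have "\<dots> = (\<Sum>C\<in>gen_cells k. ennreal (r C) * (\<integral>\<^sup>+x. \<Psi> (a C + (-\<beta>)^k * x) \<partial>lborel))"
    using \<Psi>m by (subst nn_integral_sum) (auto simp: nn_integral_cmult)
  also have "\<dots> = (\<Sum>C\<in>gen_cells k. ennreal (r C) * (ennreal (1 / \<beta>^k) * unit_int \<Phi>))"
  proof (rule sum.cong[OF refl])
    fix C
    have "unit_int \<Phi> = ennreal \<bar>(-\<beta>)^k\<bar> * (\<integral>\<^sup>+x. \<Psi> (a C + (-\<beta>)^k * x) \<partial>lborel)"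
      unfolding unit_int_def \<Psi>_def[symmetric] using \<Psi>m by (intro nn_integral_real_affine) auto
    then have "ennreal (1 / \<beta>^k) * unit_int \<Phi> = (ennreal (1 / \<beta>^k) * ennreal (\<beta>^k)) * (\<integral>\<^sup>+x. \<Psi> (a C + (-\<beta>)^k * x) \<partial>lborel)"
      by (simp add: power_abs mult.assoc)
    also have "ennreal (1 / \<beta>^k) * ennreal (\<beta>^k) = 1" by (simp flip: ennreal_mult)
    finally show "ennreal (r C) * (\<integral>\<^sup>+x. \<Psi> (a C + (-\<beta>)^k * x) \<partial>lborel) = ennreal (r C) * (ennreal (1 / \<beta>^k) * unit_int \<Phi>)" by simp
  qed
  also have "\<dots> = ennreal ((\<Sum>C\<in>gen_cells k. r C) / \<beta>^k) * unit_int \<Phi>"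
  proof -
    have "(\<Sum>C\<in>gen_cells k. ennreal (r C)) = ennreal (\<Sum>C\<in>gen_cells k. r C)" using rn by (intro sum_ennreal) auto
    then have "(\<Sum>C\<in>gen_cells k. ennreal (r C) * (ennreal (1 / \<beta>^k) * unit_int \<Phi>)) = ennreal (\<Sum>C\<in>gen_cells k. r C) * (ennreal (1 / \<beta>^k) * unit_int \<Phi>)"
      by (simp add: sum_distrib_right[symmetric])
    also have "\<dots> = (ennreal (\<Sum>C\<in>gen_cells k. r C) * ennreal (1 / \<beta>^k)) * unit_int \<Phi>" by (simp add: mult.assoc)
    also have "ennreal (\<Sum>C\<in>gen_cells k. r C) * ennreal (1 / \<beta>^k) = ennreal ((\<Sum>C\<in>gen_cells k. r C) / \<beta>^k)"
      using rn by (subst ennreal_mult[symmetric]) (auto intro: sum_nonneg)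
    finally show ?thesis .
  qed
  finally show ?thesis .
qed

text \<open>Splitting off the factor at time 0 leaves a function of \<open>(T ^^ k) x\<close>, so
  \<open>transfer_bound\<close> applies once per factor. \<open>K\<close> bounds the Kraft
  sum.\<close>

lemma prod_bound:
  assumes \<rho>m: "\<rho> \<in> borel_measurable B01" and \<rho>0: "\<And>x. 0 \<le> \<rho> x"
    and r: "\<And>C x. C \<in> gen_cells k \<Longrightarrow> x \<in> C \<Longrightarrow> \<rho> x \<le> r C" and rn: "\<And>C. 0 \<le> r C"
    and K: "(\<Sum>C\<in>gen_cells k. r C) \<le> K"
  shows "(\<lambda>x. \<Prod>i<m. ennreal (\<rho> ((T ^^ (i * k)) x))) \<in> borel_measurable B01"
    "unit_int (\<lambda>x. \<Prod>i<m. ennreal (\<rho> ((T ^^ (i * k)) x))) \<le> ennreal ((K / \<beta>^k)^m)"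
proof -
  have K0: "0 \<le> K" using K sum_nonneg[of "gen_cells k" r] rn by force
  show meas: "(\<lambda>x. \<Prod>i<m. ennreal (\<rho> ((T ^^ (i * k)) x))) \<in> borel_measurable B01" for m
    using \<rho>m by measurable
  show "unit_int (\<lambda>x. \<Prod>i<m. ennreal (\<rho> ((T ^^ (i * k)) x))) \<le> ennreal ((K / \<beta>^k)^m)"
  proof (induction m)
    case 0 then show ?case by (simp add: unit_int_def)
  next
    case (Suc m)
    have "(\<Prod>i<Suc m. ennreal (\<rho> ((T ^^ (i * k)) x))) = ennreal (\<rho> x) * (\<Prod>i<m. ennreal (\<rho> ((T ^^ (i * k)) ((T ^^ k) x))))" for x
      by (simp add: prod.lessThan_Suc_shift funpow_add[symmetric, THEN fun_cong, simplified comp_apply] add.commute del: prod.lessThan_Suc)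
    then have "unit_int (\<lambda>x. \<Prod>i<Suc m. ennreal (\<rho> ((T ^^ (i * k)) x))) \<le> ennreal ((\<Sum>C\<in>gen_cells k. r C) / \<beta>^k) * unit_int (\<lambda>x. \<Prod>i<m. ennreal (\<rho> ((T ^^ (i * k)) x)))"
      using transfer_bound[OF meas[of m] r rn] by simp
    also have "\<dots> \<le> ennreal (K / \<beta>^k) * ennreal ((K / \<beta>^k)^m)"
      using Suc K by (intro mult_mono ennreal_leI divide_right_mono) auto
    also have "\<dots> = ennreal ((K / \<beta>^k)^Suc m)" using K0 by (simp add: ennreal_mult[symmetric])
    finally show ?case .
  qed
qed


section \<open>Cross entropy and its continuous approximation\<close>

lemma cells_measurable: "\<mu> \<in> Pm \<Longrightarrow> C \<in> cells n \<Longrightarrow> C \<in> sets \<mu>"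
  using cells_sets PmD by blast

lemma sum_measure_cells:
  assumes "\<mu> \<in> Pm" "\<C> \<subseteq> cells n" shows "(\<Sum>C\<in>\<C>. measure \<mu> C) \<le> 1"
proof -
  interpret prob_space \<mu> using assms PmD by blast
  have "finite \<C>" using assms(2) finite_cells finite_subset by blast
  moreover have "disjoint_family_on (\<lambda>C. C) \<C>"
    using cells_disjoint assms(2) by (auto simp: disjoint_family_on_def)
  ultimately have "(\<Sum>C\<in>\<C>. measure \<mu> C) = measure \<mu> (\<Union>C\<in>\<C>. C)"
    using cells_measurable[OF assms(1)] assms(2) by (intro finite_measure_finite_Union[symmetric]) auto
  then show ?thesis by simp
qed

lemma lab_simple: "\<mu> \<in> Pm \<Longrightarrow> simple_function \<mu> lab"
proof -
  assume \<mu>: "\<mu> \<in> Pm"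
  have sub: "lab ` {0..1} \<subseteq> Pow S \<times> Pow S" using lab_range by (rule image_subsetI)
  have "finite (lab ` {0..1})" by (rule finite_subset[OF sub]) (simp add: fin_S)
  moreover have "lab -` {v} \<inter> {0..1} \<in> sets \<mu>" for v
  proof -
    have "{x. lab x = v} \<inter> {0..1} \<in> sets B01"
      unfolding sets_restrict_space by (rule image_eqI[OF Int_commute lab_fiber_borel])
    moreover have "lab -` {v} = {x. lab x = v}" by auto
    ultimately show ?thesis using PmD[OF \<mu>] by simp
  qed
  ultimately show ?thesis using PmD[OF \<mu>] by (simp add: simple_function_def)
qed

definition Hc :: "real measure \<Rightarrow> nat \<Rightarrow> real" where
  "Hc \<mu> n = (\<Sum>C\<in>cells n. eta (measure \<mu> C))"

lemma small_power: "(d::real) > 0 \<Longrightarrow> \<exists>k. (1/\<beta>)^k < d"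
  using real_arch_pow_inv[of d "1/\<beta>"] beta_gt_1 by simp

text \<open>Cells are the fibres of the label names, and the label generates because cells shrink
  geometrically. In particular the entropy is a real number.\<close>

lemma ks_entropy_cells:
  assumes \<mu>: "\<mu> \<in> Pm" and inv: "invariant T \<mu>"
  shows "\<exists>h. ks_entropy \<mu> T = ereal h \<and> (\<lambda>n. Hc \<mu> n / real n) \<longlonglongrightarrow> h \<and> (\<forall>n\<ge>1. h \<le> Hc \<mu> n / real n)"
proof -
  interpret I: invariant_system T \<mu> by unfold_locales (use assms in auto)
  have c: "cell n x = I.name lab n -` {I.name lab n x} \<inter> {0..1}" for n x
    by (auto simp: cell_def I.name_eq_iff)
  have H: "ent \<mu> (I.name lab n) = Hc \<mu> n" for n
  proof -
    let ?f = "\<lambda>v. I.name lab n -` {v} \<inter> {0..1}"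
    have "cells n = ?f ` I.name lab n ` {0..1}" unfolding cells_def image_image using c by simp
    moreover have "inj_on ?f (I.name lab n ` {0..1})"
    proof (rule inj_onI)
      fix v w assume "v \<in> I.name lab n ` {0..1}" "?f v = ?f w"
      then obtain x where x: "x \<in> {0..1}" "v = I.name lab n x" by blast
      then have "x \<in> ?f w" using \<open>?f v = ?f w\<close> by blast
      then show "v = w" using x by simp
    qed
    ultimately show ?thesis unfolding Hc_def ent_def by (simp add: sum.reindex)
  qed
  have "\<exists>h. ks_entropy \<mu> T = ereal h \<and> (\<lambda>n. ent \<mu> (I.name lab n) / real n) \<longlonglongrightarrow> h \<and> (\<forall>n\<ge>1. h \<le> ent \<mu> (I.name lab n) / real n)"
  proof (rule I.ks_entropy_generator[OF lab_simple[OF \<mu>]])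
    fix d :: real assume "d > 0"
    then obtain k where k: "(1/\<beta>)^k < d" using small_power by blast
    have "\<bar>x - y\<bar> < d" if "x \<in> {0..1}" "y \<in> {0..1}" "I.name lab k x = I.name lab k y" for x y
    proof -
      have "x \<in> cell k y" using that c[of k y] by simp
      then show ?thesis using cell_close[of y x k] that k by simp
    qed
    then show "\<exists>k. \<forall>x\<in>{0..1}. \<forall>y\<in>{0..1}. I.name lab k x = I.name lab k y \<longrightarrow> \<bar>x - y\<bar> < d" by blast
  qed
  then show ?thesis unfolding H .
qed

text \<open>Adding \<open>\<eta>\<close> inside the logarithm keeps the integrand finite on null
  cells and only lowers it where the cell has positive measure.\<close>

lemma cross_entropy_le:
  assumes \<mu>: "\<mu> \<in> Pm" and h: "\<eta> > 0"
  shows "(\<integral>x. - ln (\<eta> + measure \<mu> (cell k x)) \<partial>\<mu>) \<le> Hc \<mu> k"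
    "(\<lambda>x. - ln (\<eta> + measure \<mu> (cell k x))) \<in> borel_measurable \<mu>"
proof -
  interpret prob_space \<mu> using PmD[OF \<mu>] by simp
  have eq: "- ln (\<eta> + measure \<mu> (cell k x)) = (\<Sum>C\<in>cells k. - ln (\<eta> + measure \<mu> C) * indicator C x)" if x: "x \<in> {0..1}" for x
  proof -
    have c: "cell k x \<in> cells k" "x \<in> cell k x" using x cell_self by (auto simp: cells_def)
    have "indicator C x = (0::real)" if "C \<in> cells k" "C \<noteq> cell k x" for C
      using mem_cells_eq[OF that(1), of x] that(2) by (auto simp: indicator_def)
    then have "(\<Sum>C\<in>cells k - {cell k x}. - ln (\<eta> + measure \<mu> C) * indicator C x) = 0" by (intro sum.neutral) auto
    then show ?thesis using c finite_cells by (subst sum.remove[of _ "cell k x"]) auto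
  qed
  have m: "(\<lambda>x. \<Sum>C\<in>cells k. - ln (\<eta> + measure \<mu> C) * indicator C x) \<in> borel_measurable \<mu>"
    using cells_measurable[OF \<mu>] by (intro borel_measurable_sum borel_measurable_times) auto
  then show "(\<lambda>x. - ln (\<eta> + measure \<mu> (cell k x))) \<in> borel_measurable \<mu>"
    using eq PmD[OF \<mu>] by (subst measurable_cong) auto
  have "(\<integral>x. - ln (\<eta> + measure \<mu> (cell k x)) \<partial>\<mu>) = (\<integral>x. (\<Sum>C\<in>cells k. - ln (\<eta> + measure \<mu> C) * indicator C x) \<partial>\<mu>)"
    using eq PmD[OF \<mu>] by (intro Bochner_Integration.integral_cong) auto
  also have "\<dots> = (\<Sum>C\<in>cells k. - ln (\<eta> + measure \<mu> C) * measure \<mu> C)"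
  proof -
    have "integrable \<mu> (\<lambda>x. c * indicat_real C x)" if "C \<in> cells k" for C c
      using cells_measurable[OF \<mu> that] emeasure_finite[of C]
      by (intro integrable_mult_right integrable_real_indicator) (auto simp: less_top[symmetric])
    then show ?thesis using cells_measurable[OF \<mu>] by (subst Bochner_Integration.integral_sum) auto
  qed
  also have "\<dots> \<le> Hc \<mu> k" unfolding Hc_def
  proof (rule sum_mono)
    fix C
    show "- ln (\<eta> + measure \<mu> C) * measure \<mu> C \<le> eta (measure \<mu> C)"
    proof (cases "measure \<mu> C = 0")
      case False
      then have p: "measure \<mu> C > 0" using measure_nonneg[of \<mu> C] by linarith
      then have "ln (measure \<mu> C) \<le> ln (\<eta> + measure \<mu> C)" using h by simp
      then have "- ln (\<eta> + measure \<mu> C) * measure \<mu> C \<le> - ln (measure \<mu> C) * measure \<mu> C"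
        using p by (intro mult_right_mono) auto
      then show ?thesis using False by (simp add: eta_def mult.commute)
    qed (simp add: eta_def)
  qed
  finally show "(\<integral>x. - ln (\<eta> + measure \<mu> (cell k x)) \<partial>\<mu>) \<le> Hc \<mu> k" .
qed

text \<open>A continuous stand-in for \<open>\<eta> + measure \<mu> (cell k x)\<close>: the
  indicator of an open cell is approached from below by a ramp in the distance to the complement,
  that of a one-point cell from above by a tent.\<close>

definition rho :: "real measure \<Rightarrow> nat \<Rightarrow> real \<Rightarrow> real \<Rightarrow> real \<Rightarrow> real" where
  "rho \<mu> k \<eta> \<delta> x = \<eta> + (\<Sum>C\<in>gen_cells k. measure \<mu> C * min 1 (infdist x (- C) / \<delta>)) +
     (\<Sum>p\<in>sing k. measure \<mu> {p} * max 0 (1 - \<bar>x - p\<bar> / \<delta>))"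

lemma rho_continuous: "\<delta> > 0 \<Longrightarrow> continuous_on A (rho \<mu> k \<eta> \<delta>)"
  unfolding rho_def by (intro continuous_intros) auto

lemma finite_gen: "finite (gen_cells k)" using finite_cells gen_cells_sub finite_subset by blast

lemma sing_disj: "gen_cells k \<inter> (\<lambda>x. {x}) ` sing k = {}"
proof -
  have "\<not> {p} \<in> gen_cells k" if "p \<in> sing k" for p
    using gen_cell_ns[of "{p}" k p] that by (auto simp: sing_def)
  then show ?thesis by auto
qed

lemma sum_sing: "(\<Sum>p\<in>sing k. f {p}) = (\<Sum>C\<in>(\<lambda>x. {x}) ` sing k. f C)"
  by (subst sum.reindex) (auto simp: inj_on_def)

lemma sum_sing_measure: "\<mu> \<in> Pm \<Longrightarrow> (\<Sum>p\<in>sing k. measure \<mu> {p}) \<le> 1"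
  unfolding sum_sing[of "measure \<mu>"] by (rule sum_measure_cells) (auto simp: cells_split)

lemma rho_bounds:
  assumes "\<mu> \<in> Pm" "\<delta> > 0" "\<eta> > 0"
  shows "\<eta> \<le> rho \<mu> k \<eta> \<delta> x" "rho \<mu> k \<eta> \<delta> x \<le> \<eta> + 2"
proof -
  have 1: "0 \<le> (\<Sum>C\<in>gen_cells k. measure \<mu> C * min 1 (infdist x (- C) / \<delta>))"
    using assms by (intro sum_nonneg mult_nonneg_nonneg) (auto simp: infdist_nonneg)
  have 2: "0 \<le> (\<Sum>p\<in>sing k. measure \<mu> {p} * max 0 (1 - \<bar>x - p\<bar> / \<delta>))"
    by (intro sum_nonneg mult_nonneg_nonneg) auto
  have 3: "(\<Sum>C\<in>gen_cells k. measure \<mu> C * min 1 (infdist x (- C) / \<delta>)) \<le> (\<Sum>C\<in>gen_cells k. measure \<mu> C)"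
    by (intro sum_mono mult_left_le) auto
  have 4: "(\<Sum>p\<in>sing k. measure \<mu> {p} * max 0 (1 - \<bar>x - p\<bar> / \<delta>)) \<le> (\<Sum>p\<in>sing k. measure \<mu> {p})"
    using assms by (intro sum_mono mult_left_le) auto
  show "\<eta> \<le> rho \<mu> k \<eta> \<delta> x" unfolding rho_def using 1 2 by linarith
  show "rho \<mu> k \<eta> \<delta> x \<le> \<eta> + 2" unfolding rho_def
    using 3 4 sum_measure_cells[OF assms(1) gen_cells_sub[of k]] sum_sing_measure[OF assms(1), of k] by linarith
qed

lemma rho_limit:
  assumes x: "x \<in> {0..1}" and k: "k \<ge> 1"
  shows "(\<lambda>n. rho \<mu> k \<eta> (1 / real (Suc n)) x) \<longlonglongrightarrow> \<eta> + measure \<mu> (cell k x)"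
proof -
  have ev: "\<forall>\<^sub>F n in sequentially. 1 \<le> u * real (Suc n)" if "u > 0" for u
  proof -
    obtain N where N: "real N > 1 / u" using reals_Archimedean2 by blast
    have "1 \<le> u * real (Suc n)" if "n \<ge> N" for n
    proof -
      have "1 / u \<le> real (Suc n)" using N that by linarith
      then show ?thesis using \<open>u > 0\<close> by (simp add: field_simps)
    qed
    then show ?thesis by (auto simp: eventually_sequentially)
  qed
  have 1: "(\<lambda>n. min 1 (infdist x (- C) / (1 / real (Suc n)))) \<longlonglongrightarrow> indicator C x" if C: "C \<in> gen_cells k" for C
  proof (cases "x \<in> C")
    case True
    have "closed (- C)" using gen_cell_open[OF k C] by (simp add: open_closed)
    moreover have "- C \<noteq> {}"
    proof -
      have "C \<subseteq> {0..1}" using gen_cells_sub C Union_cells[of k] by blast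
      then have "2 \<in> - C" by auto
      then show ?thesis by blast
    qed
    ultimately have "infdist x (- C) > 0" using True by (intro infdist_pos_not_in_closed) auto
    from ev[OF this] have "\<forall>\<^sub>F n in sequentially. min 1 (infdist x (- C) / (1 / real (Suc n))) = indicator C x"
      by eventually_elim (use True in simp)
    then show ?thesis by (rule tendsto_eventually)
  qed simp
  have 2: "(\<lambda>n. max 0 (1 - \<bar>x - p\<bar> / (1 / real (Suc n)))) \<longlonglongrightarrow> indicator {p} x" for p
  proof (cases "x = p")
    case False
    then have "\<bar>x - p\<bar> > 0" by simp
    from ev[OF this] have "\<forall>\<^sub>F n in sequentially. max 0 (1 - \<bar>x - p\<bar> / (1 / real (Suc n))) = indicator {p} x"
      by eventually_elim (use False in simp)
    then show ?thesis by (rule tendsto_eventually)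
  qed simp
  have "(\<lambda>n. rho \<mu> k \<eta> (1 / real (Suc n)) x) \<longlonglongrightarrow> \<eta> + (\<Sum>C\<in>gen_cells k. measure \<mu> C * indicator C x) +
     (\<Sum>p\<in>sing k. measure \<mu> {p} * indicator {p} x)"
    unfolding rho_def by (intro tendsto_add tendsto_sum tendsto_mult tendsto_const 1 2)
  also have "(\<Sum>p\<in>sing k. measure \<mu> {p} * indicator {p} x) = (\<Sum>C\<in>(\<lambda>x. {x}) ` sing k. measure \<mu> C * indicator C x)"
    by (rule sum_sing[of "\<lambda>C. measure \<mu> C * indicator C x"])
  also have "\<eta> + (\<Sum>C\<in>gen_cells k. measure \<mu> C * indicator C x) + (\<Sum>C\<in>(\<lambda>x. {x}) ` sing k. measure \<mu> C * indicator C x)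
     = \<eta> + (\<Sum>C\<in>cells k. measure \<mu> C * indicator C x)"
    unfolding cells_split using finite_gen finite_sing sing_disj by (subst sum.union_disjoint) auto
  also have "(\<Sum>C\<in>cells k. measure \<mu> C * indicator C x) = measure \<mu> (cell k x)"
  proof -
    have c: "cell k x \<in> cells k" "x \<in> cell k x" using x cell_self by (auto simp: cells_def)
    have "indicator C x = (0::real)" if "C \<in> cells k" "C \<noteq> cell k x" for C
      using mem_cells_eq[OF that(1), of x] that(2) by (auto simp: indicator_def)
    then have "(\<Sum>C\<in>cells k - {cell k x}. measure \<mu> C * indicator C x) = 0" by (intro sum.neutral) auto
    then show ?thesis using c finite_cells by (subst sum.remove[of _ "cell k x"]) auto
  qed
  finally show ?thesis .
qed

text \<open>The bound 4 collects 1 from the offset, which is one over the number of cells, 1 from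
  the masses of the open cells, and 2 from the tents, each of which reaches into at most two open
  cells once \<open>\<delta>\<close> is small.\<close>

lemma rho_kraft:
  assumes \<mu>: "\<mu> \<in> Pm"
  shows "\<exists>e>0. \<forall>\<delta>. 0 < \<delta> \<and> \<delta> < e \<longrightarrow> (\<exists>r. (\<forall>C. 0 \<le> r C) \<and>
     (\<forall>C\<in>gen_cells k. \<forall>x\<in>C. rho \<mu> k (1 / real (card (cells k))) \<delta> x \<le> r C) \<and> (\<Sum>C\<in>gen_cells k. r C) \<le> 4)"
proof -
  define \<eta> where "\<eta> = 1 / real (card (cells k))"
  have e0: "\<eta> \<ge> 0" by (simp add: \<eta>_def)
  define two where "two p e \<longleftrightarrow> (\<exists>C1 C2. \<forall>y\<in>{0..1}. y \<noteq> p \<and> \<bar>y - p\<bar> < e \<longrightarrow> cell k y \<in> {C1, C2})" for p e :: real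
  have "\<forall>p\<in>sing k. \<exists>e. e > 0 \<and> two p e"
  proof
    fix p assume "p \<in> sing k"
    then have "p \<in> {0..1}" by (simp add: sing_def)
    from cells_near[OF this, of k] show "\<exists>e. e > 0 \<and> two p e" unfolding two_def .
  qed
  from bchoice[OF this] obtain E where E: "\<And>p. p \<in> sing k \<Longrightarrow> E p > 0" "\<And>p. p \<in> sing k \<Longrightarrow> two p (E p)" by blast
  define e where "e = Min (insert 1 (E ` sing k))"
  have e: "e > 0" unfolding e_def using finite_sing E(1) by (subst Min_gr_iff) auto
  have eE: "e \<le> E p" if "p \<in> sing k" for p unfolding e_def using finite_sing that by (intro Min_le) auto
  have "\<exists>r. (\<forall>C. 0 \<le> r C) \<and> (\<forall>C\<in>gen_cells k. \<forall>x\<in>C. rho \<mu> k \<eta> \<delta> x \<le> r C) \<and> (\<Sum>C\<in>gen_cells k. r C) \<le> 4"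
    if d: "0 < \<delta>" "\<delta> < e" for \<delta>
  proof -
    define near where "near p C \<longleftrightarrow> (\<exists>y\<in>C. \<bar>y - p\<bar> < \<delta>)" for p C
    \<comment> \<open>Bounds \<open>rho\<close> on the whole cell: its own ramp and every tent that
      touches it are replaced by 1.\<close>
    define r where "r C = \<eta> + measure \<mu> C + (\<Sum>p\<in>sing k. measure \<mu> {p} * (if near p C then 1 else 0))" for C
    have rn: "0 \<le> r C" for C unfolding r_def using e0 by (intro add_nonneg_nonneg sum_nonneg) auto
    have bound: "rho \<mu> k \<eta> \<delta> x \<le> r C" if C: "C \<in> gen_cells k" and x: "x \<in> C" for C x
    proof -
      have o: "min 1 (infdist x (- C') / \<delta>) = 0" if "C' \<in> gen_cells k" "C' \<noteq> C" for C'
      proof -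
        have "x \<notin> C'" using that C x cells_disjoint[of C' k C] gen_cells_sub by blast
        then show ?thesis by simp
      qed
      have "(\<Sum>C\<in>gen_cells k. measure \<mu> C * min 1 (infdist x (- C) / \<delta>)) = measure \<mu> C * min 1 (infdist x (- C) / \<delta>)"
        using C finite_gen o by (subst sum.remove[of _ C]) (auto intro!: sum.neutral)
      also have "\<dots> \<le> measure \<mu> C" by (intro mult_left_le) auto
      finally have 1: "(\<Sum>C\<in>gen_cells k. measure \<mu> C * min 1 (infdist x (- C) / \<delta>)) \<le> measure \<mu> C" .
      have 2: "(\<Sum>p\<in>sing k. measure \<mu> {p} * max 0 (1 - \<bar>x - p\<bar> / \<delta>)) \<le> (\<Sum>p\<in>sing k. measure \<mu> {p} * (if near p C then 1 else 0))"
      proof (intro sum_mono mult_left_mono)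
        fix p
        show "max 0 (1 - \<bar>x - p\<bar> / \<delta>) \<le> (if near p C then 1 else 0)"
        proof (cases "near p C")
          case False
          then have "\<delta> \<le> \<bar>x - p\<bar>" using x by (auto simp: near_def not_less)
          then have "1 \<le> \<bar>x - p\<bar> / \<delta>" using d by (simp add: field_simps)
          then show ?thesis by simp
        qed (use d in auto)
      qed auto
      show ?thesis unfolding rho_def r_def using 1 2 by linarith
    qed
    have cnt: "(\<Sum>C\<in>gen_cells k. if near p C then 1 else (0::real)) \<le> 2" if p: "p \<in> sing k" for p
    proof -
      obtain C1 C2 where C12: "\<forall>y\<in>{0..1}. y \<noteq> p \<and> \<bar>y - p\<bar> < E p \<longrightarrow> cell k y \<in> {C1, C2}"
        using E(2)[OF p] unfolding two_def by (elim exE) (rule that)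
      have "{C\<in>gen_cells k. near p C} \<subseteq> {C1, C2}"
      proof
        fix C assume "C \<in> {C\<in>gen_cells k. near p C}"
        then obtain y where y: "C \<in> gen_cells k" "y \<in> C" "\<bar>y - p\<bar> < \<delta>" by (auto simp: near_def)
        have "y \<noteq> p" using gen_cell_ns[OF y(1,2)] p by (auto simp: sing_def)
        moreover have "C = cell k y" using mem_cells_eq[of C k y] y gen_cells_sub by blast
        moreover have "y \<in> {0..1}" using y Union_cells[of k] gen_cells_sub by blast
        ultimately show "C \<in> {C1, C2}" using bspec[OF C12, of y] y(3) d eE[OF p] by simp
      qed
      then have "card {C\<in>gen_cells k. near p C} \<le> card {C1, C2}" by (intro card_mono) auto
      also have "\<dots> \<le> 2" by (simp add: card_insert_if)
      finally have "card {C\<in>gen_cells k. near p C} \<le> 2" .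
      then show ?thesis using finite_gen by (simp add: sum.If_cases Int_def)
    qed
    have "(\<Sum>C\<in>gen_cells k. r C) = real (card (gen_cells k)) * \<eta> + (\<Sum>C\<in>gen_cells k. measure \<mu> C) +
      (\<Sum>p\<in>sing k. measure \<mu> {p} * (\<Sum>C\<in>gen_cells k. if near p C then 1 else 0))"
      unfolding r_def by (simp add: sum.distrib sum_distrib_left sum.swap[of _ "gen_cells k"])
    also have "\<dots> \<le> 1 + 1 + (\<Sum>p\<in>sing k. measure \<mu> {p} * 2)"
    proof (intro add_mono sum_mono mult_left_mono cnt)
      have "card (gen_cells k) \<le> card (cells k)" using finite_cells gen_cells_sub by (rule card_mono)
      then show "real (card (gen_cells k)) * \<eta> \<le> 1" unfolding \<eta>_def
        by (cases "card (cells k) = 0") (auto simp: field_simps)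
    qed (use sum_measure_cells[OF \<mu> gen_cells_sub] in auto)
    also have "\<dots> = 2 + 2 * (\<Sum>p\<in>sing k. measure \<mu> {p})" by (simp add: sum_distrib_left mult.commute)
    also have "\<dots> \<le> 4" using sum_sing_measure[OF \<mu>, of k] by simp
    finally show ?thesis using rn bound by blast
  qed
  then show ?thesis using e unfolding \<eta>_def by blast
qed

text \<open>The first \<open>(n div k) * k\<close> terms split into \<open>k\<close> progressions of
  step \<open>k\<close>, one of which does not exceed the average. The fewer than \<open>k\<close>
  remaining terms account for \<open>real k * B\<close>.\<close>

lemma offset_sum:
  fixes f :: "real \<Rightarrow> real"
  assumes k: "k \<ge> 1" and B: "\<And>x. x \<in> {0..1} \<Longrightarrow> \<bar>f x\<bar> \<le> B" and x: "x \<in> {0..1}" and s: "(\<Sum>j<n. f ((T ^^ j) x)) < a"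
  shows "\<exists>r<k. (\<Sum>i<n div k. f ((T ^^ (i * k)) ((T ^^ r) x))) \<le> (a + real k * B) / real k"
proof (rule ccontr)
  assume "\<not> ?thesis"
  then have big: "(a + real k * B) / real k < (\<Sum>i<n div k. f ((T ^^ (i * k)) ((T ^^ r) x)))" if "r < k" for r
    using that by (meson not_le)
  define m where "m = n div k"
  have "(\<Sum>r<k. (a + real k * B) / real k) \<le> (\<Sum>r<k. \<Sum>i<m. f ((T ^^ (i * k)) ((T ^^ r) x)))"
    using big unfolding m_def by (intro sum_mono) (auto intro: less_imp_le)
  moreover have "(T ^^ (r + i * k)) x = (T ^^ (i * k)) ((T ^^ r) x)" for r i
    by (simp add: add.commute[of r] funpow_add)
  ultimately have "a + real k * B \<le> (\<Sum>r<k. \<Sum>i<m. f ((T ^^ (r + i * k)) x))"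
    using k by simp
  also have "\<dots> = (\<Sum>i<m. \<Sum>r<k. f ((T ^^ (r + i * k)) x))" by (rule sum.swap)
  also have "\<dots> = (\<Sum>i<m. \<Sum>j=i*k..<i*k+k. f ((T ^^ j) x))"
  proof (rule sum.cong[OF refl])
    fix i
    show "(\<Sum>r<k. f ((T ^^ (r + i * k)) x)) = (\<Sum>j=i*k..<i*k+k. f ((T ^^ j) x))"
      using sum.shift_bounds_nat_ivl[of "\<lambda>j. f ((T ^^ j) x)" 0 "i * k" k] by (simp add: atLeast0LessThan add.commute)
  qed
  also have "\<dots> = (\<Sum>j<m*k. f ((T ^^ j) x))" by (rule sum.nat_group)
  also have "\<dots> = (\<Sum>j<n. f ((T ^^ j) x)) - (\<Sum>j=m*k..<n. f ((T ^^ j) x))"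
  proof -
    have "m * k \<le> n" by (simp add: m_def)
    then have "(\<Sum>j<m*k. f ((T ^^ j) x)) + (\<Sum>j=m*k..<n. f ((T ^^ j) x)) = (\<Sum>j<n. f ((T ^^ j) x))"
      using sum.atLeastLessThan_concat[of 0 "m*k" n "\<lambda>j. f ((T ^^ j) x)"] by (simp add: atLeast0LessThan)
    then show ?thesis by simp
  qed
  also have "\<dots> < a + real k * B"
  proof -
    have "\<bar>\<Sum>j=m*k..<n. f ((T ^^ j) x)\<bar> \<le> (\<Sum>j=m*k..<n. B)"
      using B Tpow_range[OF x] by (intro order_trans[OF sum_abs] sum_mono) auto
    also have "\<dots> = real (n - m * k) * B" by simp
    also have "\<dots> \<le> real k * B"
    proof (intro mult_right_mono)
      have "n - m * k = n mod k" by (simp add: m_def minus_div_mult_eq_mod)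
      then show "real (n - m * k) \<le> real k" using k by (simp add: less_imp_le)
      show "0 \<le> B" using B[OF x] by linarith
    qed
    finally show ?thesis using s by linarith
  qed
  finally show False by simp
qed

text \<open>An exponential Markov inequality. A small orbit sum of \<open>- ln \<rho>\<close> makes
  a product of values of \<open>\<rho>\<close> at times spaced by \<open>k\<close> large, and the
  integral of such a product is at most \<open>4 / \<beta>^k\<close> per factor.\<close>

lemma invariant_upper:
  assumes \<mu>: "\<mu> \<in> Pm" and inv: "invariant T \<mu>" and h: "ks_entropy \<mu> T = ereal h" and t: "h - ln \<beta> < t"
  shows "\<exists>g a. continuous_on {0..1} g \<and> (\<integral>x. g x \<partial>\<mu>) < a \<and>
    (\<exists>C. \<forall>n. emeasure lborel {x\<in>{0..1}. (\<Sum>j<n. g ((T ^^ j) x)) < real n * a} \<le> ennreal (C * exp (real n * t)))"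
proof -
  interpret prob_space \<mu> using PmD[OF \<mu>] by simp
  have lim: "(\<lambda>n. Hc \<mu> n / real n) \<longlonglongrightarrow> h" using ks_entropy_cells[OF \<mu> inv] h by auto
  have "(\<lambda>n. Hc \<mu> n / real n + (1 + ln 4) / real n) \<longlonglongrightarrow> h + 0"
    by (intro tendsto_add lim lim_const_over_n)
  then have "\<forall>\<^sub>F n in sequentially. Hc \<mu> n / real n + (1 + ln 4) / real n < t + ln \<beta>"
    using t by (intro order_tendstoD(2)) auto
  then have "\<forall>\<^sub>F n in sequentially. Hc \<mu> n / real n + (1 + ln 4) / real n < t + ln \<beta> \<and> n \<ge> 1"
    using eventually_ge_at_top[of 1] by eventually_elim auto
  \<comment> \<open>The order is so large that the constants disappear in the rate: 1 is the slack
    put into \<open>a\<close>, and \<open>ln 4\<close> the price of the Kraft constant.\<close>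
  then obtain k where k: "k \<ge> 1" "Hc \<mu> k / real k + (1 + ln 4) / real k < t + ln \<beta>"
    by (auto simp: eventually_sequentially)
  define \<eta> where "\<eta> = 1 / real (card (cells k))"
  have "card (cells k) > 0" using finite_cells by (auto simp: card_gt_0_iff cells_def)
  then have eta: "\<eta> > 0" "\<eta> \<le> 1" by (auto simp: \<eta>_def)
  obtain e where e: "e > 0" "\<And>\<delta>. 0 < \<delta> \<Longrightarrow> \<delta> < e \<Longrightarrow> \<exists>r. (\<forall>C. 0 \<le> r C) \<and>
     (\<forall>C\<in>gen_cells k. \<forall>x\<in>C. rho \<mu> k \<eta> \<delta> x \<le> r C) \<and> (\<Sum>C\<in>gen_cells k. r C) \<le> 4"
    using rho_kraft[OF \<mu>, of k] unfolding \<eta>_def by blast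
  define B where "B = \<bar>ln \<eta>\<bar> + ln 3"
  have logb: "\<bar>ln (rho \<mu> k \<eta> \<delta> x)\<bar> \<le> B" if "\<delta> > 0" for \<delta> x
  proof -
    have "ln \<eta> \<le> ln (rho \<mu> k \<eta> \<delta> x)" "ln (rho \<mu> k \<eta> \<delta> x) \<le> ln 3"
      using rho_bounds[OF \<mu> that eta(1), of k x] eta by auto
    moreover have "0 \<le> ln (3::real)" by simp
    ultimately show ?thesis unfolding B_def by linarith
  qed
  have "(\<lambda>n. \<integral>x. - ln (rho \<mu> k \<eta> (1 / real (Suc n)) x) \<partial>\<mu>) \<longlonglongrightarrow> (\<integral>x. - ln (\<eta> + measure \<mu> (cell k x)) \<partial>\<mu>)"
  proof (rule integral_dominated_convergence[where w="\<lambda>_. B"])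
    show "(\<lambda>x. - ln (\<eta> + measure \<mu> (cell k x))) \<in> borel_measurable \<mu>" by (rule cross_entropy_le(2)[OF \<mu> eta(1)])
    show "(\<lambda>x. - ln (rho \<mu> k \<eta> (1 / real (Suc n)) x)) \<in> borel_measurable \<mu>" for n
    proof -
      have "rho \<mu> k \<eta> (1 / real (Suc n)) \<in> borel_measurable \<mu>"
        unfolding Pm_measurable[OF \<mu>] by (intro cont_borel rho_continuous) simp
      then show ?thesis by simp
    qed
    show "AE x in \<mu>. (\<lambda>n. - ln (rho \<mu> k \<eta> (1 / real (Suc n)) x)) \<longlonglongrightarrow> - ln (\<eta> + measure \<mu> (cell k x))"
    proof (rule AE_I2)
      fix x assume "x \<in> space \<mu>"
      then have "x \<in> {0..1}" using PmD[OF \<mu>] by simp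
      moreover have "\<eta> + measure \<mu> (cell k x) \<noteq> 0" using eta measure_nonneg[of \<mu> "cell k x"] by linarith
      ultimately show "(\<lambda>n. - ln (rho \<mu> k \<eta> (1 / real (Suc n)) x)) \<longlonglongrightarrow> - ln (\<eta> + measure \<mu> (cell k x))"
        by (intro tendsto_minus tendsto_ln rho_limit k)
    qed
    show "AE x in \<mu>. norm (- ln (rho \<mu> k \<eta> (1 / real (Suc n)) x)) \<le> B" for n by (rule AE_I2) (use logb in simp)
  qed auto
  then have "\<forall>\<^sub>F n in sequentially. (\<integral>x. - ln (rho \<mu> k \<eta> (1 / real (Suc n)) x) \<partial>\<mu>) < Hc \<mu> k + 1"
    using cross_entropy_le(1)[OF \<mu> eta(1), of k] by (intro order_tendstoD(2)) auto
  moreover have "\<forall>\<^sub>F n in sequentially. 1 / real (Suc n) < e"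
    using order_tendstoD(2)[OF LIMSEQ_Suc[OF lim_1_over_n] e(1)] .
  ultimately have "\<forall>\<^sub>F n in sequentially. (\<integral>x. - ln (rho \<mu> k \<eta> (1 / real (Suc n)) x) \<partial>\<mu>) < Hc \<mu> k + 1 \<and> 1 / real (Suc n) < e"
    by eventually_elim blast
  then obtain n0 where n0: "(\<integral>x. - ln (rho \<mu> k \<eta> (1 / real (Suc n0)) x) \<partial>\<mu>) < Hc \<mu> k + 1" "1 / real (Suc n0) < e"
    by (auto simp: eventually_sequentially)
  define \<delta> where "\<delta> = 1 / real (Suc n0)"
  have d: "\<delta> > 0" "\<delta> < e" using n0 by (auto simp: \<delta>_def)
  define \<rho> where "\<rho> = rho \<mu> k \<eta> \<delta>"
  define a where "a = Hc \<mu> k + 1"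
  define g where "g x = - ln (\<rho> x)" for x
  have \<rho>p: "\<rho> x > 0" for x unfolding \<rho>_def using rho_bounds(1)[OF \<mu> d(1) eta(1), of k x] eta by linarith
  have c\<rho>: "continuous_on {0..1} \<rho>" unfolding \<rho>_def by (rule rho_continuous[OF d(1)])
  have cg: "continuous_on {0..1} g" unfolding g_def using \<rho>p
    by (intro continuous_intros c\<rho>) (auto simp: less_imp_neq[symmetric])
  have ig: "(\<integral>x. g x \<partial>\<mu>) < a" using n0(1) by (simp add: g_def \<rho>_def a_def \<delta>_def)
  obtain r where r: "\<And>C. 0 \<le> r C" "\<And>C x. C \<in> gen_cells k \<Longrightarrow> x \<in> C \<Longrightarrow> \<rho> x \<le> r C" "(\<Sum>C\<in>gen_cells k. r C) \<le> 4"
    using e(2)[OF d] unfolding \<rho>_def by blast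
  define \<Phi> where "\<Phi> m x = (\<Prod>i<m. ennreal (\<rho> ((T ^^ (i * k)) x)))" for m x
  note pb = prod_bound[OF cont_borel[OF c\<rho>] less_imp_le[OF \<rho>p] r(2) r(1) r(3), folded \<Phi>_def]
  \<comment> \<open>Moving the offset \<open>r\<close> back to 0 is one more transfer step with
    weight 1, which costs the number of open cells of order \<open>r\<close> over
    \<open>\<beta>^r\<close>.\<close>
  define K where "K = (\<Sum>r<k. real (card (gen_cells r)) / \<beta>^r)"
  have K0: "K \<ge> 0" unfolding K_def by (intro sum_nonneg) auto
  have Bg: "\<bar>g x\<bar> \<le> B" for x unfolding g_def \<rho>_def using logb[OF d(1)] by simp
  have main: "emeasure lborel {x\<in>{0..1}. (\<Sum>j<n. g ((T ^^ j) x)) < real n * a} \<le>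
    ennreal (exp ((real n * a + real k * B) / real k) * K * (4 / \<beta>^k)^(n div k))" for n
  proof -
    define m where "m = n div k"
    define c where "c = exp ((real n * a + real k * B) / real k)"
    define A where "A = {x\<in>{0..1}. (\<Sum>j<n. g ((T ^^ j) x)) < real n * a}"
    have gm: "g \<in> borel_measurable B01" by (rule cont_borel[OF cg])
    have "A = {x\<in>space B01. (\<Sum>j<n. g ((T ^^ j) x)) < real n * a}" by (simp add: A_def space_restrict_space)
    also have "\<dots> \<in> sets B01"
    proof (rule borel_measurable_less)
      have "(\<lambda>x. g ((T ^^ j) x)) \<in> borel_measurable B01" for j using measurable_comp[OF Tpow_measurable gm] by (simp add: comp_def)
      then show "(\<lambda>x. \<Sum>j<n. g ((T ^^ j) x)) \<in> borel_measurable B01" by (intro borel_measurable_sum)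
    qed simp
    finally have Am: "A \<in> sets borel" by (auto simp: sets_restrict_space)
    \<comment> \<open>The good offset depends on \<open>x\<close>, so the indicator is dominated by
      the sum over all offsets.\<close>
    have step: "indicator A x \<le> (\<Sum>r<k. ennreal c * (ennreal 1 * \<Phi> m ((T ^^ r) x))) * indicator {0..1} x" for x
    proof (cases "x \<in> A")
      case True
      then have x: "x \<in> {0..1}" "(\<Sum>j<n. g ((T ^^ j) x)) < real n * a" by (auto simp: A_def)
      obtain r where r: "r < k" "(\<Sum>i<m. g ((T ^^ (i * k)) ((T ^^ r) x))) \<le> (real n * a + real k * B) / real k"
        using offset_sum[OF k(1) Bg x] unfolding m_def by blast
      have "(\<Prod>i<m. \<rho> ((T ^^ (i * k)) ((T ^^ r) x))) = exp (- (\<Sum>i<m. g ((T ^^ (i * k)) ((T ^^ r) x))))"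
        unfolding g_def by (simp add: sum_negf exp_sum \<rho>p)
      also have "\<dots> \<ge> exp (- ((real n * a + real k * B) / real k))" using r(2) by simp
      finally have "1 \<le> c * (\<Prod>i<m. \<rho> ((T ^^ (i * k)) ((T ^^ r) x)))"
        unfolding c_def by (simp add: exp_minus field_simps)
      then have "1 \<le> ennreal (c * (\<Prod>i<m. \<rho> ((T ^^ (i * k)) ((T ^^ r) x))))" by simp
      also have "\<dots> = ennreal c * (ennreal 1 * \<Phi> m ((T ^^ r) x))"
        unfolding \<Phi>_def using \<rho>p by (simp add: ennreal_mult c_def prod_nonneg less_imp_le prod_ennreal)
      also have "\<dots> \<le> (\<Sum>r<k. ennreal c * (ennreal 1 * \<Phi> m ((T ^^ r) x)))" using r(1) by (intro member_le_sum) auto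
      finally show ?thesis using x True by simp
    qed simp
    have "emeasure lborel A = (\<integral>\<^sup>+x. indicator A x \<partial>lborel)" using Am by simp
    also have "\<dots> \<le> (\<integral>\<^sup>+x. (\<Sum>r<k. ennreal c * (ennreal 1 * \<Phi> m ((T ^^ r) x))) * indicator {0..1} x \<partial>lborel)"
      by (intro nn_integral_mono step)
    also have "\<dots> = (\<integral>\<^sup>+x. (\<Sum>r<k. ennreal c * ((ennreal 1 * \<Phi> m ((T ^^ r) x)) * indicator {0..1} x)) \<partial>lborel)"
      by (intro nn_integral_cong) (simp add: sum_distrib_right mult.assoc)
    also have "\<dots> = (\<Sum>r<k. ennreal c * unit_int (\<lambda>x. ennreal 1 * \<Phi> m ((T ^^ r) x)))"
    proof -
      have "(\<lambda>x. ennreal 1 * \<Phi> m ((T ^^ r) x)) \<in> borel_measurable B01" for r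
        using measurable_comp[OF Tpow_measurable pb(1)] by (simp add: comp_def)
      from unit_int_meas[OF this] show ?thesis
        unfolding unit_int_def by (subst nn_integral_sum) (auto simp: nn_integral_cmult)
    qed
    also have "\<dots> \<le> (\<Sum>r<k. ennreal c * (ennreal (real (card (gen_cells r)) / \<beta>^r) * ennreal ((4 / \<beta>^k)^m)))"
    proof (intro sum_mono mult_left_mono)
      fix r
      have "unit_int (\<lambda>x. ennreal 1 * \<Phi> m ((T ^^ r) x)) \<le> ennreal ((\<Sum>C\<in>gen_cells r. 1) / \<beta>^r) * unit_int (\<Phi> m)"
        by (rule transfer_bound[OF pb(1), of r "\<lambda>_. 1" "\<lambda>_. 1"]) auto
      also have "\<dots> \<le> ennreal (real (card (gen_cells r)) / \<beta>^r) * ennreal ((4 / \<beta>^k)^m)"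
        using pb(2)[of m] by (intro mult_mono) auto
      finally show "unit_int (\<lambda>x. ennreal 1 * \<Phi> m ((T ^^ r) x)) \<le> ennreal (real (card (gen_cells r)) / \<beta>^r) * ennreal ((4 / \<beta>^k)^m)" .
    qed auto
    also have "\<dots> = (\<Sum>r<k. ennreal (c * (real (card (gen_cells r)) / \<beta>^r * (4 / \<beta>^k)^m)))"
    proof (rule sum.cong[OF refl])
      fix r
      have "ennreal c * (ennreal p * ennreal q) = ennreal (c * (p * q))" if "0 \<le> p" "0 \<le> q" for p q
        using that by (simp add: ennreal_mult c_def)
      then show "ennreal c * (ennreal (real (card (gen_cells r)) / \<beta>^r) * ennreal ((4 / \<beta>^k)^m)) =
        ennreal (c * (real (card (gen_cells r)) / \<beta>^r * (4 / \<beta>^k)^m))" by simp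
    qed
    also have "\<dots> = ennreal (\<Sum>r<k. c * (real (card (gen_cells r)) / \<beta>^r * (4 / \<beta>^k)^m))"
      by (intro sum_ennreal) (auto simp: c_def)
    also have "(\<Sum>r<k. c * (real (card (gen_cells r)) / \<beta>^r * (4 / \<beta>^k)^m)) = c * K * (4 / \<beta>^k)^m"
      unfolding K_def by (simp add: sum_distrib_left sum_distrib_right mult.assoc)
    finally show ?thesis by (simp add: A_def c_def m_def)
  qed
  \<comment> \<open>Absorbs what does not depend on \<open>n\<close>; the factor
    \<open>\<beta>^k\<close> arises because \<open>(n div k) * k\<close> may fall short of
    \<open>n\<close> by up to \<open>k\<close>.\<close>
  define D where "D = exp B * K * \<beta>^k"
  have fin: "exp ((real n * a + real k * B) / real k) * K * (4 / \<beta>^k)^(n div k) \<le> D * exp (real n * t)" for n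
  proof -
    define m where "m = n div k"
    have mk: "real m * real k \<le> real n" "real n \<le> real m * real k + real k"
    proof -
      have "m * k \<le> n" by (simp add: m_def)
      then show "real m * real k \<le> real n" by (metis of_nat_le_iff of_nat_mult)
      have "n = m * k + n mod k" "n mod k < k" using k(1) by (simp_all add: m_def)
      then have "n \<le> m * k + k" by linarith
      then show "real n \<le> real m * real k + real k" by (metis of_nat_le_iff of_nat_mult of_nat_add)
    qed
    have "(4 / \<beta>^k)^m = exp (real m * ln 4 - real m * real k * ln \<beta>)"
    proof -
      have "4 / \<beta>^k = exp (ln 4 - real k * ln \<beta>)" by (simp add: exp_diff exp_of_nat_mult)
      then have "(4 / \<beta>^k)^m = exp (real m * (ln 4 - real k * ln \<beta>))" by (simp add: exp_of_nat_mult)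
      then show ?thesis by (simp add: algebra_simps)
    qed
    also have "\<dots> \<le> exp (real n / real k * ln 4 - (real n - real k) * ln \<beta>)"
    proof -
      have "real m \<le> real n / real k" using mk(1) k(1) by (simp add: field_simps)
      then have "real m * ln 4 \<le> real n / real k * ln 4" by (intro mult_right_mono) auto
      moreover have "(real n - real k) * ln \<beta> \<le> real m * real k * ln \<beta>" using mk(2) beta_gt_1 by (intro mult_right_mono) auto
      ultimately show ?thesis by simp
    qed
    finally have "exp ((real n * a + real k * B) / real k) * K * (4 / \<beta>^k)^m
      \<le> exp ((real n * a + real k * B) / real k) * K * exp (real n / real k * ln 4 - (real n - real k) * ln \<beta>)"
      using K0 by (intro mult_left_mono) auto
    also have "\<dots> = K * exp ((real n * a + real k * B) / real k + (real n / real k * ln 4 - (real n - real k) * ln \<beta>))"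
      by (simp add: exp_add mult.assoc mult.left_commute mult.commute)
    also have "\<dots> = K * exp (B + real k * ln \<beta> + real n * (a / real k + ln 4 / real k - ln \<beta>))"
      using k(1) by (simp add: field_simps)
    also have "\<dots> \<le> K * exp (B + real k * ln \<beta> + real n * t)"
    proof (intro mult_left_mono K0)
      have "a / real k + ln 4 / real k - ln \<beta> \<le> t" using k(2) by (simp add: a_def add_divide_distrib)
      then have "real n * (a / real k + ln 4 / real k - ln \<beta>) \<le> real n * t" by (intro mult_left_mono) auto
      then show "exp (B + real k * ln \<beta> + real n * (a / real k + ln 4 / real k - ln \<beta>)) \<le> exp (B + real k * ln \<beta> + real n * t)" by simp
    qed
    also have "\<dots> = D * exp (real n * t)"
      unfolding D_def by (simp add: exp_add exp_of_nat_mult mult.assoc mult.left_commute mult.commute)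
    finally show ?thesis by (simp add: m_def)
  qed
  have "emeasure lborel {x\<in>{0..1}. (\<Sum>j<n. g ((T ^^ j) x)) < real n * a} \<le> ennreal (D * exp (real n * t))" for n
    using main[of n] ennreal_leI[OF fin[of n]] by (rule order_trans)
  then show ?thesis using cg ig by blast
qed


section \<open>The Markov property and reachability\<close>

text \<open>Points that are generic for all times. Gluing of orbits takes place within this set, and
  its complement is countable, hence negligible for density and for Lebesgue measure.\<close>

definition X0 :: "real set" where "X0 = {x\<in>{0..1}. \<forall>n. (T ^^ n) x \<notin> S}"

lemma X0_01: "x \<in> X0 \<Longrightarrow> x \<in> {0..1}" and X0_S: "x \<in> X0 \<Longrightarrow> (T ^^ n) x \<notin> S"
  by (auto simp: X0_def)

lemma X0_notin: "x \<in> X0 \<Longrightarrow> x \<notin> S" using X0_S[of x 0] by simp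

lemma X0_Tpow: "x \<in> X0 \<Longrightarrow> (T ^^ n) x \<in> X0"
proof -
  assume x: "x \<in> X0"
  have "(T ^^ m) ((T ^^ n) x) \<notin> S" for m using X0_S[OF x, of "m + n"] by (simp add: funpow_add)
  then show ?thesis using Tpow_range[OF X0_01[OF x]] by (simp add: X0_def)
qed

lemma X0_T: "x \<in> X0 \<Longrightarrow> T x \<in> X0" using X0_Tpow[of x 1] by simp

lemma X0_I: 
  assumes "x \<in> {0..1}" "x \<notin> S" "T x \<in> X0" shows "x \<in> X0"
proof -
  have "(T ^^ n) x \<notin> S" for n
  proof (cases n)
    case (Suc m) then show ?thesis using X0_S[OF assms(3), of m] by (simp add: funpow_swap1)
  qed (use assms in simp)
  then show ?thesis using assms by (simp add: X0_def)
qed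

lemma X0_open: "x \<in> X0 \<Longrightarrow> 0 < x \<and> x < 1"
proof -
  assume x: "x \<in> X0"
  have "x \<noteq> 0" "x \<noteq> 1" using X0_notin[OF x] S0 S1 by auto
  then show ?thesis using X0_01[OF x] by auto
qed

lemma countable_compl_X0: "countable ({0..1} - X0)"
proof -
  have "{0..1} - X0 \<subseteq> (\<Union>n. sing n)" 
  proof
    fix x assume "x \<in> {0..1} - X0"
    then obtain n where "x \<in> {0..1}" "(T ^^ n) x \<in> S" by (auto simp: X0_def)
    then have "x \<in> sing (Suc n)" by (auto simp: sing_def)
    then show "x \<in> (\<Union>n. sing n)" by blast
  qed
  moreover have "countable (\<Union>n. sing n)" by (simp add: countable_finite finite_sing)
  ultimately show ?thesis by (rule countable_subset)
qed

lemma X0_dense: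
  assumes "a < c" "0 \<le> a" "c \<le> 1" shows "\<exists>x\<in>X0. a < x \<and> x < c"
proof (rule ccontr)
  assume "\<not> ?thesis"
  then have "{a<..<c} \<subseteq> {0..1} - X0" using assms by auto
  then have "countable {a<..<c}" using countable_compl_X0 countable_subset by blast
  then show False using uncountable_open_interval assms(1) by blast
qed

text \<open>The endpoints of the image of an atom belong to \<open>S\<close>, so the image contains every atom it meets.\<close>
lemma glue1:
  assumes x: "x \<in> {0..1}" "x \<notin> S" and l: "lab y = lab (T x)" and Tx: "T x \<notin> S"
  shows "\<exists>z\<in>{0..1}. lab z = lab x \<and> T z = y"
proof -
  obtain i where i: "i \<le> b" "0 < x" "x < 1" "real i < \<beta> * x" "\<beta> * x < real i + 1" "T x = real i + 1 - \<beta> * x"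
    using lab_digit[OF x refl] by metis
  have Tx01: "T x \<in> {0..1}" by (rule T_range[OF x(1)])
  have yS: "y \<notin> S" using lab_notin[of "T x" y] l Tx by simp
  have nob: "\<not> (min (T x) y \<le> s \<and> s \<le> max (T x) y)" if "s \<in> S" for s
    using lab_eq_notin_iff[OF Tx yS] l that by auto
  have y01: "0 < y" "y < 1"
  proof -
    have "0 < T x" "T x < 1" using Tx S0 S1 Tx01 by (auto simp: less_le)
    then show "0 < y" "y < 1" using nob[OF S0] nob[OF S1] by (auto simp: min_def max_def split: if_splits)
  qed
  define z where "z = (real i + 1 - y) / \<beta>"
  have bz: "\<beta> * z = real i + 1 - y" by (simp add: z_def)
  have "\<not> (min x z \<le> s \<and> s \<le> max x z)" if s: "s \<in> S" for s
  proof
    assume s1: "min x z \<le> s \<and> s \<le> max x z"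
    have s01: "0 \<le> s" "s \<le> 1" using s S_01 by auto
    \<comment> \<open>The image of \<open>s\<close> under the closed branch of \<open>x\<close>: it
      is 0 or 1 at the ends of the branch and \<open>T s\<close> elsewhere, so invariance puts it
      into \<open>S\<close>, and it separates \<open>T x\<close> from \<open>y\<close>.\<close>
    define v where "v = real i + 1 - \<beta> * s"
    have "x \<noteq> s" using x s by auto
    have bs: "min (\<beta> * x) (\<beta> * z) \<le> \<beta> * s" "\<beta> * s \<le> max (\<beta> * x) (\<beta> * z)"
      using s1 by (auto simp: min_def max_def)
    have rng: "real i \<le> \<beta> * s" "\<beta> * s \<le> real i + 1" using bs i bz y01 by linarith+
    have "v \<in> S"
    proof (cases "\<beta> * s = real i \<or> \<beta> * s = real i + 1")
      case True then show ?thesis using S0 S1 by (auto simp: v_def)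
    next
      case False
      then have r2: "real i < \<beta> * s" "\<beta> * s < real i + 1" using rng by auto
      have "s \<noteq> 0" using r2 by auto
      show ?thesis
      proof (cases "s = 1")
        case True
        then have "real i < \<beta>" "\<beta> < real i + 1" using r2 by auto
        then have "i = b" using b_less beta_le by linarith
        then show ?thesis using T_S[OF S1] T_1 True by (simp add: v_def)
      next
        case False
        then have "T s = v" using T_eq[of s i] r2 s01 \<open>s \<noteq> 0\<close> by (simp add: v_def)
        then show ?thesis using T_S[OF s] by simp
      qed
    qed
    moreover have "min (T x) y \<le> v \<and> v \<le> max (T x) y" unfolding v_def using bs bz i(6) by (intro conjI) linarith+
    ultimately show False using nob by blast
  qed
  note nos = this
  have "z \<notin> S" using nos[of z] by auto
  then have lz: "lab z = lab x" using nos x(2) by (subst lab_eq_notin_iff) (auto simp: min.commute max.commute)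
  obtain j where j: "0 < z" "z < 1" "real j < \<beta> * z" "\<beta> * z < real j + 1" "T z = real j + 1 - \<beta> * z" "T x = real j + 1 - \<beta> * x"
    using lab_digit[OF x lz] by metis
  have "T z = y" using j(5,6) i(6) bz by linarith
  then show ?thesis using lz j by (intro bexI[of _ z]) auto
qed

text \<open>The target is pulled back along the orbit segment: at each step it shares its atom with
  the image of the segment, so \<open>glue1\<close> supplies a preimage in the preceding
  atom.\<close>

lemma glue:
  assumes x: "x \<in> {0..1}" and ns: "\<And>i. i \<le> n \<Longrightarrow> (T ^^ i) x \<notin> S" and y: "y \<in> X0" "lab y = lab ((T ^^ n) x)"
  shows "\<exists>z\<in>X0. (\<forall>i\<le>n. lab ((T ^^ i) z) = lab ((T ^^ i) x)) \<and> (T ^^ n) z = y"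
  using ns y
proof (induction n arbitrary: y)
  case 0 then show ?case by auto
next
  case (Suc n)
  have "(T ^^ n) x \<in> {0..1}" "(T ^^ n) x \<notin> S" "T ((T ^^ n) x) \<notin> S"
    using Tpow_range[OF x] Suc.prems(1)[of n] Suc.prems(1)[of "Suc n"] by auto
  then obtain z' where z': "z' \<in> {0..1}" "lab z' = lab ((T ^^ n) x)" "T z' = y"
    using glue1[of "(T ^^ n) x" y] Suc.prems(3) by auto
  have "z' \<notin> S" using lab_notin[of "(T ^^ n) x" z'] z'(2) Suc.prems(1)[of n] by simp
  then have "z' \<in> X0" using X0_I[OF z'(1)] z'(3) Suc.prems(2) by simp
  then obtain z where z: "z \<in> X0" "\<And>i. i \<le> n \<Longrightarrow> lab ((T ^^ i) z) = lab ((T ^^ i) x)" "(T ^^ n) z = z'"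
    using Suc.IH[of z'] Suc.prems(1) z'(2) by (metis le_SucI)
  have "(T ^^ Suc n) z = y" using z(3) z'(3) by simp
  moreover have "lab ((T ^^ i) z) = lab ((T ^^ i) x)" if "i \<le> Suc n" for i
  proof (cases "i = Suc n")
    case True then show ?thesis using \<open>(T ^^ Suc n) z = y\<close> Suc.prems(3) by metis
  next
    case False then show ?thesis using z(2) that by simp
  qed
  ultimately show ?case using z(1) by blast
qed

lemma X0_lab: assumes "x \<in> {0..1}" "x \<notin> S" shows "\<exists>y\<in>X0. lab y = lab x"
proof -
  obtain e where e: "e > 0" "\<And>y. \<bar>y - x\<bar> < e \<Longrightarrow> lab y = lab x" using lab_nbhd[OF assms(2)] by blast
  have x: "0 < x" "x < 1" using assms S0 S1 by (auto simp: less_le)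
  obtain y where "y \<in> X0" "x < y" "y < min 1 (x + e)" using X0_dense[of x "min 1 (x + e)"] x e by auto
  then show ?thesis using e(2)[of y] by (intro bexI[of _ y]) auto
qed

lemma perturb:
  assumes x: "x \<in> {0..1}" and ns: "\<And>i. i \<le> n \<Longrightarrow> (T ^^ i) x \<notin> S"
  shows "\<exists>z\<in>X0. \<forall>i\<le>n. lab ((T ^^ i) z) = lab ((T ^^ i) x)"
proof -
  obtain y where "y \<in> X0" "lab y = lab ((T ^^ n) x)" using X0_lab[of "(T ^^ n) x"] Tpow_range[OF x] ns by blast
  then show ?thesis using glue[OF x ns] by blast
qed

text \<open>The transition relation of the Markov partition. Witnesses are taken from
  \<open>X0\<close>, so the labels of points of \<open>S\<close> never occur in it.\<close>

definition rch :: "nat \<Rightarrow> real set \<times> real set \<Rightarrow> real set \<times> real set \<Rightarrow> bool" where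
  "rch n u v \<longleftrightarrow> (\<exists>z\<in>X0. lab z = u \<and> lab ((T ^^ n) z) = v)"

lemma rch_trans:
  assumes "rch m u v" "rch n v w" shows "rch (m + n) u w"
proof -
  obtain z where z: "z \<in> X0" "lab z = u" "lab ((T ^^ m) z) = v" using assms(1) by (auto simp: rch_def)
  obtain z' where z': "z' \<in> X0" "lab z' = v" "lab ((T ^^ n) z') = w" using assms(2) by (auto simp: rch_def)
  obtain y where y: "y \<in> X0" "\<forall>i\<le>m. lab ((T ^^ i) y) = lab ((T ^^ i) z)" "(T ^^ m) y = z'"
    using glue[of z m z'] z z' X0_01 X0_S by metis
  have "lab y = u" using y(2)[rule_format, of 0] z by simp
  moreover have "lab ((T ^^ (m + n)) y) = w" using y(3) z'(3) by (simp add: add.commute[of m] funpow_add)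
  ultimately show ?thesis using y(1) by (auto simp: rch_def)
qed

text \<open>There are finitely many pairs of labels, so the shortest connection times have a
  maximum. It will be the largest gap between consecutive blocks.\<close>

lemma rch_bound: "\<exists>g. \<forall>u v n. rch n u v \<longrightarrow> (\<exists>m\<le>g. rch m u v)"
proof -
  define L where "L = Pow S \<times> Pow S"
  define f where "f p = (LEAST n. rch n (fst p) (snd p))" for p
  have fin: "finite (L \<times> L)" using fin_S by (simp add: L_def)
  have "\<exists>m\<le>Max (f ` (L \<times> L)). rch m u v" if r: "rch n u v" for n u v
  proof -
    have "u \<in> L" "v \<in> L" using r lab_range unfolding rch_def L_def by auto
    then have "f (u, v) \<le> Max (f ` (L \<times> L))" using fin by (intro Max_ge) auto
    moreover have "rch (f (u, v)) u v" unfolding f_def using LeastI[of "\<lambda>n. rch n u v", OF r] by simp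
    ultimately show ?thesis by blast
  qed
  then show ?thesis by blast
qed

section \<open>Growth of intervals under the map\<close>

text \<open>On every branch \<open>T x\<close> is \<open>i - \<beta> * x\<close> with
  \<open>i\<close> one more than the digit, so preimages are found by scanning all integers; those
  outside the digit range give points outside \<open>J\<close>.\<close>

lemma T_image:
  assumes y: "y \<in> X0" and J: "J \<subseteq> {0<..<1}"
  shows "y \<in> T ` (J \<inter> X0) \<longleftrightarrow> (\<exists>i::int. (of_int i - y) / \<beta> \<in> J)"
proof
  assume "y \<in> T ` (J \<inter> X0)"
  then obtain x where x: "x \<in> J" "x \<in> X0" "y = T x" by blast
  obtain i where "T x = real i + 1 - \<beta> * x" using lab_digit[OF X0_01[OF x(2)] X0_notin[OF x(2)] refl] by metis
  then have "x = (of_int (int i + 1) - y) / \<beta>" using x(3) by simp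
  then show "\<exists>i::int. (of_int i - y) / \<beta> \<in> J" using x(1) by metis
next
  assume "\<exists>i::int. (of_int i - y) / \<beta> \<in> J"
  then obtain i :: int where i: "(of_int i - y) / \<beta> \<in> J" by blast
  define x where "x = (of_int i - y) / \<beta>"
  have x: "0 < x" "x < 1" using i J by (auto simp: x_def)
  have y01: "0 < y" "y < 1" using X0_open[OF y] by auto
  have bx: "\<beta> * x = of_int i - y" by (simp add: x_def)
  have "0 < \<beta> * x" using x by simp
  then have i1: "i \<ge> 1" using bx y01 by linarith
  have "real (nat (i - 1)) = of_int i - 1" using i1 by simp
  then have "T x = y" using T_eq[OF x, of "nat (i - 1)"] bx y01 by simp
  moreover have "x \<notin> S" using T_S[of x] X0_notin[OF y] \<open>T x = y\<close> by auto
  ultimately have "x \<in> X0" using X0_I[of x] x y by simp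
  then show "y \<in> T ` (J \<inter> X0)" using i \<open>T x = y\<close> by (intro image_eqI[of _ _ x]) (auto simp: x_def)
qed

lemma T_image_sub: "T ` (J \<inter> X0) \<subseteq> X0" using X0_T by blast

text \<open>\<open>m / \<beta>\<close> is the first cut point inside the interval: the part before
  it is mapped to a neighbourhood of 0, the part after it to one of 1. Beyond a second cut point the
  latter is everything, whence the \<open>min\<close>.\<close>

lemma image_full:
  assumes a: "0 \<le> a" "a < c" "c \<le> 1" and m: "m = \<lfloor>\<beta> * a\<rfloor> + 1" "of_int m < \<beta> * c"
  shows "T ` ({a<..<c} \<inter> X0) = ({0<..<of_int m - \<beta> * a} \<union> {1 - min 1 (\<beta> * c - of_int m)<..<1}) \<inter> X0"
proof (intro set_eqI)
  fix y
  show "y \<in> T ` ({a<..<c} \<inter> X0) \<longleftrightarrow> y \<in> ({0<..<of_int m - \<beta> * a} \<union> {1 - min 1 (\<beta> * c - of_int m)<..<1}) \<inter> X0"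
  proof (cases "y \<in> X0")
    case True
    then have y: "0 < y" "y < 1" using X0_open by auto
    have ma: "of_int m - 1 \<le> \<beta> * a" "\<beta> * a < of_int m" unfolding m(1) by linarith+
    have "y \<in> T ` ({a<..<c} \<inter> X0) \<longleftrightarrow> (\<exists>i::int. \<beta> * a < of_int i - y \<and> of_int i - y < \<beta> * c)"
    proof -
      have sub: "{a<..<c} \<subseteq> {0<..<1}" using a by auto
      show ?thesis unfolding T_image[OF True sub] by (simp add: field_simps)
    qed
    also have "\<dots> \<longleftrightarrow> y < of_int m - \<beta> * a \<or> 1 - min 1 (\<beta> * c - of_int m) < y"
    proof
      assume "\<exists>i::int. \<beta> * a < of_int i - y \<and> of_int i - y < \<beta> * c"
      then obtain i :: int where i: "\<beta> * a < of_int i - y" "of_int i - y < \<beta> * c" by blast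
      have "i \<ge> m" using i(1) ma y by linarith
      show "y < of_int m - \<beta> * a \<or> 1 - min 1 (\<beta> * c - of_int m) < y"
      proof (cases "i = m")
        case True then show ?thesis using i by simp
      next
        case False
        then have "of_int i \<ge> of_int m + (1::real)" using \<open>i \<ge> m\<close> by linarith
        then show ?thesis using i y by (auto simp: min_def)
      qed
    next
      assume "y < of_int m - \<beta> * a \<or> 1 - min 1 (\<beta> * c - of_int m) < y"
      then show "\<exists>i::int. \<beta> * a < of_int i - y \<and> of_int i - y < \<beta> * c"
      proof
        assume "y < of_int m - \<beta> * a"
        then show ?thesis using m(2) y by (intro exI[of _ m]) auto
      next
        assume "1 - min 1 (\<beta> * c - of_int m) < y"
        then show ?thesis using ma y by (intro exI[of _ "m + 1"]) (auto simp: min_def split: if_splits)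
      qed
    qed
    finally show ?thesis using y True by auto
  qed (use T_image_sub in blast)
qed

lemma image_interval:
  assumes a: "0 \<le> a" "a < c" "c \<le> 1" and m: "m = \<lfloor>\<beta> * a\<rfloor> + 1" "\<beta> * c \<le> of_int m"
  shows "T ` ({a<..<c} \<inter> X0) = {of_int m - \<beta> * c<..<of_int m - \<beta> * a} \<inter> X0"
proof (intro set_eqI)
  fix y
  show "y \<in> T ` ({a<..<c} \<inter> X0) \<longleftrightarrow> y \<in> {of_int m - \<beta> * c<..<of_int m - \<beta> * a} \<inter> X0"
  proof (cases "y \<in> X0")
    case True
    then have y: "0 < y" "y < 1" using X0_open by auto
    have ma: "of_int m - 1 \<le> \<beta> * a" "\<beta> * a < of_int m" unfolding m(1) by linarith+
    have "y \<in> T ` ({a<..<c} \<inter> X0) \<longleftrightarrow> (\<exists>i::int. \<beta> * a < of_int i - y \<and> of_int i - y < \<beta> * c)"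
    proof -
      have sub: "{a<..<c} \<subseteq> {0<..<1}" using a by auto
      show ?thesis unfolding T_image[OF True sub] by (simp add: field_simps)
    qed
    also have "\<dots> \<longleftrightarrow> \<beta> * a < of_int m - y \<and> of_int m - y < \<beta> * c"
    proof
      assume "\<exists>i::int. \<beta> * a < of_int i - y \<and> of_int i - y < \<beta> * c"
      then obtain i :: int where i: "\<beta> * a < of_int i - y" "of_int i - y < \<beta> * c" by blast
      have "i = m" using i ma m(2) y by linarith
      then show "\<beta> * a < of_int m - y \<and> of_int m - y < \<beta> * c" using i by simp
    qed blast
    finally show ?thesis using y True by auto
  qed (use T_image_sub in blast)
qed

lemma image_right_of_0:
  assumes e: "0 < e" "e \<le> 1"
  shows "T ` ({0<..<e} \<inter> X0) = {1 - min 1 (\<beta> * e)<..<1} \<inter> X0"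
proof (intro set_eqI)
  fix y
  show "y \<in> T ` ({0<..<e} \<inter> X0) \<longleftrightarrow> y \<in> {1 - min 1 (\<beta> * e)<..<1} \<inter> X0"
  proof (cases "y \<in> X0")
    case True
    then have y: "0 < y" "y < 1" using X0_open by auto
    have "y \<in> T ` ({0<..<e} \<inter> X0) \<longleftrightarrow> (\<exists>i::int. 0 < of_int i - y \<and> of_int i - y < \<beta> * e)"
    proof -
      have sub: "{0<..<e} \<subseteq> {0<..<1}" using e by auto
      show ?thesis unfolding T_image[OF True sub] by (simp add: field_simps)
    qed
    also have "\<dots> \<longleftrightarrow> 1 - min 1 (\<beta> * e) < y"
    proof
      assume "\<exists>i::int. 0 < of_int i - y \<and> of_int i - y < \<beta> * e"
      then obtain i :: int where i: "0 < of_int i - y" "of_int i - y < \<beta> * e" by blast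
      have "i \<ge> 1" using i(1) y by linarith
      then have "of_int i \<ge> (1::real)" by simp
      then show "1 - min 1 (\<beta> * e) < y" using i y by linarith
    next
      assume "1 - min 1 (\<beta> * e) < y"
      then show "\<exists>i::int. 0 < of_int i - y \<and> of_int i - y < \<beta> * e"
        using y by (intro exI[of _ 1]) (auto simp: min_def split: if_splits)
    qed
    finally show ?thesis using y True by auto
  qed (use T_image_sub in blast)
qed

lemma Tpow_Suc_image: "(T ^^ Suc n) ` A = (T ^^ n) ` (T ` A)"
  by (auto simp: funpow_swap1 image_image)

text \<open>As long as no cut point lies inside, the image is an interval \<open>\<beta>\<close>
  times as long, which can happen only finitely often; \<open>N\<close> bounds how often. In the
  base case the interval is all of \<open>{0<..<1}\<close>, which contains
  \<open>1 / \<beta>\<close>.\<close>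

lemma interval_growth:
  assumes "0 \<le> a" "a < c" "c \<le> 1"
  shows "\<exists>n \<delta> \<epsilon>. 0 < \<delta> \<and> 0 < \<epsilon> \<and> \<epsilon> \<le> 1 \<and> (T ^^ n) ` ({a<..<c} \<inter> X0) = ({0<..<\<epsilon>} \<union> {1 - \<delta><..<1}) \<inter> X0"
proof -
  have "\<exists>n \<delta> \<epsilon>. 0 < \<delta> \<and> 0 < \<epsilon> \<and> \<epsilon> \<le> 1 \<and> (T ^^ n) ` ({a<..<c} \<inter> X0) = ({0<..<\<epsilon>} \<union> {1 - \<delta><..<1}) \<inter> X0"
    if "0 \<le> a" "a < c" "c \<le> 1" "1 \<le> (c - a) * \<beta>^N" for N a c
    using that
  proof (induction N arbitrary: a c)
    case N: (0 a c)
    have ac: "a = 0" "c = 1" using N by auto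
    have "of_int (\<lfloor>\<beta> * a\<rfloor> + 1) < \<beta> * c" using ac beta_gt_1 by simp
    from image_full[OF N(1-3) refl this] show ?case using ac beta_gt_1
      by (intro exI[of _ 1] exI[of _ "min 1 (\<beta> * c - of_int (\<lfloor>\<beta> * a\<rfloor> + 1))"] exI[of _ "of_int (\<lfloor>\<beta> * a\<rfloor> + 1) - \<beta> * a"]) auto
  next
    case (Suc N a c)
    define m where "m = \<lfloor>\<beta> * a\<rfloor> + 1"
    have ma: "of_int m - 1 \<le> \<beta> * a" "\<beta> * a < of_int m" by (simp_all add: m_def)
    show ?case
    proof (cases "of_int m < \<beta> * c")
      case True
      from image_full[OF Suc.prems(1-3) m_def this] ma True show ?thesis
        by (intro exI[of _ 1] exI[of _ "min 1 (\<beta> * c - of_int m)"] exI[of _ "of_int m - \<beta> * a"]) auto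
    next
      case False
      then have mc: "\<beta> * c \<le> of_int m" by simp
      have "\<exists>n \<delta> \<epsilon>. 0 < \<delta> \<and> 0 < \<epsilon> \<and> \<epsilon> \<le> 1 \<and> (T ^^ n) ` ({of_int m - \<beta> * c<..<of_int m - \<beta> * a} \<inter> X0) = ({0<..<\<epsilon>} \<union> {1 - \<delta><..<1}) \<inter> X0"
      proof (rule Suc.IH)
        show "0 \<le> of_int m - \<beta> * c" using mc by simp
        show "of_int m - \<beta> * c < of_int m - \<beta> * a" using Suc.prems by simp
        show "of_int m - \<beta> * a \<le> 1" using ma by simp
        show "1 \<le> (of_int m - \<beta> * a - (of_int m - \<beta> * c)) * \<beta>^N" using Suc.prems(4) by (simp add: algebra_simps)
      qed
      then obtain n \<delta> \<epsilon> where *: "0 < \<delta>" "0 < \<epsilon>" "\<epsilon> \<le> 1"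
        "(T ^^ n) ` ({of_int m - \<beta> * c<..<of_int m - \<beta> * a} \<inter> X0) = ({0<..<\<epsilon>} \<union> {1 - \<delta><..<1}) \<inter> X0" by blast
      have "(T ^^ Suc n) ` ({a<..<c} \<inter> X0) = ({0<..<\<epsilon>} \<union> {1 - \<delta><..<1}) \<inter> X0"
        unfolding Tpow_Suc_image image_interval[OF Suc.prems(1-3) m_def mc] by (rule *(4))
      then show ?thesis using *(1-3) by blast
    qed
  qed
  moreover obtain N where "1 / (c - a) < \<beta>^N" using real_arch_pow[OF beta_gt_1] by blast
  then have "1 \<le> (c - a) * \<beta>^N" using assms by (simp add: field_simps)
  ultimately show ?thesis using assms by blast
qed

definition fwd :: "real set \<Rightarrow> real set" where "fwd A = (\<Union>i. (T ^^ i) ` (A \<inter> X0))"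

lemma fwd_mono: "A \<subseteq> B \<Longrightarrow> fwd A \<subseteq> fwd B" by (auto simp: fwd_def)

text \<open>Once an iterate of an interval contains a cut point, everything it reaches later is
  reached from a one-sided neighbourhood of \<open>1\<close>; these neighbourhoods are nested.\<close>
lemma interval_tail:
  assumes "0 \<le> a" "a < c" "c \<le> 1"
  shows "\<exists>\<theta>. (\<exists>n. {1 - \<theta><..<1} \<inter> X0 \<subseteq> (T ^^ n) ` ({a<..<c} \<inter> X0)) \<and>
    (\<exists>n0. \<forall>j\<ge>n0. (T ^^ j) ` ({a<..<c} \<inter> X0) \<subseteq> fwd {1 - \<theta><..<1})"
proof -
  obtain n \<delta> \<epsilon> where n: "0 < \<delta>" "0 < \<epsilon>" "\<epsilon> \<le> 1" "(T ^^ n) ` ({a<..<c} \<inter> X0) = ({0<..<\<epsilon>} \<union> {1 - \<delta><..<1}) \<inter> X0"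
    using interval_growth[OF assms] by blast
  \<comment> \<open>One more step carries the piece at 0 to a left neighbourhood of 1 of size
    \<open>\<kappa>\<close>; the wider of the two neighbourhoods of 1 then governs the tail.\<close>
  define \<kappa> where "\<kappa> = min 1 (\<beta> * \<epsilon>)"
  define \<theta> where "\<theta> = max \<delta> \<kappa>"
  have step: "(T ^^ (k + n)) ` ({a<..<c} \<inter> X0) = (T ^^ k) ` ({0<..<\<epsilon>} \<inter> X0) \<union> (T ^^ k) ` ({1 - \<delta><..<1} \<inter> X0)" for k
  proof -
    have "(T ^^ (k + n)) ` ({a<..<c} \<inter> X0) = (T ^^ k) ` ((T ^^ n) ` ({a<..<c} \<inter> X0))"
      by (simp add: funpow_add image_comp)
    then show ?thesis unfolding n(4) by (simp add: Int_Un_distrib2 image_Un)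
  qed
  have R: "(T ^^ Suc k) ` ({0<..<\<epsilon>} \<inter> X0) = (T ^^ k) ` ({1 - \<kappa><..<1} \<inter> X0)" for k
    unfolding Tpow_Suc_image image_right_of_0[OF n(2,3)] \<kappa>_def ..
  have "\<exists>n. {1 - \<theta><..<1} \<inter> X0 \<subseteq> (T ^^ n) ` ({a<..<c} \<inter> X0)"
  proof (cases "\<kappa> \<le> \<delta>")
    case True
    then have "\<theta> = \<delta>" by (simp add: \<theta>_def)
    then show ?thesis using step[of 0] by (intro exI[of _ n]) auto
  next
    case False
    then have "\<theta> = \<kappa>" by (simp add: \<theta>_def)
    then have "{1 - \<theta><..<1} \<inter> X0 \<subseteq> (T ^^ (Suc 0 + n)) ` ({a<..<c} \<inter> X0)"
      unfolding step R by simp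
    then show ?thesis by blast
  qed
  moreover have "(T ^^ j) ` ({a<..<c} \<inter> X0) \<subseteq> fwd {1 - \<theta><..<1}" if j: "j \<ge> Suc n" for j
  proof -
    obtain k where k: "j = Suc k + n" using j by (metis add.commute add_Suc le_Suc_ex)
    have "(T ^^ j) ` ({a<..<c} \<inter> X0) = (T ^^ k) ` ({1 - \<kappa><..<1} \<inter> X0) \<union> (T ^^ Suc k) ` ({1 - \<delta><..<1} \<inter> X0)"
      unfolding k step R ..
    also have "\<dots> \<subseteq> fwd {1 - \<kappa><..<1} \<union> fwd {1 - \<delta><..<1}" unfolding fwd_def by blast
    also have "\<dots> \<subseteq> fwd {1 - \<theta><..<1}" 
      by (intro Un_least fwd_mono) (auto simp: \<theta>_def)
    finally show ?thesis .
  qed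
  ultimately show ?thesis by blast
qed

lemma atom_interval:
  assumes "x \<in> {0..1}" "x \<notin> S"
  shows "\<exists>a\<in>S. \<exists>c\<in>S. 0 \<le> a \<and> a < c \<and> c \<le> 1 \<and> (\<forall>z. lab z = lab x \<longleftrightarrow> z \<in> {a<..<c})"
proof -
  have x: "0 < x" "x < 1" using assms S0 S1 by (auto simp: less_le)
  define a where "a = Max {s\<in>S. s < x}"
  define c where "c = Min {s\<in>S. x < s}"
  have A: "finite {s\<in>S. s < x}" "{s\<in>S. s < x} \<noteq> {}" using fin_S S0 x by auto
  have C: "finite {s\<in>S. x < s}" "{s\<in>S. x < s} \<noteq> {}" using fin_S S1 x by auto
  have a: "a \<in> S" "a < x" "\<And>s. s \<in> S \<Longrightarrow> s < x \<Longrightarrow> s \<le> a" using Max_in[OF A] Max_ge[OF A(1)] by (auto simp: a_def)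
  have c: "c \<in> S" "x < c" "\<And>s. s \<in> S \<Longrightarrow> x < s \<Longrightarrow> c \<le> s" using Min_in[OF C] Min_le[OF C(1)] by (auto simp: c_def)
  have key: "lab z = lab x \<longleftrightarrow> z \<in> {a<..<c}" for z
  proof
    assume "lab z = lab x"
    then have "(a < z \<longleftrightarrow> a < x) \<and> (c \<le> z \<longleftrightarrow> c \<le> x)" using a(1) c(1) unfolding lab_iff by blast
    then show "z \<in> {a<..<c}" using a c by auto
  next
    assume z: "z \<in> {a<..<c}"
    have "(s < z \<longleftrightarrow> s < x) \<and> (s \<le> z \<longleftrightarrow> s \<le> x)" if s: "s \<in> S" for s
    proof (cases "s < x")
      case True then show ?thesis using a(3)[OF s True] z by auto
    next
      case False
      then have "x < s" using s assms by (auto simp: less_le)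
      then show ?thesis using c(3)[OF s] z by auto
    qed
    then show "lab z = lab x" unfolding lab_iff by blast
  qed
  have "0 \<le> a" "a < c" "c \<le> 1" using a(1,2) c(1,2) S_01 by auto
  then show ?thesis using a(1) c(1) by (intro bexI[of _ a] bexI[of _ c] conjI allI key)
qed

lemma rch_iterate: "rch m u u \<Longrightarrow> rch (Suc k * m) u u"
proof (induction k)
  case (Suc k)
  have "rch (m + Suc k * m) u u" by (rule rch_trans[OF Suc.prems Suc.IH[OF Suc.prems]])
  then show ?case by simp
qed simp

text \<open>A recurrent atom returns to itself after arbitrarily long times, so it is reached from
  the neighbourhood of 1 that governs its tail. Of two such neighbourhoods one contains the other,
  and the atom covering the larger one reaches the other atom.\<close>

theorem recurrent_comparable:
  assumes u: "rch m u u" "m \<ge> 1" and v: "rch n v v" "n \<ge> 1"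
  shows "(\<exists>k. rch k u v) \<or> (\<exists>k. rch k v u)"
proof -
  have tail: "\<exists>\<theta>. (\<exists>n. \<forall>y\<in>{1 - \<theta><..<1} \<inter> X0. \<exists>z\<in>X0. lab z = w \<and> (T ^^ n) z = y) \<and>
      (\<exists>y\<in>fwd {1 - \<theta><..<1}. lab y = w)" if w: "rch m w w" "m \<ge> 1" for w m
  proof -
    obtain x where x: "x \<in> X0" "lab x = w" using w by (auto simp: rch_def)
    obtain a c where ac: "0 \<le> a" "a < c" "c \<le> 1" "\<And>z. lab z = lab x \<longleftrightarrow> z \<in> {a<..<c}"
      using atom_interval[OF X0_01[OF x(1)] X0_notin[OF x(1)]] by blast
    obtain \<theta> n n0 where l: "{1 - \<theta><..<1} \<inter> X0 \<subseteq> (T ^^ n) ` ({a<..<c} \<inter> X0)"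
      "\<And>j. j \<ge> n0 \<Longrightarrow> (T ^^ j) ` ({a<..<c} \<inter> X0) \<subseteq> fwd {1 - \<theta><..<1}"
      using interval_tail[OF ac(1-3)] by blast
    have "rch (Suc n0 * m) w w" using rch_iterate[OF w(1)] by blast
    then obtain z where z: "z \<in> X0" "lab z = w" "lab ((T ^^ (Suc n0 * m)) z) = w" by (auto simp: rch_def)
    have "n0 \<le> Suc n0 * m" using w(2) by (metis Suc_leD mult.commute mult_le_mono1 mult_1)
    note sub = l(2)[OF this]
    have "z \<in> {a<..<c} \<inter> X0" using ac(4)[of z] x(2) z(1,2) by simp
    then have "(T ^^ (Suc n0 * m)) z \<in> fwd {1 - \<theta><..<1}" by (rule subsetD[OF sub imageI])
    moreover have "\<exists>z\<in>X0. lab z = w \<and> (T ^^ n) z = y" if "y \<in> {1 - \<theta><..<1} \<inter> X0" for y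
    proof -
      obtain z where "z \<in> {a<..<c}" "z \<in> X0" "y = (T ^^ n) z" using l(1) \<open>y \<in> _\<close> by blast
      moreover from this have "lab z = w" using ac(4)[of z] x(2) by simp
      ultimately show ?thesis by blast
    qed
    ultimately show ?thesis using z(3) by blast
  qed
  have go: "\<exists>k. rch k v u" if lm: "\<theta> \<le> \<mu>" and lu: "y \<in> fwd {1 - \<theta><..<1}" "lab y = u"
    and lv: "\<forall>y\<in>{1 - \<mu><..<1} \<inter> X0. \<exists>z\<in>X0. lab z = v \<and> (T ^^ n) z = y" for \<theta> \<mu> y u v n
  proof -
    obtain i w where w: "w \<in> {1 - \<theta><..<1} \<inter> X0" "y = (T ^^ i) w" using lu by (auto simp: fwd_def)
    have "w \<in> {1 - \<mu><..<1} \<inter> X0" using w(1) lm by auto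
    then obtain z where z: "z \<in> X0" "lab z = v" "(T ^^ n) z = w" using lv by blast
    have "lab ((T ^^ (i + n)) z) = u" using z(3) w(2) lu(2) by (simp add: funpow_add)
    then show ?thesis using z by (auto simp: rch_def)
  qed
  obtain l1 n1 y1 where 1: "\<forall>y\<in>{1 - l1<..<1} \<inter> X0. \<exists>z\<in>X0. lab z = u \<and> (T ^^ n1) z = y" "y1 \<in> fwd {1 - l1<..<1}" "lab y1 = u"
    using tail[OF u] by blast
  obtain l2 n2 y2 where 2: "\<forall>y\<in>{1 - l2<..<1} \<inter> X0. \<exists>z\<in>X0. lab z = v \<and> (T ^^ n2) z = y" "y2 \<in> fwd {1 - l2<..<1}" "lab y2 = v"
    using tail[OF v] by blast
  show ?thesis
  proof (cases "l1 \<le> l2")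
    case True then show ?thesis using go[OF True 1(2,3) 2(1)] by blast
  next
    case False
    then have "l2 \<le> l1" by simp
    then show ?thesis using go[OF _ 2(2,3) 1(1)] by blast
  qed
qed

section \<open>Periodic points in the partition\<close>

text \<open>0 and the cut points are mapped to 1 within two steps. A periodic orbit therefore either
  passes through 1 and follows the left germ of 1, or avoids all discontinuities, where either side
  will do.\<close>

lemma periodic_germ:
  assumes p: "p \<in> {0..1}" and per: "(T ^^ j) p = p" "j \<ge> 1"
  shows "\<exists>\<sigma>. inner_germ p \<sigma> \<and> (\<forall>i. gc p \<sigma> i = (T ^^ i) p)"
proof (cases "\<exists>i. (T ^^ i) p = 1")
  case True
  then obtain i where i: "(T ^^ i) p = 1" by blast
  have mult: "(T ^^ (m * j)) p = p" for m by (induction m) (auto simp: funpow_add per(1))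
  \<comment> \<open>A multiple of the period beyond \<open>i\<close> leads back to \<open>p\<close>,
    which exhibits \<open>p\<close> as an iterate of 1.\<close>
  have "i \<le> i * j" using per(2) by simp
  then have "(T ^^ (i * j)) p = (T ^^ (i * j - i)) ((T ^^ i) p)"
    by (metis comp_apply funpow_add le_add_diff_inverse2)
  then have pk: "p = e1 (i * j - i)" using mult[of i] i e1_eq_Tpow by simp
  define k where "k = i * j - i"
  have "gc p (s1 k) l = (T ^^ l) p" for l
  proof -
    have "gc p (s1 k) l = e1 (k + l)" using gc_add[of 1 "-1" k l] pk by (simp add: s1_def k_def)
    also have "\<dots> = (T ^^ l) ((T ^^ k) 1)" unfolding e1_eq_Tpow by (simp add: add.commute[of k] funpow_add)
    also have "(T ^^ k) 1 = p" using pk e1_eq_Tpow by (simp add: k_def)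
    finally show ?thesis .
  qed
  moreover have "inner_germ p (s1 k)" using inner_germ_e1[of k] pk by (simp add: k_def)
  ultimately show ?thesis by blast
next
  case False
  have nD: "(T ^^ i) p \<notin> Dset \<beta>" for i
  proof
    assume "(T ^^ i) p \<in> Dset \<beta>"
    then consider "(T ^^ i) p = 1" | "(T ^^ i) p = 0" | m where "m \<in> {1..b}" "(T ^^ i) p = real m / \<beta>"
      by (force simp: Dset_def)
    then show False
    proof cases
      case 1 then show ?thesis using False by blast
    next
      case 2 then have "(T ^^ Suc i) p = 1" by (simp add: T_0)
      then show ?thesis using False by blast
    next
      case 3
      then have "(T ^^ Suc i) p = 0 \<or> (T ^^ Suc i) p = 1" using T_div[OF 3(1)] by simp
      then have "(T ^^ Suc (Suc i)) p = 1 \<or> (T ^^ Suc i) p = 1" by (auto simp: T_0)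
      then show ?thesis using False by blast
    qed
  qed
  have "p \<noteq> 0" "p \<noteq> 1" using nD[of 0] by (auto simp: Dset_def)
  then have ig: "inner_germ p 1" using p by (intro inner_germI) auto
  moreover have "gc p 1 i = (T ^^ i) p" for i
  proof (induction i)
    case (Suc i)
    obtain d where d: "real d < \<beta> * (T ^^ i) p" "\<beta> * (T ^^ i) p < real d + 1" "T ((T ^^ i) p) = real d + 1 - \<beta> * (T ^^ i) p"
      using T_nonsing[OF Tpow_range[OF p] nD[of i]] by metis
    have "\<lceil>\<beta> * (T ^^ i) p\<rceil> = int d + 1" "\<lfloor>\<beta> * (T ^^ i) p\<rfloor> = int d" using d by linarith+
    then have "gd ((T ^^ i) p) s = d" for s by (auto simp: gd_def)
    then show ?case using Suc d(3) by simp
  qed simp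
  ultimately show ?thesis by blast
qed

text \<open>For a charged periodic point in \<open>S\<close>, to which gluing does not apply: points
  of \<open>X0\<close> on the germ side of \<open>p\<close> stay close to its orbit and come back to
  their own atom, so one of them can stand in for \<open>p\<close>.\<close>

lemma periodic_shadow:
  assumes p: "p \<in> {0..1}" and per: "(T ^^ j) p = p" "j \<ge> 1" and N: "N \<ge> 1" and r: "r > 0"
  shows "\<exists>y\<in>X0. (\<forall>i\<le>N. \<bar>(T ^^ i) y - (T ^^ i) p\<bar> < r) \<and> (\<exists>n. rch n (lab ((T ^^ N) y)) (lab y))"
proof -
  obtain \<sigma> where s: "inner_germ p \<sigma>" "\<And>i. gc p \<sigma> i = (T ^^ i) p" using periodic_germ[OF p per] by blast
  have s0: "\<sigma> \<noteq> 0" using s by (simp add: inner_germ_def)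
  \<comment> \<open>A multiple of the period, so that the orbit is back at \<open>p\<close>; even,
    so that the germ is back on its own side; and at least \<open>N\<close>.\<close>
  define J where "J = 2 * N * j"
  have JN: "J \<ge> N" using per(2) by (simp add: J_def)
  have "(T ^^ (m * j)) p = p" for m by (induction m) (auto simp: funpow_add per(1))
  then have TJ: "(T ^^ J) p = p" by (simp add: J_def)
  have bJ: "(-\<beta>)^J = \<beta>^J" by (simp add: J_def mult.assoc)
  obtain l where l: "\<forall>\<^sub>F t in at_right 0. lab (p + \<sigma> * t) = l" using germ_lab_const[OF s0] by blast
  then obtain el where el: "el > 0" "\<And>t. 0 < t \<Longrightarrow> t < el \<Longrightarrow> lab (p + \<sigma> * t) = l" by (auto simp: eventually_at_right_field)
  have ev: "\<forall>\<^sub>F t in at_right 0. \<forall>i\<in>{..J}. (T ^^ i) (p + \<sigma> * t) = (T ^^ i) p + ((-\<beta>)^i * \<sigma>) * t"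
    by (rule eventually_ball_finite) (use germ_iter[OF s(1)] s(2) in auto)
  have ev2: "\<forall>\<^sub>F t in at_right 0. \<forall>i\<in>{..J}. \<bar>((-\<beta>)^i * \<sigma>) * t\<bar> < r"
  proof (rule eventually_ball_finite, simp, rule ballI)
    fix i
    have "((\<lambda>t. \<bar>((-\<beta>)^i * \<sigma>) * t\<bar>) \<longlongrightarrow> \<bar>((-\<beta>)^i * \<sigma>) * 0\<bar>) (at_right 0)" by (intro tendsto_intros)
    then show "\<forall>\<^sub>F t in at_right 0. \<bar>((-\<beta>)^i * \<sigma>) * t\<bar> < r" using r by (intro order_tendstoD(2)) auto
  qed
  have ev3: "\<forall>\<^sub>F t in at_right 0. 0 < p + \<sigma> * t \<and> p + \<sigma> * t < 1" using s(1) by (simp add: inner_germ_def)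
  have "\<forall>\<^sub>F t in at_right 0. t < el / \<beta>^J" using el by (auto simp: eventually_at_right_field intro!: exI[of _ "el / \<beta>^J"])
  with ev ev2 ev3 have "\<forall>\<^sub>F t in at_right 0. (\<forall>i\<in>{..J}. (T ^^ i) (p + \<sigma> * t) = (T ^^ i) p + ((-\<beta>)^i * \<sigma>) * t) \<and>
     (\<forall>i\<in>{..J}. \<bar>((-\<beta>)^i * \<sigma>) * t\<bar> < r) \<and> (0 < p + \<sigma> * t \<and> p + \<sigma> * t < 1) \<and> t < el / \<beta>^J"
    by eventually_elim blast
  then obtain e where e: "e > 0" "\<And>t. 0 < t \<Longrightarrow> t < e \<Longrightarrow> (\<forall>i\<in>{..J}. (T ^^ i) (p + \<sigma> * t) = (T ^^ i) p + ((-\<beta>)^i * \<sigma>) * t) \<and>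
     (\<forall>i\<in>{..J}. \<bar>((-\<beta>)^i * \<sigma>) * t\<bar> < r) \<and> (0 < p + \<sigma> * t \<and> p + \<sigma> * t < 1) \<and> t < el / \<beta>^J"
    unfolding eventually_at_right_field by blast
  have "\<exists>t. 0 < t \<and> t < e \<and> p + \<sigma> * t \<in> X0"
  proof (rule ccontr)
    assume neg: "\<nexists>t. 0 < t \<and> t < e \<and> p + \<sigma> * t \<in> X0"
    have "(\<lambda>t. p + \<sigma> * t) ` {0<..<e} \<subseteq> {0..1} - X0"
    proof
      fix y assume "y \<in> (\<lambda>t. p + \<sigma> * t) ` {0<..<e}"
      then obtain t where t: "0 < t" "t < e" "y = p + \<sigma> * t" by auto
      then show "y \<in> {0..1} - X0" using e(2)[OF t(1,2)] neg by auto
    qed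
    then have "countable ((\<lambda>t. p + \<sigma> * t) ` {0<..<e})" using countable_compl_X0 countable_subset by blast
    moreover have "inj_on (\<lambda>t. p + \<sigma> * t) {0<..<e}" using s0 by (auto simp: inj_on_def)
    ultimately have "countable {0<..<e}" using countable_image_inj_on by blast
    then show False using uncountable_open_interval e(1) by blast
  qed
  then obtain t where t: "0 < t" "t < e" "p + \<sigma> * t \<in> X0" by blast
  note et = e(2)[OF t(1,2)]
  define y where "y = p + \<sigma> * t"
  have yT: "(T ^^ i) y = (T ^^ i) p + ((-\<beta>)^i * \<sigma>) * t" if "i \<le> J" for i using et that by (simp add: y_def)
  have "\<bar>(T ^^ i) y - (T ^^ i) p\<bar> < r" if "i \<le> N" for i
  proof -
    have "i \<le> J" using that JN by simp
    then show ?thesis using yT[of i] et by simp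
  qed
  moreover have "rch (J - N) (lab ((T ^^ N) y)) (lab y)"
  proof -
    have "(T ^^ J) y = p + \<sigma> * (\<beta>^J * t)" using yT[of J] TJ bJ by (simp add: mult.commute mult.left_commute)
    \<comment> \<open>The reason for taking \<open>t\<close> below \<open>el / \<beta>^J\<close>:
      after \<open>J\<close> expanding steps the point is still in the range where the label is
      constant.\<close>
    moreover have "\<beta>^J * t < el" using et by (simp add: field_simps)
    ultimately have "lab ((T ^^ J) y) = l" using el(2)[of "\<beta>^J * t"] t by simp
    moreover have "lab y = l" unfolding y_def
    proof (rule el(2)[OF t(1)])
      have "1 \<le> \<beta>^J" using beta_gt_1 by simp
      then have "el / \<beta>^J \<le> el" using el(1) by (simp add: field_simps)
      then show "t < el" using et by linarith
    qed
    moreover have "(T ^^ (J - N)) ((T ^^ N) y) = (T ^^ J) y" using JN by (metis comp_apply funpow_add le_add_diff_inverse2)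
    ultimately show ?thesis using X0_Tpow[of y N] t(3) unfolding rch_def y_def by metis
  qed
  ultimately show ?thesis using t(3) unfolding y_def by blast
qed

end

section \<open>Counting arrangements\<close>

text \<open>Elementary forms of Stirling's formula suffice, since errors of order
  \<open>ln n\<close> vanish after division by \<open>n\<close>.\<close>

lemma ln_fact_lower: "real n * ln (real n) - real n \<le> ln (fact n)"
proof (induction n)
  case (Suc n)
  show ?case
  proof (cases "n = 0")
    case False
    have "1 + 1 / real n = real (Suc n) / real n" using False by (simp add: field_simps)
    then have "ln (real (Suc n)) - ln (real n) = ln (1 + 1 / real n)" using False by (simp add: ln_div)
    also have "\<dots> \<le> 1 / real n" using False by (intro ln_add_one_self_le_self) auto
    finally have "real n * (ln (real (Suc n)) - ln (real n)) \<le> real n * (1 / real n)" by (intro mult_left_mono) auto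
    then have "real n * ln (real (Suc n)) \<le> real n * ln (real n) + 1" using False by (simp add: algebra_simps)
    moreover have "ln (fact (Suc n)) = ln (real (Suc n)) + ln (fact n)"
      by (simp only: fact_Suc of_nat_mult) (rule ln_mult_pos, auto)
    ultimately show ?thesis using Suc by (simp add: algebra_simps)
  qed simp
qed simp

lemma ln_fact_upper: "n \<ge> 1 \<Longrightarrow> ln (fact n) \<le> real n * ln (real n) - real n + ln (real n) + 1"
proof (induction n rule: dec_induct)
  case (step n)
  have "ln (real n) - ln (real (Suc n)) = ln (real n / real (Suc n))" using step by (subst ln_div) auto
  also have "\<dots> \<le> real n / real (Suc n) - 1" using step by (intro ln_le_minus_one) auto
  also have "\<dots> = - 1 / real (Suc n)" by (simp add: field_simps)
  finally have "real (Suc n) * (ln (real n) - ln (real (Suc n))) \<le> real (Suc n) * (- 1 / real (Suc n))" by (intro mult_left_mono) auto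
  then have "real (Suc n) * ln (real n) + 1 \<le> real (Suc n) * ln (real (Suc n))" by (simp add: algebra_simps)
  moreover have "ln (fact (Suc n)) = ln (real (Suc n)) + ln (fact n)"
    by (simp only: fact_Suc of_nat_mult) (rule ln_mult_pos, auto)
  ultimately show ?case using step by (simp add: algebra_simps)
qed simp

definition mset_counts :: "'a set \<Rightarrow> ('a \<Rightarrow> nat) \<Rightarrow> 'a multiset" where
  "mset_counts V m = (\<Sum>C\<in>V. replicate_mset (m C) C)"

lemma mset_counts_props:
  assumes "finite V"
  shows "count (mset_counts V m) C = (if C \<in> V then m C else 0)"
    "size (mset_counts V m) = (\<Sum>C\<in>V. m C)"
    "(\<Sum>C\<in>#mset_counts V m. (h C::real)) = (\<Sum>C\<in>V. real (m C) * h C)"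
    "set_mset (mset_counts V m) \<subseteq> V"
  using assms unfolding mset_counts_def by (induction V rule: finite_induct) (auto split: if_splits)

text \<open>The multinomial coefficient estimated by Stirling's formula. Frequencies are taken
  relative to \<open>M\<close>, while rounding may make the total \<open>M'\<close> a different
  number; the term with \<open>M'\<close> accounts for the difference.\<close>

lemma ln_card_permutations:
  assumes "finite V" and m: "\<And>C. C \<in> V \<Longrightarrow> m C \<le> M" and M: "M \<ge> 1"
  defines "M' \<equiv> \<Sum>C\<in>V. m C"
  shows "real M * ((\<Sum>C\<in>V. eta (real (m C) / real M)) - eta (real M' / real M)) - real (card V) * (ln (real M) + 1)
    \<le> ln (real (card (permutations_of_multiset (mset_counts V m))))"
proof -
  define A where "A = mset_counts V m"
  have cA: "count A C = (if C \<in> V then m C else 0)" for C unfolding A_def by (rule mset_counts_props(1)[OF assms(1)])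
  have sA: "set_mset A \<subseteq> V" unfolding A_def by (rule mset_counts_props(4)[OF assms(1)])
  have "card (permutations_of_multiset A) * (\<Prod>x\<in>set_mset A. fact (count A x)) = fact (size A)"
    by (rule card_permutations_of_multiset_aux)
  moreover have "(\<Prod>x\<in>set_mset A. fact (count A x)) = (\<Prod>C\<in>V. fact (m C) :: nat)"
  proof -
    have "(\<Prod>x\<in>set_mset A. fact (count A x)) = (\<Prod>x\<in>set_mset A. fact (m x) :: nat)"
      using sA by (intro prod.cong) (auto simp: cA)
    also have "\<dots> = (\<Prod>C\<in>V. fact (m C))"
    proof (rule prod.mono_neutral_left[OF assms(1)])
      show "set_mset A \<subseteq> V" by (rule sA)
      show "\<forall>i\<in>V - set_mset A. fact (m i) = (1::nat)"
      proof
        fix i assume "i \<in> V - set_mset A"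
        then have "m i = 0" using cA[of i] by (auto simp: not_in_iff)
        then show "fact (m i) = (1::nat)" by simp
      qed
    qed
    finally show ?thesis .
  qed
  ultimately have "card (permutations_of_multiset A) * (\<Prod>C\<in>V. fact (m C)) = fact M'"
    using mset_counts_props(2)[OF assms(1), of m] by (simp add: A_def M'_def)
  then have eq: "real (card (permutations_of_multiset A)) * (\<Prod>C\<in>V. fact (m C)) = fact M'"
    by (metis (mono_tags, lifting) of_nat_fact of_nat_mult of_nat_prod prod.cong)
  have pos: "real (card (permutations_of_multiset A)) > 0"
    by (simp add: card_gt_0_iff permutations_of_multiset_not_empty)
  have "ln (fact M' :: real) = ln (real (card (permutations_of_multiset A))) + (\<Sum>C\<in>V. ln (fact (m C)))"
    unfolding eq[symmetric] using pos by (subst ln_mult_pos) (auto simp: ln_prod[OF assms(1)] prod_pos)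
  then have L: "ln (real (card (permutations_of_multiset A))) = ln (fact M') - (\<Sum>C\<in>V. ln (fact (m C)))" by simp
  have lnM: "ln (real M) \<ge> 0" using M by simp
  \<comment> \<open>Turns \<open>k * ln k\<close> into an entropy term relative to \<open>M\<close>;
    the convention \<open>eta 0 = 0\<close> covers \<open>k = 0\<close>.\<close>
  have xlnx: "real k * ln (real k) = real k * ln (real M) - real M * eta (real k / real M)" for k
  proof (cases "k = 0")
    case False
    then have "eta (real k / real M) = - (real k / real M) * (ln (real k) - ln (real M))" using M by (simp add: eta_def ln_div)
    then have "real M * eta (real k / real M) = - real k * (ln (real k) - ln (real M))" using M by simp
    then show ?thesis by (simp add: algebra_simps)
  qed (simp add: eta_def)
  have up: "ln (fact (m C)) \<le> real (m C) * ln (real (m C)) - real (m C) + (ln (real M) + 1)" if "C \<in> V" for C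
  proof (cases "m C = 0")
    case False
    then have "ln (fact (m C)) \<le> real (m C) * ln (real (m C)) - real (m C) + ln (real (m C)) + 1" by (intro ln_fact_upper) simp
    moreover have "ln (real (m C)) \<le> ln (real M)" using m[OF that] False by simp
    ultimately show ?thesis by simp
  qed (use lnM in simp)
  have "(\<Sum>C\<in>V. ln (fact (m C))) \<le> (\<Sum>C\<in>V. real (m C) * ln (real M) - real M * eta (real (m C) / real M) - real (m C) + (ln (real M) + 1))"
    using up by (intro sum_mono) (auto simp: xlnx)
  also have "\<dots> = real M' * ln (real M) - real M * (\<Sum>C\<in>V. eta (real (m C) / real M)) - real M' + real (card V) * (ln (real M) + 1)"
    by (simp add: sum.distrib sum_subtractf sum_distrib_left sum_distrib_right M'_def)
  finally have "(\<Sum>C\<in>V. ln (fact (m C))) \<le> real M' * ln (real M) - real M * (\<Sum>C\<in>V. eta (real (m C) / real M)) - real M' + real (card V) * (ln (real M) + 1)" .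
  moreover have "real M' * ln (real M) - real M * eta (real M' / real M) - real M' \<le> ln (fact M')"
    using ln_fact_lower[of M'] xlnx[of M'] by simp
  ultimately show ?thesis using L unfolding A_def by (simp add: algebra_simps)
qed

text \<open>At each position the key tells from which of the filtered subsequences the next entry
  comes.\<close>

lemma list_eq_of_filters:
  assumes "map f xs = map f ys" "\<And>k. filter (\<lambda>x. f x = k) xs = filter (\<lambda>x. f x = k) ys"
  shows "xs = ys"
  using assms
proof (induction xs arbitrary: ys)
  case Nil then show ?case by simp
next
  case (Cons x xs)
  then obtain y ys' where ys: "ys = y # ys'" "f y = f x" "map f xs = map f ys'" by (cases ys) auto
  have "x = y" using Cons.prems(2)[of "f x"] ys by simp
  have "xs = ys'"
  proof (rule Cons.IH[OF ys(3)])
    fix k show "filter (\<lambda>z. f z = k) xs = filter (\<lambda>z. f z = k) ys'"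
      using Cons.prems(2)[of k] ys(1) \<open>x = y\<close> by (cases "f x = k") auto
  qed
  then show ?case using ys(1) \<open>x = y\<close> by simp
qed

lemma card_sort_key:
  fixes f :: "'a \<Rightarrow> nat"
  assumes fin: "finite P" and len: "\<And>xs. xs \<in> P \<Longrightarrow> length xs = M" and r: "\<And>xs. xs \<in> P \<Longrightarrow> f ` set xs \<subseteq> {..r}"
  shows "card P \<le> (r + 1)^M * card (sort_key f ` P)"
proof -
  define L where "L = {l. set l \<subseteq> {..r} \<and> length l = M}"
  have cL: "card L = (r + 1)^M" and fL: "finite L" unfolding L_def
    using card_lists_length_eq[of "{..r}" M] finite_lists_length_eq[of "{..r}" M] by simp_all
  have "inj_on (\<lambda>xs. (map f xs, sort_key f xs)) P"
  proof (rule inj_onI)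
    fix xs ys assume "(map f xs, sort_key f xs) = (map f ys, sort_key f ys)"
    then have e: "map f xs = map f ys" "sort_key f xs = sort_key f ys" by auto
    show "xs = ys"
    proof (rule list_eq_of_filters[OF e(1)])
      fix k show "filter (\<lambda>x. f x = k) xs = filter (\<lambda>x. f x = k) ys"
        using sort_key_stable[of f k xs] sort_key_stable[of f k ys] e(2) by simp
    qed
  qed
  then have "card P = card ((\<lambda>xs. (map f xs, sort_key f xs)) ` P)" by (simp add: card_image)
  also have "\<dots> \<le> card (L \<times> sort_key f ` P)"
  proof (intro card_mono)
    have "f x \<le> r" if "xs \<in> P" "x \<in> set xs" for xs x using r[OF that(1)] that(2) by auto
    then show "(\<lambda>xs. (map f xs, sort_key f xs)) ` P \<subseteq> L \<times> sort_key f ` P" using len by (auto simp: L_def)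
  qed (use fin fL in simp)
  also have "\<dots> = (r + 1)^M * card (sort_key f ` P)" by (simp add: card_cartesian_product cL)
  finally show ?thesis .
qed

context markov_neg_beta begin

section \<open>Shadowing sequences of blocks\<close>

text \<open>The gap after a block is quantified and not recorded, so the predicate depends on the
  point alone. Blocks are abstract indices with representatives \<open>y\<close>, because different
  blocks may have representatives in a common cell.\<close>

fun shadow :: "nat \<Rightarrow> nat \<Rightarrow> ('a \<Rightarrow> real) \<Rightarrow> 'a list \<Rightarrow> real \<Rightarrow> bool" where
  "shadow N g y [] z \<longleftrightarrow> True"
| "shadow N g y (C # Cs) z \<longleftrightarrow> z \<in> cell N (y C) \<and> (\<exists>n\<le>g. shadow N g y Cs ((T ^^ (n + N)) z))"

lemma shadow_exists:
  assumes y: "\<And>C. C \<in> set Cs \<Longrightarrow> y C \<in> X0"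
    and con: "\<And>C D. C \<in> set Cs \<Longrightarrow> D \<in> set Cs \<Longrightarrow> R C \<le> (R D :: nat) \<Longrightarrow> \<exists>n\<le>g. rch n (lab ((T ^^ N) (y C))) (lab (y D))"
    and srt: "sorted (map R Cs)" and ne: "Cs \<noteq> []"
  shows "\<exists>z\<in>X0. shadow N g y Cs z \<and> lab z = lab (y (hd Cs))"
  using y con srt ne
proof (induction Cs)
  case (Cons C Cs)
  show ?case
  proof (cases "Cs = []")
    case True
    then show ?thesis using Cons.prems(1)[of C] cell_self[OF X0_01, of "y C" N] by (intro bexI[of _ "y C"]) auto
  next
    case False
    then obtain D Ds where Cs: "Cs = D # Ds" by (cases Cs) auto
    have "\<exists>z\<in>X0. shadow N g y Cs z \<and> lab z = lab (y (hd Cs))"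
      using Cons.prems(1,2,3) False by (intro Cons.IH) auto
    then obtain z' where z': "z' \<in> X0" "shadow N g y Cs z'" "lab z' = lab (y D)" unfolding Cs by auto
    have "R C \<le> R D" using Cons.prems(3) by (simp add: Cs)
    then obtain n where n: "n \<le> g" "rch n (lab ((T ^^ N) (y C))) (lab (y D))" using Cons.prems(2)[of C D] by (auto simp: Cs)
    then obtain w where w: "w \<in> X0" "lab w = lab ((T ^^ N) (y C))" "lab ((T ^^ n) w) = lab (y D)" by (auto simp: rch_def)
    obtain w' where w': "w' \<in> X0" "\<forall>i\<le>n. lab ((T ^^ i) w') = lab ((T ^^ i) w)" "(T ^^ n) w' = z'"
      using glue[of w n z'] w z' X0_01 X0_S by metis
    have "lab w' = lab ((T ^^ N) (y C))" using w'(2)[rule_format, of 0] w(2) by simp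
    then obtain z where z: "z \<in> X0" "\<forall>i\<le>N. lab ((T ^^ i) z) = lab ((T ^^ i) (y C))" "(T ^^ N) z = w'"
      using glue[of "y C" N w'] w'(1) Cons.prems(1)[of C] X0_01 X0_S by (metis list.set_intros(1))
    have "z \<in> cell N (y C)" using z X0_01 by (auto simp: cell_def)
    moreover have "(T ^^ (n + N)) z = z'" using z(3) w'(3) by (simp add: funpow_add)
    ultimately have "shadow N g y (C # Cs) z" using n(1) z'(2) by auto
    moreover have "lab z = lab (y C)" using z(2)[rule_format, of 0] by simp
    ultimately show ?thesis using z(1) by auto
  qed
qed simp

lemma cell_Tpow:
  assumes "x \<in> cell n z" "k + m \<le> n" shows "(T ^^ k) x \<in> cell m ((T ^^ k) z)"
proof -
  have "lab ((T ^^ i) ((T ^^ k) x)) = lab ((T ^^ i) ((T ^^ k) z))" if "i < m" for i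
  proof -
    have "lab ((T ^^ (i + k)) x) = lab ((T ^^ (i + k)) z)" using assms that by (auto simp: cell_def)
    then show ?thesis by (simp add: funpow_add)
  qed
  then show ?thesis using Tpow_range[of x k] assms by (auto simp: cell_def)
qed

lemma cell_antimono: "m \<le> n \<Longrightarrow> cell n z \<subseteq> cell m z" by (auto simp: cell_def)

text \<open>Each block with its gap takes at most \<open>N + g\<close> steps, so the labels up to
  time \<open>length Cs * (N + g)\<close> decide.\<close>

lemma shadow_cell: "shadow N g y Cs z \<Longrightarrow> x \<in> cell n z \<Longrightarrow> length Cs * (N + g) \<le> n \<Longrightarrow> shadow N g y Cs x"
proof (induction Cs arbitrary: z x n)
  case (Cons C Cs)
  obtain k where k: "k \<le> g" "shadow N g y Cs ((T ^^ (k + N)) z)" and z: "z \<in> cell N (y C)" using Cons.prems by auto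
  have len: "N + g + length Cs * (N + g) \<le> n" using Cons.prems(3) by simp
  have "x \<in> cell N z" using Cons.prems(2) cell_antimono[of N n z] len by auto
  then have "x \<in> cell N (y C)" using cell_eq[OF z] by simp
  moreover have "(T ^^ (k + N)) x \<in> cell (length Cs * (N + g)) ((T ^^ (k + N)) z)"
    using Cons.prems(2) len k(1) by (intro cell_Tpow) auto
  then have "shadow N g y Cs ((T ^^ (k + N)) x)" using Cons.IH[OF k(2)] by simp
  ultimately show ?case using k(1) by auto
qed simp

lemma sum_split_orbit:
  fixes f :: "real \<Rightarrow> real"
  shows "(\<Sum>j<m + n. f ((T ^^ j) x)) = (\<Sum>j<m. f ((T ^^ j) x)) + (\<Sum>j<n. f ((T ^^ j) ((T ^^ m) x)))"
proof -
  have "(\<Sum>j<m + n. f ((T ^^ j) x)) = (\<Sum>j<m. f ((T ^^ j) x)) + (\<Sum>j=m..<m+n. f ((T ^^ j) x))"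
    using sum.atLeastLessThan_concat[of 0 m "m+n" "\<lambda>j. f ((T ^^ j) x)"] by (simp add: atLeast0LessThan)
  also have "(\<Sum>j=m..<m+n. f ((T ^^ j) x)) = (\<Sum>j<n. f ((T ^^ (j + m)) x))"
    using sum.shift_bounds_nat_ivl[of "\<lambda>j. f ((T ^^ j) x)" 0 m n] by (simp add: atLeast0LessThan add.commute)
  finally show ?thesis by (simp add: funpow_add)
qed

lemma orbit_sum_bound:
  fixes f :: "real \<Rightarrow> real"
  assumes "\<And>x. x \<in> {0..1} \<Longrightarrow> \<bar>f x\<bar> \<le> B" "x \<in> {0..1}"
  shows "\<bar>\<Sum>j<n. f ((T ^^ j) x)\<bar> \<le> B * real n"
proof -
  have "\<bar>\<Sum>j<n. f ((T ^^ j) x)\<bar> \<le> (\<Sum>j<n. B)" using assms Tpow_range by (intro order_trans[OF sum_abs] sum_mono) auto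
  then show ?thesis by (simp add: mult.commute)
qed

text \<open>Time inside the blocks costs \<open>e\<close> per step; all remaining time, gaps and
  tail alike, costs at most \<open>B\<close> per step.\<close>

lemma shadow_sum:
  fixes f :: "real \<Rightarrow> real"
  assumes B: "\<And>x. x \<in> {0..1} \<Longrightarrow> \<bar>f x\<bar> \<le> B"
    and cl: "\<And>C x. C \<in> set Cs \<Longrightarrow> x \<in> cell N (y C) \<Longrightarrow> \<bar>(\<Sum>j<N. f ((T ^^ j) x)) - (\<Sum>j<N. f ((T ^^ j) (y C)))\<bar> \<le> real N * e"
    and sh: "shadow N g y Cs x" and x: "x \<in> {0..1}" and n: "length Cs * (N + g) \<le> n"
  shows "\<bar>(\<Sum>j<n. f ((T ^^ j) x)) - (\<Sum>C\<leftarrow>Cs. \<Sum>j<N. f ((T ^^ j) (y C)))\<bar> \<le> real (length Cs) * real N * e + B * (real n - real (length Cs) * real N)"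
  using cl sh x n
proof (induction Cs arbitrary: x n)
  case Nil then show ?case using orbit_sum_bound[of f B, OF B] by simp
next
  case (Cons C Cs)
  obtain k where k: "k \<le> g" "shadow N g y Cs ((T ^^ (k + N)) x)" and xC: "x \<in> cell N (y C)" using Cons.prems by auto
  have len: "N + g + length Cs * (N + g) \<le> n" using Cons.prems(4) by simp
  define n' where "n' = n - N - k"
  have nn: "n = N + (k + n')" using len k(1) by (simp add: n'_def)
  have n': "length Cs * (N + g) \<le> n'" using len k(1) by (simp add: n'_def)
  have x': "(T ^^ (k + N)) x \<in> {0..1}" "(T ^^ N) x \<in> {0..1}" using Tpow_range[OF Cons.prems(3)] by auto
  have IH: "\<bar>(\<Sum>j<n'. f ((T ^^ j) ((T ^^ (k + N)) x))) - (\<Sum>C\<leftarrow>Cs. \<Sum>j<N. f ((T ^^ j) (y C)))\<bar> \<le> real (length Cs) * real N * e + B * (real n' - real (length Cs) * real N)"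
    using Cons.prems(1) by (intro Cons.IH k(2) x' n') auto
  have 1: "\<bar>(\<Sum>j<N. f ((T ^^ j) x)) - (\<Sum>j<N. f ((T ^^ j) (y C)))\<bar> \<le> real N * e" using Cons.prems(1) xC by simp
  have 2: "\<bar>\<Sum>j<k. f ((T ^^ j) ((T ^^ N) x))\<bar> \<le> B * real k" by (rule orbit_sum_bound[OF B x'(2)])
  have "(\<Sum>j<n. f ((T ^^ j) x)) = (\<Sum>j<N. f ((T ^^ j) x)) + ((\<Sum>j<k. f ((T ^^ j) ((T ^^ N) x))) + (\<Sum>j<n'. f ((T ^^ j) ((T ^^ (k + N)) x))))"
    unfolding nn sum_split_orbit by (simp add: funpow_add)
  then have "\<bar>(\<Sum>j<n. f ((T ^^ j) x)) - (\<Sum>C\<leftarrow>C # Cs. \<Sum>j<N. f ((T ^^ j) (y C)))\<bar> \<le> real N * e + B * real k + (real (length Cs) * real N * e + B * (real n' - real (length Cs) * real N))"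
    using IH 1 2 by simp
  also have "\<dots> = real (length (C # Cs)) * real N * e + B * (real n - real (length (C # Cs)) * real N)"
    unfolding nn by (simp add: algebra_simps)
  finally show ?case .
qed

text \<open>Along the orbit of a fixed point each entry leaves at most \<open>q\<close> choices for
  the block and \<open>g + 1\<close> for the gap that follows.\<close>

lemma shadow_mult:
  assumes V: "finite V" and q: "\<And>z. card {C\<in>V. z \<in> cell N (y C)} \<le> q"
  shows "finite {Cs. set Cs \<subseteq> V \<and> length Cs = M \<and> shadow N g y Cs z} \<and>
    card {Cs. set Cs \<subseteq> V \<and> length Cs = M \<and> shadow N g y Cs z} \<le> (q * (g + 1))^M"
proof (induction M arbitrary: z)
  case 0
  have "{Cs. set Cs \<subseteq> V \<and> length Cs = 0 \<and> shadow N g y Cs z} = {[]}" by auto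
  then show ?case by simp
next
  case (Suc M)
  define A where "A z = {Cs. set Cs \<subseteq> V \<and> length Cs = M \<and> shadow N g y Cs z}" for z
  define W where "W = {C\<in>V. z \<in> cell N (y C)}"
  have W: "finite W" "card W \<le> q" using V q by (auto simp: W_def)
  have A: "finite (A z)" "card (A z) \<le> (q * (g + 1))^M" for z using Suc by (auto simp: A_def)
  have sub: "{Cs. set Cs \<subseteq> V \<and> length Cs = Suc M \<and> shadow N g y Cs z} \<subseteq> (\<Union>p\<in>W \<times> {..g}. (#) (fst p) ` A ((T ^^ (snd p + N)) z))"
  proof
    fix Cs assume "Cs \<in> {Cs. set Cs \<subseteq> V \<and> length Cs = Suc M \<and> shadow N g y Cs z}"
    then obtain C Ds k where "Cs = C # Ds" "C \<in> V" "set Ds \<subseteq> V" "length Ds = M" "z \<in> cell N (y C)" "k \<le> g" "shadow N g y Ds ((T ^^ (k + N)) z)"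
      by (cases Cs) auto
    then have "Cs \<in> (#) (fst (C, k)) ` A ((T ^^ (snd (C, k) + N)) z)" "(C, k) \<in> W \<times> {..g}" by (auto simp: A_def W_def)
    then show "Cs \<in> (\<Union>p\<in>W \<times> {..g}. (#) (fst p) ` A ((T ^^ (snd p + N)) z))" by blast
  qed
  have fin: "finite (\<Union>p\<in>W \<times> {..g}. (#) (fst p) ` A ((T ^^ (snd p + N)) z))" using W A by auto
  have "card {Cs. set Cs \<subseteq> V \<and> length Cs = Suc M \<and> shadow N g y Cs z} \<le> card (\<Union>p\<in>W \<times> {..g}. (#) (fst p) ` A ((T ^^ (snd p + N)) z))"
    by (rule card_mono[OF fin sub])
  also have "\<dots> \<le> (\<Sum>p\<in>W \<times> {..g}. card ((#) (fst p) ` A ((T ^^ (snd p + N)) z)))" using W by (intro card_UN_le) auto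
  also have "\<dots> \<le> (\<Sum>p\<in>W \<times> {..g}. (q * (g + 1))^M)"
    using A by (intro sum_mono) (auto intro: order_trans[OF card_image_le])
  also have "\<dots> = card W * (g + 1) * (q * (g + 1))^M" by (simp add: card_cartesian_product)
  also have "\<dots> \<le> q * (g + 1) * (q * (g + 1))^M" using W(2) by (intro mult_le_mono) auto
  also have "\<dots> = (q * (g + 1))^Suc M" by simp
  finally show ?case using finite_subset[OF sub fin] by blast
qed

lemma gap_bound: "\<exists>\<kappa>>0. \<forall>a\<in>S. \<forall>c\<in>S. a < c \<longrightarrow> \<kappa> \<le> c - a"
proof -
  define G where "G = (\<lambda>(a, c). c - a) ` {(a, c). a \<in> S \<and> c \<in> S \<and> a < c}"
  have "finite {(a, c). a \<in> S \<and> c \<in> S \<and> a < c}" by (rule finite_subset[of _ "S \<times> S"]) (use fin_S in auto)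
  then have G: "finite G" by (simp add: G_def)
  define \<kappa> where "\<kappa> = Min (insert 1 G)"
  have "\<kappa> > 0" unfolding \<kappa>_def using G by (subst Min_gr_iff) (auto simp: G_def)
  moreover have "\<kappa> \<le> c - a" if "a \<in> S" "c \<in> S" "a < c" for a c
    unfolding \<kappa>_def using G that by (intro Min_le) (auto simp: G_def)
  ultimately show ?thesis by blast
qed

text \<open>By gluing, \<open>T ^^ (n - 1)\<close> maps the cell onto a whole atom up to the
  countable complement of \<open>X0\<close>. An atom has length at least \<open>\<kappa>\<close>,
  and the slope has absolute value \<open>\<beta>^(n - 1)\<close>.\<close>

lemma cell_measure:
  assumes \<kappa>: "\<And>a c. a \<in> S \<Longrightarrow> c \<in> S \<Longrightarrow> a < c \<Longrightarrow> \<kappa> \<le> c - a" and z: "z \<in> X0" and n: "n \<ge> 1"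
  shows "ennreal (\<kappa> / \<beta>^n) \<le> emeasure lborel (cell n z)"
proof -
  obtain k where k: "n = Suc k" using n by (cases n) auto
  define x where "x = (T ^^ k) z"
  have x: "x \<in> X0" unfolding x_def by (rule X0_Tpow[OF z])
  obtain a c where ac: "a \<in> S" "c \<in> S" "0 \<le> a" "a < c" "c \<le> 1" "\<And>w. lab w = lab x \<longleftrightarrow> w \<in> {a<..<c}"
    using atom_interval[OF X0_01[OF x] X0_notin[OF x]] by blast
  define \<gamma> where "\<gamma> = (-\<beta>)^k"
  define \<alpha> where "\<alpha> = x - \<gamma> * z"
  have g0: "\<gamma> \<noteq> 0" by (simp add: \<gamma>_def)
  define lo where "lo = min ((a - \<alpha>) / \<gamma>) ((c - \<alpha>) / \<gamma>)"
  define hi where "hi = max ((a - \<alpha>) / \<gamma>) ((c - \<alpha>) / \<gamma>)"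
  have hl: "hi - lo = (c - a) / \<beta>^k"
  proof -
    have "hi - lo = \<bar>(c - \<alpha>) / \<gamma> - (a - \<alpha>) / \<gamma>\<bar>" by (auto simp: hi_def lo_def)
    also have "\<dots> = \<bar>c - a\<bar> / \<bar>\<gamma>\<bar>" by (simp add: diff_divide_distrib[symmetric])
    also have "\<bar>\<gamma>\<bar> = \<beta>^k" by (simp add: \<gamma>_def power_abs)
    finally show ?thesis using ac(4) by simp
  qed
  have inI: "\<alpha> + \<gamma> * w \<in> {a<..<c}" if w: "w \<in> {lo<..<hi}" for w
  proof (cases "\<gamma> > 0")
    case True
    then have "lo = (a - \<alpha>) / \<gamma>" "hi = (c - \<alpha>) / \<gamma>" using ac(4) by (auto simp: lo_def hi_def min_def max_def divide_right_mono field_simps)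
    then show ?thesis using w True by (auto simp: field_simps)
  next
    case False
    then have gn: "\<gamma> < 0" using g0 by simp
    then have "lo = (c - \<alpha>) / \<gamma>" "hi = (a - \<alpha>) / \<gamma>" using ac(4) by (auto simp: lo_def hi_def min_def max_def field_simps)
    then show ?thesis using w gn by (auto simp: field_simps)
  qed
  define Nl where "Nl = (\<lambda>u. (u - \<alpha>) / \<gamma>) ` ({0..1} - X0)"
  have "countable Nl" unfolding Nl_def using countable_compl_X0 by (rule countable_image)
  then have Nn: "Nl \<in> null_sets lborel" by (rule countable_imp_null_set_lborel)
  have "{lo<..<hi} \<subseteq> cell n z \<union> Nl"
  proof
    fix w assume w: "w \<in> {lo<..<hi}"
    define u where "u = \<alpha> + \<gamma> * w"
    have u: "u \<in> {a<..<c}" using inI[OF w] by (simp add: u_def)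
    have wu: "w = (u - \<alpha>) / \<gamma>" using g0 by (simp add: u_def)
    show "w \<in> cell n z \<union> Nl"
    proof (cases "u \<in> X0")
      case False
      then show ?thesis using u ac wu by (auto simp: Nl_def)
    next
      case True
      have "lab u = lab x" using ac(6) u by blast
      then obtain v where v: "v \<in> X0" "\<forall>i\<le>k. lab ((T ^^ i) v) = lab ((T ^^ i) z)" "(T ^^ k) v = u"
        using glue[of z k u] True X0_01[OF z] X0_S[OF z] unfolding x_def by blast
      have "(T ^^ k) v - (T ^^ k) z = (-\<beta>)^k * (v - z)" using v X0_01[OF z] X0_S[OF z] by (intro affine) auto
      then have "u - x = \<gamma> * (v - z)" using v(3) by (simp add: x_def \<gamma>_def)
      then have "\<gamma> * v = \<gamma> * w" by (auto simp: u_def \<alpha>_def algebra_simps)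
      then have "v = w" using g0 by simp
      moreover have "v \<in> cell n z" using v X0_01 by (auto simp: cell_def k)
      ultimately show ?thesis by simp
    qed
  qed
  then have "emeasure lborel {lo<..<hi} \<le> emeasure lborel (cell n z \<union> Nl)"
    using cell_borel Nn by (intro emeasure_mono) auto
  also have "\<dots> = emeasure lborel (cell n z)" using Nn cell_borel by (intro emeasure_Un_null_set) auto
  finally have "ennreal (hi - lo) \<le> emeasure lborel (cell n z)" by (simp add: lo_def hi_def)
  moreover have "\<kappa> / \<beta>^n \<le> hi - lo"
  proof -
    have "\<kappa> / \<beta>^n \<le> (c - a) / \<beta>^n" using \<kappa>[OF ac(1,2,4)] by (simp add: divide_right_mono)
    also have "\<dots> \<le> (c - a) / \<beta>^k" using ac(4) beta_gt_1 by (intro divide_left_mono) (auto simp: k)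
    finally show ?thesis using hl by simp
  qed
  ultimately show ?thesis using ennreal_leI order_trans by blast
qed


section \<open>Lower bound\<close>

lemma uniform_family:
  assumes "finite F" "\<And>f. f \<in> F \<Longrightarrow> continuous_on {0..1} (f :: real \<Rightarrow> real)" "e > 0"
  shows "\<exists>r>0. \<forall>f\<in>F. \<forall>u\<in>{0..1}. \<forall>v\<in>{0..1}. \<bar>u - v\<bar> < r \<longrightarrow> \<bar>f u - f v\<bar> \<le> e"
  using assms
proof (induction F rule: finite_induct)
  case empty then show ?case by (auto intro: exI[of _ 1])
next
  case (insert f F)
  have "\<exists>r>0. \<forall>f\<in>F. \<forall>u\<in>{0..1}. \<forall>v\<in>{0..1}. \<bar>u - v\<bar> < r \<longrightarrow> \<bar>f u - f v\<bar> \<le> e"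
    using insert.prems by (intro insert.IH) auto
  then obtain r where r: "r > 0" "\<forall>f\<in>F. \<forall>u\<in>{0..1}. \<forall>v\<in>{0..1}. \<bar>u - v\<bar> < r \<longrightarrow> \<bar>f u - f v\<bar> \<le> e" by blast
  have "uniformly_continuous_on {0..1} f" using insert.prems by (intro compact_uniformly_continuous) auto
  then obtain d where d: "d > 0" "\<forall>u\<in>{0..1}. \<forall>v\<in>{0..1}. dist v u < d \<longrightarrow> dist (f v) (f u) < e"
    unfolding uniformly_continuous_on_def using insert.prems(2) by blast
  have "\<forall>f'\<in>insert f F. \<forall>u\<in>{0..1}. \<forall>v\<in>{0..1}. \<bar>u - v\<bar> < min r d \<longrightarrow> \<bar>f' u - f' v\<bar> \<le> e"
  proof (intro ballI impI)
    fix f' u v assume *: "f' \<in> insert f F" "u \<in> {0..1}" "v \<in> {0..1}" "\<bar>u - v\<bar> < min r d"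
    show "\<bar>f' u - f' v\<bar> \<le> e"
    proof (cases "f' = f")
      case True
      have "dist (f u) (f v) < e" using d(2)[rule_format, of v u] * by (simp add: dist_real_def)
      then show ?thesis using True by (simp add: dist_real_def)
    next
      case False then show ?thesis using r(2)[rule_format, of f' u v] * by simp
    qed
  qed
  then show ?case using r(1) d(1) by (intro exI[of _ "min r d"]) simp
qed

text \<open>Two points of a cell of order \<open>N\<close> stay \<open>r\<close>-close except in the
  last \<open>K\<close> steps, which contribute at most \<open>2 * B' * K\<close>, a vanishing share
  of \<open>N\<close>.\<close>

lemma cell_variation:
  fixes F :: "(real \<Rightarrow> real) set"
  assumes F: "finite F" "\<And>f. f \<in> F \<Longrightarrow> continuous_on {0..1} f" and B: "\<And>f x. f \<in> F \<Longrightarrow> x \<in> {0..1} \<Longrightarrow> \<bar>f x\<bar> \<le> B" and e: "e > 0"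
  shows "\<forall>\<^sub>F N in sequentially. \<forall>f\<in>F. \<forall>x\<in>{0..1}. \<forall>y\<in>cell N x. \<bar>(\<Sum>j<N. f ((T ^^ j) y)) - (\<Sum>j<N. f ((T ^^ j) x))\<bar> \<le> real N * e"
proof -
  obtain r where r: "r > 0" "\<forall>f\<in>F. \<forall>u\<in>{0..1}. \<forall>v\<in>{0..1}. \<bar>u - v\<bar> < r \<longrightarrow> \<bar>f u - f v\<bar> \<le> e / 2"
    using uniform_family[OF F, of "e / 2"] e by auto
  obtain K where K: "(1/\<beta>)^K < r" using small_power[OF r(1)] by blast
  define B' where "B' = max B 0"
  obtain N0 where N0: "real N0 \<ge> 4 * B' * real K / e" using real_arch_simple by blast
  have "\<forall>f\<in>F. \<forall>x\<in>{0..1}. \<forall>y\<in>cell N x. \<bar>(\<Sum>j<N. f ((T ^^ j) y)) - (\<Sum>j<N. f ((T ^^ j) x))\<bar> \<le> real N * e"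
    if N: "N \<ge> max N0 K" for N
  proof (intro ballI)
    fix f x y assume f: "f \<in> F" and x: "x \<in> {0..1}" and y: "y \<in> cell N x"
    have y01: "y \<in> {0..1}" using y cell_01 by blast
    have good: "\<bar>f ((T ^^ j) y) - f ((T ^^ j) x)\<bar> \<le> e / 2" if "j < N - K" for j
    proof -
      have "(T ^^ j) y \<in> cell K ((T ^^ j) x)" using y that by (intro cell_Tpow[of y N]) auto
      then have "\<bar>(T ^^ j) y - (T ^^ j) x\<bar> < r" using cell_close[OF Tpow_range[OF x]] K by (meson le_less_trans)
      then show ?thesis using r(2) f Tpow_range[OF x] Tpow_range[OF y01] by blast
    qed
    have bad: "\<bar>f ((T ^^ j) y) - f ((T ^^ j) x)\<bar> \<le> 2 * B'" for j
      using B[OF f Tpow_range[OF x, of j]] B[OF f Tpow_range[OF y01, of j]] unfolding B'_def by linarith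
    have NK: "N = (N - K) + K" using N by simp
    have "\<bar>(\<Sum>j<N. f ((T ^^ j) y)) - (\<Sum>j<N. f ((T ^^ j) x))\<bar> = \<bar>\<Sum>j<N. f ((T ^^ j) y) - f ((T ^^ j) x)\<bar>"
      by (simp add: sum_subtractf)
    also have "\<dots> \<le> (\<Sum>j<N. \<bar>f ((T ^^ j) y) - f ((T ^^ j) x)\<bar>)" by (rule sum_abs)
    also have "\<dots> \<le> (\<Sum>j<N. (if j < N - K then e / 2 else 2 * B'))" using good bad by (intro sum_mono) auto
    also have "\<dots> = real (N - K) * (e / 2) + real K * (2 * B')"
    proof -
      have "{..<N} \<inter> {j. j < N - K} = {..<N - K}" "{..<N} \<inter> - {j. j < N - K} = {N - K..<N}" using NK by auto
      then show ?thesis using N by (simp add: sum.If_cases)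
    qed
    also have "\<dots> \<le> real N * (e / 2) + real N * (e / 2)"
    proof (intro add_mono mult_right_mono)
      have "4 * B' * real K / e \<le> real N" using N0 N by (meson max.boundedE of_nat_le_iff order_trans)
      then show "real K * (2 * B') \<le> real N * (e / 2)" using e by (simp add: field_simps)
    qed (use e in auto)
    finally show "\<bar>(\<Sum>j<N. f ((T ^^ j) y)) - (\<Sum>j<N. f ((T ^^ j) x))\<bar> \<le> real N * e" by (simp add: mult.commute)
  qed
  then show ?thesis unfolding eventually_sequentially by blast
qed

lemma T_pow_S: "x \<in> S \<Longrightarrow> (T ^^ n) x \<in> S" by (induction n) (auto intro: T_S)

text \<open>Poincare recurrence with a minimal return time: the preimages of \<open>A\<close> under
  the multiples of \<open>N\<close> have equal measure and cannot all be disjoint.\<close>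

lemma recurrence:
  assumes \<mu>: "\<mu> \<in> Pm" and inv: "invariant T \<mu>" and A: "A \<in> sets \<mu>" "measure \<mu> A > 0" and N: "N \<ge> 1"
  shows "\<exists>x\<in>A. \<exists>m\<ge>N. (T ^^ m) x \<in> A"
proof (rule ccontr)
  assume no: "\<not> ?thesis"
  interpret I: invariant_system T \<mu> by unfold_locales (use \<mu> inv in auto)
  define B where "B i = (T ^^ (i * N)) -` A \<inter> {0..1}" for i
  have Bs: "B i \<in> sets \<mu>" for i using measurable_sets[OF I.T_pow_meas A(1)] by (simp add: B_def)
  have Bm: "measure \<mu> (B i) = measure \<mu> A" for i unfolding B_def by (rule I.measure_T_pow[OF A(1)])
  have "B i \<inter> B j = {}" if "i < j" for i j
  proof (rule ccontr)
    assume "B i \<inter> B j \<noteq> {}"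
    then obtain x where x: "(T ^^ (i * N)) x \<in> A" "(T ^^ (j * N)) x \<in> A" by (auto simp: B_def)
    have "j * N = (j - i) * N + i * N" using that by (simp add: add_mult_distrib[symmetric])
    then have "(T ^^ ((j - i) * N)) ((T ^^ (i * N)) x) \<in> A" using x(2) by (simp add: funpow_add)
    moreover have "1 \<le> j - i" using that by linarith
    then have "(j - i) * N \<ge> N" using mult_le_mono1[of 1 "j - i" N] by simp
    ultimately show False using no x(1) by blast
  qed
  then have disj: "B i \<inter> B j = {}" if "i \<noteq> j" for i j using that by (metis Int_commute linorder_neqE_nat)
  obtain K :: nat where K: "real K > 1 / measure \<mu> A" using reals_Archimedean2 by blast
  have "real K * measure \<mu> A = (\<Sum>i<K. measure \<mu> (B i))" by (simp add: Bm)
  also have "\<dots> = measure \<mu> (\<Union>i<K. B i)"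
    using Bs disj by (intro I.finite_measure_finite_Union[symmetric]) (auto simp: disjoint_family_on_def)
  also have "\<dots> \<le> 1" by simp
  finally show False using K A(2) by (simp add: field_simps)
qed

text \<open>In an open cell recurrence gives a return, which is perturbed into \<open>X0\<close>. A
  one-point cell of positive measure is periodic, therefore a point of \<open>S\<close>, and is
  replaced by a shadowing point beside it, possibly in a foreign cell. The last clause confines this
  to the blocks \<open>{p}\<close> with \<open>p \<in> S\<close> and so bounds
  multiplicities.\<close>

lemma representative:
  fixes F :: "(real \<Rightarrow> real) set"
  assumes \<mu>: "\<mu> \<in> Pm" and inv: "invariant T \<mu>" and N: "N \<ge> 1" and C: "C \<in> cells N" "measure \<mu> C > 0"
    and F: "finite F" "\<And>f. f \<in> F \<Longrightarrow> continuous_on {0..1} f" and e: "e > 0"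
    and var: "\<And>f x y. f \<in> F \<Longrightarrow> x \<in> {0..1} \<Longrightarrow> y \<in> cell N x \<Longrightarrow> \<bar>(\<Sum>j<N. f ((T ^^ j) y)) - (\<Sum>j<N. f ((T ^^ j) x))\<bar> \<le> real N * e"
  shows "\<exists>y\<in>X0. (\<forall>f\<in>F. \<forall>x\<in>C. \<bar>(\<Sum>j<N. f ((T ^^ j) x)) - (\<Sum>j<N. f ((T ^^ j) y))\<bar> \<le> real N * e) \<and>
    (\<exists>n. rch n (lab ((T ^^ N) y)) (lab y)) \<and> (cell N y = C \<or> (\<exists>p\<in>S. C = {p}))"
proof -
  obtain x m where x: "x \<in> C" "m \<ge> N" "(T ^^ m) x \<in> C"
    using recurrence[OF \<mu> inv cells_measurable[OF \<mu> C(1)] C(2) N] by blast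
  have x01: "x \<in> {0..1}" using x(1) C(1) Union_cells by blast
  have Cx: "C = cell N x" using mem_cells_eq[OF C(1) x(1)] .
  have mN: "(T ^^ m) z = (T ^^ (m - N)) ((T ^^ N) z)" for z
    using x(2) by (metis comp_apply funpow_add le_add_diff_inverse2)
  show ?thesis
  proof (cases "C \<in> gen_cells N")
    case True
    \<comment> \<open>\<open>S\<close> is forward invariant, so a visit would keep the orbit in
      \<open>S\<close> up to time \<open>m\<close>, but the returning point lies in an open
      cell.\<close>
    have "(T ^^ i) x \<notin> S" if "i \<le> m" for i
    proof
      assume "(T ^^ i) x \<in> S"
      then have "(T ^^ (m - i)) ((T ^^ i) x) \<in> S" by (rule T_pow_S)
      moreover have "(T ^^ m) x = (T ^^ (m - i)) ((T ^^ i) x)" using that by (metis comp_apply funpow_add le_add_diff_inverse2)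
      ultimately have "(T ^^ 0) ((T ^^ m) x) \<in> S" by simp
      then show False using gen_cell_ns[OF True x(3), of 0] N by simp
    qed
    then obtain z where z: "z \<in> X0" "\<forall>i\<le>m. lab ((T ^^ i) z) = lab ((T ^^ i) x)" using perturb[OF x01, of m] by blast
    have zC: "z \<in> cell N x" using z x(2) X0_01 by (auto simp: cell_def)
    then have cz: "cell N z = C" using cell_eq Cx by simp
    have "lab ((T ^^ m) x) = lab x" using x(3) N unfolding Cx by (auto simp: cell_def)
    then have "lab ((T ^^ m) z) = lab z" using z(2)[rule_format, of m] z(2)[rule_format, of 0] by simp
    then have "rch (m - N) (lab ((T ^^ N) z)) (lab z)" unfolding rch_def using X0_Tpow[OF z(1), of N] mN[of z] by metis
    moreover have "\<bar>(\<Sum>j<N. f ((T ^^ j) w)) - (\<Sum>j<N. f ((T ^^ j) z))\<bar> \<le> real N * e" if "f \<in> F" "w \<in> C" for f w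
      using var[OF that(1) X0_01[OF z(1)]] that(2) cz by simp
    ultimately show ?thesis using z(1) cz by blast
  next
    case False
    then obtain p where p: "p \<in> sing N" "C = {p}" using C(1) cells_split[of N] by auto
    have xp: "x = p" using x p by simp
    have per: "(T ^^ m) p = p" "m \<ge> 1" using x p N by auto
    have p01: "p \<in> {0..1}" using p by (simp add: sing_def)
    obtain i where i: "i < N" "(T ^^ i) p \<in> S" using p by (auto simp: sing_def)
    have "p = (T ^^ (m - i)) ((T ^^ i) p)"
      using per(1) i(1) x(2) by (metis comp_apply funpow_add le_add_diff_inverse2 less_imp_le order_trans)
    then have pS: "p \<in> S" using T_pow_S[OF i(2)] by metis
    obtain r where r: "r > 0" "\<forall>f\<in>F. \<forall>u\<in>{0..1}. \<forall>v\<in>{0..1}. \<bar>u - v\<bar> < r \<longrightarrow> \<bar>f u - f v\<bar> \<le> e"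
      using uniform_family[OF F e] by blast
    obtain y where y: "y \<in> X0" "\<forall>i\<le>N. \<bar>(T ^^ i) y - (T ^^ i) p\<bar> < r" "\<exists>n. rch n (lab ((T ^^ N) y)) (lab y)"
      using periodic_shadow[OF p01 per N r(1)] by blast
    have "\<bar>(\<Sum>j<N. f ((T ^^ j) p)) - (\<Sum>j<N. f ((T ^^ j) y))\<bar> \<le> real N * e" if f: "f \<in> F" for f
    proof -
      have "\<bar>(\<Sum>j<N. f ((T ^^ j) p)) - (\<Sum>j<N. f ((T ^^ j) y))\<bar> = \<bar>\<Sum>j<N. f ((T ^^ j) p) - f ((T ^^ j) y)\<bar>"
        by (simp add: sum_subtractf)
      also have "\<dots> \<le> (\<Sum>j<N. e)"
      proof (intro order_trans[OF sum_abs] sum_mono)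
        fix j assume "j \<in> {..<N}"
        then have "\<bar>(T ^^ j) p - (T ^^ j) y\<bar> < r" using y(2)[rule_format, of j] by (simp add: abs_minus_commute)
        then show "\<bar>f ((T ^^ j) p) - f ((T ^^ j) y)\<bar> \<le> e"
          using r(2) f Tpow_range[OF p01] Tpow_range[OF X0_01[OF y(1)]] by blast
      qed
      finally show ?thesis by simp
    qed
    then show ?thesis using y p(2) pS by blast
  qed
qed

text \<open>Counting predecessors turns the total preorder of the recurrent labels into a numerical
  sort key.\<close>

definition rank :: "real set \<times> real set \<Rightarrow> nat" where
  "rank u = card {w \<in> Pow S \<times> Pow S. \<exists>n. rch n w u}"

lemma rank_bound: "rank u \<le> card (Pow S \<times> Pow S)"
  unfolding rank_def using fin_S by (intro card_mono) auto

text \<open>If only \<open>v\<close> reached \<open>u\<close>, the predecessors of \<open>v\<close>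
  would be among those of \<open>u\<close>. The assumption on the ranks makes the two sets equal,
  and \<open>u\<close> precedes itself by recurrence, so it would precede \<open>v\<close>.\<close>

lemma rank_reach:
  assumes u: "rch m u u" "m \<ge> 1" and v: "rch n v v" "n \<ge> 1" and le: "rank u \<le> rank v"
  shows "\<exists>k. rch k u v"
proof (rule ccontr)
  assume no: "\<not> ?thesis"
  then obtain k where k: "rch k v u" using recurrent_comparable[OF u v] by blast
  have sub: "{w \<in> Pow S \<times> Pow S. \<exists>n. rch n w v} \<subseteq> {w \<in> Pow S \<times> Pow S. \<exists>n. rch n w u}"
    using rch_trans[OF _ k] by blast
  have fin: "finite {w \<in> Pow S \<times> Pow S. \<exists>n. rch n w u}" using fin_S by simp
  have "{w \<in> Pow S \<times> Pow S. \<exists>n. rch n w v} = {w \<in> Pow S \<times> Pow S. \<exists>n. rch n w u}"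
    using card_seteq[OF fin sub] le by (simp add: rank_def)
  moreover have "u \<in> {w \<in> Pow S \<times> Pow S. \<exists>n. rch n w u}" using u lab_range unfolding rch_def by blast
  ultimately have "u \<in> {w \<in> Pow S \<times> Pow S. \<exists>n. rch n w v}" by simp
  then show False using no by blast
qed

text \<open>All lists whose points fall into one cell of order \<open>n\<close> are shadowed by a
  common point, so the multiplicity bound applies to the fibres.\<close>

lemma count_shadowed:
  assumes V: "finite V" and Q: "finite Q" "\<And>Cs. Cs \<in> Q \<Longrightarrow> set Cs \<subseteq> V \<and> length Cs = M"
    and q: "\<And>z. card {C\<in>V. z \<in> cell N (y C)} \<le> q"
    and sh: "\<And>Cs. Cs \<in> Q \<Longrightarrow> Z Cs \<in> X0 \<and> shadow N g y Cs (Z Cs)" and n: "M * (N + g) \<le> n"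
  shows "card Q \<le> card ((\<lambda>Cs. cell n (Z Cs)) ` Q) * (q * (g + 1))^M"
proof -
  define W where "W = (\<lambda>Cs. cell n (Z Cs)) ` Q"
  have fW: "finite W" using Q by (simp add: W_def)
  have "Q = (\<Union>w\<in>W. {Cs\<in>Q. cell n (Z Cs) = w})" by (auto simp: W_def)
  then have "card Q \<le> (\<Sum>w\<in>W. card {Cs\<in>Q. cell n (Z Cs) = w})" using card_UN_le[OF fW, of "\<lambda>w. {Cs\<in>Q. cell n (Z Cs) = w}"] by simp
  also have "\<dots> \<le> (\<Sum>w\<in>W. (q * (g + 1))^M)"
  proof (rule sum_mono)
    fix w assume "w \<in> W"
    then obtain Ds where Ds: "Ds \<in> Q" "w = cell n (Z Ds)" by (auto simp: W_def)
    define z where "z = Z Ds"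
    have zw: "z \<in> w" using Ds sh[OF Ds(1)] cell_self X0_01 by (simp add: z_def)
    have "{Cs\<in>Q. cell n (Z Cs) = w} \<subseteq> {Cs. set Cs \<subseteq> V \<and> length Cs = M \<and> shadow N g y Cs z}"
    proof
      fix Cs assume "Cs \<in> {Cs\<in>Q. cell n (Z Cs) = w}"
      then have Cs: "Cs \<in> Q" "cell n (Z Cs) = w" by auto
      have "shadow N g y Cs z"
        by (rule shadow_cell[of N g y Cs "Z Cs" z n]) (use sh[OF Cs(1)] Cs zw Q(2)[OF Cs(1)] n in auto)
      then show "Cs \<in> {Cs. set Cs \<subseteq> V \<and> length Cs = M \<and> shadow N g y Cs z}" using Q(2)[OF Cs(1)] by simp
    qed
    note sub = this
    have sm: "finite {Cs. set Cs \<subseteq> V \<and> length Cs = M \<and> shadow N g y Cs z}"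
      "card {Cs. set Cs \<subseteq> V \<and> length Cs = M \<and> shadow N g y Cs z} \<le> (q * (g + 1))^M"
      using shadow_mult[OF V q, where M=M and g=g and z=z] by simp_all
    show "card {Cs\<in>Q. cell n (Z Cs) = w} \<le> (q * (g + 1))^M"
      by (rule order_trans[OF card_mono[OF sm(1) sub] sm(2)])
  qed
  also have "\<dots> = card W * (q * (g + 1))^M" by simp
  finally show ?thesis by (simp add: W_def)
qed

text \<open>No countable description of \<open>G\<close> enters: on an open cell the iterates are
  affine and the empirical integrals continuous, so the set is open there, and the remaining cells
  are points.\<close>

lemma emp_measurable:
  assumes n: "n \<ge> 1" and G: "openin weak_top G"
  shows "{x\<in>{0..1}. empirical T n x \<in> G} \<in> sets borel"
proof -
  have E: "empirical T n x \<in> Pm" "continuous_on {0..1} f \<Longrightarrow> (\<integral>y. (f y::real) \<partial>empirical T n x) = (\<Sum>j<n. f ((T ^^ j) x)) / real n"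
    if "x \<in> {0..1}" for x f
    using empirical_Pm[OF n, of T x] empirical_integral[OF n, of T x f] Tpow_range[OF that] cont_borel by auto
  have op: "open (C \<inter> {x\<in>{0..1}. empirical T n x \<in> G})" if C: "C \<in> gen_cells n" for C
  proof (subst open_subopen, intro ballI)
    fix x assume "x \<in> C \<inter> {x\<in>{0..1}. empirical T n x \<in> G}"
    then have x: "x \<in> C" "x \<in> {0..1}" "empirical T n x \<in> G" by auto
    have oC: "open C" by (rule gen_cell_open[OF n C])
    have CX: "C = cell n x" using mem_cells_eq[of C n x] gen_cells_sub C x(1) by blast
    have C01: "C \<subseteq> {0..1}" using CX cell_01 by simp
    from weak_basis[OF G x(3)] obtain F :: "(real \<Rightarrow> real) set" and e :: real where
      F: "finite F" "e > 0" "\<forall>f\<in>F. continuous_on {0..1} f"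
      "{\<nu>\<in>Pm. \<forall>f\<in>F. \<bar>(\<integral>y. f y \<partial>\<nu>) - (\<integral>y. f y \<partial>empirical T n x)\<bar> < e} \<subseteq> G" by blast
    have cont: "continuous_on C (\<lambda>y. f ((T ^^ j) y))" if f: "f \<in> F" and j: "j < n" for f j
    proof -
      have aff: "(T ^^ j) y = (T ^^ j) x + (-\<beta>)^j * (y - x)" if "y \<in> C" for y
      proof -
        have "(T ^^ j) y - (T ^^ j) x = (-\<beta>)^j * (y - x)"
          using gen_cell_ns[OF C x(1)] that j unfolding CX by (intro affine x(2)) (auto simp: cell_def)
        then show ?thesis by simp
      qed
      have "continuous_on C (\<lambda>y. f ((T ^^ j) x + (-\<beta>)^j * (y - x)))"
      proof (rule continuous_on_compose2[of "{0..1}" f])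
        show "continuous_on {0..1} f" using F(3) f by blast
        show "(\<lambda>y. (T ^^ j) x + (-\<beta>)^j * (y - x)) ` C \<subseteq> {0..1}"
          using aff Tpow_range C01 by (metis (no_types, lifting) image_subsetI subsetD)
      qed (intro continuous_intros)
      then show ?thesis by (rule continuous_on_eq) (simp add: aff)
    qed
    define H where "H f y = (\<Sum>j<n. f ((T ^^ j) y)) / real n" for f and y :: real
    have Hc: "continuous_on C (H f)" if "f \<in> F" for f unfolding H_def using n cont[OF that] by (intro continuous_intros) auto
    have "\<forall>\<^sub>F y in at x. \<forall>f\<in>F. \<bar>H f y - H f x\<bar> < e"
    proof (rule eventually_ball_finite[OF F(1)], rule ballI)
      fix f assume f: "f \<in> F"
      have "(H f \<longlongrightarrow> H f x) (at x)" using Hc[OF f] x(1) oC by (metis continuous_on_def at_within_open)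
      then show "\<forall>\<^sub>F y in at x. \<bar>H f y - H f x\<bar> < e" using F(2) by (auto dest!: tendstoD simp: dist_real_def)
    qed
    then obtain U where U: "open U" "x \<in> U" "\<And>y. y \<in> U \<Longrightarrow> y \<noteq> x \<Longrightarrow> \<forall>f\<in>F. \<bar>H f y - H f x\<bar> < e"
      unfolding eventually_at_topological by auto
    have sub: "U \<inter> C \<subseteq> C \<inter> {x\<in>{0..1}. empirical T n x \<in> G}"
    proof
      fix y assume y: "y \<in> U \<inter> C"
      have y01: "y \<in> {0..1}" using y C01 by blast
      have "\<bar>H f y - H f x\<bar> < e" if "f \<in> F" for f using U(3)[of y] y that F(2) by (cases "y = x") auto
      then have "\<forall>f\<in>F. \<bar>(\<integral>z. f z \<partial>empirical T n y) - (\<integral>z. f z \<partial>empirical T n x)\<bar> < e"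
        using E(2)[OF y01] E(2)[OF x(2)] F(3) by (simp add: H_def)
      then have "empirical T n y \<in> {\<nu>\<in>Pm. \<forall>f\<in>F. \<bar>(\<integral>z. f z \<partial>\<nu>) - (\<integral>z. f z \<partial>empirical T n x)\<bar> < e}"
        using E(1)[OF y01] by simp
      then have "empirical T n y \<in> G" by (rule subsetD[OF F(4)])
      then show "y \<in> C \<inter> {x\<in>{0..1}. empirical T n x \<in> G}" using y y01 by simp
    qed
    show "\<exists>V. open V \<and> x \<in> V \<and> V \<subseteq> C \<inter> {x\<in>{0..1}. empirical T n x \<in> G}"
      using U(1,2) oC x(1) sub by (intro exI[of _ "U \<inter> C"]) auto
  qed
  have "C \<inter> {x\<in>{0..1}. empirical T n x \<in> G} \<in> sets borel" if Cn: "C \<in> cells n" for C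
  proof (cases "C \<in> gen_cells n")
    case True then show ?thesis using op by simp
  next
    case False
    then obtain p where "C = {p}" using Cn cells_split[of n] by auto
    then have "finite (C \<inter> {x\<in>{0..1}. empirical T n x \<in> G})" by simp
    then show ?thesis by (simp add: finite_imp_closed)
  qed
  then have "(\<Union>C\<in>cells n. C \<inter> {x\<in>{0..1}. empirical T n x \<in> G}) \<in> sets borel" using finite_cells by (intro sets.finite_UN) auto
  moreover have "(\<Union>C\<in>cells n. C \<inter> {x\<in>{0..1}. empirical T n x \<in> G}) = {x\<in>{0..1}. empirical T n x \<in> G}"
    using Union_cells[of n] by blast
  ultimately show ?thesis by simp
qed

lemma emp_measurable_closed:
  assumes n: "n \<ge> 1" and F: "closedin weak_top F"
  shows "{x\<in>{0..1}. empirical T n x \<in> F} \<in> sets borel"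
proof -
  have "openin weak_top (Pm - F)" using F topspace_weak by (simp add: closedin_def)
  from emp_measurable[OF n this] have "{0..1} - {x\<in>{0..1}. empirical T n x \<in> Pm - F} \<in> sets borel" by auto
  moreover have "{0..1} - {x\<in>{0..1}. empirical T n x \<in> Pm - F} = {x\<in>{0..1}. empirical T n x \<in> F}"
    using empirical_Pm[OF n, of T] Tpow_range by blast
  ultimately show ?thesis by simp
qed

end

section \<open>Limits of rounded frequencies\<close>

lemma tendsto_eta:
  assumes "(f \<longlongrightarrow> t) F" "t > 0" shows "((\<lambda>x. eta (f x)) \<longlongrightarrow> eta t) F"
proof -
  have "((\<lambda>x. - f x * ln (f x)) \<longlongrightarrow> - t * ln t) F" using assms by (intro tendsto_intros) auto
  moreover have "\<forall>\<^sub>F x in F. - f x * ln (f x) = eta (f x)"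
    using order_tendstoD(1)[OF assms] by eventually_elim (simp add: eta_def)
  ultimately show ?thesis using assms(2) tendsto_cong by (fastforce simp: eta_def)
qed

lemma tendsto_floor_over:
  fixes p :: real assumes "0 \<le> p"
  shows "(\<lambda>M. real (nat \<lfloor>real M * p\<rfloor>) / real M) \<longlonglongrightarrow> p"
proof (rule tendsto_sandwich[of "\<lambda>M. p - 1 / real M" _ _ "\<lambda>M. p"])
  have b: "real M * p - 1 \<le> real (nat \<lfloor>real M * p\<rfloor>) \<and> real (nat \<lfloor>real M * p\<rfloor>) \<le> real M * p" for M
  proof -
    have "0 \<le> real M * p" using assms by simp
    then have "real (nat \<lfloor>real M * p\<rfloor>) = of_int \<lfloor>real M * p\<rfloor>" by simp
    then show ?thesis by linarith
  qed
  show "\<forall>\<^sub>F M in sequentially. p - 1 / real M \<le> real (nat \<lfloor>real M * p\<rfloor>) / real M"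
    using eventually_gt_at_top[of 0]
  proof eventually_elim
    case (elim M)
    then have "p - 1 / real M = (real M * p - 1) / real M" by (simp add: diff_divide_distrib)
    then show ?case using divide_right_mono[OF conjunct1[OF b[of M]], of "real M"] by simp
  qed
  show "\<forall>\<^sub>F M in sequentially. real (nat \<lfloor>real M * p\<rfloor>) / real M \<le> p"
    using eventually_gt_at_top[of 0]
  proof eventually_elim
    case (elim M)
    then show ?case using divide_right_mono[OF conjunct2[OF b[of M]], of "real M"] by simp
  qed
  have "(\<lambda>M. p - 1 / real M) \<longlonglongrightarrow> p - 0" by (intro tendsto_diff tendsto_const lim_1_over_n)
  then show "(\<lambda>M. p - 1 / real M) \<longlonglongrightarrow> p" by simp
qed simp

lemma tendsto_div_over:
  assumes "d \<ge> (1::nat)" shows "(\<lambda>n. real (n div d) / real n) \<longlonglongrightarrow> 1 / real d"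
proof -
  have "real (nat \<lfloor>real n * (1 / real d)\<rfloor>) = real (n div d)" for n
    using floor_divide_of_nat_eq[of n d, where ?'a = real] by simp
  then show ?thesis using tendsto_floor_over[of "1 / real d"] by simp
qed

lemma filterlim_div: "d \<ge> (1::nat) \<Longrightarrow> filterlim (\<lambda>n. n div d) at_top sequentially"
  unfolding filterlim_at_top
proof (intro allI)
  fix Z assume d: "d \<ge> (1::nat)"
  have "Z \<le> n div d" if "n \<ge> Z * d" for n using div_le_mono[OF that, of d] d by simp
  then show "\<forall>\<^sub>F n in sequentially. Z \<le> n div d" unfolding eventually_sequentially by blast
qed

context markov_neg_beta begin

lemma family_bound:
  fixes F :: "(real \<Rightarrow> real) set"
  assumes "finite F" "\<And>f. f \<in> F \<Longrightarrow> continuous_on {0..1} f"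
  shows "\<exists>B>0. \<forall>f\<in>F. \<forall>x\<in>{0..1}. \<bar>f x\<bar> \<le> B"
  using assms
proof (induction F rule: finite_induct)
  case empty then show ?case by (auto intro: exI[of _ 1])
next
  case (insert f F)
  have "\<exists>B>0. \<forall>f\<in>F. \<forall>x\<in>{0..1}. \<bar>f x\<bar> \<le> B" using insert by simp
  then obtain B where B: "B > 0" "\<forall>f\<in>F. \<forall>x\<in>{0..1}. \<bar>f x\<bar> \<le> B" by blast
  obtain B' where B': "B' > 0" "\<And>x. x \<in> {0..1} \<Longrightarrow> \<bar>f x\<bar> \<le> B'" using cont_bounded[of f] insert.prems by blast
  have "\<forall>f'\<in>insert f F. \<forall>x\<in>{0..1}. \<bar>f' x\<bar> \<le> max B B'"
    using B(2) B'(2) by (auto simp: le_max_iff_disj)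
  then show ?case using B(1) by (intro exI[of _ "max B B'"]) simp
qed

lemma cells_disjoint_family: "\<C> \<subseteq> cells n \<Longrightarrow> disjoint_family_on (\<lambda>C. C) \<C>"
  unfolding disjoint_family_on_def by (meson cells_disjoint subsetD)

text \<open>The number of arrangements grows with the entropy of the cells of order
  \<open>N\<close>; sorting, gaps and coincidences cost a factor \<open>C0\<close> per block, that
  is a rate \<open>ln C0 / (N + g)\<close>. The cells of order \<open>n\<close> that are reached are
  disjoint, have measure at least \<open>\<kappa> / \<beta>^n\<close> and consist of points with
  empirical measure in \<open>G\<close>.\<close>

lemma lower_bound:
  assumes \<mu>: "\<mu> \<in> Pm" and inv: "invariant T \<mu>" and h: "ks_entropy \<mu> T = ereal h"
    and G: "openin weak_top G" "\<mu> \<in> G" and t: "t < h - ln \<beta>"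
  shows "\<forall>\<^sub>F n in sequentially. exp (real n * t) \<le> measure lborel {x\<in>{0..1}. empirical T n x \<in> G}"
proof -
  interpret I: invariant_system T \<mu> by unfold_locales (use \<mu> inv in auto)
  from weak_basis[OF G] obtain F :: "(real \<Rightarrow> real) set" and e :: real where
    F: "finite F" "e > 0" "\<forall>f\<in>F. continuous_on {0..1} f"
    "{\<nu>\<in>Pm. \<forall>f\<in>F. \<bar>(\<integral>y. f y \<partial>\<nu>) - (\<integral>y. f y \<partial>\<mu>)\<bar> < e} \<subseteq> G" by blast
  have Fc: "continuous_on {0..1} f" if "f \<in> F" for f using F(3) that by blast
  obtain B where B: "B > 0" "\<And>f x. f \<in> F \<Longrightarrow> x \<in> {0..1} \<Longrightarrow> \<bar>f x\<bar> \<le> B" using family_bound[OF F(1) Fc] by blast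
  \<comment> \<open>Passing from the orbit to the representatives and from these to
    \<open>\<mu>\<close> costs \<open>e'\<close> each, together \<open>e / 4\<close>; the gaps take
    another \<open>e / 4\<close>, and the constant \<open>K\<close> is left with
    \<open>e / 2\<close>.\<close>
  define e' where "e' = e / 8"
  have e': "e' > 0" using F(2) by (simp add: e'_def)
  obtain g where g: "\<And>u v n. rch n u v \<Longrightarrow> \<exists>m\<le>g. rch m u v" using rch_bound by blast
  define q where "q = card S + 1"
  define rk where "rk = card (Pow S \<times> Pow S)"
  \<comment> \<open>The loss per block: \<open>rk + 1\<close> sort keys, \<open>q\<close> blocks
    with representatives in the same cell, \<open>g + 1\<close> gap lengths. None of these depends
    on \<open>N\<close>, which is chosen afterwards.\<close>
  define C0 where "C0 = real ((rk + 1) * (q * (g + 1)))"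
  have C0: "C0 \<ge> 1" unfolding C0_def q_def by (simp add: Suc_le_eq)
  obtain \<kappa> where \<kappa>: "\<kappa> > 0" "\<And>a c. a \<in> S \<Longrightarrow> c \<in> S \<Longrightarrow> a < c \<Longrightarrow> \<kappa> \<le> c - a" using gap_bound by blast
  have "(\<lambda>N. h * (real N / (real N + real g)) - ln C0 * (1 / (real N + real g)) - ln \<beta>) \<longlonglongrightarrow> h * 1 - ln C0 * 0 - ln \<beta>"
  proof (intro tendsto_diff tendsto_mult tendsto_const)
    show "(\<lambda>N. real N / (real N + real g)) \<longlonglongrightarrow> 1" by real_asymp
    show "(\<lambda>N. 1 / (real N + real g)) \<longlonglongrightarrow> 0" by real_asymp
  qed
  then have ev1: "\<forall>\<^sub>F N in sequentially. t < h * (real N / (real N + real g)) - ln C0 * (1 / (real N + real g)) - ln \<beta>"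
    using t by (intro order_tendstoD(1)) auto
  have ev2: "\<forall>\<^sub>F N in sequentially. 2 * B * real g / real N < e / 4"
    using order_tendstoD(2)[OF lim_const_over_n, of "e / 4" "2 * B * real g"] F(2) by simp
  have ev3: "\<forall>\<^sub>F N in sequentially. \<forall>f\<in>F. \<forall>x\<in>{0..1}. \<forall>y\<in>cell N x. \<bar>(\<Sum>j<N. f ((T ^^ j) y)) - (\<Sum>j<N. f ((T ^^ j) x))\<bar> \<le> real N * e'"
    by (rule cell_variation[where B=B]) (use F(1) Fc B(2) e' in auto)
  have "\<forall>\<^sub>F N in sequentially. t < h * (real N / (real N + real g)) - ln C0 * (1 / (real N + real g)) - ln \<beta> \<and>
    2 * B * real g / real N < e / 4 \<and> N \<ge> 1 \<and>
    (\<forall>f\<in>F. \<forall>x\<in>{0..1}. \<forall>y\<in>cell N x. \<bar>(\<Sum>j<N. f ((T ^^ j) y)) - (\<Sum>j<N. f ((T ^^ j) x))\<bar> \<le> real N * e')"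
    using ev1 ev2 eventually_ge_at_top[of 1] ev3 by eventually_elim blast
  then obtain N where N: "t < h * (real N / (real N + real g)) - ln C0 * (1 / (real N + real g)) - ln \<beta>"
    "2 * B * real g / real N < e / 4" "N \<ge> 1"
    "\<And>f x y. f \<in> F \<Longrightarrow> x \<in> {0..1} \<Longrightarrow> y \<in> cell N x \<Longrightarrow> \<bar>(\<Sum>j<N. f ((T ^^ j) y)) - (\<Sum>j<N. f ((T ^^ j) x))\<bar> \<le> real N * e'"
    unfolding eventually_sequentially by blast
  define V where "V = {C\<in>cells N. measure \<mu> C > 0}"
  have V: "finite V" using finite_cells by (simp add: V_def)
  have sumV: "(\<Sum>C\<in>V. measure \<mu> C) = 1"
  proof -
    have "(\<Sum>C\<in>V. measure \<mu> C) = (\<Sum>C\<in>cells N. measure \<mu> C)"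
      using finite_cells measure_nonneg[of \<mu>] by (intro sum.mono_neutral_left) (auto simp: V_def le_less)
    also have "\<dots> = measure \<mu> (\<Union>C\<in>cells N. C)"
      using finite_cells cells_measurable[OF \<mu>] by (intro I.finite_measure_finite_Union[symmetric] cells_disjoint_family) auto
    also have "\<dots> = 1" using I.prob_space Union_cells[of N] by simp
    finally show ?thesis .
  qed
  have HV: "(\<Sum>C\<in>V. eta (measure \<mu> C)) = Hc \<mu> N"
    unfolding Hc_def using finite_cells measure_nonneg[of \<mu>] by (intro sum.mono_neutral_left) (auto simp: V_def le_less eta_def)
  define rep where "rep C y \<longleftrightarrow> y \<in> X0 \<and> (\<forall>f\<in>F. \<forall>x\<in>C. \<bar>(\<Sum>j<N. f ((T ^^ j) x)) - (\<Sum>j<N. f ((T ^^ j) y))\<bar> \<le> real N * e') \<and>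
    (\<exists>n. rch n (lab ((T ^^ N) y)) (lab y)) \<and> (cell N y = C \<or> (\<exists>p\<in>S. C = {p}))" for C y
  have "\<forall>C\<in>V. \<exists>y. rep C y"
  proof
    fix C assume "C \<in> V"
    then have C: "C \<in> cells N" "measure \<mu> C > 0" by (auto simp: V_def)
    show "\<exists>y. rep C y" unfolding rep_def Bex_def[symmetric]
      by (rule representative[OF \<mu> inv N(3) C F(1) _ e']) (rule Fc, assumption, rule N(4), assumption+)
  qed
  from bchoice[OF this] obtain y where rep: "\<And>C. C \<in> V \<Longrightarrow> rep C (y C)" by blast
  have y: "\<And>C. C \<in> V \<Longrightarrow> y C \<in> X0"
    "\<And>C f x. C \<in> V \<Longrightarrow> f \<in> F \<Longrightarrow> x \<in> C \<Longrightarrow> \<bar>(\<Sum>j<N. f ((T ^^ j) x)) - (\<Sum>j<N. f ((T ^^ j) (y C)))\<bar> \<le> real N * e'"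
    "\<And>C. C \<in> V \<Longrightarrow> \<exists>n. rch n (lab ((T ^^ N) (y C))) (lab (y C))" "\<And>C. C \<in> V \<Longrightarrow> cell N (y C) = C \<or> (\<exists>p\<in>S. C = {p})"
    using rep by (simp_all add: rep_def)
  define R where "R C = rank (lab (y C))" for C
  have con: "\<exists>n\<le>g. rch n (lab ((T ^^ N) (y C))) (lab (y D))" if CD: "C \<in> V" "D \<in> V" "R C \<le> R D" for C D
  proof -
    have rec: "\<exists>m\<ge>1. rch m (lab (y C)) (lab (y C))" if Cv: "C \<in> V" for C
    proof -
      obtain n where n: "rch n (lab ((T ^^ N) (y C))) (lab (y C))" using y(3)[OF Cv] by blast
      have "rch N (lab (y C)) (lab ((T ^^ N) (y C)))" unfolding rch_def using y(1)[OF Cv] by blast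
      then have "rch (N + n) (lab (y C)) (lab (y C))" using n by (rule rch_trans)
      then show ?thesis using N(3) by (intro exI[of _ "N + n"]) auto
    qed
    obtain m1 where m1: "m1 \<ge> 1" "rch m1 (lab (y C)) (lab (y C))" using rec[OF CD(1)] by blast
    obtain m2 where m2: "m2 \<ge> 1" "rch m2 (lab (y D)) (lab (y D))" using rec[OF CD(2)] by blast
    obtain k where k: "rch k (lab (y C)) (lab (y D))" using rank_reach[OF m1(2,1) m2(2,1)] CD(3) unfolding R_def by blast
    obtain n where "rch n (lab ((T ^^ N) (y C))) (lab (y C))" using y(3)[OF CD(1)] by blast
    from rch_trans[OF this k] show ?thesis by (rule g)
  qed
  \<comment> \<open>A block that contains its representative is the cell of \<open>z\<close> itself;
    all other candidates are single points of \<open>S\<close>.\<close>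
  have mult: "card {C\<in>V. z \<in> cell N (y C)} \<le> q" for z
  proof -
    have "{C\<in>V. z \<in> cell N (y C)} \<subseteq> insert (cell N z) ((\<lambda>p. {p}) ` S)"
    proof
      fix C assume "C \<in> {C\<in>V. z \<in> cell N (y C)}"
      then have C: "C \<in> V" "z \<in> cell N (y C)" by auto
      then show "C \<in> insert (cell N z) ((\<lambda>p. {p}) ` S)" using y(4)[OF C(1)] cell_eq[OF C(2)] by auto
    qed
    then have "card {C\<in>V. z \<in> cell N (y C)} \<le> card (insert (cell N z) ((\<lambda>p. {p}) ` S))" using fin_S by (intro card_mono) auto
    also have "\<dots> \<le> Suc (card ((\<lambda>p. {p}) ` S))" by (rule card_insert_le_m1) auto
    also have "\<dots> \<le> q" unfolding q_def using card_image_le[OF fin_S, of "\<lambda>p. {p}"] by simp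
    finally show ?thesis .
  qed
  \<comment> \<open>Rounding down keeps the total at most \<open>M\<close>, so the blocks and their
    gaps fit into \<open>n\<close> steps.\<close>
  define m where "m M C = nat \<lfloor>real M * measure \<mu> C\<rfloor>" for M C
  have mb: "real (m M C) \<le> real M * measure \<mu> C" "real M * measure \<mu> C - 1 \<le> real (m M C)" for M C
  proof -
    have "real (m M C) = of_int \<lfloor>real M * measure \<mu> C\<rfloor>" by (simp add: m_def)
    then show "real (m M C) \<le> real M * measure \<mu> C" "real M * measure \<mu> C - 1 \<le> real (m M C)" by linarith+
  qed
  have mM: "m M C \<le> M" for M C
  proof -
    have "real M * measure \<mu> C \<le> real M * 1" by (intro mult_left_mono) auto
    then have "real (m M C) \<le> real M" using mb(1)[of M C] by simp
    then show ?thesis by simp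
  qed
  define M' where "M' M = (\<Sum>C\<in>V. m M C)" for M
  have M'b: "real (M' M) \<le> real M" "real M - real (card V) \<le> real (M' M)" for M
  proof -
    have "real (M' M) \<le> (\<Sum>C\<in>V. real M * measure \<mu> C)" unfolding M'_def of_nat_sum using mb by (intro sum_mono) auto
    also have "\<dots> = real M" by (simp add: sum_distrib_left[symmetric] sumV)
    finally show "real (M' M) \<le> real M" .
    have "(\<Sum>C\<in>V. real M * measure \<mu> C - 1) \<le> real (M' M)" unfolding M'_def of_nat_sum using mb by (intro sum_mono) auto
    then show "real M - real (card V) \<le> real (M' M)" by (simp add: sum_subtractf sum_distrib_left[symmetric] sumV)
  qed
  define d where "d = N + g"
  have d: "d \<ge> 1" using N(3) by (simp add: d_def)
  define P where "P M = permutations_of_multiset (mset_counts V (m M))" for M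
  define SN where "SN f x = (\<Sum>j<N. f ((T ^^ j) x))" for f :: "real \<Rightarrow> real" and x
  \<comment> \<open>By invariance the orbit sum of length \<open>N\<close> has integral
    \<open>N\<close> times that of \<open>f\<close>, and the step function formed from the
    representatives differs from it by at most \<open>N * e'\<close>.\<close>
  have block: "\<bar>(\<Sum>C\<in>V. measure \<mu> C * SN f (y C)) - real N * (\<integral>x. f x \<partial>\<mu>)\<bar> \<le> real N * e'" if f: "f \<in> F" for f
  proof -
    have fi: "integrable \<mu> (\<lambda>x. f ((T ^^ j) x))" for j
    proof (rule bounded_integrable[OF \<mu>])
      show "(\<lambda>x. f ((T ^^ j) x)) \<in> borel_measurable B01"
        using measurable_comp[OF Tpow_measurable cont_borel[OF Fc[OF f]]] by (simp add: comp_def)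
      show "\<bar>f ((T ^^ j) x)\<bar> \<le> B" if "x \<in> {0..1}" for x using B(2)[OF f] Tpow_range[OF that] by blast
    qed
    have fm: "f \<in> borel_measurable \<mu>" unfolding Pm_measurable[OF \<mu>] by (rule cont_borel[OF Fc[OF f]])
    have SNi: "integrable \<mu> (SN f)" unfolding SN_def[abs_def] using fi by (intro Bochner_Integration.integrable_sum)
    have SNv: "(\<integral>x. SN f x \<partial>\<mu>) = real N * (\<integral>x. f x \<partial>\<mu>)"
    proof -
      have "(\<integral>x. SN f x \<partial>\<mu>) = (\<Sum>j<N. \<integral>x. f ((T ^^ j) x) \<partial>\<mu>)" unfolding SN_def using fi by (intro Bochner_Integration.integral_sum)
      also have "\<dots> = (\<Sum>j<N. \<integral>x. f x \<partial>\<mu>)" using I.integral_T_pow[OF fm] by simp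
      finally show ?thesis by simp
    qed
    define \<Psi> where "\<Psi> x = (\<Sum>C\<in>V. SN f (y C) * indicator C x)" for x
    have Vm: "C \<in> sets \<mu>" if "C \<in> V" for C using cells_measurable[OF \<mu>] that by (auto simp: V_def)
    have ind: "integrable \<mu> (\<lambda>x. c * indicat_real C x)" if "C \<in> V" for C c
      using Vm[OF that] I.emeasure_finite[of C] by (intro integrable_mult_right integrable_real_indicator) (auto simp: less_top[symmetric])
    have \<Psi>i: "integrable \<mu> \<Psi>" unfolding \<Psi>_def[abs_def] using ind by (intro Bochner_Integration.integrable_sum) auto
    have \<Psi>v: "(\<integral>x. \<Psi> x \<partial>\<mu>) = (\<Sum>C\<in>V. measure \<mu> C * SN f (y C))"
    proof -
      have "C \<inter> {0..1} = C" if "C \<in> V" for C using sets.sets_into_space[OF Vm[OF that]] by auto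
      then show ?thesis unfolding \<Psi>_def using ind Vm
        by (subst Bochner_Integration.integral_sum) (auto simp: mult.commute intro!: sum.cong)
    qed
    have "AE x in \<mu>. x \<in> \<Union>V"
    proof -
      have "\<Union>V \<in> sets \<mu>" using V Vm by auto
      moreover have "measure \<mu> (\<Union>C\<in>V. C) = 1"
        using V Vm sumV cells_disjoint_family[of V N] by (subst I.finite_measure_finite_Union) (auto simp: V_def)
      ultimately show ?thesis using I.prob_eq_1[of "\<Union>V"] by simp
    qed
    then have ae: "AE x in \<mu>. \<bar>\<Psi> x - SN f x\<bar> \<le> real N * e'"
    proof eventually_elim
      case (elim x)
      then obtain C where C: "C \<in> V" "x \<in> C" by blast
      have "indicator D x = (0::real)" if "D \<in> V" "D \<noteq> C" for D
        using cells_disjoint[of D N C] that C by (auto simp: V_def indicator_def)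
      then have "\<Psi> x = SN f (y C)" unfolding \<Psi>_def using V C by (subst sum.remove[of _ C]) (auto intro!: sum.neutral)
      then show ?case using y(2)[OF C(1) f C(2)] by (simp add: SN_def abs_minus_commute)
    qed
    have "\<bar>(\<integral>x. \<Psi> x \<partial>\<mu>) - (\<integral>x. SN f x \<partial>\<mu>)\<bar> = \<bar>\<integral>x. \<Psi> x - SN f x \<partial>\<mu>\<bar>" using \<Psi>i SNi by simp
    also have "\<dots> \<le> (\<integral>x. \<bar>\<Psi> x - SN f x\<bar> \<partial>\<mu>)" by (rule integral_abs_bound)
    also have "\<dots> \<le> (\<integral>x. real N * e' \<partial>\<mu>)" using \<Psi>i SNi ae by (intro integral_mono_AE) auto
    also have "\<dots> = real N * e'" using I.prob_space by simp
    finally show ?thesis unfolding \<Psi>v SNv .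
  qed
  \<comment> \<open>Costs that do not grow with \<open>n\<close>: the incomplete last block of at
    most \<open>N + g\<close> steps and at most one block per cell lost by rounding, each entering
    twice.\<close>
  define K where "K = 2 * B * (real N + real g) + 2 * B * real (card V) * real N"
  have orbit: "\<bar>(\<Sum>j<n. f ((T ^^ j) x)) - real n * (\<integral>x. f x \<partial>\<mu>)\<bar> \<le> real n * (e / 2) + K"
    if f: "f \<in> F" and x: "x \<in> {0..1}" and sh: "shadow N g y Cs x" and Cs: "mset Cs = mset_counts V (m (n div d))" for f x Cs n
  proof -
    define M where "M = n div d"
    define If where "If = (\<integral>x. f x \<partial>\<mu>)"
    have len: "length Cs = M' M" using mset_counts_props(2)[OF V, of "m M"] Cs size_mset[of Cs] by (simp add: M'_def M_def)
    have setC: "set Cs \<subseteq> V" using mset_counts_props(4)[OF V, of "m M"] Cs by (metis M_def set_mset_mset)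
    have Md: "M * d \<le> n" "n \<le> M * d + d"
    proof -
      show "M * d \<le> n" by (simp add: M_def)
      have "n = M * d + n mod d" "n mod d < d" using d by (simp_all add: M_def)
      then show "n \<le> M * d + d" by linarith
    qed
    have "M' M \<le> M" using M'b(1)[of M] by simp
    then have "length Cs * (N + g) \<le> n" using Md(1) len unfolding d_def by (metis mult_le_mono1 order_trans)
    note ss = shadow_sum[of f B Cs N y e' g x n, OF B(2)[OF f] _ sh x this]
    have 1: "\<bar>(\<Sum>j<n. f ((T ^^ j) x)) - (\<Sum>C\<leftarrow>Cs. SN f (y C))\<bar> \<le> real (M' M) * real N * e' + B * (real n - real (M' M) * real N)"
      using ss N(4)[OF f] X0_01[OF y(1)] setC unfolding len SN_def by blast
    have "(\<Sum>C\<leftarrow>Cs. SN f (y C)) = (\<Sum>C\<in>#mset Cs. SN f (y C))" by (simp flip: sum_mset_sum_list)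
    also have "\<dots> = (\<Sum>C\<in>V. real (m M C) * SN f (y C))" unfolding Cs using mset_counts_props(3)[OF V] by (simp add: M_def)
    finally have list: "(\<Sum>C\<leftarrow>Cs. SN f (y C)) = (\<Sum>C\<in>V. real (m M C) * SN f (y C))" .
    have SB: "\<bar>SN f (y C)\<bar> \<le> B * real N" if "C \<in> V" for C
      unfolding SN_def by (rule orbit_sum_bound[OF B(2)[OF f] X0_01[OF y(1)[OF that]]])
    have 2: "\<bar>(\<Sum>C\<in>V. real (m M C) * SN f (y C)) - real M * (\<Sum>C\<in>V. measure \<mu> C * SN f (y C))\<bar> \<le> real (card V) * (B * real N)"
    proof -
      have "(\<Sum>C\<in>V. real (m M C) * SN f (y C)) - real M * (\<Sum>C\<in>V. measure \<mu> C * SN f (y C)) = (\<Sum>C\<in>V. (real (m M C) - real M * measure \<mu> C) * SN f (y C))"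
        by (simp add: sum_distrib_left sum_subtractf algebra_simps)
      also have "\<bar>\<dots>\<bar> \<le> (\<Sum>C\<in>V. 1 * (B * real N))"
      proof (intro order_trans[OF sum_abs] sum_mono)
        fix C assume C: "C \<in> V"
        have "\<bar>real (m M C) - real M * measure \<mu> C\<bar> \<le> 1" using mb[of M C] by linarith
        then show "\<bar>(real (m M C) - real M * measure \<mu> C) * SN f (y C)\<bar> \<le> 1 * (B * real N)"
          unfolding abs_mult using SB[OF C] by (intro mult_mono) auto
      qed
      finally show ?thesis by simp
    qed
    have 3: "\<bar>real M * (\<Sum>C\<in>V. measure \<mu> C * SN f (y C)) - real M * (real N * If)\<bar> \<le> real M * (real N * e')"
      unfolding right_diff_distrib[symmetric] abs_mult If_def using block[OF f] by (simp add: mult_left_mono)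
    have IfB: "\<bar>If\<bar> \<le> B"
    proof -
      have "\<bar>If\<bar> \<le> (\<integral>x. \<bar>f x\<bar> \<partial>\<mu>)" unfolding If_def by (rule integral_abs_bound)
      also have "\<dots> \<le> (\<integral>x. B \<partial>\<mu>)" using cont_integrable[OF \<mu> Fc[OF f]] B(2)[OF f] by (intro integral_mono) auto
      also have "\<dots> = B" using I.prob_space by simp
      finally show ?thesis .
    qed
    have MN: "real M * real N \<le> real n" "real n - real M * real N \<le> real M * real g + real N + real g"
    proof -
      have "M * N \<le> n" using Md(1) by (simp add: d_def algebra_simps)
      then show "real M * real N \<le> real n" by (metis of_nat_le_iff of_nat_mult)
      have "n \<le> M * N + M * g + N + g" using Md(2) by (simp add: d_def algebra_simps)
      then have "real n \<le> real M * real N + real M * real g + real N + real g" by (metis of_nat_le_iff of_nat_mult of_nat_add)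
      then show "real n - real M * real N \<le> real M * real g + real N + real g" by simp
    qed
    have 4: "\<bar>real M * (real N * If) - real n * If\<bar> \<le> B * (real n - real M * real N)"
    proof -
      have "real M * (real N * If) - real n * If = - ((real n - real M * real N) * If)" by (simp add: algebra_simps)
      then have "\<bar>real M * (real N * If) - real n * If\<bar> = (real n - real M * real N) * \<bar>If\<bar>" using MN(1) by (simp add: abs_mult)
      also have "\<dots> \<le> (real n - real M * real N) * B" using IfB MN(1) by (intro mult_left_mono) auto
      finally show ?thesis by (simp add: mult.commute)
    qed
    have t1: "real (M' M) * real N * e' \<le> real n * e'"
    proof (intro mult_right_mono)
      have "real (M' M) * real N \<le> real M * real N" using M'b(1)[of M] by (intro mult_right_mono) auto
      then show "real (M' M) * real N \<le> real n" using MN(1) by linarith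
    qed (use e' in simp)
    have t2: "B * (real n - real (M' M) * real N) \<le> B * (real n - real M * real N) + B * real (card V) * real N"
    proof -
      have "(real M - real (card V)) * real N \<le> real (M' M) * real N" using M'b(2)[of M] by (intro mult_right_mono) auto
      then have "real n - real (M' M) * real N \<le> (real n - real M * real N) + real (card V) * real N" by (simp add: algebra_simps)
      then have "B * (real n - real (M' M) * real N) \<le> B * ((real n - real M * real N) + real (card V) * real N)" using B(1) by (intro mult_left_mono) auto
      then show ?thesis by (simp add: algebra_simps)
    qed
    have t3: "real M * (real N * e') \<le> real n * e'"
    proof -
      have "real M * (real N * e') = (real M * real N) * e'" by simp
      also have "\<dots> \<le> real n * e'" using MN(1) e' by (intro mult_right_mono) auto
      finally show ?thesis .
    qed
    have t4: "2 * B * (real n - real M * real N) \<le> real n * (e / 4) + 2 * B * (real N + real g)"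
    proof -
      have "2 * B * (real n - real M * real N) \<le> 2 * B * (real M * real g + real N + real g)" using MN(2) B(1) by (intro mult_left_mono) auto
      also have "\<dots> = (real M * real N) * (2 * B * real g / real N) + 2 * B * (real N + real g)" using N(3) by (simp add: field_simps)
      also have "(real M * real N) * (2 * B * real g / real N) \<le> real n * (e / 4)"
        using MN(1) N(2) B(1) by (intro mult_mono) auto
      finally show ?thesis by simp
    qed
    have e8: "2 * (real n * e') = real n * (e / 4)" by (simp add: e'_def)
    have "\<bar>(\<Sum>j<n. f ((T ^^ j) x)) - real n * If\<bar> \<le> real n * e' + (B * (real n - real M * real N) + B * real (card V) * real N) + real (card V) * (B * real N) + real n * e' + B * (real n - real M * real N)"
      using 1 2 3 4 t1 t2 t3 unfolding list by linarith
    also have "\<dots> = 2 * (real n * e') + 2 * B * (real n - real M * real N) + 2 * B * real (card V) * real N" by (simp add: algebra_simps)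
    also have "\<dots> \<le> real n * (e / 2) + K"
    proof -
      have "real n * (e / 2) = real n * (e / 4) + real n * (e / 4)" by simp
      then show ?thesis using t4 e8 unfolding K_def by linarith
    qed
    finally show ?thesis by (simp add: If_def)
  qed
  have large: "\<forall>\<^sub>F n in sequentially. real n * (e / 2) + K < real n * e \<and> n \<ge> 1"
  proof -
    have "\<forall>\<^sub>F n in sequentially. K / real n < e / 2" using order_tendstoD(2)[OF lim_const_over_n, of "e / 2" K] F(2) by simp
    then show ?thesis using eventually_ge_at_top[of 1]
    proof eventually_elim
      case (elim n)
      then have "K < real n * (e / 2)" by (simp add: field_simps)
      then show ?case using elim by (simp add: field_simps)
    qed
  qed
  have count: "\<forall>\<^sub>F n in sequentially. \<kappa> / \<beta>^n * (real (card (P (n div d))) / C0^(n div d)) \<le> measure lborel {x\<in>{0..1}. empirical T n x \<in> G}"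
    using large
  proof eventually_elim
    case (elim n)
    define M where "M = n div d"
    define E where "E = {x\<in>{0..1}. empirical T n x \<in> G}"
    have Eb: "E \<in> sets borel" unfolding E_def using emp_measurable[OF _ G(1)] elim by blast
    have Efin: "emeasure lborel E \<noteq> \<infinity>"
    proof -
      have "emeasure lborel E \<le> emeasure lborel {0..1::real}" by (intro emeasure_mono) (auto simp: E_def)
      then show ?thesis by (auto simp: top_unique)
    qed
    \<comment> \<open>Orbits are available for the arrangements sorted along reachability, so only
      these are realised and counted.\<close>
    define Q where "Q = sort_key R ` P M"
    have fP: "finite (P M)" by (simp add: P_def)
    have pP: "mset Cs = mset_counts V (m M)" if "Cs \<in> P M" for Cs using that by (auto simp: P_def permutations_of_multiset_def)
    have pQ: "mset Cs = mset_counts V (m M)" "sorted (map R Cs)" if "Cs \<in> Q" for Cs using that pP by (auto simp: Q_def)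
    have sl: "set Cs \<subseteq> V \<and> length Cs = M' M" if "mset Cs = mset_counts V (m M)" for Cs
      using mset_counts_props(2)[OF V, of "m M"] mset_counts_props(4)[OF V, of "m M"] that size_mset[of Cs] set_mset_mset[of Cs] by (simp add: M'_def)
    have "\<exists>z\<in>X0. shadow N g y Cs z" if Cs: "Cs \<in> Q" for Cs
    proof (cases "Cs = []")
      case True
      obtain z where "z \<in> X0" using X0_dense[of 0 1] by auto
      then show ?thesis using True by auto
    next
      case False
      have sV: "set Cs \<subseteq> V" using sl pQ(1)[OF Cs] by blast
      then show ?thesis using shadow_exists[of Cs y R g N] y(1) con pQ(2)[OF Cs] False by blast
    qed
    then have "\<forall>Cs\<in>Q. \<exists>z. z \<in> X0 \<and> shadow N g y Cs z" by blast
    from bchoice[OF this] obtain Z where Z: "\<And>Cs. Cs \<in> Q \<Longrightarrow> Z Cs \<in> X0 \<and> shadow N g y Cs (Z Cs)" by blast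
    define W where "W = (\<lambda>Cs. cell n (Z Cs)) ` Q"
    have fQ: "finite Q" using fP by (simp add: Q_def)
    have M'M: "M' M \<le> M" using M'b(1)[of M] by simp
    have nM: "M' M * (N + g) \<le> n"
    proof -
      have "M' M * (N + g) \<le> M * d" using M'M by (simp add: d_def)
      also have "\<dots> \<le> n" by (simp add: M_def)
      finally show ?thesis .
    qed
    have cP: "card (P M) \<le> (rk + 1)^(M' M) * card Q"
      unfolding Q_def
    proof (rule card_sort_key[OF fP])
      have "R C \<le> rk" for C unfolding R_def rk_def by (rule rank_bound)
      then show "R ` set xs \<subseteq> {..rk}" if "xs \<in> P M" for xs by auto
    qed (use sl pP in blast)
    have cQ: "card Q \<le> card W * (q * (g + 1))^(M' M)"
      unfolding W_def by (rule count_shadowed[OF V fQ _ mult Z nM]) (use sl pQ in auto)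
    have "card (P M) \<le> (rk + 1)^(M' M) * (card W * (q * (g + 1))^(M' M))"
      by (rule order_trans[OF cP mult_le_mono2[OF cQ]])
    also have "\<dots> = card W * ((rk + 1) * (q * (g + 1)))^(M' M)"
      unfolding power_mult_distrib[of "rk + 1" "q * (g + 1)"] by (rule mult.left_commute)
    finally have "real (card (P M)) \<le> real (card W * ((rk + 1) * (q * (g + 1)))^(M' M))" by (simp only: of_nat_le_iff)
    then have "real (card (P M)) \<le> real (card W) * C0^(M' M)" by (simp only: C0_def of_nat_mult of_nat_power)
    also have "\<dots> \<le> real (card W) * C0^M" using C0 M'M by (intro mult_left_mono power_increasing) auto
    finally have cW: "real (card (P M)) / C0^M \<le> real (card W)" using C0 by (simp add: divide_le_eq)
    have WE: "w \<subseteq> E" if "w \<in> W" for w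
    proof
      fix x assume xw: "x \<in> w"
      obtain Cs where Cs: "Cs \<in> Q" "w = cell n (Z Cs)" using \<open>w \<in> W\<close> by (auto simp: W_def)
      have x01: "x \<in> {0..1}" using xw Cs cell_01 by blast
      have "length Cs * (N + g) \<le> n" using sl[OF pQ(1)[OF Cs(1)]] nM by simp
      then have sh: "shadow N g y Cs x" using shadow_cell[of N g y Cs "Z Cs" x n] Z[OF Cs(1)] xw Cs(2) by simp
      have n1: "n \<ge> 1" using elim by simp
      have "\<bar>(\<integral>z. f z \<partial>empirical T n x) - (\<integral>z. f z \<partial>\<mu>)\<bar> < e" if f: "f \<in> F" for f
      proof -
        have "\<bar>(\<Sum>j<n. f ((T ^^ j) x)) - real n * (\<integral>x. f x \<partial>\<mu>)\<bar> < real n * e"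
          using orbit[OF f x01 sh] pQ(1)[OF Cs(1)] elim unfolding M_def by fastforce
        moreover have "(\<integral>z. f z \<partial>empirical T n x) = (\<Sum>j<n. f ((T ^^ j) x)) / real n"
          using empirical_integral[OF n1, of T x f] Tpow_range[OF x01] cont_borel[OF Fc[OF f]] by blast
        ultimately have "\<bar>real n * ((\<integral>z. f z \<partial>empirical T n x) - (\<integral>z. f z \<partial>\<mu>))\<bar> < real n * e" using n1 by (simp add: algebra_simps)
        then show ?thesis using n1 by (simp add: abs_mult)
      qed
      moreover have "empirical T n x \<in> Pm" using empirical_Pm[OF n1, of T x] Tpow_range[OF x01] by blast
      ultimately have "empirical T n x \<in> G" using F(4) by blast
      then show "x \<in> E" using x01 by (simp add: E_def)
    qed
    have Wc: "W \<subseteq> cells n" using Z X0_01 by (auto simp: W_def cells_def)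
    have fW: "finite W" using fQ by (simp add: W_def)
    have Wb: "w \<in> sets borel" if "w \<in> W" for w using that cell_borel by (auto simp: W_def)
    have wfin: "emeasure lborel w \<noteq> \<infinity>" if "w \<in> W" for w
    proof -
      have "emeasure lborel w \<le> emeasure lborel E" using WE[OF that] Eb by (intro emeasure_mono) auto
      then show ?thesis using Efin by (auto simp: top_unique)
    qed
    have mw: "\<kappa> / \<beta>^n \<le> measure lborel w" if ww: "w \<in> W" for w
    proof -
      obtain Cs where Cs: "Cs \<in> Q" "w = cell n (Z Cs)" using ww by (auto simp: W_def)
      have "ennreal (\<kappa> / \<beta>^n) \<le> emeasure lborel w" unfolding Cs(2) using cell_measure[OF \<kappa>(2)] Z[OF Cs(1)] elim by blast
      also have "\<dots> = ennreal (measure lborel w)" using wfin[OF ww] by (simp add: emeasure_eq_ennreal_measure)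
      finally show ?thesis by (simp add: ennreal_le_iff)
    qed
    have "\<kappa> / \<beta>^n * (real (card (P M)) / C0^M) \<le> \<kappa> / \<beta>^n * real (card W)" using cW \<kappa>(1) by (intro mult_left_mono) auto
    also have "\<dots> = (\<Sum>w\<in>W. \<kappa> / \<beta>^n)" by simp
    also have "\<dots> \<le> (\<Sum>w\<in>W. measure lborel w)" by (intro sum_mono mw)
    also have "\<dots> = measure lborel (\<Union>w\<in>W. w)"
      using fW Wb wfin by (intro measure_finite_Union[symmetric] cells_disjoint_family[OF Wc]) auto
    also have "\<dots> \<le> measure lborel E"
      using WE Eb Efin fW Wb by (intro measure_mono_fmeasurable) (auto simp: fmeasurable_def less_top)
    finally show ?case by (simp add: M_def E_def)
  qed
  \<comment> \<open>The Stirling lower bound for the logarithm of the number of arrangements, per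
    block.\<close>
  define \<Phi> where "\<Phi> M = (\<Sum>C\<in>V. eta (real (m M C) / real M)) - eta (real (M' M) / real M) - real (card V) * ((ln (real M) + 1) / real M)" for M
  have \<Phi>lim: "\<Phi> \<longlonglongrightarrow> Hc \<mu> N"
  proof -
    have mlim: "(\<lambda>M. real (m M C) / real M) \<longlonglongrightarrow> measure \<mu> C" for C
      unfolding m_def by (rule tendsto_floor_over) simp
    have "(\<lambda>M. \<Sum>C\<in>V. real (m M C) / real M) \<longlonglongrightarrow> (\<Sum>C\<in>V. measure \<mu> C)" by (intro tendsto_sum mlim)
    then have "(\<lambda>M. real (M' M) / real M) \<longlonglongrightarrow> 1" by (simp add: M'_def sum_divide_distrib sumV)
    then have "(\<lambda>M. eta (real (M' M) / real M)) \<longlonglongrightarrow> eta 1" by (intro tendsto_eta) auto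
    moreover have "(\<lambda>M. (ln (real M) + 1) / real M) \<longlonglongrightarrow> 0" by real_asymp
    moreover have "(\<lambda>M. \<Sum>C\<in>V. eta (real (m M C) / real M)) \<longlonglongrightarrow> (\<Sum>C\<in>V. eta (measure \<mu> C))"
      by (intro tendsto_sum tendsto_eta mlim) (simp add: V_def)
    ultimately have "\<Phi> \<longlonglongrightarrow> (\<Sum>C\<in>V. eta (measure \<mu> C)) - eta 1 - real (card V) * 0"
      unfolding \<Phi>_def by (intro tendsto_diff tendsto_mult tendsto_const)
    then show ?thesis unfolding HV by (simp add: eta_def)
  qed
  have "(\<lambda>n. ln \<kappa> / real n - ln \<beta> + real (n div d) / real n * (\<Phi> (n div d) - ln C0)) \<longlonglongrightarrow> 0 - ln \<beta> + 1 / real d * (Hc \<mu> N - ln C0)"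
    by (intro tendsto_add tendsto_diff tendsto_mult tendsto_const lim_const_over_n tendsto_div_over d filterlim_compose[OF \<Phi>lim filterlim_div[OF d]])
  moreover have "t < 0 - ln \<beta> + 1 / real d * (Hc \<mu> N - ln C0)"
  proof -
    \<comment> \<open>The entropy rate is a lower bound of every finite-order rate, so the fixed
      block length \<open>N\<close> loses nothing against \<open>h\<close>.\<close>
    have "h \<le> Hc \<mu> N / real N" using ks_entropy_cells[OF \<mu> inv] h N(3) by auto
    then have "real N * h \<le> Hc \<mu> N" using N(3) by (simp add: field_simps)
    then have "1 / real d * (real N * h - ln C0) \<le> 1 / real d * (Hc \<mu> N - ln C0)" by (intro mult_left_mono) auto
    moreover have "1 / real d * (real N * h - ln C0) = h * (real N / (real N + real g)) - ln C0 * (1 / (real N + real g))"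
      by (simp add: d_def diff_divide_distrib mult.commute)
    ultimately show ?thesis using N(1) by linarith
  qed
  ultimately have "\<forall>\<^sub>F n in sequentially. t < ln \<kappa> / real n - ln \<beta> + real (n div d) / real n * (\<Phi> (n div d) - ln C0)"
    by (rule order_tendstoD(1))
  then show ?thesis using count eventually_ge_at_top[of d]
  proof eventually_elim
    case (elim n)
    define M where "M = n div d"
    have M1: "M \<ge> 1" using elim(3) d by (simp add: M_def div_greater_zero_iff Suc_le_eq)
    have n1: "real n > 0" using elim(3) d by simp
    have "real M * ((\<Sum>C\<in>V. eta (real (m M C) / real M)) - eta (real (M' M) / real M)) - real (card V) * (ln (real M) + 1) \<le> ln (real (card (P M)))"
      unfolding P_def M'_def by (rule ln_card_permutations[OF V mM M1])
    moreover have "real M * \<Phi> M = real M * ((\<Sum>C\<in>V. eta (real (m M C) / real M)) - eta (real (M' M) / real M)) - real (card V) * (ln (real M) + 1)"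
      unfolding \<Phi>_def using M1 by (simp add: right_diff_distrib)
    ultimately have lnP: "real M * \<Phi> M \<le> ln (real (card (P M)))" by simp
    have Pp: "real (card (P M)) > 0" unfolding P_def by (simp add: card_gt_0_iff permutations_of_multiset_not_empty)
    have "real n * t \<le> real n * (ln \<kappa> / real n - ln \<beta> + real M / real n * (\<Phi> M - ln C0))"
      using elim(1) n1 unfolding M_def by (intro mult_left_mono) auto
    also have "\<dots> = ln \<kappa> - real n * ln \<beta> + (real M * \<Phi> M - real M * ln C0)" using n1 by (simp add: field_simps)
    also have "\<dots> \<le> ln \<kappa> - real n * ln \<beta> + (ln (real (card (P M))) - real M * ln C0)" using lnP by simp
    also have "\<dots> = ln (\<kappa> / \<beta>^n * (real (card (P M)) / C0^M))"
      using \<kappa>(1) Pp C0 by (simp add: ln_mult_pos ln_div ln_realpow)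
    finally have "exp (real n * t) \<le> exp (ln (\<kappa> / \<beta>^n * (real (card (P M)) / C0^M)))" by simp
    also have "\<dots> = \<kappa> / \<beta>^n * (real (card (P M)) / C0^M)" using \<kappa>(1) Pp C0 by (intro exp_ln mult_pos_pos divide_pos_pos) auto
    also have "\<dots> \<le> measure lborel {x\<in>{0..1}. empirical T n x \<in> G}" using elim(2) by (simp add: M_def)
    finally show ?case .
  qed
qed

end

section \<open>The large deviation principle\<close>

lemma limsup_elog:
  assumes "\<forall>\<^sub>F n in sequentially. a n \<le> C * exp (real n * t)" "C > 0"
  shows "limsup (\<lambda>n. elog (a n) / ereal (real n)) \<le> ereal t"
proof -
  have "\<forall>\<^sub>F n in sequentially. elog (a n) / ereal (real n) \<le> ereal (ln C / real n + t)"
    using assms(1) eventually_ge_at_top[of 1]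
  proof eventually_elim
    case (elim n)
    show ?case
    proof (cases "a n > 0")
      case True
      have "ln (a n) \<le> ln (C * exp (real n * t))" using elim True by simp
      also have "\<dots> = ln C + real n * t" using assms(2) by (simp add: ln_mult_pos)
      finally have "ln (a n) / real n \<le> (ln C + real n * t) / real n" by (simp add: divide_right_mono)
      also have "\<dots> = ln C / real n + t" using elim by (simp add: add_divide_distrib)
      finally show ?thesis using True elim by (simp add: elog_def)
    next
      case False
      then show ?thesis using elim by (simp add: elog_def)
    qed
  qed
  then have "limsup (\<lambda>n. elog (a n) / ereal (real n)) \<le> limsup (\<lambda>n. ereal (ln C / real n + t))" by (rule Limsup_mono)
  also have "\<dots> = ereal t"
  proof (rule lim_imp_Limsup)
    have "(\<lambda>n. ln C / real n + t) \<longlonglongrightarrow> 0 + t" by (intro tendsto_add tendsto_const lim_const_over_n)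
    then show "(\<lambda>n. ereal (ln C / real n + t)) \<longlonglongrightarrow> ereal t" by simp
  qed simp
  finally show ?thesis .
qed

lemma liminf_elog:
  assumes "\<forall>\<^sub>F n in sequentially. exp (real n * t) \<le> a n"
  shows "ereal t \<le> liminf (\<lambda>n. elog (a n) / ereal (real n))"
proof (rule Liminf_bounded)
  show "\<forall>\<^sub>F n in sequentially. ereal t \<le> elog (a n) / ereal (real n)" using assms eventually_ge_at_top[of 1]
  proof eventually_elim
    case (elim n)
    have p: "a n > 0" using elim by (meson exp_gt_zero less_le_trans)
    have "ln (exp (real n * t)) \<le> ln (a n)" using elim p by (subst ln_le_cancel_iff) auto
    then have "t \<le> ln (a n) / real n" using elim by (simp add: field_simps)
    then show ?case using p elim by (simp add: elog_def)
  qed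
qed

lemma lebesgue_on_measure:
  "E \<in> sets borel \<Longrightarrow> E \<subseteq> {0..1} \<Longrightarrow> measure (lebesgue_on {0..1}) E = measure lborel (E :: real set)"
  by (simp add: measure_restrict_space measure_completion)

lemma unit_measure:
  assumes "E \<in> sets borel" "E \<subseteq> {0..1::real}"
  shows "emeasure lborel E \<noteq> \<infinity>" "measure lborel E \<le> 1"
proof -
  have le: "emeasure lborel E \<le> emeasure lborel {0..1::real}" using assms by (intro emeasure_mono) auto
  then show "emeasure lborel E \<noteq> \<infinity>" by (auto simp: top_unique)
  show "measure lborel E \<le> 1"
  proof -
    have "measure lborel E \<le> measure lborel {0..1::real}"
      using assms by (intro measure_mono_fmeasurable) (auto simp: fmeasurable_def)
    then show ?thesis by simp
  qed
qed

context markov_neg_beta begin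

text \<open>Entropy is finite here, so the subtraction in \<open>free_energy\<close> is one of real
  numbers.\<close>

lemma free_energy_cases:
  assumes "\<mu> \<in> Pm"
  obtains "\<not> invariant T \<mu>" "free_energy \<beta> \<mu> = -\<infinity>"
    | h where "invariant T \<mu>" "ks_entropy \<mu> T = ereal h" "free_energy \<beta> \<mu> = ereal (h - ln \<beta>)"
proof (cases "invariant T \<mu>")
  case True
  then obtain h where "ks_entropy \<mu> T = ereal h" using ks_entropy_cells[OF assms] by blast
  then show thesis using True that(2)[of h] by (simp add: free_energy_def)
next
  case False then show thesis using that(1) by (simp add: free_energy_def)
qed

definition half :: "(real \<Rightarrow> real) \<Rightarrow> real \<Rightarrow> nat \<Rightarrow> real set" where
  "half f a n = {x\<in>{0..1}. (\<Sum>j<n. f ((T ^^ j) x)) < real n * a}"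

lemma half_borel:
  assumes "continuous_on {0..1} f" shows "half f a n \<in> sets borel" "half f a n \<subseteq> {0..1}"
proof -
  have "(\<lambda>x. f ((T ^^ j) x)) \<in> borel_measurable B01" for j
    using measurable_comp[OF Tpow_measurable cont_borel[OF assms]] by (simp add: comp_def)
  then have "(\<lambda>x. \<Sum>j<n. f ((T ^^ j) x)) \<in> borel_measurable B01" by (intro borel_measurable_sum)
  then have "{x\<in>space B01. (\<Sum>j<n. f ((T ^^ j) x)) < real n * a} \<in> sets B01" by (rule borel_measurable_less) simp
  then show "half f a n \<in> sets borel" by (auto simp: half_def space_restrict_space sets_restrict_space)
qed (auto simp: half_def)

lemma empirical_half:
  assumes "n \<ge> 1" "x \<in> {0..1}" "continuous_on {0..1} f"
  shows "(\<integral>y. f y \<partial>empirical T n x) < a \<longleftrightarrow> x \<in> half f a n"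
proof -
  have "(\<integral>y. f y \<partial>empirical T n x) = (\<Sum>j<n. f ((T ^^ j) x)) / real n"
    using empirical_integral[OF assms(1), of T x f] Tpow_range[OF assms(2)] cont_borel[OF assms(3)] by blast
  moreover have "(\<Sum>j<n. f ((T ^^ j) x)) / real n < a \<longleftrightarrow> (\<Sum>j<n. f ((T ^^ j) x)) < real n * a"
    using assms(1) by (simp add: divide_less_eq mult.commute)
  ultimately show ?thesis using assms(2) by (simp add: half_def)
qed

text \<open>Both kinds of measures receive a half-space neighbourhood with the same kind of
  estimate; around a non-invariant measure the set of points is eventually empty.\<close>

lemma local_upper:
  assumes \<mu>: "\<mu> \<in> Pm" and t: "free_energy \<beta> \<mu> < ereal t"
  shows "\<exists>f a. continuous_on {0..1} f \<and> (\<integral>x. f x \<partial>\<mu>) < a \<and>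
    (\<exists>C>0. \<forall>\<^sub>F n in sequentially. measure lborel (half f a n) \<le> C * exp (real n * t))"
proof (cases rule: free_energy_cases[OF \<mu>])
  case 1
  obtain f a where f: "continuous_on {0..1} f" "(\<integral>x. f x \<partial>\<mu>) < a"
    "\<forall>\<^sub>F n in sequentially. {x\<in>{0..1}. (\<Sum>j<n. f ((T ^^ j) x)) < real n * a} = {}"
    using noninvariant_upper[OF \<mu> 1(1)] by blast
  have "\<forall>\<^sub>F n in sequentially. measure lborel (half f a n) \<le> 1 * exp (real n * t)"
    using f(3)
  proof eventually_elim
    case (elim n)
    then have "half f a n = {}" unfolding half_def .
    then show ?case by simp
  qed
  then show ?thesis using f(1,2) zero_less_one by blast
next
  case (2 h)
  have "h - ln \<beta> < t" using t 2(3) by simp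
  from invariant_upper[OF \<mu> 2(1,2) this] obtain f a C where f: "continuous_on {0..1} f" "(\<integral>x. f x \<partial>\<mu>) < a"
    "\<And>n. emeasure lborel {x\<in>{0..1}. (\<Sum>j<n. f ((T ^^ j) x)) < real n * a} \<le> ennreal (C * exp (real n * t))"
    by blast
  have "measure lborel (half f a n) \<le> (max C 1) * exp (real n * t)" for n
  proof -
    have "ennreal (C * exp (real n * t)) \<le> ennreal (max C 1 * exp (real n * t))" by (intro ennreal_leI mult_right_mono) auto
    then have "emeasure lborel (half f a n) \<le> ennreal (max C 1 * exp (real n * t))" using f(3)[of n] unfolding half_def by (rule order_trans[rotated])
    then show ?thesis unfolding measure_def by (intro enn2real_leI) auto
  qed
  then have "\<forall>\<^sub>F n in sequentially. measure lborel (half f a n) \<le> (max C 1) * exp (real n * t)" by simp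
  moreover have "max C 1 > 0" by simp
  ultimately show ?thesis using f(1,2) by blast
qed

abbreviation Lm :: "nat \<Rightarrow> real measure set \<Rightarrow> real" where
  "Lm n G \<equiv> measure (lebesgue_on {0..1}) {x\<in>{0..1}. empirical T n x \<in> G}"

lemma ldp_lower:
  assumes G: "openin weak_top G" and \<mu>: "\<mu> \<in> G"
  shows "free_energy \<beta> \<mu> \<le> liminf (\<lambda>n. elog (Lm n G) / ereal (real n))"
proof -
  have P: "\<mu> \<in> Pm" using openin_subset[OF G] \<mu> topspace_weak by blast
  show ?thesis
  proof (cases rule: free_energy_cases[OF P])
    case (2 h)
    have "ereal t \<le> liminf (\<lambda>n. elog (Lm n G) / ereal (real n))" if t: "t < h - ln \<beta>" for t
    proof (rule liminf_elog)
      show "\<forall>\<^sub>F n in sequentially. exp (real n * t) \<le> Lm n G"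
        using lower_bound[OF P 2(1,2) G \<mu> t] eventually_ge_at_top[of 1]
      proof eventually_elim
        case (elim n)
        have "Lm n G = measure lborel {x\<in>{0..1}. empirical T n x \<in> G}"
          by (rule lebesgue_on_measure[OF emp_measurable[OF elim(2) G]]) auto
        then show ?case using elim(1) by simp
      qed
    qed
    note below = this
    have "ereal (h - ln \<beta>) \<le> liminf (\<lambda>n. elog (Lm n G) / ereal (real n))"
    proof (rule ccontr)
      assume "\<not> ?thesis"
      then have "liminf (\<lambda>n. elog (Lm n G) / ereal (real n)) < ereal (h - ln \<beta>)" by (simp only: not_le)
      from ereal_dense2[OF this] obtain t where t: "liminf (\<lambda>n. elog (Lm n G) / ereal (real n)) < ereal t"
        "ereal t < ereal (h - ln \<beta>)" by (elim exE conjE) (rule that)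
      then show False using below[of t] by simp
    qed
    then show ?thesis using 2(3) by simp
  qed simp
qed

lemma ldp_limsup_half:
  assumes f: "continuous_on {0..1} f" and C: "C > 0" "\<forall>\<^sub>F n in sequentially. measure lborel (half f a n) \<le> C * exp (real n * t)"
  shows "limsup (\<lambda>n. elog (Lm n {\<nu>\<in>Pm. (\<integral>x. f x \<partial>\<nu>) < a}) / ereal (real n)) \<le> ereal t"
proof (rule limsup_elog[OF _ C(1)])
  show "\<forall>\<^sub>F n in sequentially. Lm n {\<nu>\<in>Pm. (\<integral>x. f x \<partial>\<nu>) < a} \<le> C * exp (real n * t)"
    using C(2) eventually_ge_at_top[of 1]
  proof eventually_elim
    case (elim n)
    have "{x\<in>{0..1}. empirical T n x \<in> {\<nu>\<in>Pm. (\<integral>x. f x \<partial>\<nu>) < a}} = half f a n"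
      using empirical_half[OF elim(2) _ f, of _ a] empirical_Pm[OF elim(2), of T] Tpow_range half_borel(2)[OF f, of a n] by blast
    then show ?case using elim(1) lebesgue_on_measure[OF half_borel[OF f]] by simp
  qed
qed

text \<open>The lower bound for the whole space of measures compares the free energy with the rate
  of a mass at most 1.\<close>

lemma free_energy_nonpos: 
  assumes "\<mu> \<in> Pm" shows "free_energy \<beta> \<mu> \<le> 0"
proof -
  have G: "openin weak_top Pm" using openin_topspace[of weak_top] topspace_weak by simp
  have "free_energy \<beta> \<mu> \<le> liminf (\<lambda>n. elog (Lm n Pm) / ereal (real n))" by (rule ldp_lower[OF G assms])
  also have "\<dots> \<le> limsup (\<lambda>n. elog (Lm n Pm) / ereal (real n))" by (rule Liminf_le_Limsup) simp
  also have "\<dots> \<le> ereal 0"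
  proof (rule limsup_elog[of _ 1])
    show "\<forall>\<^sub>F n in sequentially. Lm n Pm \<le> 1 * exp (real n * 0)" using eventually_ge_at_top[of 1]
    proof eventually_elim
      case (elim n)
      have b: "{x\<in>{0..1}. empirical T n x \<in> Pm} \<in> sets borel" by (rule emp_measurable[OF elim G])
      have s: "{x\<in>{0..1}. empirical T n x \<in> Pm} \<subseteq> {0..1}" by blast
      show ?case unfolding lebesgue_on_measure[OF b s] using unit_measure(2)[OF b s] by simp
    qed
  qed simp
  finally show ?thesis unfolding zero_ereal_def .
qed

text \<open>Inside the half-space supplied by \<open>local_upper\<close> the lower bound at any
  measure cannot exceed the upper bound for the half-space, which has a rate \<open>t0\<close> below
  \<open>t\<close>.\<close>

lemma free_energy_usc: "openin weak_top {\<mu>\<in>Pm. free_energy \<beta> \<mu> < ereal t}"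
proof (subst openin_subopen, intro ballI)
  fix \<mu> assume "\<mu> \<in> {\<mu>\<in>Pm. free_energy \<beta> \<mu> < ereal t}"
  then have \<mu>: "\<mu> \<in> Pm" "free_energy \<beta> \<mu> < ereal t" by auto
  obtain t0 where t0: "free_energy \<beta> \<mu> < ereal t0" "ereal t0 < ereal t" using ereal_dense2[OF \<mu>(2)] by blast
  obtain f a C where f: "continuous_on {0..1} f" "(\<integral>x. f x \<partial>\<mu>) < a" and C: "C > 0"
    "\<forall>\<^sub>F n in sequentially. measure lborel (half f a n) \<le> C * exp (real n * t0)" using local_upper[OF \<mu>(1) t0(1)] by blast
  define U where "U = {\<nu>\<in>Pm. (\<integral>x. f x \<partial>\<nu>) < a}"
  have U: "openin weak_top U" unfolding U_def by (rule openin_weak_less[OF f(1)])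
  have "free_energy \<beta> \<nu> < ereal t" if "\<nu> \<in> U" for \<nu>
  proof -
    have "free_energy \<beta> \<nu> \<le> liminf (\<lambda>n. elog (Lm n U) / ereal (real n))" by (rule ldp_lower[OF U that])
    also have "\<dots> \<le> limsup (\<lambda>n. elog (Lm n U) / ereal (real n))" by (rule Liminf_le_Limsup) simp
    also have "\<dots> \<le> ereal t0" unfolding U_def by (rule ldp_limsup_half[OF f(1) C])
    also have "\<dots> < ereal t" by (rule t0(2))
    finally show ?thesis .
  qed
  then have "U \<subseteq> {\<mu>\<in>Pm. free_energy \<beta> \<mu> < ereal t}" by (auto simp: U_def)
  moreover have "\<mu> \<in> U" using \<mu> f(2) by (simp add: U_def)
  ultimately show "\<exists>U. openin weak_top U \<and> \<mu> \<in> U \<and> U \<subseteq> {\<mu>\<in>Pm. free_energy \<beta> \<mu> < ereal t}" using U by blast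
qed

text \<open>Compactness covers \<open>F\<close> by finitely many half-spaces of rate
  \<open>t\<close>, and a finite sum of such exponentials has the same rate.\<close>

lemma ldp_upper:
  assumes F: "closedin weak_top F" and t: "\<And>\<mu>. \<mu> \<in> F \<Longrightarrow> free_energy \<beta> \<mu> < ereal t"
  shows "limsup (\<lambda>n. elog (Lm n F) / ereal (real n)) \<le> ereal t"
proof -
  have FP: "F \<subseteq> Pm" using closedin_subset[OF F] topspace_weak by simp
  define Q where "Q f a \<longleftrightarrow> (\<exists>C>0. \<forall>\<^sub>F n in sequentially. measure lborel (half f a n) \<le> C * exp (real n * t))" for f a
  have "\<exists>A. finite A \<and> (\<forall>(f, a)\<in>A. continuous_on {0..1} f \<and> Q f a) \<and> (\<forall>\<nu>\<in>F. \<exists>(f, a)\<in>A. (\<integral>x. f x \<partial>\<nu>) < a)"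
  proof (rule weak_finite_cover[OF F])
    fix \<mu> assume \<mu>: "\<mu> \<in> F"
    then have "\<mu> \<in> Pm" using FP by blast
    from local_upper[OF this t[OF \<mu>]] show "\<exists>f a. continuous_on {0..1} f \<and> (\<integral>x. f x \<partial>\<mu>) < a \<and> Q f a" unfolding Q_def .
  qed
  then obtain A where A: "finite A" "\<forall>(f, a)\<in>A. continuous_on {0..1} f \<and> Q f a" "\<forall>\<nu>\<in>F. \<exists>(f, a)\<in>A. (\<integral>x. f x \<partial>\<nu>) < a" by blast
  have Ac: "continuous_on {0..1} (fst p)" "Q (fst p) (snd p)" if "p \<in> A" for p using A(2) that by (auto simp: case_prod_beta)
  have "\<forall>p\<in>A. \<exists>C. C > 0 \<and> (\<forall>\<^sub>F n in sequentially. measure lborel (half (fst p) (snd p) n) \<le> C * exp (real n * t))"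
    using Ac(2) unfolding Q_def by blast
  from bchoice[OF this] obtain C where C: "\<And>p. p \<in> A \<Longrightarrow> C p > 0"
    "\<And>p. p \<in> A \<Longrightarrow> \<forall>\<^sub>F n in sequentially. measure lborel (half (fst p) (snd p) n) \<le> C p * exp (real n * t)" by blast
  \<comment> \<open>The summand 1 keeps the constant positive when the cover is empty.\<close>
  define D where "D = 1 + (\<Sum>p\<in>A. C p)"
  have D: "D > 0" unfolding D_def using C(1) by (intro add_pos_nonneg sum_nonneg) (auto intro: less_imp_le)
  show ?thesis
  proof (rule limsup_elog[OF _ D])
    have "\<forall>\<^sub>F n in sequentially. \<forall>p\<in>A. measure lborel (half (fst p) (snd p) n) \<le> C p * exp (real n * t)"
      by (rule eventually_ball_finite[OF A(1)]) (use C(2) in blast)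
    then show "\<forall>\<^sub>F n in sequentially. Lm n F \<le> D * exp (real n * t)" using eventually_ge_at_top[of 1]
    proof eventually_elim
      case (elim n)
      define E where "E = {x\<in>{0..1}. empirical T n x \<in> F}"
      have Eb: "E \<in> sets borel" "E \<subseteq> {0..1}" unfolding E_def using emp_measurable_closed[OF elim(2) F] by auto
      have sub: "E \<subseteq> (\<Union>p\<in>A. half (fst p) (snd p) n)"
      proof
        fix x assume "x \<in> E"
        then have x: "x \<in> {0..1}" "empirical T n x \<in> F" by (auto simp: E_def)
        obtain p where p: "p \<in> A" "(\<integral>z. fst p z \<partial>empirical T n x) < snd p" using A(3) x(2) by (auto simp: case_prod_beta)
        then show "x \<in> (\<Union>p\<in>A. half (fst p) (snd p) n)" using empirical_half[OF elim(2) x(1) Ac(1)[OF p(1)]] by blast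
      qed
      have hb: "half (fst p) (snd p) n \<in> fmeasurable lborel" if "p \<in> A" for p
        using unit_measure(1)[OF half_borel[OF Ac(1)[OF that]]] half_borel(1)[OF Ac(1)[OF that]] by (auto simp: fmeasurable_def less_top)
      have "measure lborel E \<le> measure lborel (\<Union>p\<in>A. half (fst p) (snd p) n)"
        using sub Eb A(1) hb by (intro measure_mono_fmeasurable fmeasurable.finite_UN) auto
      also have "\<dots> \<le> (\<Sum>p\<in>A. measure lborel (half (fst p) (snd p) n))"
        using A(1) hb by (intro measure_UNION_le) (auto simp: fmeasurable_def)
      also have "\<dots> \<le> (\<Sum>p\<in>A. C p * exp (real n * t))" using elim(1) by (intro sum_mono) auto
      also have "\<dots> \<le> D * exp (real n * t)" unfolding D_def by (simp add: sum_distrib_right distrib_right)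
      finally show ?case using lebesgue_on_measure[OF Eb] by (simp add: E_def)
    qed
  qed
qed

theorem level2_LDP_markov: "level2_LDP T (lebesgue_on {0..1}) (free_energy \<beta>)"
  unfolding level2_LDP_def
proof (intro conjI ballI allI impI)
  fix G assume G: "openin weak_top G"
  show "(SUP \<mu>\<in>G. free_energy \<beta> \<mu>) \<le> liminf (\<lambda>n. elog (Lm n G) / ereal (real n))"
    by (rule SUP_least) (rule ldp_lower[OF G])
next
  fix F assume F: "closedin weak_top F"
  show "limsup (\<lambda>n. elog (Lm n F) / ereal (real n)) \<le> (SUP \<mu>\<in>F. free_energy \<beta> \<mu>)"
  proof (rule ccontr)
    assume "\<not> ?thesis"
    then have "(SUP \<mu>\<in>F. free_energy \<beta> \<mu>) < limsup (\<lambda>n. elog (Lm n F) / ereal (real n))" by (simp only: not_le)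
    from ereal_dense2[OF this] obtain t where t: "(SUP \<mu>\<in>F. free_energy \<beta> \<mu>) < ereal t"
      "ereal t < limsup (\<lambda>n. elog (Lm n F) / ereal (real n))" by (elim exE conjE) (rule that)
    have "free_energy \<beta> \<mu> < ereal t" if "\<mu> \<in> F" for \<mu> using le_less_trans[OF SUP_upper[OF that] t(1)] .
    from ldp_upper[OF F this] show False using t(2) by simp
  qed
qed (use free_energy_nonpos free_energy_usc in auto)

end

theorem theoremB:
  fixes \<beta> :: real
  assumes "\<beta> > 1" and "yrrap \<beta>"
  shows "level2_LDP (Tneg \<beta>) (lebesgue_on {0..1}) (free_energy \<beta>)"
proof -
  interpret neg_beta \<beta> by unfold_locales (rule assms(1))
  define O1 where "O1 = range (\<lambda>k. (Tneg \<beta> ^^ k) 1)"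
  obtain m p where p: "p > 0" "(Tneg \<beta> ^^ (m + p)) 1 = (Tneg \<beta> ^^ m) 1" using assms(2) by (auto simp: yrrap_def)
  \<comment> \<open>Eventual periodicity folds every later time back below \<open>m + p\<close>, so
    the orbit of 1 is finite.\<close>
  have red: "\<exists>j<m + p. (Tneg \<beta> ^^ k) 1 = (Tneg \<beta> ^^ j) 1" for k
  proof (induction k rule: less_induct)
    case (less k)
    show ?case
    proof (cases "k < m + p")
      case False
      then have "k = (k - (m + p)) + (m + p)" by simp
      then have "(Tneg \<beta> ^^ k) 1 = (Tneg \<beta> ^^ (k - (m + p))) ((Tneg \<beta> ^^ (m + p)) 1)" by (metis comp_apply funpow_add)
      also have "\<dots> = (Tneg \<beta> ^^ (k - (m + p) + m)) 1" unfolding p(2) by (simp add: funpow_add)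
      finally have "(Tneg \<beta> ^^ k) 1 = (Tneg \<beta> ^^ (k - p)) 1" using False by simp
      moreover have "k - p < k" using False p(1) by simp
      ultimately show ?thesis using less.IH by metis
    qed blast
  qed
  then have "O1 \<subseteq> (\<lambda>k. (Tneg \<beta> ^^ k) 1) ` {..<m + p}" unfolding O1_def by blast
  then have finO: "finite O1" using finite_subset by blast
  \<comment> \<open>Cut points are sent to 0 or 1, and 0 to 1, so adding the orbit of 1 makes the
    set forward invariant. The Yrrap property enters through the finiteness of this set.\<close>
  interpret markov_neg_beta \<beta> "Dset \<beta> \<union> O1"
  proof
    show "finite (Dset \<beta> \<union> O1)" using finO by (simp add: Dset_def setcompr_eq_image)
    show "Dset \<beta> \<union> O1 \<subseteq> {0..1}"
    proof -
      have "Dset \<beta> \<subseteq> {0..1}"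
      proof
        fix x assume "x \<in> Dset \<beta>"
        then consider "x = 1" | i where "i \<le> bdig \<beta>" "x = real i / \<beta>" by (auto simp: Dset_def)
        then show "x \<in> {0..1}"
        proof cases
          case (2 i)
          then have "real i \<le> \<beta>" using b_less by linarith
          then show ?thesis using 2 by (simp add: divide_le_eq_1)
        qed simp
      qed
      moreover have "O1 \<subseteq> {0..1}" using Tpow_range[of 1] by (auto simp: O1_def)
      ultimately show ?thesis by blast
    qed
    show "Tneg \<beta> x \<in> Dset \<beta> \<union> O1" if xS: "x \<in> Dset \<beta> \<union> O1" for x
    proof -
      have O: "Tneg \<beta> y \<in> O1" if yO: "y \<in> O1" for y
      proof -
        obtain k where "y = (Tneg \<beta> ^^ k) 1" using yO by (auto simp: O1_def)
        then have "Tneg \<beta> y = (Tneg \<beta> ^^ Suc k) 1" by simp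
        then show ?thesis unfolding O1_def by blast
      qed
      have one: "1 \<in> O1" unfolding O1_def by (rule range_eqI[of _ _ 0]) simp
      have zero: "0 \<in> Dset \<beta>" unfolding Dset_def by force
      consider "x \<in> O1" | "x = 0" | i where "i \<in> {1..bdig \<beta>}" "x = real i / \<beta>"
        using xS one by (force simp: Dset_def)
      then show ?thesis
      proof cases
        case 1 then show ?thesis using O by blast
      next
        case 2 then show ?thesis using one T_0 by simp
      next
        case (3 i) then show ?thesis using T_div[OF 3(1)] one zero by auto
      qed
    qed
  qed auto
  show ?thesis by (rule level2_LDP_markov)
qed

end
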